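(* For each integer $d\geq 8$ there is $\epsilon_d>0$ such that for each $\beta \in [0,\beta_c(d)+\epsilon_d)$ the following holds for the Ising model on $\mathbb{Z}^d$: there is a parameter $\tilde p=\tilde p(\beta)\in[0,1]$ with $\tilde{p}>p_c^s(d)$ such that the $+$ spins under the minus phase $P^-_{\mathbb{Z}^d,\beta}$ stochastically dominate site percolation on $\mathbb{Z}^d$ with parameter $\tilde{p}$. In particular, for all such $\beta$ there is $+$ percolation under the minus phase, i.e. there is an infinite cluster of $+$ spins under $P^-_{\mathbb{Z}^d,\beta}$.
   Context: For finite $\Lambda \subset \mathbb{Z}^d$ let $E(\Lambda)$ be the set of nearest-neighbor edges $xy$ with $x,y\in\Lambda$; write $x\sim y$ when $x,y$ are nearest neighbors. The Ising model on $\Lambda$ at inverse temperature $\beta\ge 0$ (no external field) with boundary conditions $\eta \in \{-1, 0, +1\}^{\mathbb{Z}^d}$ is the probability measure on $\{-1,+1\}^{\Lambda}$ $$P_{\Lambda,\beta}^{\eta}(\sigma)=\frac{1}{Z_{\Lambda,\beta}^{\eta}}\exp\Big[\beta \sum_{xy\in E(\Lambda)}\sigma_x\sigma_y+\beta \sum_{xy: x \sim y, x\in \Lambda, y\notin \Lambda}\sigma_x\eta_y\Big],$$ where $Z_{\Lambda,\beta}^{\eta}$ is the normalizing partition function. $P^-_{\Lambda,\beta}$ is the case $\eta\equiv -1$, and the minus phase $P^-_{\mathbb{Z}^d,\beta}$ is the weak limit of $P^-_{\Lambda,\beta}$ as $\Lambda\uparrow\mathbb{Z}^d$ (it exists). $\beta_c(d)$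 is the critical inverse temperature of this model, in the standard sense: $\beta_c(d)=\sup\{\beta\ge 0: \langle\sigma_0\rangle^-_{\mathbb{Z}^d,\beta}=0\}$, where $\langle\cdot\rangle^-_{\mathbb{Z}^d,\beta}$ is expectation under $P^-_{\mathbb{Z}^d,\beta}$. Site percolation on $\mathbb{Z}^d$ with parameter $p$ is the product measure $\mathbb{P}^s_p$ on $\{0,1\}^{\mathbb{Z}^d}$ under which each vertex is open ($=1$) with probability $p$ independently, and $p_c^s(d):=\inf \{p\in [0,1]: \mathbb{P}^s_p(\text{there is an infinite open cluster})>0\}$, clusters being connected components of the subgraph induced by open vertices. An infinite $+$ cluster is an infinite connected component of the subgraph of $\mathbb{Z}^d$ induced by $\{x:\sigma_x=+1\}$. Stochastic domination: for families $Y=(Y_x)_{x\in S}$, $Z=(Z_x)_{x\in S}$ of $\{0,1\}$-valued random variables indexed by a countable set $S$, $Y$ stochastically dominates $Z$ if $\mathbb{E} f(Y)\ge \mathbb{E} f(Z)$ for every bounded measurable function $f:\{0,1\}^S\to\mathbb{R}$ that is increasing for the coordinatewise order. For the Ising model, spin $+1$ is identified with $1$ and spin $-1$ with $0$. *)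

theory Defs
  imports "HOL-Probability.Probability"
begin

section \<open>The lattice\<close>

type_synonym site = "nat \<Rightarrow> int"

definition Zd :: "nat \<Rightarrow> site set" where
  "Zd d = {..<d} \<rightarrow>\<^sub>E UNIV"

definition origin :: "nat \<Rightarrow> site" where
  "origin d = (\<lambda>i\<in>{..<d}. 0)"

definition nbr :: "nat \<Rightarrow> site \<Rightarrow> site \<Rightarrow> bool" where
  "nbr d x y \<longleftrightarrow> x \<in> Zd d \<and> y \<in> Zd d \<and> (\<Sum>i<d. \<bar>x i - y i\<bar>) = 1"

definition edges :: "nat \<Rightarrow> site set \<Rightarrow> site set set" where
  "edges d \<Lambda> = {{x, y} | x y. x \<in> \<Lambda> \<and> y \<in> \<Lambda> \<and> nbr d x y}"

definition boundary_edges :: "nat \<Rightarrow> site set \<Rightarrow> (site \<times> site) set" where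
  "boundary_edges d \<Lambda> = {(x, y). nbr d x y \<and> x \<in> \<Lambda> \<and> y \<notin> \<Lambda>}"

text \<open>Vertex sets of the connected components of the subgraph induced by \<open>A\<close>.\<close>

definition clusters :: "nat \<Rightarrow> site set \<Rightarrow> site set set" where
  "clusters d A = (\<lambda>x. {y. (\<lambda>u v. u \<in> A \<and> v \<in> A \<and> nbr d u v)\<^sup>*\<^sup>* x y}) ` A"

section \<open>Site percolation\<close>

definition site_percolation :: "nat \<Rightarrow> real \<Rightarrow> (site \<Rightarrow> bool) measure" where
  "site_percolation d p = (\<Pi>\<^sub>M x\<in>Zd d. measure_pmf (bernoulli_pmf p))"

definition site_pc :: "nat \<Rightarrow> real" where
  "site_pc d = Inf {p \<in> {0..1}.
     \<P>(\<omega> in site_percolation d p. \<exists>C \<in> clusters d {x \<in> Zd d. \<omega> x}. infinite C) > 0}"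

section \<open>The Ising model\<close>

text \<open>A doubleton \<open>e = {x, y}\<close> contributes \<open>\<Prod>z\<in>e. \<sigma> z = \<sigma> x * \<sigma> y\<close>.\<close>

definition ising_weight ::
  "nat \<Rightarrow> site set \<Rightarrow> real \<Rightarrow> (site \<Rightarrow> real) \<Rightarrow> (site \<Rightarrow> real) \<Rightarrow> real" where
  "ising_weight d \<Lambda> \<beta> \<eta> \<sigma> =
     exp (\<beta> * (\<Sum>e\<in>edges d \<Lambda>. \<Prod>z\<in>e. \<sigma> z) + \<beta> * (\<Sum>(x, y)\<in>boundary_edges d \<Lambda>. \<sigma> x * \<eta> y))"

definition ising_Z :: "nat \<Rightarrow> site set \<Rightarrow> real \<Rightarrow> (site \<Rightarrow> real) \<Rightarrow> real" where
  "ising_Z d \<Lambda> \<beta> \<eta> = (\<Sum>\<sigma>\<in>\<Lambda> \<rightarrow>\<^sub>E {-1, 1}. ising_weight d \<Lambda> \<beta> \<eta> \<sigma>)"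

definition ising ::
  "nat \<Rightarrow> site set \<Rightarrow> real \<Rightarrow> (site \<Rightarrow> real) \<Rightarrow> (site \<Rightarrow> real) measure" where
  "ising d \<Lambda> \<beta> \<eta> =
     point_measure (\<Lambda> \<rightarrow>\<^sub>E {-1, 1}) (\<lambda>\<sigma>. ennreal (ising_weight d \<Lambda> \<beta> \<eta> \<sigma> / ising_Z d \<Lambda> \<beta> \<eta>))"

text \<open>
  The finite-volume measures live on different spaces. To speak of their weak limit, a
  configuration on \<open>\<Lambda>\<close> is regarded as one on the whole lattice by continuing it with the
  boundary condition \<open>-1\<close>. Weak convergence is convergence of the integrals of all
  continuous functions on the (compact) product space, along the finite subsets of the
  lattice directed by inclusion.
\<close>

definition minus_extend :: "nat \<Rightarrow> site set \<Rightarrow> (site \<Rightarrow> real) \<Rightarrow> site \<Rightarrow> real" where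
  "minus_extend d \<Lambda> \<sigma> = (\<lambda>x\<in>Zd d. if x \<in> \<Lambda> then \<sigma> x else -1)"

definition is_minus_phase :: "nat \<Rightarrow> real \<Rightarrow> (site \<Rightarrow> real) measure \<Rightarrow> bool" where
  "is_minus_phase d \<beta> \<mu> \<longleftrightarrow>
     prob_space \<mu> \<and>
     sets \<mu> = sets (\<Pi>\<^sub>M x\<in>Zd d. count_space {-1, 1}) \<and>
     (\<forall>f. continuous_map (product_topology (\<lambda>x. discrete_topology {-1, 1}) (Zd d)) euclideanreal f \<longrightarrow>
        ((\<lambda>\<Lambda>. \<integral>\<sigma>. f (minus_extend d \<Lambda> \<sigma>) \<partial>ising d \<Lambda> \<beta> (\<lambda>x. -1)) \<longlongrightarrow> (\<integral>\<sigma>. f \<sigma> \<partial>\<mu>))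
          (finite_subsets_at_top (Zd d)))"

definition minus_phase :: "nat \<Rightarrow> real \<Rightarrow> (site \<Rightarrow> real) measure" where
  "minus_phase d \<beta> = (THE \<mu>. is_minus_phase d \<beta> \<mu>)"

text \<open>
  The supremum is taken in the reals, so this is the critical inverse temperature only
  when the latter is finite, that is for \<open>d \<ge> 2\<close>.
\<close>

definition beta_c :: "nat \<Rightarrow> real" where
  "beta_c d = Sup {\<beta>. \<beta> \<ge> 0 \<and> (\<integral>\<sigma>. \<sigma> (origin d) \<partial>minus_phase d \<beta>) = 0}"

section \<open>Stochastic domination\<close>

text \<open>
  The families \<open>Y\<close> and \<open>Z\<close> may live on different probability spaces \<open>M\<close> and \<open>N\<close>; the values
  0 and 1 are \<open>False\<close> and \<open>True\<close>. On extensional functions, the order used by \<open>mono_on\<close>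
  is the coordinatewise order on \<open>S\<close>.
\<close>

definition stochastically_dominates ::
  "'i set \<Rightarrow> 'a measure \<Rightarrow> ('i \<Rightarrow> 'a \<Rightarrow> bool) \<Rightarrow> 'b measure \<Rightarrow> ('i \<Rightarrow> 'b \<Rightarrow> bool) \<Rightarrow> bool" where
  "stochastically_dominates S M Y N Z \<longleftrightarrow>
     prob_space M \<and> prob_space N \<and>
     (\<forall>x\<in>S. Y x \<in> M \<rightarrow>\<^sub>M count_space UNIV) \<and> (\<forall>x\<in>S. Z x \<in> N \<rightarrow>\<^sub>M count_space UNIV) \<and>
     (\<forall>f :: ('i \<Rightarrow> bool) \<Rightarrow> real.
        f \<in> borel_measurable (\<Pi>\<^sub>M x\<in>S. count_space UNIV) \<and>
        bounded (f ` (S \<rightarrow>\<^sub>E UNIV)) \<and> mono_on (S \<rightarrow>\<^sub>E UNIV) f \<longrightarrow>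
        (\<integral>\<omega>. f (\<lambda>x\<in>S. Y x \<omega>) \<partial>M) \<ge> (\<integral>\<omega>. f (\<lambda>x\<in>S. Z x \<omega>) \<partial>N))"

end

theory Submission
  imports Defs "HOL-Combinatorics.Multiset_Permutations"
begin

text \<open>
  The percolation threshold is bounded from above by the second moment method for oriented paths,
  whose input is the expected number of meetings of two independent oriented walks.

  The same numbers bound the energy of a flow from the origin to infinity, obtained by averaging the
  oriented walks in the \<open>2 ^ 8\<close> orthants spanned by eight coordinates and then over windows of eight
  coordinates. Inserting this flow as test function into the infrared bound on a torus gives
  long-range order as soon as \<open>2 d \<beta> > 1.0872\<close>; by the correlation inequalities of Griffiths,
  boundary conditions turn it into a nonzero magnetization, so \<open>beta_c d \<le> 1.0872 / (2 * d)\<close>.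

  For the domination, let \<open>p\<close> be the probability of a plus spin at the lexicographically smallest
  site of a finite region under minus boundary conditions. By the FKG inequality, exposing sites
  in lexicographic order shows that the minus phase dominates percolation with parameter \<open>p\<close>. If
  \<open>p \<le> q\<close> for all regions, a large cube is entirely minus with probability at least
  \<open>(1 - q)\<close> to the power of its volume, and comparison with the partition function bounds
  this probability from above, which forces \<open>2 * (1 - q) \<le> (1 + tanh \<beta>) ^ d\<close>. For \<open>\<beta>\<close> slightly
  beyond \<open>1.0872 / (2 * d)\<close> this fails for some \<open>q\<close> above the percolation threshold.
\<close>

section \<open>Correlation inequalities\<close>

text \<open>Everything hinges on a narrow numerical window. In dimension 8 the path method needs
  parameters above 0.1774 / 1.1774, about 0.1507, while minus cubes at 2 d \<beta> = 1.0872 allow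
  only parameters below about 0.154. Hence the collision numbers are computed exactly up to time 17,
  only the tail is estimated, and dimension 8 is separated from d \<ge> 9, where nine letters give a
  smaller threshold.

  The infrared bound is used in dual form, without Fourier analysis: for an antisymmetric bond
  field, the second moment of the spins paired with its divergence is bounded by the energy of the
  field. For a unit flow this pairing is the spin at the origin minus an average M over a distant
  sphere. As a spin has square 1, small energy forces correlation with M.

  One eight-dimensional flow serves every d \<ge> 8: a direction lies in at most eight of the d
  cyclic windows, so by Cauchy-Schwarz averaging changes the energy by a factor 8 / d, and 8 * 2 *
  0.06795 = 1.0872. Orthants are averaged because this more than halves the energy of a single
  oriented walk.\<close>

lemma four_functions_base:
  fixes a0 a1 b0 b1 c0 c1 e0 e1 :: real
  assumes nn: "0 \<le> a0" "0 \<le> a1" "0 \<le> b0" "0 \<le> b1" "0 \<le> c0" "0 \<le> c1" "0 \<le> e0" "0 \<le> e1"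
    and h00: "a0 * b0 \<le> c0 * e0" and h01: "a0 * b1 \<le> c1 * e0"
    and h10: "a1 * b0 \<le> c1 * e0" and h11: "a1 * b1 \<le> c1 * e1"
  shows "(a0 + a1) * (b0 + b1) \<le> (c0 + c1) * (e0 + e1)"
proof (cases "c1 * e0 = 0")
  case True
  have p: "0 \<le> a0 * b1" "0 \<le> a1 * b0" using nn by (auto intro: mult_nonneg_nonneg)
  have z: "a0 * b1 = 0" "a1 * b0 = 0"
    using order_antisym[OF h01[unfolded True] p(1)] order_antisym[OF h10[unfolded True] p(2)] .
  have "0 \<le> c0 * e1" using nn by simp
  then show ?thesis using z h00 h11 True unfolding distrib_left distrib_right by linarith
next
  case False
  define u where "u = c1 * e0"
  have u: "u > 0" using False mult_nonneg_nonneg[OF nn(6,7)] unfolding u_def by linarith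
  \<comment> \<open>Each mixed product is at most u, and the product of the two is at most u * (c0 *
    e1); expanding this inequality bounds their sum by u + c0 * e1.\<close>
  have "(u - a0 * b1) * (u - a1 * b0) \<ge> 0"
    using h01 h10 by (intro mult_nonneg_nonneg) (auto simp: u_def)
  then have "u * (a0 * b1 + a1 * b0) \<le> u * u + (a0 * b1) * (a1 * b0)"
    by (simp add: algebra_simps)
  also have "(a0 * b1) * (a1 * b0) = (a0 * b0) * (a1 * b1)" by (simp add: algebra_simps)
  also have "\<dots> \<le> (c0 * e0) * (c1 * e1)"
    by (rule mult_mono[OF h00 h11]) (auto simp: nn)
  also have "(c0 * e0) * (c1 * e1) = u * (c0 * e1)" by (simp add: u_def algebra_simps)
  finally have "u * (a0 * b1 + a1 * b0) \<le> u * (u + c0 * e1)" by (simp add: algebra_simps)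
  then have "a0 * b1 + a1 * b0 \<le> u + c0 * e1" using u by simp
  then show ?thesis using h00 h11 unfolding u_def distrib_left distrib_right by linarith
qed

lemma sum_Pow_insert:
  fixes f :: "'a set \<Rightarrow> 'b :: comm_monoid_add"
  assumes "finite S" "x \<notin> S"
  shows "(\<Sum>A\<in>Pow (insert x S). f A) = (\<Sum>A\<in>Pow S. f A + f (insert x A))"
proof -
  have "(\<Sum>A\<in>Pow (insert x S). f A) = (\<Sum>A\<in>Pow S. f A) + (\<Sum>A\<in>insert x ` Pow S. f A)"
    unfolding Pow_insert using assms by (intro sum.union_disjoint) auto
  also have "(\<Sum>A\<in>insert x ` Pow S. f A) = (\<Sum>A\<in>Pow S. f (insert x A))"
    using assms by (subst sum.reindex) (auto simp: inj_on_def insert_ident)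
  finally show ?thesis by (simp add: sum.distrib)
qed

text \<open>The theorem of Ahlswede and Daykin. Summing out one element turns the four functions
  into functions on the subsets of a smaller set, and \<open>four_functions_base\<close> says that
  the hypothesis survives.\<close>

lemma four_functions:
  fixes \<alpha> \<beta> \<gamma> \<delta> :: "'a set \<Rightarrow> real"
  assumes "finite S"
    and "\<And>A. A \<subseteq> S \<Longrightarrow> 0 \<le> \<alpha> A" "\<And>A. A \<subseteq> S \<Longrightarrow> 0 \<le> \<beta> A"
    and "\<And>A. A \<subseteq> S \<Longrightarrow> 0 \<le> \<gamma> A" "\<And>A. A \<subseteq> S \<Longrightarrow> 0 \<le> \<delta> A"
    and "\<And>A B. A \<subseteq> S \<Longrightarrow> B \<subseteq> S \<Longrightarrow> \<alpha> A * \<beta> B \<le> \<gamma> (A \<union> B) * \<delta> (A \<inter> B)"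
  shows "(\<Sum>A\<in>Pow S. \<alpha> A) * (\<Sum>A\<in>Pow S. \<beta> A) \<le> (\<Sum>A\<in>Pow S. \<gamma> A) * (\<Sum>A\<in>Pow S. \<delta> A)"
  using assms
proof (induction S arbitrary: \<alpha> \<beta> \<gamma> \<delta> rule: finite_induct)
  case empty
  then show ?case by auto
next
  case (insert x S)
  note nn = insert.prems(1-4) and le = insert.prems(5)
  show ?case
    unfolding sum_Pow_insert[OF insert.hyps(1,2)]
  proof (rule insert.IH)
    fix A B assume A: "A \<subseteq> S" and B: "B \<subseteq> S"
    have x: "x \<notin> A" "x \<notin> B" using A B insert.hyps by auto
    have sub: "A \<subseteq> insert x S" "insert x A \<subseteq> insert x S" "B \<subseteq> insert x S" "insert x B \<subseteq> insert x S"
      "A \<union> B \<subseteq> insert x S" "insert x (A \<union> B) \<subseteq> insert x S"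
      "A \<inter> B \<subseteq> insert x S" "insert x (A \<inter> B) \<subseteq> insert x S"
      using A B by auto
    show "(\<alpha> A + \<alpha> (insert x A)) * (\<beta> B + \<beta> (insert x B))
        \<le> (\<gamma> (A \<union> B) + \<gamma> (insert x (A \<union> B))) * (\<delta> (A \<inter> B) + \<delta> (insert x (A \<inter> B)))"
    proof (rule four_functions_base)
      show "\<alpha> A * \<beta> B \<le> \<gamma> (A \<union> B) * \<delta> (A \<inter> B)" using le sub by blast
      show "\<alpha> A * \<beta> (insert x B) \<le> \<gamma> (insert x (A \<union> B)) * \<delta> (A \<inter> B)"
        using le[of A "insert x B"] sub x by simp
      show "\<alpha> (insert x A) * \<beta> B \<le> \<gamma> (insert x (A \<union> B)) * \<delta> (A \<inter> B)"
        using le[of "insert x A" B] sub x by simp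
      show "\<alpha> (insert x A) * \<beta> (insert x B) \<le> \<gamma> (insert x (A \<union> B)) * \<delta> (insert x (A \<inter> B))"
        using le[of "insert x A" "insert x B"] sub x by simp
    qed (intro nn sub)+
  next
    fix A assume "A \<subseteq> S"
    then have A: "A \<subseteq> insert x S" "insert x A \<subseteq> insert x S" by auto
    show "0 \<le> \<alpha> A + \<alpha> (insert x A)" "0 \<le> \<beta> A + \<beta> (insert x A)"
      "0 \<le> \<gamma> A + \<gamma> (insert x A)" "0 \<le> \<delta> A + \<delta> (insert x A)"
      by (intro add_nonneg_nonneg nn A)+
  qed
qed

text \<open>Configurations of spins are represented by the set of sites carrying a plus spin.\<close>

definition log_supermodular :: "'a set \<Rightarrow> ('a set \<Rightarrow> real) \<Rightarrow> bool" where
  "log_supermodular S W \<longleftrightarrow> (\<forall>A\<subseteq>S. W A > 0) \<and>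
     (\<forall>A\<subseteq>S. \<forall>B\<subseteq>S. W A * W B \<le> W (A \<union> B) * W (A \<inter> B))"

definition increasing_on :: "'a set \<Rightarrow> ('a set \<Rightarrow> real) \<Rightarrow> bool" where
  "increasing_on S f \<longleftrightarrow> (\<forall>A B. A \<subseteq> B \<longrightarrow> B \<subseteq> S \<longrightarrow> f A \<le> f B)"

lemma log_supermodular_pos: "log_supermodular S W \<Longrightarrow> A \<subseteq> S \<Longrightarrow> 0 < W A"
  by (auto simp: log_supermodular_def)

lemma log_supermodular_le:
  "log_supermodular S W \<Longrightarrow> A \<subseteq> S \<Longrightarrow> B \<subseteq> S \<Longrightarrow> W A * W B \<le> W (A \<union> B) * W (A \<inter> B)"
  by (auto simp: log_supermodular_def)

lemma log_supermodular_subset: "log_supermodular S W \<Longrightarrow> D \<subseteq> S \<Longrightarrow> log_supermodular D W"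
  unfolding log_supermodular_def by (meson order_trans)

lemma increasing_onD: "increasing_on S f \<Longrightarrow> A \<subseteq> B \<Longrightarrow> B \<subseteq> S \<Longrightarrow> f A \<le> f B"
  by (auto simp: increasing_on_def)

text \<open>The four functions theorem for \<open>F * W\<close>, \<open>G * W\<close>,
  \<open>F * G * W\<close> and \<open>W\<close>. It requires nonnegative functions, so f and g are
  first reduced by their minima, the values at \<open>{}\<close>; this leaves the covariance
  unchanged.\<close>

lemma FKG:
  fixes f g :: "'a set \<Rightarrow> real"
  assumes S: "finite S" and W: "log_supermodular S W"
    and f: "increasing_on S f" and g: "increasing_on S g"
  shows "(\<Sum>A\<in>Pow S. f A * W A) * (\<Sum>A\<in>Pow S. g A * W A)
       \<le> (\<Sum>A\<in>Pow S. f A * g A * W A) * (\<Sum>A\<in>Pow S. W A)"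
proof -
  define F where "F A = f A - f {}" for A
  define G where "G A = g A - g {}" for A
  have F0: "0 \<le> F A" and G0: "0 \<le> G A" if "A \<subseteq> S" for A
    using that f g by (auto simp: F_def G_def increasing_on_def)
  have FG: "F A \<le> F (A \<union> B)" "G B \<le> G (A \<union> B)" if "A \<subseteq> S" "B \<subseteq> S" for A B
    using increasing_onD[OF f, of A "A \<union> B"] increasing_onD[OF g, of B "A \<union> B"] that
    by (auto simp: F_def G_def)
  have *: "(\<Sum>A\<in>Pow S. F A * W A) * (\<Sum>A\<in>Pow S. G A * W A)
       \<le> (\<Sum>A\<in>Pow S. F A * G A * W A) * (\<Sum>A\<in>Pow S. W A)"
  proof (rule four_functions[OF S])
    fix A B assume A: "A \<subseteq> S" and B: "B \<subseteq> S"
    have "F A * W A * (G B * W B) = (F A * G B) * (W A * W B)" by (simp add: algebra_simps)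
    also have "\<dots> \<le> (F (A \<union> B) * G (A \<union> B)) * (W (A \<union> B) * W (A \<inter> B))"
      using FG[OF A B] F0[OF A] G0[OF B] F0[of "A \<union> B"] G0[of "A \<union> B"] A B log_supermodular_le[OF W A B]
        log_supermodular_pos[OF W A] log_supermodular_pos[OF W B]
      by (intro mult_mono[of "F A * G B" "F (A \<union> B) * G (A \<union> B)" "W A * W B"]
          mult_mono[of "F A" "F (A \<union> B)" "G B"] mult_nonneg_nonneg) auto
    finally show "F A * W A * (G B * W B) \<le> F (A \<union> B) * G (A \<union> B) * W (A \<union> B) * W (A \<inter> B)"
      by (simp add: algebra_simps)
  next
    fix A assume A: "A \<subseteq> S"
    have "0 \<le> W A" using log_supermodular_pos[OF W A] by simp
    then show "0 \<le> F A * W A" "0 \<le> G A * W A" "0 \<le> F A * G A * W A" "0 \<le> W A"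
      using F0[OF A] G0[OF A] by auto
  qed
  define z where "z = (\<Sum>A\<in>Pow S. W A)"
  define sf where "sf = (\<Sum>A\<in>Pow S. f A * W A)"
  define sg where "sg = (\<Sum>A\<in>Pow S. g A * W A)"
  define sfg where "sfg = (\<Sum>A\<in>Pow S. f A * g A * W A)"
  have 1: "(\<Sum>A\<in>Pow S. F A * W A) = sf - f {} * z" "(\<Sum>A\<in>Pow S. G A * W A) = sg - g {} * z"
    by (simp_all add: F_def G_def sf_def sg_def z_def algebra_simps sum_subtractf sum_distrib_left)
  have "(\<Sum>A\<in>Pow S. F A * G A * W A)
      = (\<Sum>A\<in>Pow S. f A * g A * W A - g {} * (f A * W A) - f {} * (g A * W A) + f {} * g {} * W A)"
    by (simp add: F_def G_def algebra_simps)
  also have "\<dots> = sfg - g {} * sf - f {} * sg + f {} * g {} * z"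
    by (simp add: sum.distrib sum_subtractf sum_distrib_left sf_def sg_def sfg_def z_def)
  finally have 2: "(\<Sum>A\<in>Pow S. F A * G A * W A) = sfg - g {} * sf - f {} * sg + f {} * g {} * z" .
  have "(sf - f {} * z) * (sg - g {} * z) \<le> (sfg - g {} * sf - f {} * sg + f {} * g {} * z) * z"
    using * unfolding 1 2 z_def .
  then have "sf * sg \<le> sfg * z" by (simp add: algebra_simps)
  then show ?thesis by (simp add: sf_def sg_def sfg_def z_def)
qed

definition expect :: "('a set \<Rightarrow> real) \<Rightarrow> 'a set \<Rightarrow> ('a set \<Rightarrow> real) \<Rightarrow> real" where
  "expect W S f = (\<Sum>A\<in>Pow S. f A * W A) / (\<Sum>A\<in>Pow S. W A)"

lemma sum_weight_pos: "finite S \<Longrightarrow> log_supermodular S W \<Longrightarrow> 0 < (\<Sum>A\<in>Pow S. W A)"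
  by (intro sum_pos) (auto simp: log_supermodular_def)

text \<open>Restricting the weight to the subsets of a smaller set \<open>D\<close> amounts to conditioning on
  all spins outside \<open>D\<close> being minus.\<close>

lemma expect_mono_set:
  assumes S: "finite S" and W: "log_supermodular S W" and f: "increasing_on S f" and D: "D \<subseteq> S"
  shows "expect W D f \<le> expect W S f"
proof -
  \<comment> \<open>Minus the indicator of the event that all spins outside D are minus. It is
    increasing, so FKG pairs it with f.\<close>
  define g where "g A = (if A \<subseteq> D then -1 else (0::real))" for A
  have g: "increasing_on S g" by (auto simp: increasing_on_def g_def)
  have fD: "(\<Sum>A\<in>Pow S. h A * g A * W A) = - (\<Sum>A\<in>Pow D. h A * W A)" for h
  proof -
    have "(\<Sum>A\<in>Pow S. h A * g A * W A) = (\<Sum>A\<in>Pow D. h A * g A * W A)"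
      using D S by (intro sum.mono_neutral_right) (auto simp: g_def)
    also have "\<dots> = (\<Sum>A\<in>Pow D. - (h A * W A))" by (intro sum.cong) (auto simp: g_def)
    finally show ?thesis by (simp add: sum_negf)
  qed
  have "(\<Sum>A\<in>Pow S. f A * W A) * (\<Sum>A\<in>Pow S. g A * W A)
       \<le> (\<Sum>A\<in>Pow S. f A * g A * W A) * (\<Sum>A\<in>Pow S. W A)"
    by (rule FKG[OF S W f g])
  also have "(\<Sum>A\<in>Pow S. g A * W A) = - (\<Sum>A\<in>Pow D. W A)" using fD[of "\<lambda>_. 1"] by simp
  also have "(\<Sum>A\<in>Pow S. f A * g A * W A) = - (\<Sum>A\<in>Pow D. f A * W A)" by (rule fD)
  finally have "(\<Sum>A\<in>Pow D. f A * W A) * (\<Sum>A\<in>Pow S. W A) \<le> (\<Sum>A\<in>Pow S. f A * W A) * (\<Sum>A\<in>Pow D. W A)"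
    by simp
  moreover have "0 < (\<Sum>A\<in>Pow S. W A)" "0 < (\<Sum>A\<in>Pow D. W A)"
    using sum_weight_pos[OF S W] sum_weight_pos[OF finite_subset[OF D S] log_supermodular_subset[OF W D]] by auto
  ultimately show ?thesis by (simp add: expect_def field_simps)
qed

text \<open>All minus is the worst configuration on F for a plus spin at x: relative to it, the
  density \<open>g\<close> of the configuration \<xi> is increasing by log-supermodularity, and FKG
  applies to \<open>g\<close>.\<close>

lemma conditional_plus_ge:
  assumes S: "finite S" and W: "log_supermodular S W" and F: "F \<subseteq> S" and \<xi>: "\<xi> \<subseteq> F"
    and x: "x \<in> S - F"
  shows "expect W (S - F) (\<lambda>A. of_bool (x \<in> A)) * (\<Sum>A\<in>Pow (S - F). W (\<xi> \<union> A))
       \<le> (\<Sum>A\<in>Pow (S - F). of_bool (x \<in> A) * W (\<xi> \<union> A))"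
proof -
  define D where "D = S - F"
  have D: "D \<subseteq> S" "finite D" using S by (auto simp: D_def)
  have WD: "log_supermodular D W" by (rule log_supermodular_subset[OF W D(1)])
  define g where "g A = W (\<xi> \<union> A) / W A" for A
  have g: "increasing_on D g"
    unfolding increasing_on_def
  proof (intro allI impI)
    fix A B assume AB: "A \<subseteq> B" "B \<subseteq> D"
    have s: "\<xi> \<union> A \<subseteq> S" "B \<subseteq> S" "A \<subseteq> S" using AB D \<xi> F by auto
    have u: "(\<xi> \<union> A) \<union> B = \<xi> \<union> B" "(\<xi> \<union> A) \<inter> B = A" using AB \<xi> by (auto simp: D_def)
    have "W (\<xi> \<union> A) * W B \<le> W (\<xi> \<union> B) * W A"
      using log_supermodular_le[OF W s(1,2)] unfolding u .
    then show "g A \<le> g B"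
      using log_supermodular_pos[OF W s(2)] log_supermodular_pos[OF W s(3)] by (simp add: g_def field_simps)
  qed
  have gW: "g A * W A = W (\<xi> \<union> A)" if "A \<subseteq> D" for A
    using log_supermodular_pos[OF WD that] by (simp add: g_def)
  have f: "increasing_on D (\<lambda>A. of_bool (x \<in> A))" by (auto simp: increasing_on_def)
  have "(\<Sum>A\<in>Pow D. of_bool (x \<in> A) * W A) * (\<Sum>A\<in>Pow D. g A * W A)
      \<le> (\<Sum>A\<in>Pow D. of_bool (x \<in> A) * g A * W A) * (\<Sum>A\<in>Pow D. W A)"
    by (rule FKG[OF D(2) WD f g])
  also have "(\<Sum>A\<in>Pow D. g A * W A) = (\<Sum>A\<in>Pow D. W (\<xi> \<union> A))" by (intro sum.cong) (auto simp: gW)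
  also have "(\<Sum>A\<in>Pow D. of_bool (x \<in> A) * g A * W A) = (\<Sum>A\<in>Pow D. of_bool (x \<in> A) * W (\<xi> \<union> A))"
    by (intro sum.cong) (auto simp: gW)
  finally show ?thesis
    using sum_weight_pos[OF D(2) WD] by (simp add: expect_def D_def field_simps)
qed

lemma sum_Pow_split:
  fixes f :: "'a set \<Rightarrow> 'b::comm_monoid_add"
  assumes "finite S" "F \<subseteq> S"
  shows "(\<Sum>A\<in>Pow S. f A) = (\<Sum>\<xi>\<in>Pow F. \<Sum>B\<in>Pow (S - F). f (\<xi> \<union> B))"
proof -
  have "(\<Sum>A\<in>Pow S. f A) = (\<Sum>(\<xi>,B)\<in>Pow F \<times> Pow (S - F). f (\<xi> \<union> B))"
    using assms
    by (intro sum.reindex_bij_witness[where i="\<lambda>(\<xi>,B). \<xi> \<union> B" and j="\<lambda>A. (A \<inter> F, A - F)"])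
       (auto simp: Int_Diff_Un Un_Diff)
  then show ?thesis by (simp add: sum.cartesian_product)
qed

section \<open>Comparison with product measures by exposing spins one by one\<close>

definition bernoulli_expect :: "real \<Rightarrow> 'a set \<Rightarrow> ('a set \<Rightarrow> real) \<Rightarrow> real" where
  "bernoulli_expect p S f = (\<Sum>A\<in>Pow S. f A * (p ^ card A * (1 - p) ^ card (S - A)))"

lemma bernoulli_expect_insert:
  assumes "finite S" "x \<notin> S"
  shows "bernoulli_expect p (insert x S) f
       = bernoulli_expect p S (\<lambda>A. p * f (insert x A) + (1 - p) * f A)"
  unfolding bernoulli_expect_def sum_Pow_insert[OF assms]
proof (intro sum.cong refl)
  fix A assume A: "A \<in> Pow S"
  have fin: "finite A" "finite (S - A)" using A assms(1) by (auto intro: finite_subset)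
  have x: "x \<notin> A" "x \<notin> S - A" using A assms(2) by auto
  have d: "insert x S - A = insert x (S - A)" "insert x S - insert x A = S - A" using x by auto
  have c: "card (insert x A) = Suc (card A)" "card (insert x (S - A)) = Suc (card (S - A))"
    using fin x by (simp_all only: card_insert_disjoint not_False_eq_True)
  show "f A * (p ^ card A * (1 - p) ^ card (insert x S - A)) +
         f (insert x A) * (p ^ card (insert x A) * (1 - p) ^ card (insert x S - insert x A)) =
         (p * f (insert x A) + (1 - p) * f A) * (p ^ card A * (1 - p) ^ card (S - A))"
    unfolding d c by (simp add: algebra_simps)
qed

text \<open>Revealing the spins of the list one by one, the last one being compared first.\<close>

lemma dominates_bernoulli_finite:
  assumes S: "finite S" and W: "log_supermodular S W" and p: "0 \<le> p" "p \<le> 1"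
    and xs: "distinct xs" "set xs \<subseteq> S"
    and le: "\<And>k. k < length xs \<Longrightarrow>
       p \<le> expect W (S - set (take k xs)) (\<lambda>A. of_bool (xs ! k \<in> A))"
    and f: "increasing_on (set xs) f"
  shows "bernoulli_expect p (set xs) f \<le> expect W S (\<lambda>A. f (A \<inter> set xs))"
  using xs le f
proof (induction xs arbitrary: f rule: rev_induct)
  case Nil
  have "expect W S (\<lambda>A. f (A \<inter> {})) = f {}"
    using sum_weight_pos[OF S W] by (simp add: expect_def sum_distrib_left[symmetric])
  then show ?case by (simp add: bernoulli_expect_def)
next
  case (snoc x xs)
  let ?F = "set xs"
  have F: "?F \<subseteq> S" "x \<in> S - ?F" "finite ?F" using snoc.prems(1,2) by auto
  \<comment> \<open>The spin at x is averaged out as an independent Bernoulli variable; the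
    induction hypothesis then compares the remaining spins.\<close>
  define g where "g = (\<lambda>A. p * f (insert x A) + (1 - p) * f A)"
  have g: "increasing_on ?F g"
    unfolding increasing_on_def g_def
  proof (intro allI impI)
    fix A B assume "A \<subseteq> B" "B \<subseteq> ?F"
    then have "f (insert x A) \<le> f (insert x B)" "f A \<le> f B"
      by (auto intro!: increasing_onD[OF snoc.prems(4)])
    then show "p * f (insert x A) + (1 - p) * f A \<le> p * f (insert x B) + (1 - p) * f B"
      using p by (intro add_mono mult_left_mono) auto
  qed
  have q: "p \<le> expect W (S - ?F) (\<lambda>A. of_bool (x \<in> A))"
  proof -
    have "length xs < length (xs @ [x])" by simp
    from snoc.prems(3)[OF this] show ?thesis by (simp only: nth_append_length take_append take_all) simp
  qed
  have "bernoulli_expect p (set (xs @ [x])) f = bernoulli_expect p ?F g"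
    unfolding g_def set_append list.set Un_insert_right Un_empty_right
    using F(2,3) by (intro bernoulli_expect_insert) auto
  also have "\<dots> \<le> expect W S (\<lambda>A. g (A \<inter> ?F))"
  proof (rule snoc.IH[OF _ _ _ g])
    show "distinct xs" "set xs \<subseteq> S" using snoc.prems(1,2) by auto
    show "p \<le> expect W (S - set (take k xs)) (\<lambda>A. of_bool (xs ! k \<in> A))" if "k < length xs" for k
      using snoc.prems(3)[of k] that by (simp add: nth_append)
  qed
  also have "\<dots> \<le> expect W S (\<lambda>A. f (A \<inter> set (xs @ [x])))"
    unfolding expect_def
  proof (rule divide_right_mono)
    show "(\<Sum>A\<in>Pow S. g (A \<inter> ?F) * W A) \<le> (\<Sum>A\<in>Pow S. f (A \<inter> set (xs @ [x])) * W A)"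
      unfolding sum_Pow_split[OF S F(1)]
    proof (rule sum_mono)
      fix \<xi> assume "\<xi> \<in> Pow ?F"
      then have \<xi>: "\<xi> \<subseteq> ?F" by simp
      have i: "(\<xi> \<union> B) \<inter> ?F = \<xi>" if "B \<in> Pow (S - ?F)" for B using that \<xi> by auto
      have j: "(\<xi> \<union> B) \<inter> set (xs @ [x]) = (if x \<in> B then insert x \<xi> else \<xi>)" if "B \<in> Pow (S - ?F)" for B
        using that \<xi> F(2) by (auto)
      define z where "z = (\<Sum>B\<in>Pow (S - ?F). W (\<xi> \<union> B))"
      define zx where "zx = (\<Sum>B\<in>Pow (S - ?F). of_bool (x \<in> B) * W (\<xi> \<union> B))"
      have z: "0 \<le> z"
        unfolding z_def
      proof (rule sum_nonneg)
        fix B assume "B \<in> Pow (S - ?F)"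
        then have "\<xi> \<union> B \<subseteq> S" using \<xi> F(1) by blast
        then show "0 \<le> W (\<xi> \<union> B)" using log_supermodular_pos[OF W] by (simp add: less_imp_le)
      qed
      have "p * z \<le> expect W (S - ?F) (\<lambda>A. of_bool (x \<in> A)) * z" by (rule mult_right_mono[OF q z])
      also have "\<dots> \<le> zx" unfolding z_def zx_def by (rule conditional_plus_ge[OF S W F(1) \<xi> F(2)])
      finally have pz: "p * z \<le> zx" .
      have df: "0 \<le> f (insert x \<xi>) - f \<xi>"
        using increasing_onD[OF snoc.prems(4), of \<xi> "insert x \<xi>"] \<xi> by auto
      have "(\<Sum>B\<in>Pow (S - ?F). g ((\<xi> \<union> B) \<inter> ?F) * W (\<xi> \<union> B)) = g \<xi> * z"
        unfolding z_def sum_distrib_left by (intro sum.cong) (auto simp: i)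
      \<comment> \<open>The increment of f at x is nonnegative, so replacing p by the conditional
        probability \<open>zx / z\<close> of a plus spin can only increase the sum.\<close>
      also have "\<dots> = f \<xi> * z + (f (insert x \<xi>) - f \<xi>) * (p * z)" by (simp add: g_def algebra_simps)
      also have "\<dots> \<le> f \<xi> * z + (f (insert x \<xi>) - f \<xi>) * zx"
        using pz df by (intro add_left_mono mult_left_mono) auto
      also have "\<dots> = (\<Sum>B\<in>Pow (S - ?F). f \<xi> * W (\<xi> \<union> B) + (f (insert x \<xi>) - f \<xi>) * (of_bool (x \<in> B) * W (\<xi> \<union> B)))"
        by (simp add: z_def zx_def sum_distrib_left sum.distrib)
      also have "\<dots> = (\<Sum>B\<in>Pow (S - ?F). f ((\<xi> \<union> B) \<inter> set (xs @ [x])) * W (\<xi> \<union> B))"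
        by (intro sum.cong refl) (simp only: j, simp add: algebra_simps)
      finally show "(\<Sum>B\<in>Pow (S - ?F). g ((\<xi> \<union> B) \<inter> ?F) * W (\<xi> \<union> B))
         \<le> (\<Sum>B\<in>Pow (S - ?F). f ((\<xi> \<union> B) \<inter> set (xs @ [x])) * W (\<xi> \<union> B))" .
    qed
    show "0 \<le> (\<Sum>A\<in>Pow S. W A)" using sum_weight_pos[OF S W] by simp
  qed
  finally show ?case .
qed

section \<open>Characters of spin configurations and the inequalities of Griffiths\<close>

definition spin :: "'a set \<Rightarrow> 'a \<Rightarrow> real" where
  "spin A x = (if x \<in> A then 1 else -1)"

definition chi :: "'a set \<Rightarrow> 'a set \<Rightarrow> real" where
  "chi B A = (\<Prod>x\<in>B. spin A x)"

lemma spin_square [simp]: "spin A x * spin A x = 1"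
  by (simp add: spin_def)

lemma chi_empty [simp]: "chi {} A = 1"
  by (simp add: chi_def)

lemma chi_cases: "chi B A = 1 \<or> chi B A = -1"
proof (induction B rule: infinite_finite_induct)
  case (insert x F)
  then show ?case by (auto simp: chi_def spin_def)
qed (auto simp: chi_def)

lemma chi_mult:
  assumes "finite B" "finite C"
  shows "chi B A * chi C A = chi (sym_diff B C) A"
proof -
  have B: "chi B A = chi (B - C) A * chi (B \<inter> C) A"
    unfolding chi_def using assms by (subst prod.Int_Diff[of B _ C]) (auto simp: mult.commute)
  have C: "chi C A = chi (C - B) A * chi (B \<inter> C) A"
    unfolding chi_def using assms by (subst prod.Int_Diff[of C _ B]) (auto simp: mult.commute Int_commute)
  have D: "chi (sym_diff B C) A = chi (B - C) A * chi (C - B) A"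
    unfolding chi_def using assms by (subst prod.union_disjoint) auto
  have "chi (B \<inter> C) A * chi (B \<inter> C) A = 1" using chi_cases[of "B \<inter> C" A] by auto
  then show ?thesis unfolding B C D by (simp add: algebra_simps)
qed

text \<open>Flipping one spin of B changes the sign of the character, so the sum vanishes unless B
  is empty.\<close>

lemma sum_chi_nonneg:
  assumes "finite S" "B \<subseteq> S"
  shows "0 \<le> (\<Sum>A\<in>Pow S. chi B A)"
proof (cases "B = {}")
  case False
  then obtain x where x: "x \<in> B" by auto
  have S: "S = insert x (S - {x})" using x assms by auto
  have fin: "finite B" using assms by (auto intro: finite_subset)
  have "(\<Sum>A\<in>Pow S. chi B A) = (\<Sum>A\<in>Pow (S - {x}). chi B A + chi B (insert x A))"
    by (subst S, rule sum_Pow_insert) (use assms in auto)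
  also have "\<dots> = 0"
  proof (intro sum.neutral ballI)
    fix A assume A: "A \<in> Pow (S - {x})"
    have "chi (B - {x}) (insert x A) = chi (B - {x}) A"
      unfolding chi_def by (intro prod.cong) (auto simp: spin_def)
    moreover have "chi B C = spin C x * chi (B - {x}) C" for C
      unfolding chi_def using x fin by (subst prod.remove[of B x]) auto
    moreover have "spin A x = -1" "spin (insert x A) x = 1" using A by (auto simp: spin_def)
    ultimately show "chi B A + chi B (insert x A) = 0" by simp
  qed
  finally show ?thesis by simp
qed simp

text \<open>High temperature expansion: multiplied out, the sum becomes a nonnegative combination of
  sums of characters. In the induction one factor at a time is absorbed into B as a symmetric
  difference.\<close>

lemma sum_chi_prod_nonneg:
  assumes S: "finite S" and I: "finite I" and B: "B \<subseteq> S"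
    and "\<And>i. i \<in> I \<Longrightarrow> 0 \<le> c i" "\<And>i. i \<in> I \<Longrightarrow> 0 \<le> e i" "\<And>i. i \<in> I \<Longrightarrow> b i \<subseteq> S"
  shows "0 \<le> (\<Sum>A\<in>Pow S. chi B A * (\<Prod>i\<in>I. c i + e i * chi (b i) A))"
  using I B assms(4-)
proof (induction I arbitrary: B rule: finite_induct)
  case empty
  then show ?case using sum_chi_nonneg[OF S] by simp
next
  case (insert i I)
  let ?P = "\<lambda>A. \<Prod>i\<in>I. c i + e i * chi (b i) A"
  have bi: "b i \<subseteq> S" "finite (b i)" "finite B"
    using insert.prems(4)[of i] finite_subset[OF insert.prems(1) S] finite_subset[OF insert.prems(4)[of i] S]
    by auto
  have IH: "0 \<le> (\<Sum>A\<in>Pow S. chi C A * ?P A)" if "C \<subseteq> S" for C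
    by (rule insert.IH[OF that]) (use insert.prems in auto)
  have "sym_diff B (b i) \<subseteq> S" using bi insert.prems(1) by auto
  note 2 = IH[OF this] and 1 = IH[OF insert.prems(1)]
  have "(\<Sum>A\<in>Pow S. chi B A * (\<Prod>i\<in>insert i I. c i + e i * chi (b i) A))
     = (\<Sum>A\<in>Pow S. c i * (chi B A * ?P A) + e i * (chi (sym_diff B (b i)) A * ?P A))"
    using insert.hyps by (intro sum.cong refl) (simp add: chi_mult[OF bi(3,2), symmetric] algebra_simps)
  also have "\<dots> = c i * (\<Sum>A\<in>Pow S. chi B A * ?P A) + e i * (\<Sum>A\<in>Pow S. chi (sym_diff B (b i)) A * ?P A)"
    by (simp add: sum.distrib sum_distrib_left)
  also have "\<dots> \<ge> 0"
    by (intro add_nonneg_nonneg mult_nonneg_nonneg 1 2 insert.prems) auto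
  finally show ?case .
qed

text \<open>All terms of the expansion are nonnegative. Only the one without any character is kept,
  and summing it over all configurations gives the power of 2.\<close>

lemma sum_chi_prod_ge:
  assumes S: "finite S" and I: "finite I"
    and "\<And>i. i \<in> I \<Longrightarrow> 0 \<le> c i" "\<And>i. i \<in> I \<Longrightarrow> 0 \<le> e i" "\<And>i. i \<in> I \<Longrightarrow> b i \<subseteq> S"
  shows "2 ^ card S * (\<Prod>i\<in>I. c i) \<le> (\<Sum>A\<in>Pow S. \<Prod>i\<in>I. c i + e i * chi (b i) A)"
  using I assms(3-)
proof (induction I rule: finite_induct)
  case empty
  then show ?case using S by (simp add: card_Pow)
next
  case (insert i I)
  let ?P = "\<lambda>A. \<Prod>i\<in>I. c i + e i * chi (b i) A"
  have IH: "2 ^ card S * (\<Prod>i\<in>I. c i) \<le> (\<Sum>A\<in>Pow S. ?P A)"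
    by (rule insert.IH) (use insert.prems in auto)
  have 2: "0 \<le> (\<Sum>A\<in>Pow S. chi (b i) A * ?P A)"
    by (rule sum_chi_prod_nonneg[OF S insert.hyps(1)]) (use insert.prems in auto)
  have "2 ^ card S * (\<Prod>i\<in>insert i I. c i) = c i * (2 ^ card S * (\<Prod>i\<in>I. c i))"
    using insert.hyps by simp
  also have "\<dots> \<le> c i * (\<Sum>A\<in>Pow S. ?P A)"
    by (rule mult_left_mono[OF IH]) (use insert.prems in auto)
  also have "\<dots> \<le> c i * (\<Sum>A\<in>Pow S. ?P A) + e i * (\<Sum>A\<in>Pow S. chi (b i) A * ?P A)"
    using 2 insert.prems by simp
  also have "\<dots> = (\<Sum>A\<in>Pow S. \<Prod>i\<in>insert i I. c i + e i * chi (b i) A)"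
    using insert.hyps by (simp add: sum.distrib sum_distrib_left algebra_simps)
  finally show ?case .
qed

lemma exp_mult_sign:
  fixes J s :: real
  assumes "s = 1 \<or> s = -1"
  shows "exp (J * s) = cosh J + sinh J * s"
  using assms by (auto simp: cosh_plus_sinh cosh_minus_sinh)

lemma exp_sum_chi:
  "finite I \<Longrightarrow> exp (\<Sum>i\<in>I. J i * chi (b i) A) = (\<Prod>i\<in>I. cosh (J i) + sinh (J i) * chi (b i) A)"
  by (simp add: exp_sum exp_mult_sign[OF chi_cases])

text \<open>Griffiths' first inequality. Each character is a sign, so the exponential factors into
  terms cosh J + sinh J times a character, whose coefficients are nonnegative for J \<ge> 0.\<close>

lemma GKS_first:
  assumes "finite S" "finite I" "B \<subseteq> S" "\<And>i. i \<in> I \<Longrightarrow> 0 \<le> J i" "\<And>i. i \<in> I \<Longrightarrow> b i \<subseteq> S"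
  shows "0 \<le> (\<Sum>A\<in>Pow S. chi B A * exp (\<Sum>i\<in>I. J i * chi (b i) A))"
  unfolding exp_sum_chi[OF assms(2)]
  by (rule sum_chi_prod_nonneg) (use assms in \<open>auto simp: cosh_real_nonneg sinh_real_nonneg_iff\<close>)

lemma chi_sym_diff: 
  assumes "finite C"
  shows "chi C (sym_diff A T) = chi C A * (\<Prod>x\<in>C. if x \<in> T then -1 else 1)"
  unfolding chi_def prod.distrib[symmetric] by (intro prod.cong) (auto simp: spin_def)

lemma prod_sign_cases: "(\<Prod>x\<in>C. if x \<in> T then -1 else 1) = (1::real) \<or> (\<Prod>x\<in>C. if x \<in> T then -1 else 1) = (-1::real)"
  by (induction C rule: infinite_finite_induct) auto

text \<open>Ginibre's duplication argument.\<close>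

lemma GKS_second:
  assumes S: "finite S" and I: "finite I" and B: "B \<subseteq> S" and C: "C \<subseteq> S"
    and J: "\<And>i. i \<in> I \<Longrightarrow> 0 \<le> J i" and b: "\<And>i. i \<in> I \<Longrightarrow> b i \<subseteq> S"
  defines "w \<equiv> \<lambda>A. exp (\<Sum>i\<in>I. J i * chi (b i) A)"
  shows "(\<Sum>A\<in>Pow S. chi B A * w A) * (\<Sum>A\<in>Pow S. chi C A * w A)
       \<le> (\<Sum>A\<in>Pow S. chi B A * chi C A * w A) * (\<Sum>A\<in>Pow S. w A)"
proof -
  \<comment> \<open>The sign by which flipping the spins in T changes the character of D.\<close>
  define k where "k D T = (\<Prod>x\<in>D. if x \<in> T then -1 else (1::real))" for D T :: "'a set"
  have fin: "finite (b i)" if "i \<in> I" for i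
    by (rule finite_subset[OF b[OF that] S])
  have finBC: "finite B" "finite C" using B C S by (auto intro: finite_subset)
  have k: "-1 \<le> k D T" "k D T \<le> 1" for D T using prod_sign_cases[of T D] by (auto simp: k_def)
  \<comment> \<open>The second copy is the first one with the spins in T flipped. For fixed T the
    product of the two weights is again ferromagnetic, since its couplings J (1 + k) are
    nonnegative, and the first inequality applies.\<close>
  have ww: "w A * w (sym_diff A T) = exp (\<Sum>i\<in>I. (J i * (1 + k (b i) T)) * chi (b i) A)" for A T
    unfolding w_def exp_add[symmetric] sum.distrib[symmetric]
    by (intro arg_cong[where f=exp] sum.cong refl)
       (simp add: chi_sym_diff[OF fin] k_def[symmetric] algebra_simps)
  have re: "(\<Sum>A'\<in>Pow S. f A') = (\<Sum>T\<in>Pow S. f (sym_diff A T))" if "A \<in> Pow S" for f :: "'a set \<Rightarrow> real" and A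
  proof -
    have sd: "sym_diff A (sym_diff A a) = a" for a :: "'a set" by auto
    show ?thesis
      by (rule sum.reindex_bij_witness[where i="sym_diff A" and j="sym_diff A"]) (simp_all only: sd, use that in auto)
  qed
  have "(\<Sum>A\<in>Pow S. chi B A * chi C A * w A) * (\<Sum>A\<in>Pow S. w A)
      - (\<Sum>A\<in>Pow S. chi B A * w A) * (\<Sum>A\<in>Pow S. chi C A * w A)
      = (\<Sum>A\<in>Pow S. \<Sum>A'\<in>Pow S. chi B A * (chi C A - chi C A') * (w A * w A'))"
    unfolding sum_product sum_subtractf[symmetric] by (simp add: algebra_simps)
  also have "\<dots> = (\<Sum>A\<in>Pow S. \<Sum>T\<in>Pow S. chi B A * (chi C A - chi C (sym_diff A T)) * (w A * w (sym_diff A T)))"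
    by (rule sum.cong[OF refl]) (rule re)
  also have "\<dots> = (\<Sum>T\<in>Pow S. \<Sum>A\<in>Pow S. chi B A * (chi C A - chi C (sym_diff A T)) * (w A * w (sym_diff A T)))"
    by (rule sum.swap)
  also have "\<dots> = (\<Sum>T\<in>Pow S. (1 - k C T) * (\<Sum>A\<in>Pow S. chi (sym_diff B C) A *
        exp (\<Sum>i\<in>I. (J i * (1 + k (b i) T)) * chi (b i) A)))"
    unfolding ww sum_distrib_left
    by (intro sum.cong refl)
       (simp add: chi_sym_diff[OF finBC(2)] k_def[symmetric] chi_mult[OF finBC, symmetric] algebra_simps)
  also have "\<dots> \<ge> 0"
  proof (rule sum_nonneg)
    fix T
    have "0 \<le> (\<Sum>A\<in>Pow S. chi (sym_diff B C) A * exp (\<Sum>i\<in>I. (J i * (1 + k (b i) T)) * chi (b i) A))"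
    proof (rule GKS_first[OF S I])
      show "0 \<le> J i * (1 + k (b i) T)" if "i \<in> I" for i
        using J[OF that] k(1)[of "b i" T] by (intro mult_nonneg_nonneg) auto
    qed (use B C b in auto)
    then show "0 \<le> (1 - k C T) * (\<Sum>A\<in>Pow S. chi (sym_diff B C) A *
        exp (\<Sum>i\<in>I. (J i * (1 + k (b i) T)) * chi (b i) A))"
      using k(2)[of C T] by (intro mult_nonneg_nonneg) auto
  qed
  finally show ?thesis by simp
qed

lemma prod_one_plus_spin: "finite R \<Longrightarrow> (\<Prod>x\<in>R. 1 + spin A x) = (\<Sum>C\<in>Pow R. chi C A)"
proof (induction R rule: finite_induct)
  case (insert x R)
  have "chi (insert x C) A = spin A x * chi C A" if "C \<in> Pow R" for C
    using that insert.hyps unfolding chi_def by (subst prod.insert) (auto intro: finite_subset)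
  then show ?case
    using insert.hyps
    by (simp add: sum_Pow_insert insert.IH sum_distrib_left sum.distrib algebra_simps)
qed auto

lemma prod_one_plus_spin_eq:
  "finite R \<Longrightarrow> (\<Prod>x\<in>R. 1 + spin A x) = (if R \<subseteq> A then 2 ^ card R else 0)"
proof (induction R rule: finite_induct)
  case (insert x R)
  then show ?case by (auto simp: spin_def)
qed auto

text \<open>The indicator that all spins of R are plus is a positive combination of characters, by
  expanding the product of 1 + spin over R, and the second inequality holds term by term. Freezing
  spins to plus thus increases correlations, which is how plus boundary conditions enter.\<close>

lemma GKS_conditional:
  assumes S: "finite S" and I: "finite I" and B: "B \<subseteq> S" and R: "R \<subseteq> S"
    and J: "\<And>i. i \<in> I \<Longrightarrow> 0 \<le> J i" and b: "\<And>i. i \<in> I \<Longrightarrow> b i \<subseteq> S"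
  defines "w \<equiv> \<lambda>A. exp (\<Sum>i\<in>I. J i * chi (b i) A)"
  shows "(\<Sum>A\<in>Pow S. chi B A * w A) * (\<Sum>A\<in>Pow S. of_bool (R \<subseteq> A) * w A)
       \<le> (\<Sum>A\<in>Pow S. of_bool (R \<subseteq> A) * (chi B A * w A)) * (\<Sum>A\<in>Pow S. w A)"
proof -
  have finR: "finite R" using R S by (rule finite_subset)
  have ind: "(\<Sum>A\<in>Pow S. of_bool (R \<subseteq> A) * f A) * 2 ^ card R = (\<Sum>C\<in>Pow R. \<Sum>A\<in>Pow S. chi C A * f A)"
    for f :: "'a set \<Rightarrow> real"
  proof -
    have "(\<Sum>C\<in>Pow R. \<Sum>A\<in>Pow S. chi C A * f A) = (\<Sum>A\<in>Pow S. (\<Sum>C\<in>Pow R. chi C A) * f A)"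
      by (subst sum.swap) (simp add: sum_distrib_right)
    also have "\<dots> = (\<Sum>A\<in>Pow S. of_bool (R \<subseteq> A) * f A * 2 ^ card R)"
      unfolding prod_one_plus_spin[OF finR, symmetric] prod_one_plus_spin_eq[OF finR]
      by (intro sum.cong) auto
    finally show ?thesis by (simp add: sum_distrib_right)
  qed
  have "(\<Sum>A\<in>Pow S. chi B A * w A) * (\<Sum>A\<in>Pow S. of_bool (R \<subseteq> A) * w A) * 2 ^ card R
    = (\<Sum>C\<in>Pow R. (\<Sum>A\<in>Pow S. chi B A * w A) * (\<Sum>A\<in>Pow S. chi C A * w A))"
    by (simp only: mult.assoc ind) (simp add: sum_distrib_left)
  also have "\<dots> \<le> (\<Sum>C\<in>Pow R. (\<Sum>A\<in>Pow S. chi B A * chi C A * w A) * (\<Sum>A\<in>Pow S. w A))"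
    unfolding w_def by (rule sum_mono, rule GKS_second[OF S I B _ J b]) (use R in auto)
  also have "\<dots> = (\<Sum>C\<in>Pow R. \<Sum>A\<in>Pow S. chi C A * (chi B A * w A)) * (\<Sum>A\<in>Pow S. w A)"
    by (subst sum_distrib_right[symmetric]) (simp add: mult_ac)
  also have "\<dots> = (\<Sum>A\<in>Pow S. of_bool (R \<subseteq> A) * (chi B A * w A)) * (\<Sum>A\<in>Pow S. w A) * 2 ^ card R"
    by (simp only: ind[symmetric]) simp
  finally show ?thesis by simp
qed

section \<open>Reflection positivity\<close>

lemma psd_power:
  fixes c :: "'i \<Rightarrow> real" and u :: "'i \<Rightarrow> 'k \<Rightarrow> real"
  shows "0 \<le> (\<Sum>i\<in>I. \<Sum>j\<in>I. c i * c j * (\<Sum>k\<in>C. u i k * u j k) ^ n)"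
proof (induction n arbitrary: c)
  case 0
  have "(\<Sum>i\<in>I. \<Sum>j\<in>I. c i * c j * (\<Sum>k\<in>C. u i k * u j k) ^ 0) = (\<Sum>i\<in>I. c i) * (\<Sum>i\<in>I. c i)"
    by (simp add: sum_product)
  then show ?case by simp
next
  case (Suc n)
  \<comment> \<open>One inner product is peeled off; for each l its factors \<open>u i l\<close> and
    \<open>u j l\<close> are absorbed into the coefficients.\<close>
  have "(\<Sum>i\<in>I. \<Sum>j\<in>I. c i * c j * (\<Sum>k\<in>C. u i k * u j k) ^ Suc n)
     = (\<Sum>i\<in>I. \<Sum>j\<in>I. \<Sum>l\<in>C. (c i * u i l) * (c j * u j l) * (\<Sum>k\<in>C. u i k * u j k) ^ n)"
    by (intro sum.cong refl) (simp add: sum_distrib_left sum_distrib_right mult_ac)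
  also have "\<dots> = (\<Sum>i\<in>I. \<Sum>l\<in>C. \<Sum>j\<in>I. (c i * u i l) * (c j * u j l) * (\<Sum>k\<in>C. u i k * u j k) ^ n)"
    by (rule sum.cong[OF refl]) (rule sum.swap)
  also have "\<dots> = (\<Sum>l\<in>C. \<Sum>i\<in>I. \<Sum>j\<in>I. (c i * u i l) * (c j * u j l) * (\<Sum>k\<in>C. u i k * u j k) ^ n)"
    by (rule sum.swap)
  also have "\<dots> \<ge> 0" by (rule sum_nonneg) (rule Suc.IH)
  finally show ?case .
qed

text \<open>The exponential series has nonnegative coefficients, and powers of a Gram matrix are
  positive semidefinite.\<close>

lemma psd_exp:
  fixes c :: "'i \<Rightarrow> real" and u :: "'i \<Rightarrow> 'k \<Rightarrow> real"
  assumes b: "0 \<le> b"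
  shows "0 \<le> (\<Sum>i\<in>I. \<Sum>j\<in>I. c i * c j * exp (b * (\<Sum>k\<in>C. u i k * u j k)))"
proof -
  define s where "s i j = (\<Sum>k\<in>C. u i k * u j k)" for i j
  have lim: "(\<lambda>N. \<Sum>n<N. (b * s i j) ^ n /\<^sub>R fact n) \<longlonglongrightarrow> exp (b * s i j)" for i j
    using exp_converges[of "b * s i j"] by (simp add: sums_def)
  have "(\<lambda>N. \<Sum>i\<in>I. \<Sum>j\<in>I. c i * c j * (\<Sum>n<N. (b * s i j) ^ n /\<^sub>R fact n))
      \<longlonglongrightarrow> (\<Sum>i\<in>I. \<Sum>j\<in>I. c i * c j * exp (b * s i j))"
    by (intro tendsto_intros lim)
  moreover have "0 \<le> (\<Sum>i\<in>I. \<Sum>j\<in>I. c i * c j * (\<Sum>n<N. (b * s i j) ^ n /\<^sub>R fact n))" for N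
  proof -
    have "(\<Sum>i\<in>I. \<Sum>j\<in>I. c i * c j * (\<Sum>n<N. (b * s i j) ^ n /\<^sub>R fact n))
       = (\<Sum>i\<in>I. \<Sum>j\<in>I. \<Sum>n<N. b ^ n / fact n * (c i * c j * s i j ^ n))"
      by (intro sum.cong refl) (simp add: sum_distrib_left power_mult_distrib divide_inverse mult_ac)
    also have "\<dots> = (\<Sum>i\<in>I. \<Sum>n<N. \<Sum>j\<in>I. b ^ n / fact n * (c i * c j * s i j ^ n))"
      by (rule sum.cong[OF refl]) (rule sum.swap)
    also have "\<dots> = (\<Sum>n<N. \<Sum>i\<in>I. \<Sum>j\<in>I. b ^ n / fact n * (c i * c j * s i j ^ n))"
      by (rule sum.swap)
    also have "\<dots> = (\<Sum>n<N. b ^ n / fact n * (\<Sum>i\<in>I. \<Sum>j\<in>I. c i * c j * s i j ^ n))"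
      by (simp add: sum_distrib_left)
    also have "\<dots> \<ge> 0"
      unfolding s_def using b by (intro sum_nonneg mult_nonneg_nonneg psd_power) auto
    finally show ?thesis .
  qed
  ultimately have "0 \<le> (\<Sum>i\<in>I. \<Sum>j\<in>I. c i * c j * exp (b * s i j))"
    by (intro LIMSEQ_le_const) auto
  then show ?thesis by (simp add: s_def)
qed

text \<open>Expanding the square splits the Gaussian kernel into \<open>g i * g j\<close>, absorbed
  into the coefficients, and the exponential of an inner product.\<close>

lemma psd_gauss:
  fixes c :: "'i \<Rightarrow> real" and u :: "'i \<Rightarrow> 'k \<Rightarrow> real"
  assumes b: "0 \<le> b"
  shows "0 \<le> (\<Sum>i\<in>I. \<Sum>j\<in>I. c i * c j * exp (- (b / 2) * (\<Sum>k\<in>C. (u i k - u j k)\<^sup>2)))"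
proof -
  define g where "g i = exp (- (b / 2) * (\<Sum>k\<in>C. (u i k)\<^sup>2))" for i
  have eq: "exp (- (b / 2) * (\<Sum>k\<in>C. (u i k - u j k)\<^sup>2)) = g i * g j * exp (b * (\<Sum>k\<in>C. u i k * u j k))" for i j
  proof -
    have "(\<Sum>k\<in>C. (u i k - u j k)\<^sup>2) = (\<Sum>k\<in>C. (u i k)\<^sup>2) + (\<Sum>k\<in>C. (u j k)\<^sup>2) - 2 * (\<Sum>k\<in>C. u i k * u j k)"
      unfolding sum_distrib_left sum.distrib[symmetric] sum_subtractf[symmetric]
      by (intro sum.cong refl) (simp add: power2_eq_square algebra_simps)
    then show ?thesis
      unfolding g_def exp_add[symmetric] by (simp only:) (rule arg_cong[where f=exp], simp add: field_simps)
  qed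
  have "0 \<le> (\<Sum>i\<in>I. \<Sum>j\<in>I. (c i * g i) * (c j * g j) * exp (b * (\<Sum>k\<in>C. u i k * u j k)))"
    by (rule psd_exp[OF b])
  also have "\<dots> = (\<Sum>i\<in>I. \<Sum>j\<in>I. c i * c j * exp (- (b / 2) * (\<Sum>k\<in>C. (u i k - u j k)\<^sup>2)))"
    unfolding eq by (simp add: mult_ac)
  finally show ?thesis .
qed

text \<open>Positivity of the quadratic form on the doubled index set, at the vector with entries f
  at the points u and - g at the points v. This is Cauchy-Schwarz for the kernel, in additive
  form.\<close>

lemma gauss_cross_le:
  fixes f g :: "'i \<Rightarrow> real" and u v :: "'i \<Rightarrow> 'k \<Rightarrow> real" and C :: "'k set"
  assumes b: "0 \<le> b" and I: "finite I"
  defines "K \<equiv> \<lambda>p q :: 'k \<Rightarrow> real. exp (- (b / 2) * (\<Sum>k\<in>C. (p k - q k)\<^sup>2))"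
  shows "2 * (\<Sum>i\<in>I. \<Sum>j\<in>I. f i * g j * K (u i) (v j))
     \<le> (\<Sum>i\<in>I. \<Sum>j\<in>I. f i * f j * K (u i) (u j)) + (\<Sum>i\<in>I. \<Sum>j\<in>I. g i * g j * K (v i) (v j))"
proof -
  define c where "c = case_sum f (\<lambda>i. - g i)"
  define w where "w = case_sum u v"
  have sym: "K p q = K q p" for p q
    unfolding K_def by (intro arg_cong[where f=exp]) (simp add: power2_commute)
  have "0 \<le> (\<Sum>i\<in>I <+> I. \<Sum>j\<in>I <+> I. c i * c j * K (w i) (w j))"
    unfolding K_def by (rule psd_gauss[OF b])
  also have "\<dots> = (\<Sum>i\<in>I. (\<Sum>j\<in>I. f i * f j * K (u i) (u j)) + (\<Sum>j\<in>I. - (f i * g j * K (u i) (v j))))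
       + (\<Sum>i\<in>I. (\<Sum>j\<in>I. - (g i * f j * K (v i) (u j))) + (\<Sum>j\<in>I. g i * g j * K (v i) (v j)))"
    by (simp add: sum.Plus[OF I I] c_def w_def comp_def)
  also have "\<dots> = (\<Sum>i\<in>I. \<Sum>j\<in>I. f i * f j * K (u i) (u j)) - (\<Sum>i\<in>I. \<Sum>j\<in>I. f i * g j * K (u i) (v j))
       - (\<Sum>i\<in>I. \<Sum>j\<in>I. g i * f j * K (v i) (u j)) + (\<Sum>i\<in>I. \<Sum>j\<in>I. g i * g j * K (v i) (v j))"
    by (simp add: sum.distrib sum_negf sum_subtractf)
  also have "(\<Sum>i\<in>I. \<Sum>j\<in>I. g i * f j * K (v i) (u j)) = (\<Sum>i\<in>I. \<Sum>j\<in>I. f i * g j * K (u i) (v j))"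
    by (subst sum.swap) (simp add: sym mult_ac)
  finally show ?thesis by simp
qed

text \<open>Fields live on ordered pairs and are antisymmetric; every edge is counted in both
  directions, whence the factor \<open>1 / 4\<close> instead of \<open>1 / 2\<close>.\<close>

definition partition_field :: "'a set \<Rightarrow> ('a \<times> 'a) set \<Rightarrow> real \<Rightarrow> ('a \<times> 'a \<Rightarrow> real) \<Rightarrow> real" where
  "partition_field V E b h =
     (\<Sum>A\<in>Pow V. exp (- (b / 4) * (\<Sum>(x, y)\<in>E. (spin A x - spin A y + h (x, y))\<^sup>2)))"

definition antisym_field :: "('a \<times> 'a \<Rightarrow> real) \<Rightarrow> bool" where
  "antisym_field h \<longleftrightarrow> (\<forall>x y. h (y, x) = - h (x, y))"

lemma antisym_fieldD: "antisym_field h \<Longrightarrow> h (y, x) = - h (x, y)"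
  unfolding antisym_field_def by blast

lemma antisym_fieldI: "(\<And>x y. h (y, x) = - h (x, y)) \<Longrightarrow> antisym_field h"
  unfolding antisym_field_def by blast

section \<open>Reflections through a bond\<close>

locale bond_reflection =
  fixes V :: "'a set" and E :: "('a \<times> 'a) set" and \<theta> :: "'a \<Rightarrow> 'a" and L :: "'a set"
  assumes V: "finite V" and E: "E \<subseteq> V \<times> V" and sym: "\<And>x y. (x, y) \<in> E \<Longrightarrow> (y, x) \<in> E"
    and L: "L \<subseteq> V" and \<theta>V: "\<And>x. x \<in> V \<Longrightarrow> \<theta> x \<in> V" and \<theta>\<theta>: "\<And>x. x \<in> V \<Longrightarrow> \<theta> (\<theta> x) = x"
    and \<theta>L: "\<And>x. x \<in> V \<Longrightarrow> \<theta> x \<in> L \<longleftrightarrow> x \<notin> L"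
    and \<theta>E: "\<And>x y. (x, y) \<in> E \<Longrightarrow> (\<theta> x, \<theta> y) \<in> E"
    and cross: "\<And>x y. (x, y) \<in> E \<Longrightarrow> x \<in> L \<Longrightarrow> y \<notin> L \<Longrightarrow> y = \<theta> x"
begin

definition C where "C = {x \<in> L. (x, \<theta> x) \<in> E}"
definition ELL where "ELL = {(x, y). (x, y) \<in> E \<and> x \<in> L \<and> y \<in> L}"
definition ERR where "ERR = {(x, y). (x, y) \<in> E \<and> x \<notin> L \<and> y \<notin> L}"
definition q where "q h A = (\<Sum>(x, y)\<in>ELL. (spin A x - spin A y + h (x, y))\<^sup>2)"
definition tw where "tw h = (\<lambda>(x, y). h (\<theta> x, \<theta> y))"
text \<open>The field on L, mirrored onto the other half and erased on crossing bonds. The value 0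
  off \<open>E\<close> keeps all fields obtained by repeated reflections within a finite
  set.\<close>

definition hl where
  "hl h = (\<lambda>(x, y). if (x, y) \<notin> E then 0 else if x \<in> L \<and> y \<in> L then h (x, y)
     else if x \<notin> L \<and> y \<notin> L then h (\<theta> x, \<theta> y) else 0)"
definition hr where
  "hr h = (\<lambda>(x, y). if (x, y) \<notin> E then 0 else if x \<in> L \<and> y \<in> L then h (\<theta> x, \<theta> y)
     else if x \<notin> L \<and> y \<notin> L then h (x, y) else 0)"

lemma finE: "finite E" using finite_subset[OF E] V by auto

lemma bij_ERR: "bij_betw (\<lambda>(x, y). (\<theta> x, \<theta> y)) ELL ERR"
proof (rule bij_betw_byWitness[where f'="\<lambda>(x, y). (\<theta> x, \<theta> y)"])
  show "\<forall>a\<in>ELL. (\<lambda>(x, y). (\<theta> x, \<theta> y)) ((\<lambda>(x, y). (\<theta> x, \<theta> y)) a) = a"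
    "\<forall>a\<in>ERR. (\<lambda>(x, y). (\<theta> x, \<theta> y)) ((\<lambda>(x, y). (\<theta> x, \<theta> y)) a) = a"
    using E \<theta>\<theta> by (auto simp: ELL_def ERR_def)
  show "(\<lambda>(x, y). (\<theta> x, \<theta> y)) ` ELL \<subseteq> ERR" "(\<lambda>(x, y). (\<theta> x, \<theta> y)) ` ERR \<subseteq> ELL"
    using E \<theta>L \<theta>E by (fastforce simp: ELL_def ERR_def)+
qed

text \<open>Bonds lie inside L, are mirror images of such bonds, or cross. Crossing bonds occur in
  both directions, whence the factor 2.\<close>

lemma sum_E:
  fixes F :: "'a \<times> 'a \<Rightarrow> real"
  assumes F: "\<And>x y. F (y, x) = F (x, y)"
  shows "(\<Sum>e\<in>E. F e) = (\<Sum>e\<in>ELL. F e) + (\<Sum>(x, y)\<in>ELL. F (\<theta> x, \<theta> y)) + 2 * (\<Sum>x\<in>C. F (x, \<theta> x))"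
proof -
  define LR where "LR = {(x, y). (x, y) \<in> E \<and> x \<in> L \<and> y \<notin> L}"
  define RL where "RL = {(x, y). (x, y) \<in> E \<and> x \<notin> L \<and> y \<in> L}"
  have eq: "E = (ELL \<union> ERR) \<union> (LR \<union> RL)" by (auto simp: ELL_def ERR_def LR_def RL_def)
  have fin: "finite ELL" "finite ERR" "finite LR" "finite RL"
    by (rule finite_subset[OF _ finE], auto simp: ELL_def ERR_def LR_def RL_def)+
  have dj: "ELL \<inter> ERR = {}" "(ELL \<union> ERR) \<inter> (LR \<union> RL) = {}" "LR \<inter> RL = {}"
    by (auto simp: ELL_def ERR_def LR_def RL_def)
  have "(\<Sum>e\<in>E. F e) = (\<Sum>e\<in>ELL. F e) + (\<Sum>e\<in>ERR. F e) + ((\<Sum>e\<in>LR. F e) + (\<Sum>e\<in>RL. F e))"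
    by (subst eq, subst sum.union_disjoint[OF _ _ dj(2)], use fin in simp, use fin in simp,
        simp only: sum.union_disjoint[OF fin(1,2) dj(1)] sum.union_disjoint[OF fin(3,4) dj(3)])
  also have "(\<Sum>e\<in>ERR. F e) = (\<Sum>(x, y)\<in>ELL. F (\<theta> x, \<theta> y))"
    by (subst sum.reindex_bij_betw[OF bij_ERR, symmetric]) (simp add: case_prod_beta')
  also have "(\<Sum>e\<in>RL. F e) = (\<Sum>e\<in>LR. F e)"
    by (intro sum.reindex_bij_witness[where i="\<lambda>(x,y). (y,x)" and j="\<lambda>(x,y). (y,x)"])
       (auto simp: LR_def RL_def F intro: sym)
  also have "(\<Sum>e\<in>LR. F e) = (\<Sum>x\<in>C. F (x, \<theta> x))"
    using cross \<theta>L L E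
    by (intro sum.reindex_bij_witness[where i="\<lambda>x. (x, \<theta> x)" and j=fst]) (auto simp: LR_def C_def)
  finally show ?thesis by simp
qed

text \<open>The spins outside L are read through the reflection, so that both halves become
  configurations on L. They interact only across bonds from x to \<theta> x, through a Gaussian
  kernel between the vectors spin + h and spin.\<close>

lemma partition_factor:
  assumes h: "antisym_field h"
  shows "partition_field V E b h = (\<Sum>A1\<in>Pow L. \<Sum>A2\<in>Pow L.
     exp (- (b / 4) * q h A1) * exp (- (b / 4) * q (tw h) A2) *
     exp (- (b / 2) * (\<Sum>x\<in>C. ((spin A1 x + h (x, \<theta> x)) - spin A2 x)\<^sup>2)))"
proof -
  let ?Q = "\<lambda>A. \<Sum>(x, y)\<in>E. (spin A x - spin A y + h (x, y))\<^sup>2"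
  have "partition_field V E b h = (\<Sum>(A1, A2)\<in>Pow L \<times> Pow L. exp (- (b / 4) * ?Q (A1 \<union> \<theta> ` A2)))"
    unfolding partition_field_def
  proof (rule sum.reindex_bij_witness[where i="\<lambda>(A1, A2). A1 \<union> \<theta> ` A2" and j="\<lambda>A. (A \<inter> L, {x \<in> L. \<theta> x \<in> A})"])
    fix A assume "A \<in> Pow V"
    then have A: "A \<subseteq> V" by simp
    have *: "A \<inter> L \<union> \<theta> ` {x \<in> L. \<theta> x \<in> A} = A"
    proof (intro equalityI subsetI)
      fix x assume x: "x \<in> A"
      then have xV: "x \<in> V" using A by auto
      show "x \<in> A \<inter> L \<union> \<theta> ` {x \<in> L. \<theta> x \<in> A}"
      proof (cases "x \<in> L")
        case False
        then show ?thesis using x xV \<theta>\<theta>[OF xV] \<theta>L[OF xV] by (intro UnI2 image_eqI[of _ _ "\<theta> x"]) auto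
      qed (use x in auto)
    qed auto
    then show "(case (A \<inter> L, {x \<in> L. \<theta> x \<in> A}) of (A1, A2) \<Rightarrow> A1 \<union> \<theta> ` A2) = A" by simp
    show "(A \<inter> L, {x \<in> L. \<theta> x \<in> A}) \<in> Pow L \<times> Pow L" by auto
    show "(case (A \<inter> L, {x \<in> L. \<theta> x \<in> A}) of (A1, A2) \<Rightarrow> exp (- (b / 4) * ?Q (A1 \<union> \<theta> ` A2))) = exp (- (b / 4) * ?Q A)"
      by (simp add: *)
  next
    fix p assume p: "p \<in> Pow L \<times> Pow L"
    obtain A1 A2 where pe: "p = (A1, A2)" and A: "A1 \<subseteq> L" "A2 \<subseteq> L" using p by auto
    have t: "\<theta> x \<notin> L" if "x \<in> A2" for x using that A L \<theta>L by auto
    have 1: "(A1 \<union> \<theta> ` A2) \<inter> L = A1" using A t by auto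
    have 2: "{x \<in> L. \<theta> x \<in> A1 \<union> \<theta> ` A2} = A2"
    proof (intro equalityI subsetI)
      fix x assume x: "x \<in> {x \<in> L. \<theta> x \<in> A1 \<union> \<theta> ` A2}"
      then have "\<theta> x \<notin> L" using L \<theta>L by auto
      then obtain y where "y \<in> A2" "\<theta> x = \<theta> y" using x A by auto
      moreover have "x \<in> V" "y \<in> V" using x \<open>y \<in> A2\<close> A L by auto
      ultimately show "x \<in> A2" using \<theta>\<theta> by metis
    qed (use A in auto)
    show "(\<lambda>A. (A \<inter> L, {x \<in> L. \<theta> x \<in> A})) (case p of (A1, A2) \<Rightarrow> A1 \<union> \<theta> ` A2) = p"
      using 1 2 by (simp add: pe)
    show "(case p of (A1, A2) \<Rightarrow> A1 \<union> \<theta> ` A2) \<in> Pow V" using A L \<theta>V by (auto simp: pe)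
  qed
  also have "\<dots> = (\<Sum>A1\<in>Pow L. \<Sum>A2\<in>Pow L. exp (- (b / 4) * ?Q (A1 \<union> \<theta> ` A2)))"
    by (simp add: sum.cartesian_product)
  also have "\<dots> = (\<Sum>A1\<in>Pow L. \<Sum>A2\<in>Pow L.
     exp (- (b / 4) * q h A1) * exp (- (b / 4) * q (tw h) A2) *
     exp (- (b / 2) * (\<Sum>x\<in>C. ((spin A1 x + h (x, \<theta> x)) - spin A2 x)\<^sup>2)))"
  proof (intro sum.cong refl)
    fix A1 A2 assume A: "A1 \<in> Pow L" "A2 \<in> Pow L"
    define A where "A = A1 \<union> \<theta> ` A2"
    have s1: "spin A x = spin A1 x" if "x \<in> L" for x
      using that A L \<theta>L by (auto simp: spin_def A_def)
    have s2: "spin A (\<theta> x) = spin A2 x" if "x \<in> L" for x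
    proof -
      have "x \<in> V" using that L by auto
      then have "\<theta> x \<notin> L" using \<theta>L that by auto
      moreover have "\<theta> x \<in> \<theta> ` A2 \<longleftrightarrow> x \<in> A2"
      proof
        assume "\<theta> x \<in> \<theta> ` A2"
        then obtain y where "y \<in> A2" "\<theta> x = \<theta> y" by auto
        then show "x \<in> A2" using \<theta>\<theta>[OF \<open>x \<in> V\<close>] \<theta>\<theta>[of y] A L by auto
      qed auto
      ultimately show ?thesis using A by (auto simp: spin_def A_def)
    qed
    have F: "(spin A y - spin A x + h (y, x))\<^sup>2 = (spin A x - spin A y + h (x, y))\<^sup>2" for x y
    proof -
      have "spin A y - spin A x + h (y, x) = - (spin A x - spin A y + h (x, y))"
        unfolding antisym_fieldD[OF h, of y x] by simp
      then show ?thesis by (simp only: power2_minus)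
    qed
    have qA: "?Q A = q h A1 + q (tw h) A2 + 2 * (\<Sum>x\<in>C. ((spin A1 x + h (x, \<theta> x)) - spin A2 x)\<^sup>2)"
    proof (subst sum_E)
      have "(\<Sum>e\<in>ELL. (case e of (x, y) \<Rightarrow> (spin A x - spin A y + h (x, y))\<^sup>2)) = q h A1"
        unfolding q_def by (intro sum.cong refl) (auto simp: ELL_def s1)
      moreover have "(\<Sum>(x, y)\<in>ELL. (case (\<theta> x, \<theta> y) of (x, y) \<Rightarrow> (spin A x - spin A y + h (x, y))\<^sup>2)) = q (tw h) A2"
        unfolding q_def tw_def by (intro sum.cong refl) (auto simp: ELL_def s2)
      moreover have "(\<Sum>x\<in>C. (case (x, \<theta> x) of (x, y) \<Rightarrow> (spin A x - spin A y + h (x, y))\<^sup>2))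
         = (\<Sum>x\<in>C. ((spin A1 x + h (x, \<theta> x)) - spin A2 x)\<^sup>2)"
        by (intro sum.cong refl) (auto simp: C_def s1 s2 algebra_simps)
      ultimately show "(\<Sum>e\<in>ELL. (case e of (x, y) \<Rightarrow> (spin A x - spin A y + h (x, y))\<^sup>2))
        + (\<Sum>(x, y)\<in>ELL. (case (\<theta> x, \<theta> y) of (x, y) \<Rightarrow> (spin A x - spin A y + h (x, y))\<^sup>2))
        + 2 * (\<Sum>x\<in>C. (case (x, \<theta> x) of (x, y) \<Rightarrow> (spin A x - spin A y + h (x, y))\<^sup>2))
        = q h A1 + q (tw h) A2 + 2 * (\<Sum>x\<in>C. ((spin A1 x + h (x, \<theta> x)) - spin A2 x)\<^sup>2)" by simp
    qed (simp add: F)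
    show "exp (- (b / 4) * ?Q (A1 \<union> \<theta> ` A2)) = exp (- (b / 4) * q h A1) * exp (- (b / 4) * q (tw h) A2) *
       exp (- (b / 2) * (\<Sum>x\<in>C. ((spin A1 x + h (x, \<theta> x)) - spin A2 x)\<^sup>2))"
      unfolding A_def[symmetric] qA exp_add[symmetric] by (rule arg_cong[where f=exp]) (simp add: field_simps)
  qed
  finally show ?thesis .
qed

lemma antisym_hl:
  assumes h: "antisym_field h" shows "antisym_field (hl h)"
proof (rule antisym_fieldI)
  fix x y
  have "(y, x) \<in> E \<longleftrightarrow> (x, y) \<in> E" using sym by blast
  then show "hl h (y, x) = - hl h (x, y)"
    using antisym_fieldD[OF h, of y x] antisym_fieldD[OF h, of "\<theta> y" "\<theta> x"] by (simp add: hl_def)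
qed

lemma antisym_hr:
  assumes h: "antisym_field h" shows "antisym_field (hr h)"
proof (rule antisym_fieldI)
  fix x y
  have "(y, x) \<in> E \<longleftrightarrow> (x, y) \<in> E" using sym by blast
  then show "hr h (y, x) = - hr h (x, y)"
    using antisym_fieldD[OF h, of y x] antisym_fieldD[OF h, of "\<theta> y" "\<theta> x"] by (simp add: hr_def)
qed

lemma q_cong: "(\<And>x y. (x, y) \<in> ELL \<Longrightarrow> h (x, y) = h' (x, y)) \<Longrightarrow> q h = q h'"
  unfolding q_def by (intro ext sum.cong) auto

lemma partition_hl:
  assumes h: "antisym_field h"
  shows "partition_field V E b (hl h) = (\<Sum>A1\<in>Pow L. \<Sum>A2\<in>Pow L.
     exp (- (b / 4) * q h A1) * exp (- (b / 4) * q h A2) *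
     exp (- (b / 2) * (\<Sum>x\<in>C. (spin A1 x - spin A2 x)\<^sup>2)))"
proof -
  have 1: "q (hl h) = q h" by (rule q_cong) (auto simp: hl_def ELL_def)
  have 2: "q (tw (hl h)) = q h"
  proof (rule q_cong)
    fix x y assume "(x, y) \<in> ELL"
    then have xy: "(x, y) \<in> E" "x \<in> L" "y \<in> L" by (auto simp: ELL_def)
    then have "x \<in> V" "y \<in> V" using L by auto
    then show "tw (hl h) (x, y) = h (x, y)"
      using xy \<theta>E[OF xy(1)] \<theta>L[of x] \<theta>L[of y] \<theta>\<theta>[of x] \<theta>\<theta>[of y] by (simp add: hl_def tw_def)
  qed
  have 3: "hl h (x, \<theta> x) = 0" if "x \<in> C" for x using that L \<theta>L by (auto simp: hl_def C_def)
  show ?thesis unfolding partition_factor[OF antisym_hl[OF h]] 1 2 by (simp add: 3)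
qed

lemma partition_hr:
  assumes h: "antisym_field h"
  shows "partition_field V E b (hr h) = (\<Sum>A1\<in>Pow L. \<Sum>A2\<in>Pow L.
     exp (- (b / 4) * q (tw h) A1) * exp (- (b / 4) * q (tw h) A2) *
     exp (- (b / 2) * (\<Sum>x\<in>C. (spin A1 x - spin A2 x)\<^sup>2)))"
proof -
  have 1: "q (hr h) = q (tw h)" by (rule q_cong) (auto simp: hr_def tw_def ELL_def)
  have 2: "q (tw (hr h)) = q (tw h)"
  proof (rule q_cong)
    fix x y assume "(x, y) \<in> ELL"
    then have xy: "(x, y) \<in> E" "x \<in> L" "y \<in> L" by (auto simp: ELL_def)
    then have "x \<in> V" "y \<in> V" using L by auto
    then show "tw (hr h) (x, y) = (tw h) (x, y)"
      using xy \<theta>E[OF xy(1)] \<theta>L[of x] \<theta>L[of y] \<theta>\<theta>[of x] \<theta>\<theta>[of y] by (simp add: hr_def tw_def)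
  qed
  have 3: "hr h (x, \<theta> x) = 0" if "x \<in> C" for x using that L \<theta>L by (auto simp: hr_def C_def)
  show ?thesis unfolding partition_factor[OF antisym_hr[OF h]] 1 2 by (simp add: 3)
qed

text \<open>An instance of \<open>gauss_cross_le\<close>. In each diagonal term the two vectors
  carry the same shift, which cancels in their difference; what remains are the partition functions
  of the two symmetrised fields, which vanish on crossing bonds.\<close>

lemma reflection_positivity:
  assumes h: "antisym_field h" and b: "0 \<le> b"
  shows "2 * partition_field V E b h \<le> partition_field V E b (hl h) + partition_field V E b (hr h)"
proof -
  have "2 * partition_field V E b h \<le>
    (\<Sum>A1\<in>Pow L. \<Sum>A2\<in>Pow L. exp (- (b / 4) * q h A1) * exp (- (b / 4) * q h A2) *
     exp (- (b / 2) * (\<Sum>x\<in>C. ((spin A1 x + h (x, \<theta> x)) - (spin A2 x + h (x, \<theta> x)))\<^sup>2))) +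
    (\<Sum>A1\<in>Pow L. \<Sum>A2\<in>Pow L. exp (- (b / 4) * q (tw h) A1) * exp (- (b / 4) * q (tw h) A2) *
     exp (- (b / 2) * (\<Sum>x\<in>C. (spin A1 x - spin A2 x)\<^sup>2)))"
    unfolding partition_factor[OF h]
    by (rule gauss_cross_le[OF b, where u="\<lambda>A x. spin A x + h (x, \<theta> x)" and v="spin"])
       (use finite_subset[OF L V] in simp)
  then show ?thesis unfolding partition_hl[OF h] partition_hr[OF h] by simp
qed

text \<open>The support of \<open>hl h\<close> is at most twice the support of h inside L, that of
  \<open>hr h\<close> at most twice the support outside L. The crossing bond from x to y belongs to
  the support of h but to neither part, hence the strict inequality.\<close>

lemma card_nonzero:
  assumes "(x, y) \<in> E" "x \<in> L" "y \<notin> L" "h (x, y) \<noteq> 0"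
  shows "card {e \<in> E. hl h e \<noteq> 0} + card {e \<in> E. hr h e \<noteq> 0} < 2 * card {e \<in> E. h e \<noteq> 0}"
proof -
  let ?t = "\<lambda>(x, y). (\<theta> x, \<theta> y)"
  let ?l = "{e \<in> ELL. h e \<noteq> 0}" and ?r = "{e \<in> ERR. h e \<noteq> 0}"
  have fin: "finite ELL" "finite ERR" using finE by (auto simp: ELL_def ERR_def intro: finite_subset)
  have "{e \<in> E. hl h e \<noteq> 0} \<subseteq> ?l \<union> ?t ` ?l"
  proof
    fix e assume e: "e \<in> {e \<in> E. hl h e \<noteq> 0}"
    obtain x y where xy: "e = (x, y)" by (cases e)
    have V: "x \<in> V" "y \<in> V" using e xy E by auto
    from e have "(x \<in> L \<and> y \<in> L \<and> h (x, y) \<noteq> 0) \<or> (x \<notin> L \<and> y \<notin> L \<and> h (\<theta> x, \<theta> y) \<noteq> 0)"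
      by (auto simp: hl_def xy split: if_splits)
    then show "e \<in> ?l \<union> ?t ` ?l"
    proof
      assume "x \<notin> L \<and> y \<notin> L \<and> h (\<theta> x, \<theta> y) \<noteq> 0"
      then have "(\<theta> x, \<theta> y) \<in> ?l" using e xy V \<theta>L \<theta>E by (auto simp: ELL_def)
      moreover have "e = ?t (\<theta> x, \<theta> y)" using V \<theta>\<theta> xy by simp
      ultimately show ?thesis by blast
    qed (use e xy in \<open>auto simp: ELL_def\<close>)
  qed
  then have "card {e \<in> E. hl h e \<noteq> 0} \<le> card (?l \<union> ?t ` ?l)" using fin by (intro card_mono) auto
  also have "\<dots> \<le> card ?l + card (?t ` ?l)" by (rule card_Un_le)
  also have "card (?t ` ?l) \<le> card ?l" using fin by (intro card_image_le) auto
  finally have 1: "card {e \<in> E. hl h e \<noteq> 0} \<le> 2 * card ?l" by simp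
  have "{e \<in> E. hr h e \<noteq> 0} \<subseteq> ?r \<union> ?t ` ?r"
  proof
    fix e assume e: "e \<in> {e \<in> E. hr h e \<noteq> 0}"
    obtain x y where xy: "e = (x, y)" by (cases e)
    have V: "x \<in> V" "y \<in> V" using e xy E by auto
    from e have "(x \<notin> L \<and> y \<notin> L \<and> h (x, y) \<noteq> 0) \<or> (x \<in> L \<and> y \<in> L \<and> h (\<theta> x, \<theta> y) \<noteq> 0)"
      by (auto simp: hr_def xy split: if_splits)
    then show "e \<in> ?r \<union> ?t ` ?r"
    proof
      assume "x \<in> L \<and> y \<in> L \<and> h (\<theta> x, \<theta> y) \<noteq> 0"
      then have "(\<theta> x, \<theta> y) \<in> ?r" using e xy V \<theta>L \<theta>E by (auto simp: ERR_def)
      moreover have "e = ?t (\<theta> x, \<theta> y)" using V \<theta>\<theta> xy by simp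
      ultimately show ?thesis by blast
    qed (use e xy in \<open>auto simp: ERR_def\<close>)
  qed
  then have "card {e \<in> E. hr h e \<noteq> 0} \<le> card (?r \<union> ?t ` ?r)" using fin by (intro card_mono) auto
  also have "\<dots> \<le> card ?r + card (?t ` ?r)" by (rule card_Un_le)
  also have "card (?t ` ?r) \<le> card ?r" using fin by (intro card_image_le) auto
  finally have 2: "card {e \<in> E. hr h e \<noteq> 0} \<le> 2 * card ?r" by simp
  have "card (insert (x, y) (?l \<union> ?r)) \<le> card {e \<in> E. h e \<noteq> 0}"
    using finE assms by (intro card_mono) (auto simp: ELL_def ERR_def)
  moreover have "card (insert (x, y) (?l \<union> ?r)) = Suc (card (?l \<union> ?r))"
    using fin assms by (intro card_insert_disjoint) (auto simp: ELL_def ERR_def)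
  moreover have "card (?l \<union> ?r) = card ?l + card ?r"
    using fin by (intro card_Un_disjoint) (auto simp: ELL_def ERR_def)
  ultimately show ?thesis using 1 2 by linarith
qed

end

text \<open>Among the maximisers with values in a fixed finite set, one with the smallest support
  vanishes: otherwise reflecting through a bond of its support yields a smaller one.\<close>

lemma gaussian_domination:
  fixes V :: "'a set"
  assumes V: "finite V" and E: "E \<subseteq> V \<times> V" and sym: "\<And>x y. (x, y) \<in> E \<Longrightarrow> (y, x) \<in> E"
    and bonds: "\<And>x y. (x, y) \<in> E \<Longrightarrow> \<exists>\<theta> L. bond_reflection V E \<theta> L \<and> x \<in> L \<and> y \<notin> L"
    and h: "antisym_field h" and b: "0 \<le> b"
  shows "partition_field V E b h \<le> partition_field V E b (\<lambda>_. 0)"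
proof -
  let ?Z = "partition_field V E b"
  have finE: "finite E" using finite_subset[OF E] V by auto
  define W where "W = insert 0 (h ` E)"
  \<comment> \<open>Values are restricted to those of h and 0, so there are finitely many
    candidates, and both symmetrisations of a candidate are candidates.\<close>
  define H where "H = {f. antisym_field f \<and> (\<forall>e. (e \<in> E \<longrightarrow> f e \<in> W) \<and> (e \<notin> E \<longrightarrow> f e = 0))}"
  have "finite {f. \<forall>e. (e \<in> E \<longrightarrow> f e \<in> W) \<and> (e \<notin> E \<longrightarrow> f e = 0)}"
    using finE by (intro finite_set_of_finite_funs) (auto simp: W_def)
  then have finH: "finite H" by (rule rev_finite_subset) (auto simp: H_def)
  define h0 where "h0 e = (if e \<in> E then h e else 0)" for e
  have "antisym_field h0"
  proof (rule antisym_fieldI)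
    fix x y
    have "(y, x) \<in> E \<longleftrightarrow> (x, y) \<in> E" using sym by blast
    then show "h0 (y, x) = - h0 (x, y)" using antisym_fieldD[OF h, of y x] by (simp add: h0_def)
  qed
  then have h0: "h0 \<in> H" by (auto simp: H_def h0_def W_def)
  have Zh0: "?Z h0 = ?Z h"
    unfolding partition_field_def h0_def
    by (intro sum.cong refl arg_cong[where f=exp] arg_cong2[where f="(*)"]) auto
  define m where "m = Max (?Z ` H)"
  have le_m: "?Z f \<le> m" if "f \<in> H" for f unfolding m_def using that finH by auto
  have "m \<in> ?Z ` H" unfolding m_def using finH h0 by (intro Max_in) auto
  then obtain k where k: "k \<in> H \<and> ?Z k = m" by auto
  obtain f where f: "f \<in> H" "?Z f = m"
    and least: "\<And>g. g \<in> H \<Longrightarrow> ?Z g = m \<Longrightarrow> card {e \<in> E. f e \<noteq> 0} \<le> card {e \<in> E. g e \<noteq> 0}"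
    using ex_has_least_nat[of "\<lambda>f. f \<in> H \<and> ?Z f = m", OF k, of "\<lambda>g. card {e \<in> E. g e \<noteq> 0}"] by blast
  have "f e = 0" if eE: "e \<in> E" for e
  proof (rule ccontr)
    assume ne: "f e \<noteq> 0"
    obtain x y where xy: "e = (x, y)" by (cases e)
    obtain \<theta> L where R: "bond_reflection V E \<theta> L" and xL: "x \<in> L" and yL: "y \<notin> L"
      using bonds[of x y] eE xy by auto
    interpret bond_reflection V E \<theta> L by (rule R)
    have af: "antisym_field f" using f by (simp add: H_def)
    have fW: "f e \<in> W" for e
    proof (cases "e \<in> E")
      case True
      then show ?thesis using f(1) unfolding H_def by blast
    next
      case False
      then have "f e = 0" using f(1) unfolding H_def by blast
      then show ?thesis by (simp add: W_def)
    qed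
    have hlH: "hl f \<in> H" "hr f \<in> H"
    proof -
      have "0 \<in> W" by (simp add: W_def)
      then have "hl f e \<in> W" "hr f e \<in> W" for e
        using fW by (cases e; simp add: hl_def hr_def)+
      moreover have "hl f e = 0" "hr f e = 0" if "e \<notin> E" for e
        using that by (cases e; simp add: hl_def hr_def)+
      ultimately show "hl f \<in> H" "hr f \<in> H"
        using antisym_hl[OF af] antisym_hr[OF af] unfolding H_def by blast+
    qed
    have "2 * m \<le> ?Z (hl f) + ?Z (hr f)" using reflection_positivity[OF af b] f by simp
    \<comment> \<open>Neither value exceeds the maximum m and their mean is at least m, so both
      symmetrised fields are maximisers too.\<close>
    then have "?Z (hl f) = m" "?Z (hr f) = m" using le_m[OF hlH(1)] le_m[OF hlH(2)] by auto
    then have "card {e \<in> E. f e \<noteq> 0} \<le> card {e \<in> E. hl f e \<noteq> 0}"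
      "card {e \<in> E. f e \<noteq> 0} \<le> card {e \<in> E. hr f e \<noteq> 0}" using least hlH by auto
    moreover have "card {e \<in> E. hl f e \<noteq> 0} + card {e \<in> E. hr f e \<noteq> 0} < 2 * card {e \<in> E. f e \<noteq> 0}"
      using card_nonzero[of x y f] eE ne xL yL xy by auto
    ultimately show False by linarith
  qed
  then have "?Z f = ?Z (\<lambda>_. 0)"
    unfolding partition_field_def
    by (intro sum.cong refl arg_cong[where f=exp] arg_cong2[where f="(*)"]) auto
  then show ?thesis using le_m[OF h0] f Zh0 by simp
qed

section \<open>From Gaussian domination to the infrared bound\<close>

lemma exp_slope_le:
  fixes a c :: real
  assumes "\<And>t. t > 0 \<Longrightarrow> 1 + a * t \<le> exp (c * t)"
  shows "a \<le> c"
proof -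
  \<comment> \<open>Both sides equal 1 at t = 0, so their slopes there can be compared.\<close>
  have "((\<lambda>t. exp (c * t)) has_real_derivative c) (at 0)"
    by (auto intro!: derivative_eq_intros)
  then have "((\<lambda>t. (exp (c * t) - 1) / t) \<longlongrightarrow> c) (at_right 0)"
    unfolding has_field_derivative_iff by (auto intro: filterlim_mono at_within_le_at)
  moreover have "eventually (\<lambda>t. a \<le> (exp (c * t) - 1) / t) (at_right 0)"
    unfolding eventually_at_right_field
    using assms by (intro exI[of _ 1]) (auto simp: field_simps)
  ultimately show ?thesis by (intro tendsto_lowerbound[of _ c "at_right 0"]) auto
qed

text \<open>Gaussian domination for the field \<epsilon> h, to second order in \<epsilon>; the first
  order disappears by averaging over both signs of \<epsilon>. As E contains every edge in both
  directions, the factor b / 2 makes \<open>w\<close> the Ising weight at inverse temperature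
  b.\<close>

lemma infrared_bound:
  fixes V :: "'a set"
  assumes V: "finite V" and E: "E \<subseteq> V \<times> V" and sym: "\<And>x y. (x, y) \<in> E \<Longrightarrow> (y, x) \<in> E"
    and bonds: "\<And>x y. (x, y) \<in> E \<Longrightarrow> \<exists>\<theta> L. bond_reflection V E \<theta> L \<and> x \<in> L \<and> y \<notin> L"
    and h: "antisym_field h" and b: "0 < b"
  defines "w \<equiv> \<lambda>A. exp (b / 2 * (\<Sum>(x, y)\<in>E. spin A x * spin A y))"
  shows "(\<Sum>A\<in>Pow V. (\<Sum>(x, y)\<in>E. spin A x * h (x, y))\<^sup>2 * w A)
     \<le> (\<Sum>e\<in>E. (h e)\<^sup>2) / (2 * b) * (\<Sum>A\<in>Pow V. w A)"
proof -
  have finE: "finite E" using finite_subset[OF E] V by auto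
  define Hs where "Hs = (\<Sum>e\<in>E. (h e)\<^sup>2)"
  define Y where "Y A = (\<Sum>(x, y)\<in>E. spin A x * h (x, y))" for A
  define k where "k = exp (- (b / 2) * real (card E))"
  \<comment> \<open>The linear term pairs h with differences of spins; by antisymmetry both
    endpoints contribute equally, so it is twice the pairing \<open>Y\<close>.\<close>
  have swap: "(\<Sum>(x, y)\<in>E. spin A y * h (x, y)) = - Y A" for A
  proof -
    have "(\<Sum>(x, y)\<in>E. spin A y * h (x, y)) = (\<Sum>(x, y)\<in>E. spin A x * h (y, x))"
      by (intro sum.reindex_bij_witness[where i="\<lambda>(x,y). (y,x)" and j="\<lambda>(x,y). (y,x)"]) (auto intro: sym)
    also have "\<dots> = (\<Sum>(x, y)\<in>E. - (spin A x * h (x, y)))"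
      by (intro sum.cong refl, clarify) (subst antisym_fieldD[OF h], simp)
    finally show ?thesis by (simp add: Y_def sum_negf case_prod_unfold)
  qed
  have Q: "(\<Sum>(x, y)\<in>E. (spin A x - spin A y + \<epsilon> * h (x, y))\<^sup>2)
     = 2 * real (card E) - 2 * (\<Sum>(x, y)\<in>E. spin A x * spin A y) + 4 * \<epsilon> * Y A + \<epsilon>\<^sup>2 * Hs" for A \<epsilon>
  proof -
    have sq: "(spin A x)\<^sup>2 = 1" for x by (simp add: spin_def)
    have "(\<Sum>(x, y)\<in>E. (spin A x - spin A y + \<epsilon> * h (x, y))\<^sup>2)
      = (\<Sum>(x, y)\<in>E. 2 - 2 * (spin A x * spin A y) + 2 * \<epsilon> * (spin A x * h (x, y))
           - 2 * \<epsilon> * (spin A y * h (x, y)) + \<epsilon>\<^sup>2 * (h (x, y))\<^sup>2)"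
      by (intro sum.cong refl) (auto simp: power2_eq_square algebra_simps sq[unfolded power2_eq_square])
    also have "\<dots> = (\<Sum>(x, y)\<in>E. 2) - 2 * (\<Sum>(x, y)\<in>E. spin A x * spin A y) + 2 * \<epsilon> * (\<Sum>(x, y)\<in>E. spin A x * h (x, y))
           - 2 * \<epsilon> * (\<Sum>(x, y)\<in>E. spin A y * h (x, y)) + \<epsilon>\<^sup>2 * Hs"
      by (simp add: Hs_def case_prod_unfold sum.distrib sum_subtractf sum_distrib_left)
    finally show ?thesis unfolding swap by (simp add: Y_def case_prod_unfold algebra_simps)
  qed
  have Z: "partition_field V E b (\<lambda>e. \<epsilon> * h e) = k * exp (- b * \<epsilon>\<^sup>2 * Hs / 4) * (\<Sum>A\<in>Pow V. exp (- b * \<epsilon> * Y A) * w A)" for \<epsilon>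
  proof -
    define S where "S A = (\<Sum>(x, y)\<in>E. spin A x * spin A y)" for A
    have id: "- (b / 4) * (2 * e - 2 * s + 4 * \<epsilon> * y + \<epsilon>\<^sup>2 * Hs)
        = - (b / 2) * e + - b * \<epsilon>\<^sup>2 * Hs / 4 + (- b * \<epsilon> * y + b / 2 * s)" for e s y
      by argo
    have "partition_field V E b (\<lambda>e. \<epsilon> * h e)
       = (\<Sum>A\<in>Pow V. k * exp (- b * \<epsilon>\<^sup>2 * Hs / 4) * (exp (- b * \<epsilon> * Y A) * w A))"
      unfolding partition_field_def Q k_def w_def S_def[symmetric]
      unfolding exp_add[symmetric] by (rule sum.cong[OF refl], rule arg_cong[where f=exp], rule id)
    then show ?thesis by (simp only: sum_distrib_left)
  qed
  define Zw where "Zw = (\<Sum>A\<in>Pow V. w A)"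
  have wpos: "w A > 0" for A by (simp add: w_def)
  have Zw: "Zw > 0" unfolding Zw_def using V wpos by (intro sum_pos) auto
  have kpos: "k > 0" by (simp add: k_def)
  have dom: "(\<Sum>A\<in>Pow V. exp (- b * \<epsilon> * Y A) * w A) \<le> exp (b * \<epsilon>\<^sup>2 * Hs / 4) * Zw" for \<epsilon>
  proof -
    have "antisym_field (\<lambda>e. \<epsilon> * h e)"
      by (rule antisym_fieldI, subst antisym_fieldD[OF h], simp)
    from gaussian_domination[OF V E sym bonds this less_imp_le[OF b]]
    have "k * exp (- b * \<epsilon>\<^sup>2 * Hs / 4) * (\<Sum>A\<in>Pow V. exp (- b * \<epsilon> * Y A) * w A) \<le> k * Zw"
      using Z[of \<epsilon>] Z[of 0] by (simp add: Zw_def)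
    then have "exp (- b * \<epsilon>\<^sup>2 * Hs / 4) * (\<Sum>A\<in>Pow V. exp (- b * \<epsilon> * Y A) * w A) \<le> Zw"
      using kpos by (simp add: mult.assoc)
    then show ?thesis by (simp add: exp_minus field_simps)
  qed
  define M where "M = (\<Sum>A\<in>Pow V. (Y A)\<^sup>2 * w A)"
  have "1 + (b\<^sup>2 * M / (2 * Zw)) * t \<le> exp (b * Hs / 4 * t)" if t: "t > 0" for t
  proof -
    define \<epsilon> where "\<epsilon> = sqrt t"
    have \<epsilon>: "\<epsilon>\<^sup>2 = t" using t by (simp add: \<epsilon>_def)
    \<comment> \<open>That is, cosh y is at least 1 + y^2 / 2; it follows from the square of 2 *
      sinh (y / 2).\<close>
    have cosh: "2 + y\<^sup>2 \<le> exp y + exp (- y)" for y :: real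
    proof -
      have "1 + y + y\<^sup>2 / 2 \<le> exp y" if "0 \<le> y" for y :: real using exp_lower_Taylor_quadratic[OF that] .
      have "exp y + exp (- y) - 2 = (exp (y / 2) - exp (- y / 2))\<^sup>2"
        by (simp add: power2_eq_square algebra_simps exp_add[symmetric])
      also have "\<dots> = (2 * sinh (y / 2))\<^sup>2" by (simp add: sinh_field_def diff_divide_distrib)
      also have "\<dots> \<ge> y\<^sup>2"
      proof -
        have "\<bar>y / 2\<bar> \<le> \<bar>sinh (y / 2)\<bar>"
          using real_le_abs_sinh[of "y / 2"] by (simp add: sinh_field_def exp_minus)
        then have "\<bar>y\<bar> \<le> \<bar>2 * sinh (y / 2)\<bar>" by simp
        then show ?thesis by (simp only: abs_le_square_iff)
      qed
      finally show ?thesis by simp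
    qed
    have "2 * Zw + b\<^sup>2 * t * M = (\<Sum>A\<in>Pow V. (2 + (b * \<epsilon> * Y A)\<^sup>2) * w A)"
      by (simp add: Zw_def M_def \<epsilon>[symmetric] sum.distrib sum_distrib_left algebra_simps power_mult_distrib)
    also have "\<dots> \<le> (\<Sum>A\<in>Pow V. (exp (b * \<epsilon> * Y A) + exp (- (b * \<epsilon> * Y A))) * w A)"
      by (intro sum_mono mult_right_mono cosh less_imp_le[OF wpos])
    also have "\<dots> = (\<Sum>A\<in>Pow V. exp (- b * (- \<epsilon>) * Y A) * w A) + (\<Sum>A\<in>Pow V. exp (- b * \<epsilon> * Y A) * w A)"
      by (simp add: distrib_right sum.distrib)
    also have "\<dots> \<le> exp (b * (- \<epsilon>)\<^sup>2 * Hs / 4) * Zw + exp (b * \<epsilon>\<^sup>2 * Hs / 4) * Zw"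
      by (intro add_mono dom)
    also have "\<dots> = 2 * exp (b * Hs / 4 * t) * Zw" using \<epsilon> by (simp add: mult_ac)
    finally show ?thesis using Zw by (simp add: field_simps)
  qed
  then have "b\<^sup>2 * M / (2 * Zw) \<le> b * Hs / 4" by (rule exp_slope_le)
  then have "b\<^sup>2 * M * 4 \<le> b * Hs * (2 * Zw)" using Zw by (simp add: field_simps)
  then have "b * (2 * b * M) \<le> b * (Hs * Zw)" by (simp add: power2_eq_square algebra_simps)
  then have "2 * b * M \<le> Hs * Zw" using b by simp
  then have "M \<le> Hs / (2 * b) * Zw" using b by (simp add: field_simps)
  then show ?thesis unfolding M_def Hs_def Zw_def Y_def .
qed

section \<open>The minus phase\<close>

lemma nbr_sym: "nbr d x y \<Longrightarrow> nbr d y x"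
  by (simp add: nbr_def abs_minus_commute)

lemma nbr_iff:
  "nbr d x y \<longleftrightarrow> x \<in> Zd d \<and> (\<exists>i<d. y = x(i := x i + 1) \<or> y = x(i := x i - 1))"
proof
  assume n: "nbr d x y"
  have "int (\<Sum>i<d. nat \<bar>x i - y i\<bar>) = 1" using n by (simp add: nbr_def)
  then have "(\<Sum>i<d. nat \<bar>x i - y i\<bar>) = 1" by linarith
  then obtain i where i: "i < d" "nat \<bar>x i - y i\<bar> = 1" and z: "\<forall>j\<in>{..<d}. i \<noteq> j \<longrightarrow> nat \<bar>x j - y j\<bar> = 0"
    by (subst (asm) sum_eq_1_iff) auto
  have xy: "x \<in> Zd d" "y \<in> Zd d" using n by (auto simp: nbr_def)
  have "y j = x j" if "j \<noteq> i" for j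
  proof (cases "j < d")
    case True then show ?thesis using z that by auto
  next
    case False then show ?thesis using xy by (auto simp: Zd_def PiE_iff extensional_def)
  qed
  moreover have "y i = x i + 1 \<or> y i = x i - 1" using i(2) by linarith
  ultimately have "y = x(i := x i + 1) \<or> y = x(i := x i - 1)" by (auto simp: fun_eq_iff)
  then show "x \<in> Zd d \<and> (\<exists>i<d. y = x(i := x i + 1) \<or> y = x(i := x i - 1))" using xy i by auto
next
  assume a: "x \<in> Zd d \<and> (\<exists>i<d. y = x(i := x i + 1) \<or> y = x(i := x i - 1))"
  then obtain i where i: "i < d" "y = x(i := x i + 1) \<or> y = x(i := x i - 1)" by auto
  then have y: "y \<in> Zd d" using a by (auto simp: Zd_def PiE_iff extensional_def)
  have "(\<Sum>j<d. \<bar>x j - y j\<bar>) = \<bar>x i - y i\<bar> + (\<Sum>j\<in>{..<d} - {i}. \<bar>x j - y j\<bar>)"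
    using i(1) by (subst sum.remove[of _ i]) auto
  also have "(\<Sum>j\<in>{..<d} - {i}. \<bar>x j - y j\<bar>) = 0"
  proof (intro sum.neutral ballI)
    fix j assume "j \<in> {..<d} - {i}"
    then have "y j = x j" using i(2) by auto
    then show "\<bar>x j - y j\<bar> = 0" by simp
  qed
  also have "\<bar>x i - y i\<bar> = 1" using i(2) by auto
  finally show "nbr d x y" using a y by (simp add: nbr_def)
qed

lemma finite_nbr: "finite {y. nbr d x y}"
  by (rule finite_subset[of _ "(\<lambda>i. x(i := x i + 1)) ` {..<d} \<union> (\<lambda>i. x(i := x i - 1)) ` {..<d}"])
     (auto simp: nbr_iff)

section \<open>Finite volume: Ising weights of sets of plus sites\<close>

definition level :: "nat \<Rightarrow> site \<Rightarrow> int" where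
  "level d x = (\<Sum>i<d. x i)"

lemma level_upd: "i < d \<Longrightarrow> level d (x(i := k)) = level d x - x i + k"
  unfolding level_def by (subst (1 2) sum.remove[of _ i]) auto

lemma nbr_level: "nbr d x y \<Longrightarrow> level d y = level d x + 1 \<or> level d y = level d x - 1"
  by (auto simp: nbr_iff level_upd)

text \<open>Each edge touching \<open>\<Lambda>\<close> is listed once, oriented upwards.\<close>

definition touching :: "nat \<Rightarrow> site set \<Rightarrow> (site \<times> site) set" where
  "touching d \<Lambda> = {(x, y). nbr d x y \<and> level d y = level d x + 1 \<and> (x \<in> \<Lambda> \<or> y \<in> \<Lambda>)}"

lemma finite_touching: "finite \<Lambda> \<Longrightarrow> finite (touching d \<Lambda>)"
proof (rule finite_subset)
  show "touching d \<Lambda> \<subseteq> (SIGMA x:\<Lambda>. {y. nbr d x y}) \<union> (\<lambda>(x, y). (y, x)) ` (SIGMA x:\<Lambda>. {y. nbr d x y})"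
    by (auto simp: touching_def image_iff intro: nbr_sym)
qed (auto simp: finite_nbr)

text \<open>For A inside the region all outer sites count as minus. Since edges to outer sites are
  included among the touching ones, the minus boundary condition is built into the weight.\<close>

definition weight :: "nat \<Rightarrow> real \<Rightarrow> site set \<Rightarrow> site set \<Rightarrow> real" where
  "weight d \<beta> \<Lambda> A = exp (\<beta> * (\<Sum>(x, y)\<in>touching d \<Lambda>. spin A x * spin A y))"

lemma log_supermodular_weight:
  assumes "0 \<le> \<beta>"
  shows "log_supermodular S (weight d \<beta> \<Lambda>)"
  unfolding log_supermodular_def
proof (intro conjI allI impI)
  fix A B
  have "(\<Sum>(x, y)\<in>touching d \<Lambda>. spin A x * spin A y) + (\<Sum>(x, y)\<in>touching d \<Lambda>. spin B x * spin B y)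
     \<le> (\<Sum>(x, y)\<in>touching d \<Lambda>. spin (A \<union> B) x * spin (A \<union> B) y) + (\<Sum>(x, y)\<in>touching d \<Lambda>. spin (A \<inter> B) x * spin (A \<inter> B) y)"
    unfolding sum.distrib[symmetric] by (intro sum_mono) (auto simp: spin_def)
  from mult_left_mono[OF this assms]
  show "weight d \<beta> \<Lambda> A * weight d \<beta> \<Lambda> B \<le> weight d \<beta> \<Lambda> (A \<union> B) * weight d \<beta> \<Lambda> (A \<inter> B)"
    unfolding weight_def exp_add[symmetric] by (simp add: distrib_left)
qed (simp add: weight_def)

abbreviation mexp :: "nat \<Rightarrow> real \<Rightarrow> site set \<Rightarrow> (site set \<Rightarrow> real) \<Rightarrow> real" where
  "mexp d \<beta> \<Lambda> \<equiv> expect (weight d \<beta> \<Lambda>) \<Lambda>"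

lemma expect_scale:
  assumes "\<And>A. A \<subseteq> S \<Longrightarrow> W1 A = c * W2 A" "c \<noteq> 0"
  shows "expect W1 S f = expect W2 S f"
proof -
  have "(\<Sum>A\<in>Pow S. f A * W1 A) = c * (\<Sum>A\<in>Pow S. f A * W2 A)"
    unfolding sum_distrib_left by (intro sum.cong refl) (simp add: assms(1))
  moreover have "(\<Sum>A\<in>Pow S. W1 A) = c * (\<Sum>A\<in>Pow S. W2 A)"
    unfolding sum_distrib_left by (intro sum.cong refl) (simp add: assms(1))
  ultimately show ?thesis using assms(2) by (simp add: expect_def)
qed

lemma expect_cong: "(\<And>A. A \<subseteq> S \<Longrightarrow> f A = g A) \<Longrightarrow> expect W S f = expect W S g"
  unfolding expect_def by (intro arg_cong2[where f="(/)"] sum.cong) auto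

lemma expect_const: "finite S \<Longrightarrow> log_supermodular S W \<Longrightarrow> expect W S (\<lambda>_. c) = c"
  using sum_weight_pos[of S W] by (simp add: expect_def sum_distrib_left[symmetric])

lemma expect_mono:
  assumes "finite S" "log_supermodular S W" "\<And>A. A \<subseteq> S \<Longrightarrow> f A \<le> g A"
  shows "expect W S f \<le> expect W S g"
  unfolding expect_def
proof (intro divide_right_mono sum_mono mult_right_mono)
  show "0 \<le> sum W (Pow S)" using sum_weight_pos[OF assms(1,2)] by simp
  show "0 \<le> W A" if "A \<in> Pow S" for A using log_supermodular_pos[OF assms(2), of A] that by simp
qed (use assms(3) in auto)

lemma expect_add: "expect W S (\<lambda>A. f A + g A) = expect W S f + expect W S g"
  by (simp add: expect_def distrib_right sum.distrib add_divide_distrib)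

lemma expect_cmult: "expect W S (\<lambda>A. c * f A) = c * expect W S f"
  by (simp add: expect_def sum_distrib_left mult.assoc)

lemma expect_sum: "finite I \<Longrightarrow> expect W S (\<lambda>A. \<Sum>i\<in>I. f i A) = (\<Sum>i\<in>I. expect W S (f i))"
proof (induction I rule: finite_induct)
  case empty
  then show ?case by (simp add: expect_def)
qed (simp add: expect_add)

text \<open>Edges touching the larger but not the smaller region join two minus spins and give a
  constant factor. So one weight, restricted to the subsets of a smaller region, describes the minus
  boundary condition there.\<close>

lemma weight_subset:
  assumes \<Lambda>: "\<Lambda> \<subseteq> \<Lambda>'" "finite \<Lambda>'" and A: "A \<subseteq> \<Lambda>"
  shows "weight d \<beta> \<Lambda>' A = exp (\<beta> * real (card (touching d \<Lambda>' - touching d \<Lambda>))) * weight d \<beta> \<Lambda> A"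
proof -
  let ?g = "\<lambda>(x, y). spin A x * spin A y"
  have sub: "touching d \<Lambda> \<subseteq> touching d \<Lambda>'" using \<Lambda> by (auto simp: touching_def)
  have "sum ?g (touching d \<Lambda>') = sum ?g (touching d \<Lambda>' - touching d \<Lambda>) + sum ?g (touching d \<Lambda>)"
    by (rule sum.subset_diff[OF sub finite_touching[OF \<Lambda>(2)]])
  also have "sum ?g (touching d \<Lambda>' - touching d \<Lambda>) = (\<Sum>e\<in>touching d \<Lambda>' - touching d \<Lambda>. 1)"
  proof (intro sum.cong refl, clarify)
    fix x y assume "(x, y) \<in> touching d \<Lambda>'" "(x, y) \<notin> touching d \<Lambda>"
    then have "x \<notin> A" "y \<notin> A" using A by (auto simp: touching_def)
    then show "spin A x * spin A y = 1" by (simp add: spin_def)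
  qed
  finally show ?thesis by (simp add: weight_def exp_add[symmetric] distrib_left)
qed

lemma mexp_subset:
  assumes "\<Lambda> \<subseteq> \<Lambda>'" "finite \<Lambda>'"
  shows "expect (weight d \<beta> \<Lambda>') \<Lambda> f = mexp d \<beta> \<Lambda> f"
  by (rule expect_scale[OF weight_subset[OF assms]]) auto

text \<open>The measure in the smaller region is the one in the larger region conditioned on minus
  spins in between, which lowers increasing functions.\<close>

lemma mexp_mono:
  assumes "\<Lambda> \<subseteq> \<Lambda>'" "finite \<Lambda>'" "0 \<le> \<beta>" "increasing_on \<Lambda>' f"
  shows "mexp d \<beta> \<Lambda> f \<le> mexp d \<beta> \<Lambda>' f"
  using expect_mono_set[OF assms(2) log_supermodular_weight[OF assms(3)] assms(4,1), of d \<Lambda>']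
  by (simp add: mexp_subset[OF assms(1,2)])

definition config :: "nat \<Rightarrow> site set \<Rightarrow> site \<Rightarrow> real" where
  "config d A = (\<lambda>x\<in>Zd d. spin A x)"

lemma bij_spin_config:
  "bij_betw (\<lambda>A. \<lambda>x\<in>\<Lambda>. spin A x) (Pow \<Lambda>) (\<Lambda> \<rightarrow>\<^sub>E {-1, 1::real})"
proof (rule bij_betw_byWitness[where f'="\<lambda>\<sigma>. {x \<in> \<Lambda>. \<sigma> x = 1}"])
  show "\<forall>\<sigma>\<in>\<Lambda> \<rightarrow>\<^sub>E {-1, 1::real}. (\<lambda>x\<in>\<Lambda>. spin {x \<in> \<Lambda>. \<sigma> x = 1} x) = \<sigma>"
  proof (intro ballI ext)
    fix \<sigma> :: "'a \<Rightarrow> real" and x assume \<sigma>: "\<sigma> \<in> \<Lambda> \<rightarrow>\<^sub>E {-1, 1}"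
    show "(\<lambda>x\<in>\<Lambda>. spin {x \<in> \<Lambda>. \<sigma> x = 1} x) x = \<sigma> x"
      using PiE_mem[OF \<sigma>, of x] PiE_arb[OF \<sigma>, of x] by (auto simp: spin_def)
  qed
qed (auto simp: spin_def split: if_splits)

text \<open>Upward oriented touching edges are inner ones, boundary edges starting inside, and
  boundary edges ending inside. The definition of the model lists inner edges as doubletons and
  boundary edges as pairs pointing outwards, so the third kind has to be reversed.\<close>

lemma ising_weight_eq:
  assumes \<Lambda>: "finite \<Lambda>" and A: "A \<subseteq> \<Lambda>"
  shows "ising_weight d \<Lambda> \<beta> (\<lambda>x. -1) (\<lambda>x\<in>\<Lambda>. spin A x) = weight d \<beta> \<Lambda> A"
proof -
  let ?s = "\<lambda>x\<in>\<Lambda>. spin A x" and ?g = "\<lambda>(x, y). spin A x * spin A y"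
  define T1 where "T1 = {(x, y) \<in> touching d \<Lambda>. x \<in> \<Lambda> \<and> y \<in> \<Lambda>}"
  define T2 where "T2 = {(x, y) \<in> touching d \<Lambda>. x \<in> \<Lambda> \<and> y \<notin> \<Lambda>}"
  define T3 where "T3 = {(x, y) \<in> touching d \<Lambda>. x \<notin> \<Lambda> \<and> y \<in> \<Lambda>}"
  have T: "touching d \<Lambda> = T1 \<union> (T2 \<union> T3)" by (auto simp: T1_def T2_def T3_def touching_def)
  have fin: "finite T1" "finite T2" "finite T3"
    by (rule finite_subset[OF _ finite_touching[OF \<Lambda>, of d]], auto simp: T1_def T2_def T3_def)+
  have irr: "x \<noteq> y" if "nbr d x y" for x y using nbr_level[OF that] by auto
  have inj: "inj_on (\<lambda>(x, y). {x, y}) T1"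
    by (auto simp: inj_on_def T1_def touching_def doubleton_eq_iff)
  have E: "edges d \<Lambda> = (\<lambda>(x, y). {x, y}) ` T1"
  proof (intro equalityI subsetI)
    fix e assume "e \<in> edges d \<Lambda>"
    then obtain x y where e: "e = {x, y}" "x \<in> \<Lambda>" "y \<in> \<Lambda>" "nbr d x y" by (auto simp: edges_def)
    from nbr_level[OF e(4)] show "e \<in> (\<lambda>(x, y). {x, y}) ` T1"
    proof
      assume "level d y = level d x + 1"
      then have "(x, y) \<in> T1" using e by (auto simp: T1_def touching_def)
      then show ?thesis using e by force
    next
      assume "level d y = level d x - 1"
      then have "(y, x) \<in> T1" using e nbr_sym by (auto simp: T1_def touching_def)
      then show ?thesis using e by force
    qed
  qed (auto simp: edges_def T1_def touching_def)
  have 1: "(\<Sum>e\<in>edges d \<Lambda>. \<Prod>z\<in>e. ?s z) = sum ?g T1"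
    unfolding E by (subst sum.reindex[OF inj]) (auto intro!: sum.cong simp: T1_def touching_def irr)
  have B: "boundary_edges d \<Lambda> = T2 \<union> (\<lambda>(x, y). (y, x)) ` T3"
  proof (intro equalityI subsetI)
    fix e assume "e \<in> boundary_edges d \<Lambda>"
    then obtain x y where e: "e = (x, y)" "x \<in> \<Lambda>" "y \<notin> \<Lambda>" "nbr d x y" by (auto simp: boundary_edges_def)
    from nbr_level[OF e(4)] show "e \<in> T2 \<union> (\<lambda>(x, y). (y, x)) ` T3"
    proof
      assume "level d y = level d x - 1"
      then have "(y, x) \<in> T3" using e nbr_sym by (auto simp: T3_def touching_def)
      then show ?thesis using e by force
    qed (use e in \<open>auto simp: T2_def touching_def\<close>)
  qed (auto simp: boundary_edges_def T2_def T3_def touching_def nbr_sym)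
  have inj3: "inj_on (\<lambda>(x, y). (y, x)) T3" by (auto simp: inj_on_def)
  have "(\<Sum>(x, y)\<in>boundary_edges d \<Lambda>. ?s x * - 1)
     = (\<Sum>(x, y)\<in>T2. ?s x * - 1) + (\<Sum>(x, y)\<in>(\<lambda>(x, y). (y, x)) ` T3. ?s x * - 1)"
    unfolding B using fin by (intro sum.union_disjoint) (auto simp: T2_def T3_def touching_def)
  also have "(\<Sum>(x, y)\<in>T2. ?s x * - 1) = sum ?g T2"
    using A by (intro sum.cong refl) (auto simp: T2_def spin_def)
  also have "(\<Sum>(x, y)\<in>(\<lambda>(x, y). (y, x)) ` T3. ?s x * - 1) = sum ?g T3"
    using A by (subst sum.reindex[OF inj3]) (auto intro!: sum.cong simp: T3_def spin_def)
  finally have 2: "(\<Sum>(x, y)\<in>boundary_edges d \<Lambda>. ?s x * - 1) = sum ?g T2 + sum ?g T3" .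
  have "sum ?g (touching d \<Lambda>) = sum ?g T1 + sum ?g (T2 \<union> T3)"
    unfolding T using fin by (intro sum.union_disjoint) (auto simp: T1_def T2_def T3_def)
  also have "sum ?g (T2 \<union> T3) = sum ?g T2 + sum ?g T3"
    using fin by (intro sum.union_disjoint) (auto simp: T2_def T3_def)
  finally have 3: "sum ?g (touching d \<Lambda>) = sum ?g T1 + (sum ?g T2 + sum ?g T3)" .
  show ?thesis unfolding ising_weight_def weight_def 1 2 3 by (simp add: distrib_left)
qed

lemma integral_ising:
  assumes \<Lambda>: "finite \<Lambda>" "\<Lambda> \<subseteq> Zd d"
  shows "(\<integral>\<sigma>. f (minus_extend d \<Lambda> \<sigma>) \<partial>ising d \<Lambda> \<beta> (\<lambda>x. -1)) = mexp d \<beta> \<Lambda> (\<lambda>A. f (config d A))"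
proof -
  let ?P = "\<Lambda> \<rightarrow>\<^sub>E {-1, 1::real}" and ?w = "ising_weight d \<Lambda> \<beta> (\<lambda>x. -1)"
  have fin: "finite ?P" using \<Lambda> by (intro finite_PiE) auto
  have re: "(\<Sum>\<sigma>\<in>?P. g \<sigma>) = (\<Sum>A\<in>Pow \<Lambda>. g (\<lambda>x\<in>\<Lambda>. spin A x))" for g :: "_ \<Rightarrow> real"
    by (rule sum.reindex_bij_betw[OF bij_spin_config, symmetric])
  have Z: "ising_Z d \<Lambda> \<beta> (\<lambda>x. -1) = (\<Sum>A\<in>Pow \<Lambda>. weight d \<beta> \<Lambda> A)"
    unfolding ising_Z_def re by (intro sum.cong refl ising_weight_eq \<Lambda>) auto
  have Zpos: "0 \<le> ising_Z d \<Lambda> \<beta> (\<lambda>x. -1)" unfolding Z by (intro sum_nonneg) (simp add: weight_def)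
  have "(\<integral>\<sigma>. f (minus_extend d \<Lambda> \<sigma>) \<partial>ising d \<Lambda> \<beta> (\<lambda>x. -1))
     = (\<Sum>\<sigma>\<in>?P. ?w \<sigma> / ising_Z d \<Lambda> \<beta> (\<lambda>x. -1) * f (minus_extend d \<Lambda> \<sigma>))"
    unfolding ising_def using fin Zpos
    by (subst lebesgue_integral_point_measure_finite) (auto simp: ising_weight_def)
  also have "\<dots> = (\<Sum>A\<in>Pow \<Lambda>. f (config d A) * weight d \<beta> \<Lambda> A / ising_Z d \<Lambda> \<beta> (\<lambda>x. -1))"
    unfolding re
  proof (intro sum.cong refl)
    fix A assume A: "A \<in> Pow \<Lambda>"
    have "minus_extend d \<Lambda> (\<lambda>x\<in>\<Lambda>. spin A x) = config d A"
      using A by (auto simp: minus_extend_def config_def fun_eq_iff spin_def)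
    then show "?w (\<lambda>x\<in>\<Lambda>. spin A x) / ising_Z d \<Lambda> \<beta> (\<lambda>x. -1) * f (minus_extend d \<Lambda> (\<lambda>x\<in>\<Lambda>. spin A x))
      = f (config d A) * weight d \<beta> \<Lambda> A / ising_Z d \<Lambda> \<beta> (\<lambda>x. -1)"
      using ising_weight_eq[OF \<Lambda>(1), of A d \<beta>] A by simp
  qed
  finally show ?thesis unfolding expect_def Z by (simp add: sum_divide_distrib)
qed

section \<open>Construction of the minus phase from limits of cylinder expectations\<close>

lemma measurable_pred_set:
  assumes J: "finite J" and p: "\<And>x. x \<in> J \<Longrightarrow> Measurable.pred N (\<lambda>\<sigma>. P \<sigma> x)"
  shows "(\<lambda>\<sigma>. g {x \<in> J. P \<sigma> x} :: real) \<in> borel_measurable N"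
proof -
  have "(\<lambda>\<sigma>. {x \<in> J. P \<sigma> x}) \<in> N \<rightarrow>\<^sub>M count_space (Pow J)"
    unfolding measurable_count_space_eq2[OF finite_Pow_iff[THEN iffD2, OF J]]
  proof (intro conjI ballI)
    fix \<xi> assume \<xi>: "\<xi> \<in> Pow J"
    have "(\<lambda>\<sigma>. {x \<in> J. P \<sigma> x}) -` {\<xi>} \<inter> space N = {\<sigma> \<in> space N. \<forall>x\<in>J. P \<sigma> x = (x \<in> \<xi>)}"
      using \<xi> by auto
    also have "\<dots> \<in> sets N"
    proof (rule sets.sets_Collect_finite_All[OF _ J])
      fix x assume "x \<in> J"
      note [measurable] = p[OF this]
      show "{\<sigma> \<in> space N. P \<sigma> x = (x \<in> \<xi>)} \<in> sets N" by measurable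
    qed
    finally show "(\<lambda>\<sigma>. {x \<in> J. P \<sigma> x}) -` {\<xi>} \<inter> space N \<in> sets N" .
  qed auto
  from measurable_compose[OF this, of g borel] show ?thesis by simp
qed

lemma tendsto_mono_finite_subsets:
  fixes F :: "'a set \<Rightarrow> real"
  assumes mono: "\<And>X Y. finite Y \<Longrightarrow> X \<subseteq> Y \<Longrightarrow> Y \<subseteq> S \<Longrightarrow> F X \<le> F Y"
    and bdd: "\<And>X. finite X \<Longrightarrow> X \<subseteq> S \<Longrightarrow> F X \<le> C"
  shows "\<exists>l. (F \<longlongrightarrow> l) (finite_subsets_at_top S)"
proof -
  let ?D = "{X. finite X \<and> X \<subseteq> S}"
  have b: "bdd_above (F ` ?D)" using bdd by (auto intro!: bdd_aboveI[of _ C])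
  have "(F \<longlongrightarrow> (SUP X\<in>?D. F X)) (finite_subsets_at_top S)"
  proof (rule order_tendstoI)
    fix a assume "a < (SUP X\<in>?D. F X)"
    then obtain X where X: "X \<in> ?D" "a < F X"
      using less_cSUP_iff[OF _ b, of a] by auto
    then show "\<forall>\<^sub>F Y in finite_subsets_at_top S. a < F Y"
      unfolding eventually_finite_subsets_at_top
      by (intro exI[of _ X]) (auto intro: less_le_trans mono)
  next
    fix a assume a: "(SUP X\<in>?D. F X) < a"
    have "F Y < a" if "finite Y" "Y \<subseteq> S" for Y
      using cSUP_upper[OF _ b, of Y] that a by auto
    then show "\<forall>\<^sub>F Y in finite_subsets_at_top S. F Y < a"
      unfolding eventually_finite_subsets_at_top by (intro exI[of _ "{}"]) auto
  qed
  then show ?thesis by blast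
qed

definition cyl_lim :: "nat \<Rightarrow> real \<Rightarrow> site set \<Rightarrow> (site set \<Rightarrow> real) \<Rightarrow> real" where
  "cyl_lim d \<beta> J g = Lim (finite_subsets_at_top (Zd d)) (\<lambda>\<Lambda>. mexp d \<beta> \<Lambda> (\<lambda>A. g (A \<inter> J)))"

locale beta_nonneg =
  fixes d :: nat and \<beta> :: real
  assumes \<beta>: "0 \<le> \<beta>"
begin

lemma W: "log_supermodular S (weight d \<beta> \<Lambda>)"
  by (rule log_supermodular_weight[OF \<beta>])

lemma increasing_convergent:
  assumes f: "\<And>S. increasing_on S f" and b: "\<And>A. f A \<le> C"
  shows "\<exists>l. ((\<lambda>\<Lambda>. mexp d \<beta> \<Lambda> f) \<longlongrightarrow> l) (finite_subsets_at_top (Zd d))"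
proof (rule tendsto_mono_finite_subsets)
  show "mexp d \<beta> X f \<le> mexp d \<beta> Y f" if "finite Y" "X \<subseteq> Y" for X Y
    by (rule mexp_mono[OF that(2,1) \<beta> f])
  show "mexp d \<beta> X f \<le> C" if "finite X" for X
    using expect_mono[OF that W, where f=f and g="\<lambda>_. C"] expect_const[OF that W, where c=C] b by simp
qed

text \<open>A cylinder function becomes increasing when a large multiple of the number of plus spins
  in \<open>J\<close> is added.\<close>

lemma cyl_convergent:
  assumes J: "finite J"
  shows "((\<lambda>\<Lambda>. mexp d \<beta> \<Lambda> (\<lambda>A. g (A \<inter> J))) \<longlongrightarrow> cyl_lim d \<beta> J g) (finite_subsets_at_top (Zd d))"
proof -
  \<comment> \<open>Two values of g differ by at most C, so a gain of C per additional plus site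
    outweighs any decrease of g.\<close>
  define C where "C = 2 * (\<Sum>\<xi>\<in>Pow J. \<bar>g \<xi>\<bar>)"
  have C0: "0 \<le> C" by (simp add: C_def sum_nonneg)
  have gC: "2 * \<bar>g (A \<inter> J)\<bar> \<le> C" for A
    unfolding C_def using J by (intro mult_left_mono member_le_sum) auto
  define f1 where "f1 A = g (A \<inter> J) + C * real (card (A \<inter> J))" for A
  define f2 where "f2 A = C * real (card (A \<inter> J))" for A
  have cm: "card (A \<inter> J) \<le> card (B \<inter> J)" if "A \<subseteq> B" for A B
    using J that by (intro card_mono) auto
  have cJ: "C * real (card (A \<inter> J)) \<le> C * real (card J)" for A
    using J C0 by (intro mult_left_mono of_nat_mono card_mono) auto
  have i2: "increasing_on S f2" for S
    unfolding increasing_on_def f2_def using cm C0 by (auto intro!: mult_left_mono)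
  have i1: "increasing_on S f1" for S
    unfolding increasing_on_def
  proof (intro allI impI)
    fix A B :: "site set" assume AB: "A \<subseteq> B"
    show "f1 A \<le> f1 B"
    proof (cases "A \<inter> J = B \<inter> J")
      case False
      then have "A \<inter> J \<subset> B \<inter> J" using AB by auto
      then have "card (A \<inter> J) < card (B \<inter> J)" using J by (intro psubset_card_mono) auto
      then have "real (card (A \<inter> J)) + 1 \<le> real (card (B \<inter> J))" by linarith
      from mult_left_mono[OF this C0] show ?thesis
        unfolding f1_def using gC[of A] gC[of B] by (simp add: distrib_left)
    qed (simp add: f1_def)
  qed
  obtain l1 where l1: "((\<lambda>\<Lambda>. mexp d \<beta> \<Lambda> f1) \<longlongrightarrow> l1) (finite_subsets_at_top (Zd d))"
    using increasing_convergent[OF i1, of "C + C * real (card J)"] gC cJ C0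
    by (auto simp: f1_def) (smt (verit))
  obtain l2 where l2: "((\<lambda>\<Lambda>. mexp d \<beta> \<Lambda> f2) \<longlongrightarrow> l2) (finite_subsets_at_top (Zd d))"
    using increasing_convergent[OF i2, of "C * real (card J)"] cJ by (auto simp: f2_def)
  have "mexp d \<beta> \<Lambda> (\<lambda>A. g (A \<inter> J)) = mexp d \<beta> \<Lambda> f1 - mexp d \<beta> \<Lambda> f2" for \<Lambda>
  proof -
    have "f1 = (\<lambda>A. g (A \<inter> J) + f2 A)" by (simp add: f1_def f2_def fun_eq_iff)
    then show ?thesis by (simp add: expect_add)
  qed
  then have "((\<lambda>\<Lambda>. mexp d \<beta> \<Lambda> (\<lambda>A. g (A \<inter> J))) \<longlongrightarrow> l1 - l2) (finite_subsets_at_top (Zd d))"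
    using tendsto_diff[OF l1 l2] by simp
  then show ?thesis unfolding cyl_lim_def by (simp add: tendsto_Lim)
qed

lemma cyl_lim_unique:
  assumes "finite J" "((\<lambda>\<Lambda>. mexp d \<beta> \<Lambda> (\<lambda>A. g (A \<inter> J))) \<longlongrightarrow> l) (finite_subsets_at_top (Zd d))"
  shows "cyl_lim d \<beta> J g = l"
  by (rule tendsto_unique[OF _ cyl_convergent[OF assms(1)] assms(2)]) simp

lemma cyl_lim_const: "finite J \<Longrightarrow> cyl_lim d \<beta> J (\<lambda>_. c) = c"
proof (rule cyl_lim_unique)
  have "\<forall>\<^sub>F \<Lambda> in finite_subsets_at_top (Zd d). mexp d \<beta> \<Lambda> (\<lambda>A. c) = c"
    by (intro eventually_finite_subsets_at_top_weakI expect_const W)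
  then show "((\<lambda>\<Lambda>. mexp d \<beta> \<Lambda> (\<lambda>A. c)) \<longlongrightarrow> c) (finite_subsets_at_top (Zd d))"
    by (rule tendsto_eventually)
qed

definition prb :: "site set \<Rightarrow> site set \<Rightarrow> real" where
  "prb J \<xi> = cyl_lim d \<beta> J (\<lambda>A. of_bool (A = \<xi>))"

lemma cyl_lim_eq_sum:
  assumes J: "finite J"
  shows "cyl_lim d \<beta> J g = (\<Sum>\<xi>\<in>Pow J. g \<xi> * prb J \<xi>)"
proof (rule cyl_lim_unique[OF J])
  have "mexp d \<beta> \<Lambda> (\<lambda>A. g (A \<inter> J)) = (\<Sum>\<xi>\<in>Pow J. g \<xi> * mexp d \<beta> \<Lambda> (\<lambda>A. of_bool (A \<inter> J = \<xi>)))" for \<Lambda>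
  proof -
    have "g (A \<inter> J) = (\<Sum>\<xi>\<in>Pow J. g \<xi> * of_bool (A \<inter> J = \<xi>))" for A
    proof -
      have "(\<Sum>\<xi>\<in>Pow J. g \<xi> * of_bool (A \<inter> J = \<xi>)) = (\<Sum>\<xi>\<in>Pow J. if \<xi> = A \<inter> J then g \<xi> else 0)"
        by (intro sum.cong) auto
      then show ?thesis using J by (simp add: sum.delta)
    qed
    then have "mexp d \<beta> \<Lambda> (\<lambda>A. g (A \<inter> J)) = mexp d \<beta> \<Lambda> (\<lambda>A. \<Sum>\<xi>\<in>Pow J. g \<xi> * of_bool (A \<inter> J = \<xi>))"
      by (intro expect_cong)
    then show ?thesis using J by (simp only: expect_sum finite_Pow_iff expect_cmult)
  qed
  then show "((\<lambda>\<Lambda>. mexp d \<beta> \<Lambda> (\<lambda>A. g (A \<inter> J))) \<longlongrightarrow> (\<Sum>\<xi>\<in>Pow J. g \<xi> * prb J \<xi>)) (finite_subsets_at_top (Zd d))"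
    unfolding prb_def by (auto intro!: tendsto_intros cyl_convergent[OF J])
qed

lemma prb_nonneg: "finite J \<Longrightarrow> 0 \<le> prb J \<xi>"
  unfolding prb_def
proof (rule tendsto_lowerbound[OF cyl_convergent])
  show "\<forall>\<^sub>F \<Lambda> in finite_subsets_at_top (Zd d). 0 \<le> mexp d \<beta> \<Lambda> (\<lambda>A. of_bool (A \<inter> J = \<xi>))"
    by (intro eventually_finite_subsets_at_top_weakI) 
       (auto simp: expect_def weight_def intro!: divide_nonneg_nonneg sum_nonneg)
qed auto

lemma prb_outside: "finite J \<Longrightarrow> \<not> \<xi> \<subseteq> J \<Longrightarrow> prb J \<xi> = 0"
proof -
  assume J: "finite J" "\<not> \<xi> \<subseteq> J"
  have "A \<inter> J = \<xi> \<longleftrightarrow> False" for A using J by auto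
  then show ?thesis
    unfolding prb_def using cyl_lim_unique[OF J(1), of "\<lambda>A. of_bool (A = \<xi>)" 0] by (simp add: expect_def)
qed

lemma sum_prb: "finite J \<Longrightarrow> (\<Sum>\<xi>\<in>Pow J. prb J \<xi>) = 1"
  using cyl_lim_eq_sum[of J "\<lambda>_. 1"] cyl_lim_const[of J 1] by simp

definition qpmf :: "site set \<Rightarrow> site set pmf" where
  "qpmf J = embed_pmf (prb J)"

lemma pmf_qpmf: "finite J \<Longrightarrow> pmf (qpmf J) \<xi> = prb J \<xi>"
  unfolding qpmf_def
proof (rule pmf_embed_pmf)
  assume J: "finite J"
  show "0 \<le> prb J \<xi>" for \<xi> by (rule prb_nonneg[OF J])
  have "(\<integral>\<^sup>+\<xi>. ennreal (prb J \<xi>) \<partial>count_space UNIV) = (\<Sum>\<xi>\<in>Pow J. ennreal (prb J \<xi>))"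
    using J by (intro nn_integral_count_space') (auto simp: prb_outside)
  also have "\<dots> = ennreal (\<Sum>\<xi>\<in>Pow J. prb J \<xi>)" by (intro sum_ennreal prb_nonneg J)
  finally show "(\<integral>\<^sup>+\<xi>. ennreal (prb J \<xi>) \<partial>count_space UNIV) = 1" using J by (simp add: sum_prb)
qed

lemma integral_qpmf:
  assumes J: "finite J"
  shows "(\<integral>\<xi>. g \<xi> \<partial>measure_pmf (qpmf J)) = cyl_lim d \<beta> J g"
proof -
  have "(\<integral>\<xi>. g \<xi> \<partial>measure_pmf (qpmf J)) = (\<Sum>\<xi>\<in>Pow J. g \<xi> * pmf (qpmf J) \<xi>)"
  proof (rule integral_measure_pmf_real)
    show "\<xi> \<in> Pow J" if "\<xi> \<in> set_pmf (qpmf J)" for \<xi>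
      using that prb_outside[OF J, of \<xi>] by (auto simp: set_pmf_iff pmf_qpmf[OF J])
  qed (use J in auto)
  then show ?thesis using J by (simp add: cyl_lim_eq_sum pmf_qpmf)
qed

lemma map_qpmf:
  assumes "J \<subseteq> H" "finite H"
  shows "map_pmf (\<lambda>\<xi>. \<xi> \<inter> J) (qpmf H) = qpmf J"
proof (rule pmf_eqI)
  fix \<xi>
  have J: "finite J" using assms by (rule finite_subset)
  have "pmf (map_pmf (\<lambda>\<xi>. \<xi> \<inter> J) (qpmf H)) \<xi> = measure (measure_pmf (qpmf H)) {\<eta>. \<eta> \<inter> J = \<xi>}"
    by (simp add: pmf_map vimage_def)
  also have "\<dots> = (\<integral>\<eta>. indicator {\<eta>. \<eta> \<inter> J = \<xi>} \<eta> \<partial>measure_pmf (qpmf H))" by simp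
  also have "\<dots> = (\<integral>\<eta>. of_bool (\<eta> \<inter> J = \<xi>) \<partial>measure_pmf (qpmf H))"
    by (intro Bochner_Integration.integral_cong) (auto simp: indicator_def)
  also have "\<dots> = cyl_lim d \<beta> H (\<lambda>\<eta>. of_bool (\<eta> \<inter> J = \<xi>))" by (rule integral_qpmf[OF assms(2)])
  also have "\<dots> = cyl_lim d \<beta> J (\<lambda>\<eta>. of_bool (\<eta> = \<xi>))"
  proof (rule cyl_lim_unique[OF assms(2)])
    have "A \<inter> H \<inter> J = A \<inter> J" for A using assms by auto
    then show "((\<lambda>\<Lambda>. mexp d \<beta> \<Lambda> (\<lambda>A. of_bool (A \<inter> H \<inter> J = \<xi>))) \<longlongrightarrow> cyl_lim d \<beta> J (\<lambda>\<eta>. of_bool (\<eta> = \<xi>))) (finite_subsets_at_top (Zd d))"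
      using cyl_convergent[OF J, of "\<lambda>\<eta>. of_bool (\<eta> = \<xi>)"] by simp
  qed
  finally show "pmf (map_pmf (\<lambda>\<xi>. \<xi> \<inter> J) (qpmf H)) \<xi> = pmf (qpmf J) \<xi>" by (simp add: pmf_qpmf[OF J] prb_def)
qed

text \<open>Spins are treated as Borel real coordinates, so that the consistent marginals of
  \<open>map_qpmf\<close> form a projective family over a Polish space and Kolmogorov's extension
  theorem provides the limit measure.\<close>

definition fdd :: "site set \<Rightarrow> (site \<Rightarrow> real) measure" where
  "fdd J = distr (measure_pmf (qpmf J)) (\<Pi>\<^sub>M x\<in>J. borel) (\<lambda>\<xi>. \<lambda>x\<in>J. spin \<xi> x)"

lemma meas_fdd [measurable]: "(\<lambda>\<xi>. \<lambda>x\<in>J. spin \<xi> x) \<in> measure_pmf p \<rightarrow>\<^sub>M (\<Pi>\<^sub>M x\<in>J. borel)"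
  by (simp add: measurable_pmf_measure1 space_PiM PiE_iff)

sublocale PP: polish_projective "Zd d" fdd
proof (intro polish_projective.intro projective_family.intro)
  fix J H :: "site set" assume JH: "J \<subseteq> H" "finite H" "H \<subseteq> Zd d"
  have J: "finite J" using JH finite_subset by auto
  have "distr (fdd H) (\<Pi>\<^sub>M x\<in>J. borel) (\<lambda>f. restrict f J)
     = distr (measure_pmf (qpmf H)) (\<Pi>\<^sub>M x\<in>J. borel) ((\<lambda>f. restrict f J) \<circ> (\<lambda>\<xi>. \<lambda>x\<in>H. spin \<xi> x))"
    unfolding fdd_def using JH by (intro distr_distr measurable_restrict_subset meas_fdd) auto
  also have "\<dots> = distr (measure_pmf (qpmf H)) (\<Pi>\<^sub>M x\<in>J. borel) ((\<lambda>\<xi>. \<lambda>x\<in>J. spin \<xi> x) \<circ> (\<lambda>\<xi>. \<xi> \<inter> J))"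
    using JH by (intro distr_cong refl) (auto simp: fun_eq_iff restrict_def spin_def)
  also have "\<dots> = distr (distr (measure_pmf (qpmf H)) (count_space UNIV) (\<lambda>\<xi>. \<xi> \<inter> J)) (\<Pi>\<^sub>M x\<in>J. borel) (\<lambda>\<xi>. \<lambda>x\<in>J. spin \<xi> x)"
    by (intro distr_distr[symmetric]) (auto simp: space_PiM PiE_iff)
  also have "distr (measure_pmf (qpmf H)) (count_space UNIV) (\<lambda>\<xi>. \<xi> \<inter> J) = measure_pmf (qpmf J)"
    unfolding map_qpmf[OF JH(1,2), symmetric] by (rule map_pmf_rep_eq[symmetric])
  finally show "fdd J = distr (fdd H) (\<Pi>\<^sub>M x\<in>J. borel) (\<lambda>f. restrict f J)"
    unfolding fdd_def[of J] by (rule sym)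
next
  fix J :: "site set"
  show "prob_space (fdd J)" unfolding fdd_def
    by (intro prob_space.prob_space_distr meas_fdd measure_pmf.prob_space_axioms)
qed

abbreviation PM :: "(site \<Rightarrow> real) measure" where
  "PM \<equiv> \<Pi>\<^sub>M x\<in>Zd d. count_space {-1, 1}"

text \<open>The projective limit lives on all real-valued functions. Every value other than 1 is
  rounded to -1, which moves the measure to the product of two-point spaces without changing the
  marginals.\<close>

definition \<mu> :: "(site \<Rightarrow> real) measure" where
  "\<mu> = distr PP.lim PM (\<lambda>\<omega>. \<lambda>x\<in>Zd d. if \<omega> x = 1 then 1 else -1)"

lemma pred_borel_component:
  assumes "x \<in> I"
  shows "Measurable.pred (\<Pi>\<^sub>M x\<in>I. borel :: real measure) (\<lambda>\<omega>. \<omega> x = 1)"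
proof -
  have "(\<lambda>\<omega>. \<omega> x) \<in> borel_measurable (\<Pi>\<^sub>M x\<in>I. borel :: real measure)"
    by (rule measurable_component_singleton[OF assms])
  then have "(\<lambda>\<omega>. \<omega> x) -` {1} \<inter> space (\<Pi>\<^sub>M x\<in>I. borel :: real measure) \<in> sets (\<Pi>\<^sub>M x\<in>I. borel)"
    by (rule measurable_sets) simp
  moreover have "{\<omega> \<in> space (\<Pi>\<^sub>M x\<in>I. borel :: real measure). \<omega> x = 1}
      = (\<lambda>\<omega>. \<omega> x) -` {1} \<inter> space (\<Pi>\<^sub>M x\<in>I. borel)" by auto
  ultimately show ?thesis unfolding pred_def by (simp only:)
qed

lemma pred_lim: "x \<in> Zd d \<Longrightarrow> Measurable.pred PP.lim (\<lambda>\<omega>. \<omega> x = 1)"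
proof -
  assume x: "x \<in> Zd d"
  from pred_borel_component[OF x]
  show ?thesis unfolding pred_def PP.sets_lim PP.space_lim .
qed

lemma meas_sign [measurable]: "(\<lambda>\<omega>. \<lambda>x\<in>Zd d. if \<omega> x = 1 then 1 else -1) \<in> PP.lim \<rightarrow>\<^sub>M PM"
proof (rule measurable_restrict)
  fix x assume x: "x \<in> Zd d"
  show "(\<lambda>\<omega>. if \<omega> x = 1 then 1 else -1) \<in> PP.lim \<rightarrow>\<^sub>M count_space {- 1, 1}"
  proof (rule measurable_If)
    show "{\<omega> \<in> space PP.lim. \<omega> x = 1} \<in> sets PP.lim" using pred_lim[OF x] unfolding pred_def .
  qed auto
qed

lemma prob_space_\<mu>: "prob_space \<mu>"
  unfolding \<mu>_def by (intro PP.P.prob_space_distr meas_sign)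

lemma sets_\<mu> [simp, measurable_cong]: "sets \<mu> = sets PM"
  by (simp add: \<mu>_def)

lemma pred_component: "x \<in> Zd d \<Longrightarrow> Measurable.pred PM (\<lambda>\<sigma>. \<sigma> x = 1)"
proof -
  assume x: "x \<in> Zd d"
  have [measurable]: "(\<lambda>\<sigma>. \<sigma> x) \<in> PM \<rightarrow>\<^sub>M count_space {-1, 1}" by (rule measurable_component_singleton[OF x])
  have [measurable]: "Measurable.pred (count_space {-1, 1}) (\<lambda>s::real. s = 1)" by simp
  show ?thesis by measurable
qed

lemma measurable_plus_PM:
  assumes "finite J" "J \<subseteq> Zd d"
  shows "(\<lambda>\<sigma>. g {x \<in> J. \<sigma> x = 1} :: real) \<in> borel_measurable PM"
  using assms(1) pred_component[OF subsetD[OF assms(2)]] by (rule measurable_pred_set)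

lemma integral_\<mu>_cyl:
  assumes J: "finite J" "J \<subseteq> Zd d"
  shows "(\<integral>\<sigma>. g {x \<in> J. \<sigma> x = 1} \<partial>\<mu>) = cyl_lim d \<beta> J g"
proof -
  let ?B = "\<Pi>\<^sub>M x\<in>J. borel :: real measure"
  have pJ: "Measurable.pred ?B (\<lambda>\<sigma>. \<sigma> x = 1)" if "x \<in> J" for x
    by (rule pred_borel_component[OF that])
  have rm: "(\<lambda>f. restrict f J) \<in> PP.lim \<rightarrow>\<^sub>M ?B"
    using measurable_restrict_subset[OF J(2), of "\<lambda>_. borel"] by (simp cong: measurable_cong_sets)
  have dl: "distr PP.lim ?B (\<lambda>f. restrict f J) = fdd J"
  proof (rule measure_eqI)
    fix X assume "X \<in> sets (distr PP.lim ?B (\<lambda>f. restrict f J))"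
    then have X: "X \<in> sets ?B" by simp
    have "emeasure (distr PP.lim ?B (\<lambda>f. restrict f J)) X = emeasure PP.lim (prod_emb (Zd d) (\<lambda>_. borel) J X)"
      using X by (subst emeasure_distr[OF rm]) (auto simp: prod_emb_def space_PiM)
    also have "\<dots> = emeasure (fdd J) X" by (rule PP.emeasure_lim_emb[OF J(2,1) X])
    finally show "emeasure (distr PP.lim ?B (\<lambda>f. restrict f J)) X = emeasure (fdd J) X" .
  qed (simp add: fdd_def)
  have "(\<integral>\<sigma>. g {x \<in> J. \<sigma> x = 1} \<partial>\<mu>) = (\<integral>\<omega>. g {x \<in> J. (\<lambda>x\<in>Zd d. if \<omega> x = 1 then 1 else -1::real) x = 1} \<partial>PP.lim)"
    unfolding \<mu>_def by (intro integral_distr meas_sign measurable_plus_PM J)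
  also have "\<dots> = (\<integral>\<omega>. g {x \<in> J. (restrict \<omega> J) x = 1} \<partial>PP.lim)"
    using J by (intro Bochner_Integration.integral_cong refl arg_cong[where f=g]) auto
  also have "\<dots> = (\<integral>f. g {x \<in> J. f x = 1} \<partial>distr PP.lim ?B (\<lambda>f. restrict f J))"
    using J pJ by (intro integral_distr[symmetric] rm measurable_pred_set) auto
  also have "\<dots> = (\<integral>\<xi>. g {x \<in> J. (\<lambda>x\<in>J. spin \<xi> x) x = 1} \<partial>measure_pmf (qpmf J))"
    unfolding dl unfolding fdd_def using J pJ by (intro integral_distr meas_fdd measurable_pred_set) auto
  also have "\<dots> = (\<integral>\<xi>. g (\<xi> \<inter> J) \<partial>measure_pmf (qpmf J))"
    by (intro Bochner_Integration.integral_cong refl arg_cong[where f=g]) (auto simp: spin_def split: if_splits)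
  also have "\<dots> = cyl_lim d \<beta> J (\<lambda>A. g (A \<inter> J))" by (rule integral_qpmf[OF J(1)])
  also have "\<dots> = cyl_lim d \<beta> J g" unfolding cyl_lim_def by simp
  finally show ?thesis .
qed

section \<open>Continuous functions of the configuration: existence and uniqueness of the weak
  limit\<close>

abbreviation CT :: "(site \<Rightarrow> real) topology" where
  "CT \<equiv> product_topology (\<lambda>x. discrete_topology {-1, 1}) (Zd d)"

text \<open>Uniform continuity by compactness: each configuration has a cylinder neighbourhood on
  which f stays within e / 2 of its value there. Finitely many of these cover the space, and the
  union of their coordinate sets serves as J.\<close>

lemma uniform_approx:
  assumes f: "continuous_map CT euclideanreal f" and e: "0 < e"
  shows "\<exists>J. finite J \<and> J \<subseteq> Zd d \<and> (\<forall>\<sigma>\<in>Zd d \<rightarrow>\<^sub>E {-1, 1}. \<forall>\<tau>\<in>Zd d \<rightarrow>\<^sub>E {-1, 1}.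
     (\<forall>x\<in>J. \<sigma> x = \<tau> x) \<longrightarrow> \<bar>f \<sigma> - f \<tau>\<bar> < e)"
proof -
  let ?X = "Zd d \<rightarrow>\<^sub>E {-1, 1::real}"
  have ts: "topspace CT = ?X" by simp
  have "\<exists>J. finite J \<and> J \<subseteq> Zd d \<and> (\<forall>\<tau>\<in>?X. (\<forall>x\<in>J. \<tau> x = \<sigma> x) \<longrightarrow> \<bar>f \<tau> - f \<sigma>\<bar> < e / 2)"
    if \<sigma>: "\<sigma> \<in> ?X" for \<sigma>
  proof -
    have "openin CT {\<tau> \<in> topspace CT. f \<tau> \<in> ball (f \<sigma>) (e / 2)}"
      using f by (rule openin_continuous_map_preimage) auto
    moreover have "\<sigma> \<in> {\<tau> \<in> topspace CT. f \<tau> \<in> ball (f \<sigma>) (e / 2)}" using \<sigma> e by (simp only: ts) simp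
    ultimately obtain U where U: "finite {i \<in> Zd d. U i \<noteq> topspace (discrete_topology {-1, 1::real})}"
      "\<sigma> \<in> Pi\<^sub>E (Zd d) U" "Pi\<^sub>E (Zd d) U \<subseteq> {\<tau> \<in> topspace CT. f \<tau> \<in> ball (f \<sigma>) (e / 2)}"
      unfolding openin_product_topology_alt by meson
    define J where "J = {i \<in> Zd d. U i \<noteq> topspace (discrete_topology {-1, 1::real})}"
    have "\<bar>f \<tau> - f \<sigma>\<bar> < e / 2" if \<tau>: "\<tau> \<in> ?X" "\<forall>x\<in>J. \<tau> x = \<sigma> x" for \<tau>
    proof -
      have "\<tau> \<in> Pi\<^sub>E (Zd d) U"
      proof (rule PiE_I)
        fix x assume x: "x \<in> Zd d"
        show "\<tau> x \<in> U x"
        proof (cases "x \<in> J")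
          case True
          then show ?thesis using \<tau>(2) PiE_mem[OF U(2) x] by simp
        next
          case False
          then have "U x = {-1, 1}" using x by (simp add: J_def)
          then show ?thesis using PiE_mem[OF \<tau>(1) x] by simp
        qed
      qed (use PiE_arb[OF \<tau>(1)] in auto)
      then have "f \<tau> \<in> ball (f \<sigma>) (e / 2)" using U(3) by auto
      then show ?thesis by (simp add: dist_real_def abs_minus_commute)
    qed
    then show ?thesis using U(1) by (intro exI[of _ J]) (auto simp: J_def)
  qed
  then obtain J where J: "\<And>\<sigma>. \<sigma> \<in> ?X \<Longrightarrow> finite (J \<sigma>) \<and> J \<sigma> \<subseteq> Zd d \<and>
      (\<forall>\<tau>\<in>?X. (\<forall>x\<in>J \<sigma>. \<tau> x = \<sigma> x) \<longrightarrow> \<bar>f \<tau> - f \<sigma>\<bar> < e / 2)" by metis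
  define N where "N \<sigma> = {\<tau> \<in> ?X. \<forall>x\<in>J \<sigma>. \<tau> x = \<sigma> x}" for \<sigma>
  have open_N: "openin CT (N \<sigma>)" if "\<sigma> \<in> ?X" for \<sigma>
  proof -
    have "N \<sigma> = Pi\<^sub>E (Zd d) (\<lambda>x. if x \<in> J \<sigma> then {\<sigma> x} else {-1, 1})"
      using J[OF that] PiE_mem[OF that]
      by (fastforce simp: N_def PiE_iff extensional_def split: if_splits)
    moreover have "{x \<in> Zd d. (if x \<in> J \<sigma> then {\<sigma> x} else {-1, 1}) \<noteq> topspace (discrete_topology {-1, 1::real})} \<subseteq> J \<sigma>"
      by auto
    ultimately show ?thesis
      using J[OF that] PiE_mem[OF that] by (auto simp: openin_PiE_gen intro: finite_subset)
  qed
  have cpt: "compact_space CT" by (simp add: compact_space_product_topology compact_space_discrete_topology)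
  have op: "\<forall>U\<in>N ` ?X. openin CT U" using open_N by blast
  have cov: "topspace CT \<subseteq> \<Union>(N ` ?X)" unfolding ts by (auto simp: N_def)
  have "\<exists>F. finite F \<and> F \<subseteq> N ` ?X \<and> topspace CT \<subseteq> \<Union>F"
    using cpt op cov unfolding compact_space_alt by blast
  then obtain F where F: "finite F" "F \<subseteq> N ` ?X" "?X \<subseteq> \<Union>F" unfolding ts by auto
  then obtain S where S: "finite S" "S \<subseteq> ?X" "F = N ` S" by (meson finite_subset_image)
  define K where "K = (\<Union>\<sigma>\<in>S. J \<sigma>)"
  have "\<bar>f \<sigma> - f \<tau>\<bar> < e" if \<sigma>: "\<sigma> \<in> ?X" and \<tau>: "\<tau> \<in> ?X" and eq: "\<forall>x\<in>K. \<sigma> x = \<tau> x" for \<sigma> \<tau>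
  proof -
    obtain \<rho> where \<rho>: "\<rho> \<in> S" "\<sigma> \<in> N \<rho>" using F(3) S(3) \<sigma> by auto
    have \<rho>X: "\<rho> \<in> ?X" using \<rho> S by auto
    have 1: "\<forall>x\<in>J \<rho>. \<sigma> x = \<rho> x" using \<rho> by (simp add: N_def)
    have 2: "\<forall>x\<in>J \<rho>. \<tau> x = \<rho> x" using 1 eq \<rho>(1) by (auto simp: K_def)
    have "\<bar>f \<sigma> - f \<rho>\<bar> < e / 2" "\<bar>f \<tau> - f \<rho>\<bar> < e / 2" using J[OF \<rho>X] \<sigma> \<tau> 1 2 by auto
    then show ?thesis by linarith
  qed
  moreover have JS: "finite (J \<sigma>)" "J \<sigma> \<subseteq> Zd d" if "\<sigma> \<in> S" for \<sigma> using J[of \<sigma>] S(2) that by blast+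
  have "finite K" "K \<subseteq> Zd d" unfolding K_def using S(1) JS by (blast intro: finite_UN_I)+
  ultimately show ?thesis by (intro exI[of _ K]) blast
qed

lemma space_PM: "space PM = Zd d \<rightarrow>\<^sub>E {-1, 1}"
  by (simp add: space_PiM)

lemma config_mem: "config d A \<in> Zd d \<rightarrow>\<^sub>E {-1, 1}"
  by (auto simp: config_def spin_def)

lemma approx_by_config:
  assumes f: "continuous_map CT euclideanreal f" and e: "0 < e"
  shows "\<exists>J. finite J \<and> J \<subseteq> Zd d \<and> (\<forall>\<sigma>\<in>Zd d \<rightarrow>\<^sub>E {-1, 1}. \<bar>f \<sigma> - f (config d {x \<in> J. \<sigma> x = 1})\<bar> < e)"
proof -
  from uniform_approx[OF f e] obtain J where JJ: "finite J \<and> J \<subseteq> Zd d \<and> (\<forall>\<sigma>\<in>Zd d \<rightarrow>\<^sub>E {-1, 1}. \<forall>\<tau>\<in>Zd d \<rightarrow>\<^sub>E {-1, 1}.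
     (\<forall>x\<in>J. \<sigma> x = \<tau> x) \<longrightarrow> \<bar>f \<sigma> - f \<tau>\<bar> < e)" by (rule exE)
  note J = JJ[THEN conjunct1] JJ[THEN conjunct2, THEN conjunct1]
  note le = JJ[THEN conjunct2, THEN conjunct2, rule_format]
  have "\<bar>f \<sigma> - f (config d {x \<in> J. \<sigma> x = 1})\<bar> < e" if \<sigma>: "\<sigma> \<in> Zd d \<rightarrow>\<^sub>E {-1, 1}" for \<sigma>
  proof (rule le[OF \<sigma> config_mem])
    fix x assume "x \<in> J"
    then show "\<sigma> x = config d {x \<in> J. \<sigma> x = 1} x"
      using PiE_mem[OF \<sigma>, of x] J by (auto simp: config_def spin_def)
  qed
  then show ?thesis using J by blast
qed

text \<open>A limit of functions of finitely many spins, obtained by setting all spins outside a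
  finite set to minus.\<close>

lemma measurable_continuous:
  assumes f: "continuous_map CT euclideanreal f"
  shows "f \<in> borel_measurable PM"
proof -
  have "\<forall>n. \<exists>J. finite J \<and> J \<subseteq> Zd d \<and> (\<forall>\<sigma>\<in>Zd d \<rightarrow>\<^sub>E {-1, 1}. \<bar>f \<sigma> - f (config d {x \<in> J. \<sigma> x = 1})\<bar> < 1 / real (Suc n))"
    by (intro allI approx_by_config[OF f]) simp
  from choice[OF this] obtain J where JJ: "\<forall>n. finite (J n) \<and> J n \<subseteq> Zd d \<and>
    (\<forall>\<sigma>\<in>Zd d \<rightarrow>\<^sub>E {-1, 1}. \<bar>f \<sigma> - f (config d {x \<in> J n. \<sigma> x = 1})\<bar> < 1 / real (Suc n))" by (rule exE)
  note J = JJ[rule_format, THEN conjunct1] JJ[rule_format, THEN conjunct2, THEN conjunct1]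
  note le = JJ[rule_format, THEN conjunct2, THEN conjunct2, rule_format]
  show ?thesis
  proof (rule borel_measurable_LIMSEQ_real)
    fix n show "(\<lambda>\<sigma>. f (config d {x \<in> J n. \<sigma> x = 1})) \<in> borel_measurable PM"
      by (rule measurable_plus_PM[OF J, where g="\<lambda>A. f (config d A)"])
  next
    fix \<sigma> assume "\<sigma> \<in> space PM"
    then have \<sigma>: "\<sigma> \<in> Zd d \<rightarrow>\<^sub>E {-1, 1}" by (simp add: space_PM)
    have "(\<lambda>n. f (config d {x \<in> J n. \<sigma> x = 1}) - f \<sigma>) \<longlonglongrightarrow> 0"
    proof (rule Lim_null_comparison)
      show "\<forall>\<^sub>F n in sequentially. norm (f (config d {x \<in> J n. \<sigma> x = 1}) - f \<sigma>) \<le> 1 / real (Suc n)"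
        using le[OF \<sigma>] by (intro always_eventually) (auto simp: abs_minus_commute less_imp_le)
      show "(\<lambda>n. 1 / real (Suc n)) \<longlonglongrightarrow> 0" using LIMSEQ_inverse_real_of_nat by (simp add: inverse_eq_divide)
    qed
    then show "(\<lambda>n. f (config d {x \<in> J n. \<sigma> x = 1})) \<longlonglongrightarrow> f \<sigma>" by (rule LIM_zero_cancel)
  qed
qed

lemma bounded_continuous_CT:
  assumes f: "continuous_map CT euclideanreal f"
  shows "\<exists>B. \<forall>\<sigma>\<in>Zd d \<rightarrow>\<^sub>E {-1, 1}. \<bar>f \<sigma>\<bar> \<le> B"
proof -
  from approx_by_config[OF f, of 1, OF zero_less_one] obtain J where JJ: "finite J \<and> J \<subseteq> Zd d \<and>
    (\<forall>\<sigma>\<in>Zd d \<rightarrow>\<^sub>E {-1, 1}. \<bar>f \<sigma> - f (config d {x \<in> J. \<sigma> x = 1})\<bar> < 1)" by (rule exE)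
  note J = JJ[THEN conjunct1]
  note le = JJ[THEN conjunct2, THEN conjunct2, rule_format]
  have "\<bar>f \<sigma>\<bar> \<le> 1 + (\<Sum>A\<in>Pow J. \<bar>f (config d A)\<bar>)" if "\<sigma> \<in> Zd d \<rightarrow>\<^sub>E {-1, 1}" for \<sigma>
  proof -
    have "\<bar>f (config d {x \<in> J. \<sigma> x = 1})\<bar> \<le> (\<Sum>A\<in>Pow J. \<bar>f (config d A)\<bar>)"
      using J by (intro member_le_sum) auto
    then show ?thesis using le[OF that] by linarith
  qed
  then show ?thesis by blast
qed

text \<open>An argument with three errors e / 3: f is uniformly close to a cylinder function, both
  under the limit measure and in every finite volume, and cylinder expectations converge by
  construction.\<close>

lemma is_minus_phase_\<mu>: "is_minus_phase d \<beta> \<mu>"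
  unfolding is_minus_phase_def
proof (intro conjI allI impI)
  show "prob_space \<mu>" by (rule prob_space_\<mu>)
  interpret prob_space \<mu> by (rule prob_space_\<mu>)
  fix f assume f: "continuous_map CT euclideanreal f"
  let ?E = "\<lambda>\<Lambda>. \<integral>\<sigma>. f (minus_extend d \<Lambda> \<sigma>) \<partial>ising d \<Lambda> \<beta> (\<lambda>x. -1)"
  have fm: "f \<in> borel_measurable \<mu>" using measurable_continuous[OF f] by (simp cong: measurable_cong_sets)
  obtain B where B: "\<And>\<sigma>. \<sigma> \<in> Zd d \<rightarrow>\<^sub>E {-1, 1} \<Longrightarrow> \<bar>f \<sigma>\<bar> \<le> B" using bounded_continuous_CT[OF f] by blast
  have sp: "space \<mu> = Zd d \<rightarrow>\<^sub>E {-1, 1}" using sets_eq_imp_space_eq[OF sets_\<mu>] by (simp add: space_PM)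
  have fi: "integrable \<mu> f" by (rule integrable_const_bound[of _ B]) (use B fm sp in auto)
  show "(?E \<longlongrightarrow> (\<integral>\<sigma>. f \<sigma> \<partial>\<mu>)) (finite_subsets_at_top (Zd d))"
  proof (rule tendstoI)
    fix e :: real assume e: "0 < e"
    have e3: "0 < e / 3" using e by simp
    from approx_by_config[OF f e3] obtain J where JJ: "finite J \<and> J \<subseteq> Zd d \<and>
      (\<forall>\<sigma>\<in>Zd d \<rightarrow>\<^sub>E {-1, 1}. \<bar>f \<sigma> - f (config d {x \<in> J. \<sigma> x = 1})\<bar> < e / 3)" by (rule exE)
    note J = JJ[THEN conjunct1] JJ[THEN conjunct2, THEN conjunct1]
    note le = JJ[THEN conjunct2, THEN conjunct2, rule_format]
    define g where "g A = f (config d A)" for A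
    have gm: "(\<lambda>\<sigma>. g {x \<in> J. \<sigma> x = 1}) \<in> borel_measurable \<mu>"
      using measurable_plus_PM[OF J, of g] by (simp only: measurable_cong_sets[OF sets_\<mu> refl])
    have gi: "integrable \<mu> (\<lambda>\<sigma>. g {x \<in> J. \<sigma> x = 1})"
      by (rule integrable_const_bound[of _ B]) (use B[OF config_mem] gm in \<open>auto simp: g_def\<close>)
    have 1: "\<bar>(\<integral>\<sigma>. f \<sigma> \<partial>\<mu>) - cyl_lim d \<beta> J g\<bar> \<le> e / 3"
    proof -
      have "(\<integral>\<sigma>. f \<sigma> \<partial>\<mu>) - cyl_lim d \<beta> J g = (\<integral>\<sigma>. f \<sigma> - g {x \<in> J. \<sigma> x = 1} \<partial>\<mu>)"
        unfolding integral_\<mu>_cyl[OF J, symmetric] using fi gi by simp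
      also have "\<bar>\<dots>\<bar> \<le> (\<integral>\<sigma>. \<bar>f \<sigma> - g {x \<in> J. \<sigma> x = 1}\<bar> \<partial>\<mu>)" by (rule integral_abs_bound)
      also have "\<dots> \<le> (\<integral>\<sigma>. e / 3 \<partial>\<mu>)"
        using fi gi le sp by (intro integral_mono) (auto simp: g_def less_imp_le)
      finally show ?thesis by (simp add: prob_space)
    qed
    have 2: "\<bar>?E \<Lambda> - mexp d \<beta> \<Lambda> (\<lambda>A. g (A \<inter> J))\<bar> \<le> e / 3" if \<Lambda>: "finite \<Lambda>" "\<Lambda> \<subseteq> Zd d" for \<Lambda>
    proof -
      have ab: "\<bar>f (config d A) - g (A \<inter> J)\<bar> \<le> e / 3" for A
      proof -
        have "{x \<in> J. config d A x = 1} = A \<inter> J" using J by (auto simp: config_def spin_def split: if_splits)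
        then show ?thesis using le[OF config_mem[of A]] by (simp add: g_def)
      qed
      have fg: "f (config d A) \<le> g (A \<inter> J) + e / 3" "g (A \<inter> J) \<le> f (config d A) + e / 3" for A
        using ab[of A] by linarith+
      have "mexp d \<beta> \<Lambda> (\<lambda>A. f (config d A)) \<le> mexp d \<beta> \<Lambda> (\<lambda>A. g (A \<inter> J) + e / 3)"
        "mexp d \<beta> \<Lambda> (\<lambda>A. g (A \<inter> J)) \<le> mexp d \<beta> \<Lambda> (\<lambda>A. f (config d A) + e / 3)"
        by (intro expect_mono[OF \<Lambda>(1) W] fg)+
      then show ?thesis
        unfolding integral_ising[OF \<Lambda>] expect_add expect_const[OF \<Lambda>(1) W] by linarith
    qed
    have "\<forall>\<^sub>F \<Lambda> in finite_subsets_at_top (Zd d). dist (mexp d \<beta> \<Lambda> (\<lambda>A. g (A \<inter> J))) (cyl_lim d \<beta> J g) < e / 3"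
      using tendstoD[OF cyl_convergent[OF J(1)], of "e / 3"] e by simp
    moreover have "\<forall>\<^sub>F \<Lambda> in finite_subsets_at_top (Zd d). \<bar>?E \<Lambda> - mexp d \<beta> \<Lambda> (\<lambda>A. g (A \<inter> J))\<bar> \<le> e / 3"
      by (intro eventually_finite_subsets_at_top_weakI 2)
    ultimately show "\<forall>\<^sub>F \<Lambda> in finite_subsets_at_top (Zd d). dist (?E \<Lambda>) (\<integral>\<sigma>. f \<sigma> \<partial>\<mu>) < e"
    proof eventually_elim
      case (elim \<Lambda>)
      then show ?case using 1 unfolding dist_real_def by linarith
    qed
  qed
qed simp

lemma continuous_map_cyl:
  assumes J: "finite J" "J \<subseteq> Zd d"
  shows "continuous_map CT euclideanreal (\<lambda>\<sigma>. g {x \<in> J. \<sigma> x = 1})"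
  unfolding continuous_map_def
proof (intro conjI allI impI)
  fix U :: "real set"
  let ?S = "{\<sigma> \<in> topspace CT. g {x \<in> J. \<sigma> x = 1} \<in> U}"
  show "openin CT ?S"
  proof (subst openin_subopen, intro ballI)
    fix \<sigma> assume \<sigma>: "\<sigma> \<in> ?S"
    define T where "T = Pi\<^sub>E (Zd d) (\<lambda>x. if x \<in> J then {\<sigma> x} else {-1, 1})"
    have \<sigma>X: "\<sigma> \<in> Zd d \<rightarrow>\<^sub>E {-1, 1}" using \<sigma> by simp
    have "{x \<in> Zd d. (if x \<in> J then {\<sigma> x} else {-1, 1}) \<noteq> topspace (discrete_topology {-1, 1::real})} \<subseteq> J"
      by auto
    then have "openin CT T"
      unfolding T_def using J PiE_mem[OF \<sigma>X] by (auto simp: openin_PiE_gen intro: finite_subset)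
    moreover have "\<sigma> \<in> T" using \<sigma>X by (auto simp: T_def PiE_iff)
    moreover have "T \<subseteq> ?S"
    proof
      fix \<tau> assume \<tau>: "\<tau> \<in> T"
      have tm: "\<tau> x \<in> (if x \<in> J then {\<sigma> x} else {-1, 1})" if "x \<in> Zd d" for x
        using \<tau> that unfolding T_def by (rule PiE_mem)
      have "\<tau> x = \<sigma> x" if "x \<in> J" for x using tm[of x] that J by auto
      then have "{x \<in> J. \<tau> x = 1} = {x \<in> J. \<sigma> x = 1}" by auto
      moreover have "\<tau> \<in> Zd d \<rightarrow>\<^sub>E {-1, 1}"
      proof (rule PiE_I)
        fix x assume x: "x \<in> Zd d"
        show "\<tau> x \<in> {-1, 1}" using tm[OF x] PiE_mem[OF \<sigma>X x] by (auto split: if_splits)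
      next
        fix x assume "x \<notin> Zd d"
        then show "\<tau> x = undefined" using \<tau> unfolding T_def by (rule PiE_arb[rotated])
      qed
      ultimately show "\<tau> \<in> ?S" using \<sigma> by simp
    qed
    ultimately show "\<exists>T. openin CT T \<and> \<sigma> \<in> T \<and> T \<subseteq> ?S" by blast
  qed
qed simp

text \<open>Indicators of finite-dimensional boxes are continuous because the factors are discrete.
  So two weak limits agree on a family of sets that determines the measure.\<close>

lemma is_minus_phase_unique:
  assumes P: "is_minus_phase d \<beta> P" and Q: "is_minus_phase d \<beta> Q"
  shows "P = Q"
proof (rule measure_eqI_PiM_infinite)
  show sP: "sets P = sets PM" and sQ: "sets Q = sets PM" using P Q by (auto simp: is_minus_phase_def)
  interpret P: prob_space P using P by (simp add: is_minus_phase_def)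
  interpret Q: prob_space Q using Q by (simp add: is_minus_phase_def)
  show "finite_measure P" by (rule P.finite_measure_axioms)
  have eq: "(\<integral>\<sigma>. f \<sigma> \<partial>P) = (\<integral>\<sigma>. f \<sigma> \<partial>Q)" if f: "continuous_map CT euclideanreal f" for f
  proof -
    let ?E = "\<lambda>\<Lambda>. \<integral>\<sigma>. f (minus_extend d \<Lambda> \<sigma>) \<partial>ising d \<Lambda> \<beta> (\<lambda>x. -1)"
    have "(?E \<longlongrightarrow> (\<integral>\<sigma>. f \<sigma> \<partial>P)) (finite_subsets_at_top (Zd d))"
      using P f unfolding is_minus_phase_def by blast
    moreover have "(?E \<longlongrightarrow> (\<integral>\<sigma>. f \<sigma> \<partial>Q)) (finite_subsets_at_top (Zd d))"
      using Q f unfolding is_minus_phase_def by blast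
    ultimately show ?thesis by (intro tendsto_unique[of "finite_subsets_at_top (Zd d)"]) simp_all
  qed
  fix F :: "site \<Rightarrow> real set" and J assume J: "finite J" "J \<subseteq> Zd d" and F: "\<And>j. j \<in> J \<Longrightarrow> F j \<in> sets (count_space {-1, 1})"
  let ?X = "prod_emb (Zd d) (\<lambda>_. count_space {-1, 1}) J (Pi\<^sub>E J F)"
  have X: "?X \<in> sets PM" using J F by (intro sets_PiM_I) auto
  define g where "g A = (if \<forall>x\<in>J. spin A x \<in> F x then 1 else (0::real))" for A
  have ind: "indicator ?X \<sigma> = g {x \<in> J. \<sigma> x = 1}" if "\<sigma> \<in> Zd d \<rightarrow>\<^sub>E {-1, 1}" for \<sigma>
  proof -
    have "\<sigma> \<in> ?X \<longleftrightarrow> (\<forall>x\<in>J. \<sigma> x \<in> F x)"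
      using that J by (auto simp: prod_emb_iff PiE_iff)
    moreover have "spin {x \<in> J. \<sigma> x = 1} x = \<sigma> x" if "x \<in> J" for x
      using PiE_mem[OF \<open>\<sigma> \<in> Zd d \<rightarrow>\<^sub>E {-1, 1}\<close>, of x] that J by (auto simp: spin_def)
    ultimately show ?thesis by (auto simp: g_def indicator_def)
  qed
  have "measure P ?X = (\<integral>\<sigma>. indicator ?X \<sigma> \<partial>P)" using X sP by simp
  also have "\<dots> = (\<integral>\<sigma>. g {x \<in> J. \<sigma> x = 1} \<partial>P)"
    using sets_eq_imp_space_eq[OF sP] by (intro Bochner_Integration.integral_cong ind refl) (simp add: space_PM)
  also have "\<dots> = (\<integral>\<sigma>. g {x \<in> J. \<sigma> x = 1} \<partial>Q)" by (rule eq[OF continuous_map_cyl[OF J]])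
  also have "\<dots> = (\<integral>\<sigma>. indicator ?X \<sigma> \<partial>Q)"
    using sets_eq_imp_space_eq[OF sQ] by (intro Bochner_Integration.integral_cong ind[symmetric] refl) (simp add: space_PM)
  also have "\<dots> = measure Q ?X" using X sQ by simp
  finally show "emeasure P ?X = emeasure Q ?X" by (simp add: P.emeasure_eq_measure Q.emeasure_eq_measure)
qed

lemma minus_phase_eq: "minus_phase d \<beta> = \<mu>"
  unfolding minus_phase_def
  by (rule the_equality[of "is_minus_phase d \<beta>", OF is_minus_phase_\<mu>]) (rule is_minus_phase_unique[OF _ is_minus_phase_\<mu>])

end

section \<open>Collisions of oriented walks\<close>

text \<open>\<open>bsq k n\<close> counts the pairs of words of length \<open>n\<close> over \<open>k\<close> letters that are rearrangements
  of each other; \<open>collision k n\<close> is the probability that two oriented walks meet at time \<open>n\<close>.\<close>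

primrec bsq :: "nat \<Rightarrow> nat \<Rightarrow> int" where
  "bsq 0 n = of_bool (n = 0)"
| "bsq (Suc k) n = (\<Sum>j\<le>n. (int (n choose j))\<^sup>2 * bsq k j)"

definition collision :: "nat \<Rightarrow> nat \<Rightarrow> real" where
  "collision k n = bsq k n / (real k ^ n)\<^sup>2"

section \<open>Multinomial coefficients\<close>

definition types :: "'i set \<Rightarrow> nat \<Rightarrow> ('i \<Rightarrow> nat) set" where
  "types I n = {y \<in> I \<rightarrow>\<^sub>E UNIV. sum y I = n}"

definition multinom :: "'i set \<Rightarrow> ('i \<Rightarrow> nat) \<Rightarrow> real" where
  "multinom I y = fact (sum y I) / (\<Prod>i\<in>I. fact (y i))"

lemma finite_types: "finite I \<Longrightarrow> finite (types I n)"
  using finite_PiE[of I "\<lambda>_. {..n}"]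
  by (rule finite_subset[of _ "I \<rightarrow>\<^sub>E {..n}", rotated]) (auto simp: types_def PiE_def Pi_def intro!: member_le_sum)

lemma types_insert_sum:
  fixes f :: "('i \<Rightarrow> nat) \<Rightarrow> real"
  assumes "finite I" "a \<notin> I"
  shows "(\<Sum>y\<in>types (insert a I) n. f y) = (\<Sum>j\<le>n. \<Sum>y\<in>types I j. f (y(a := n - j)))"
proof -
  have "(\<Sum>y\<in>types (insert a I) n. f y) = (\<Sum>(j, y)\<in>Sigma {..n} (types I). f (y(a := n - j)))"
  proof (rule sum.reindex_bij_witness[where i="\<lambda>(j, y). y(a := n - j)" and j="\<lambda>y. (n - y a, restrict y I)"])
    fix y assume y: "y \<in> types (insert a I) n"
    have sy: "sum y I + y a = n" using y assms by (simp add: types_def)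
    have e: "(restrict y I)(a := y a) = y"
      using y by (auto simp: types_def fun_eq_iff PiE_iff extensional_def)
    then show "(case (n - y a, restrict y I) of (j, y) \<Rightarrow> y(a := n - j)) = y" using sy by simp
    show "(n - y a, restrict y I) \<in> Sigma {..n} (types I)" using sy by (auto simp: types_def)
    show "(case (n - y a, restrict y I) of (j, y) \<Rightarrow> f (y(a := n - j))) = f y" using e sy by simp
  next
    fix p assume p: "p \<in> Sigma {..n} (types I)"
    obtain j y where pe: "p = (j, y)" and j: "j \<le> n" and y: "y \<in> I \<rightarrow>\<^sub>E UNIV" "sum y I = j"
      using p by (auto simp: types_def)
    have r: "restrict (y(a := n - j)) I = y"
      using y assms by (auto simp: fun_eq_iff PiE_iff extensional_def)
    then show "(\<lambda>y. (n - y a, restrict y I)) (case p of (j, y) \<Rightarrow> y(a := n - j)) = p"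
      using pe j by simp
    have "sum (y(a := n - j)) I = sum y I" using assms by (intro sum.cong) auto
    then show "(case p of (j, y) \<Rightarrow> y(a := n - j)) \<in> types (insert a I) n"
      using pe j y assms by (auto simp: types_def PiE_iff extensional_def)
  qed
  then show ?thesis using assms by (simp add: sum.Sigma finite_types)
qed

lemma multinom_upd:
  assumes "finite I" "a \<notin> I" "y \<in> types I j" "j \<le> n"
  shows "multinom (insert a I) (y(a := n - j)) = real (n choose j) * multinom I y"
proof -
  have s: "sum (y(a := n - j)) I = j" using assms by (subst sum.cong[of I I _ y]) (auto simp: types_def)
  then have s: "sum (y(a := n - j)) (insert a I) = n"
    using assms by (simp add: sum.insert del: fun_upd_apply) simp
  have "(\<Prod>i\<in>I. fact ((y(a := n - j)) i)) = (\<Prod>i\<in>I. fact (y i) :: real)"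
    using assms by (intro prod.cong) auto
  then have p: "(\<Prod>i\<in>insert a I. fact ((y(a := n - j)) i)) = fact (n - j) * (\<Prod>i\<in>I. fact (y i) :: real)"
    using assms by (simp add: prod.insert del: fun_upd_apply) simp
  have sj: "sum y I = j" using assms(3) by (simp add: types_def)
  have "(fact n :: real) = fact j * fact (n - j) * real (n choose j)"
    using assms(4) by (simp add: binomial_fact)
  moreover have "(\<Prod>i\<in>I. fact (y i) :: real) \<noteq> 0" using assms(1) by simp
  ultimately show ?thesis unfolding multinom_def s p sj by (simp add: field_simps)
qed

text \<open>The letters are treated one after the other: fixing the n - j places of the letter a
  contributes a binomial coefficient, squared for the pair, which is the recursion of
  \<open>bsq\<close>.\<close>

lemma sum_multinom_square:
  "finite I \<Longrightarrow> (\<Sum>y\<in>types I n. (multinom I y)\<^sup>2) = bsq (card I) n"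
proof (induction I arbitrary: n rule: finite_induct)
  case empty
  have "types {} k = (if k = 0 then {\<lambda>_::'a. undefined} else {})" for k by (auto simp: types_def)
  then show ?case by (simp add: multinom_def)
next
  case (insert a I)
  have "(\<Sum>y\<in>types (insert a I) n. (multinom (insert a I) y)\<^sup>2)
      = (\<Sum>j\<le>n. \<Sum>y\<in>types I j. (real (n choose j))\<^sup>2 * (multinom I y)\<^sup>2)"
    unfolding types_insert_sum[OF insert.hyps(1,2)]
    by (intro sum.cong refl) (simp add: multinom_upd insert.hyps power_mult_distrib)
  also have "\<dots> = (\<Sum>j\<le>n. (real (n choose j))\<^sup>2 * bsq (card I) j)"
    by (simp add: sum_distrib_left[symmetric] insert.IH)
  finally show ?case using insert.hyps by simp
qed

lemma sum_multinom: "finite I \<Longrightarrow> (\<Sum>y\<in>types I n. multinom I y) = real (card I) ^ n"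
proof (induction I arbitrary: n rule: finite_induct)
  case empty
  have "types {} k = (if k = 0 then {\<lambda>_::'a. undefined} else {})" for k by (auto simp: types_def)
  then show ?case by (simp add: multinom_def)
next
  case (insert a I)
  have "(\<Sum>y\<in>types (insert a I) n. multinom (insert a I) y)
      = (\<Sum>j\<le>n. \<Sum>y\<in>types I j. real (n choose j) * multinom I y)"
    unfolding types_insert_sum[OF insert.hyps(1,2)]
    by (intro sum.cong refl) (simp add: multinom_upd insert.hyps)
  also have "\<dots> = (\<Sum>j\<le>n. real (n choose j) * real (card I) ^ j * 1 ^ (n - j))"
    by (simp add: sum_distrib_left[symmetric] insert.IH)
  also have "\<dots> = (real (card I) + 1) ^ n" by (rule binomial_ring[symmetric])
  finally show ?case using insert.hyps by (simp add: add.commute)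
qed

lemma multinom_nonneg: "0 \<le> multinom I y"
  unfolding multinom_def by (intro divide_nonneg_nonneg prod_nonneg) auto

lemma bsq_nonneg: "0 \<le> bsq k n"
  by (induction k arbitrary: n) (auto intro: sum_nonneg)

lemma collision_nonneg: "0 \<le> collision k n"
  unfolding collision_def using bsq_nonneg by simp

section \<open>The tail of the collision probabilities\<close>

lemma fact_ge_power:
  "fact q * real q ^ y \<le> fact y * real q ^ q"
proof (cases "q \<le> y")
  case True
  then obtain r where r: "y = q + r" using le_Suc_ex by blast
  have "fact q * real q ^ r \<le> fact (q + r)" for r
  proof (induction r)
    case (Suc r)
    have "fact q * real q ^ Suc r = real q * (fact q * real q ^ r)" by simp
    also have "\<dots> \<le> real (Suc (q + r)) * fact (q + r)" using Suc by (intro mult_mono) auto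
    finally show ?case by simp
  qed simp
  from mult_right_mono[OF this[of r], of "real q ^ q"] show ?thesis by (simp add: r power_add mult_ac)
next
  case False
  then obtain r where r: "q = y + r" using le_Suc_ex by (metis nat_le_linear)
  have "(fact (y + r) :: real) \<le> fact y * real (y + r) ^ r" for r
  proof (induction r)
    case (Suc r)
    have "(fact (y + Suc r) :: real) = real (y + Suc r) * fact (y + r)" by simp
    also have "\<dots> \<le> real (y + Suc r) * (fact y * real (y + r) ^ r)" by (intro mult_left_mono Suc) auto
    also have "\<dots> \<le> real (y + Suc r) * (fact y * real (y + Suc r) ^ r)"
      by (intro mult_left_mono power_mono) auto
    finally show ?case by (simp add: mult_ac)
  qed simp
  from mult_right_mono[OF this[of r], of "real q ^ y"] show ?thesis by (simp add: r power_add mult_ac)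
qed

text \<open>With a fixed total, the product of factorials is smallest for equal counts: multiplying
  \<open>fact_ge_power\<close> over the letters, the powers of q cancel.\<close>

lemma multinom_le_balanced:
  assumes I: "finite I" and q: "q > 0" and y: "y \<in> types I (card I * q)"
  shows "multinom I y \<le> fact (card I * q) / fact q ^ card I"
proof -
  have s: "sum y I = card I * q" using y by (simp add: types_def)
  have "(\<Prod>i\<in>I. fact q * real q ^ y i) \<le> (\<Prod>i\<in>I. fact (y i) * real q ^ q)"
    by (intro prod_mono) (auto intro: fact_ge_power)
  then have "fact q ^ card I * real q ^ (card I * q) \<le> (\<Prod>i\<in>I. fact (y i)) * real q ^ (card I * q)"
    by (simp add: prod.distrib power_sum[symmetric] s power_mult[symmetric] mult.commute[of q])
  then have "fact q ^ card I \<le> (\<Prod>i\<in>I. fact (y i) :: real)" using q by simp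
  then show ?thesis unfolding multinom_def s
    by (intro divide_left_mono) (auto intro!: mult_pos_pos prod_pos)
qed

text \<open>The probability that an oriented walk on m coordinates has made q steps in each of them
  at time m * q; by \<open>multinom_le_balanced\<close> no other site is more likely at that
  time.\<close>

definition peak :: "nat \<Rightarrow> nat \<Rightarrow> real" where
  "peak m q = fact (m * q) / (fact q ^ m * real m ^ (m * q))"

text \<open>A sum of squared probabilities is at most the largest of these probabilities.\<close>

lemma collision_le_peak:
  assumes "q > 0" "m > 0"
  shows "collision m (m * q) \<le> peak m q"
proof -
  let ?I = "{..<m}" and ?n = "m * q"
  have "bsq m ?n = (\<Sum>y\<in>types ?I ?n. (multinom ?I y)\<^sup>2)" by (simp add: sum_multinom_square)
  also have "\<dots> \<le> (\<Sum>y\<in>types ?I ?n. fact ?n / fact q ^ m * multinom ?I y)"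
    unfolding power2_eq_square using multinom_le_balanced[of ?I q] assms
    by (intro sum_mono mult_right_mono multinom_nonneg) auto
  also have "\<dots> = fact ?n / fact q ^ m * real m ^ ?n"
    by (simp only: sum_distrib_left[symmetric] sum_multinom[OF finite_lessThan] card_lessThan)
  finally have "bsq m ?n / (real m ^ ?n)\<^sup>2 \<le> fact ?n / fact q ^ m * real m ^ ?n / (real m ^ ?n)\<^sup>2"
    by (intro divide_right_mono) auto
  then show ?thesis using assms by (simp add: collision_def peak_def power2_eq_square)
qed

text \<open>The law of the walk at time n + 1 is the average of m translates of the law at time n,
  so by Cauchy-Schwarz its sum of squares does not grow. On coefficients this is Pascal's rule,
  obtained by lowering one positive count.\<close>

lemma collision_Suc_le: "m > 0 \<Longrightarrow> collision m (Suc n) \<le> collision m n"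
proof -
  assume m: "m > 0"
  let ?I = "{..<m}" and ?M = "multinom {..<m}"
  let ?T = "\<lambda>i. {y \<in> types ?I (Suc n). y i > 0}"
  let ?d = "\<lambda>y i. y(i := y i - Suc 0)"
  have dec: "?M (?d y i) = real (y i) * fact n / (\<Prod>i\<in>?I. fact (y i))"
    if y: "y \<in> types ?I (Suc n)" and i: "i \<in> ?I" "y i > 0" for y i
  proof -
    have "sum y ?I = y i + sum y (?I - {i})" using i by (simp add: sum.remove)
    moreover have "sum (?d y i) ?I = (y i - 1) + sum y (?I - {i})"
      using i by (simp add: sum.remove[of ?I i])
    ultimately have s: "sum (?d y i) ?I = n" using y i by (simp add: types_def)
    have p1: "(\<Prod>j\<in>?I. fact (y j)) = fact (y i) * (\<Prod>j\<in>?I - {i}. fact (y j) :: real)"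
      using i by (subst prod.remove[of ?I i]) auto
    have p2: "(\<Prod>j\<in>?I. fact (?d y i j)) = fact (y i - 1) * (\<Prod>j\<in>?I - {i}. fact (y j) :: real)"
      using i by (subst prod.remove[of ?I i]) auto
    have p3: "(fact (y i) :: real) = real (y i) * fact (y i - 1)" using i by (simp add: fact_reduce)
    have "(\<Prod>j\<in>?I - {i}. fact (y j) :: real) \<noteq> 0" by simp
    then show ?thesis unfolding multinom_def s p1 p2 p3 using i by (simp add: field_simps)
  qed
  have M: "?M y = (\<Sum>i | i \<in> ?I \<and> y i > 0. ?M (?d y i))" if y: "y \<in> types ?I (Suc n)" for y
  proof -
    have "(\<Sum>i | i \<in> ?I \<and> y i > 0. ?M (?d y i)) = (\<Sum>i | i \<in> ?I \<and> y i > 0. real (y i) * fact n / (\<Prod>i\<in>?I. fact (y i)))"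
      by (intro sum.cong refl dec y) auto
    also have "\<dots> = (\<Sum>i\<in>?I. real (y i) * fact n / (\<Prod>i\<in>?I. fact (y i)))"
      by (intro sum.mono_neutral_left) auto
    also have "\<dots> = real (sum y ?I) * fact n / (\<Prod>i\<in>?I. fact (y i))"
      by (simp add: sum_distrib_right sum_divide_distrib)
    finally have eq: "(\<Sum>i | i \<in> ?I \<and> y i > 0. ?M (?d y i)) = real (sum y ?I) * fact n / (\<Prod>i\<in>?I. fact (y i))" .
    have sy: "sum y ?I = Suc n" using y by (simp add: types_def)
    show ?thesis unfolding eq unfolding multinom_def sy by simp
  qed
  have "real_of_int (bsq m (Suc n)) = (\<Sum>y\<in>types ?I (Suc n). (?M y)\<^sup>2)" by (simp add: sum_multinom_square)
  also have "\<dots> \<le> (\<Sum>y\<in>types ?I (Suc n). real m * (\<Sum>i | i \<in> ?I \<and> y i > 0. (?M (?d y i))\<^sup>2))"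
  proof (rule sum_mono)
    fix y assume y: "y \<in> types ?I (Suc n)"
    have "(?M y)\<^sup>2 \<le> (\<Sum>i | i \<in> ?I \<and> y i > 0. (?M (?d y i))\<^sup>2) * real (card {i. i \<in> ?I \<and> y i > 0})"
      unfolding M[OF y] by (rule sum_squared_le_sum_of_squares)
    also have "\<dots> \<le> (\<Sum>i | i \<in> ?I \<and> y i > 0. (?M (?d y i))\<^sup>2) * real m"
    proof (intro mult_left_mono sum_nonneg)
      have "card {i. i \<in> ?I \<and> y i > 0} \<le> card ?I" by (intro card_mono) auto
      then show "real (card {i. i \<in> ?I \<and> y i > 0}) \<le> real m" by simp
    qed auto
    finally show "(?M y)\<^sup>2 \<le> real m * (\<Sum>i | i \<in> ?I \<and> y i > 0. (?M (?d y i))\<^sup>2)" by (simp add: mult.commute)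
  qed
  also have "\<dots> = real m * (\<Sum>i\<in>?I. \<Sum>y\<in>?T i. (?M (?d y i))\<^sup>2)"
    unfolding sum_distrib_left[symmetric]
    by (subst sum.swap_restrict) (simp_all add: finite_types)
  also have "(\<Sum>i\<in>?I. \<Sum>y\<in>?T i. (?M (?d y i))\<^sup>2) = (\<Sum>i\<in>?I. \<Sum>y\<in>types ?I n. (?M y)\<^sup>2)"
  proof (rule sum.cong[OF refl])
    fix i assume i: "i \<in> ?I"
    have s: "sum (y(i := k)) ?I + y i = sum y ?I + k" for y :: "nat \<Rightarrow> nat" and k
      using i by (simp add: sum.remove[of ?I i])
    show "(\<Sum>y\<in>?T i. (?M (?d y i))\<^sup>2) = (\<Sum>y\<in>types ?I n. (?M y)\<^sup>2)"
    proof (rule sum.reindex_bij_witness[where i="\<lambda>y. y(i := Suc (y i))" and j="\<lambda>y. ?d y i"])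
      fix y assume y: "y \<in> ?T i"
      then show "(?d y i)(i := Suc ((?d y i) i)) = y" by auto
      show "?d y i \<in> types ?I n" using y i s[of y "y i - Suc 0"] by (auto simp: types_def PiE_iff extensional_def)
    next
      fix y assume y: "y \<in> types ?I n"
      show "?d (y(i := Suc (y i))) i = y" by auto
      show "y(i := Suc (y i)) \<in> ?T i" using y i s[of y "Suc (y i)"] by (auto simp: types_def PiE_iff extensional_def)
    qed auto
  qed
  also have "\<dots> = real m * bsq m n" by (simp add: sum_multinom_square)
  finally have "bsq m (Suc n) \<le> (real m)\<^sup>2 * bsq m n" by (simp add: power2_eq_square)
  then have "bsq m (Suc n) / (real m ^ Suc n)\<^sup>2 \<le> (real m)\<^sup>2 * bsq m n / (real m ^ Suc n)\<^sup>2"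
    by (rule divide_right_mono) auto
  then show ?thesis using m by (simp add: collision_def power_mult_distrib)
qed

lemma collision_antimono: "m > 0 \<Longrightarrow> n \<le> n' \<Longrightarrow> collision m n' \<le> collision m n"
  by (rule lift_Suc_antimono_le[of "collision m"]) (auto intro: collision_Suc_le)

text \<open>In terms of u = 2 q + 2 the claim is (u - 1)^7 * (u + 4) \<le> u^7 * (u - 2). After
  dropping lower terms it reduces to u^2 + 7 u \<ge> 84, which holds from u = 8 on but fails at u =
  6; hence q \<ge> 3.\<close>

lemma peak_ratio_bound:
  fixes q :: real
  assumes "q \<ge> 3"
  shows "((2 * q + 1) / (2 * q + 2)) ^ 7 * (q + 3) \<le> q"
proof -
  define u where "u = 2 * q + 2"
  have u: "u \<ge> 8" using assms by (simp add: u_def)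
  have "(u - 1) ^ 7 = u ^ 7 - 7 * u ^ 6 + 21 * u ^ 5 - 35 * u ^ 3 * (u - 1) - 7 * u * (3 * u - 1) - 1"
    by (simp add: eval_nat_numeral algebra_simps)
  also have "\<dots> \<le> u ^ 7 - 7 * u ^ 6 + 21 * u ^ 5"
  proof -
    have "0 \<le> 35 * u ^ 3 * (u - 1)" "0 \<le> 7 * u * (3 * u - 1)" using u by auto
    then show ?thesis by linarith
  qed
  finally have "(u - 1) ^ 7 * (u + 4) \<le> (u ^ 7 - 7 * u ^ 6 + 21 * u ^ 5) * (u + 4)"
    using u by (intro mult_right_mono) auto
  also have "\<dots> = u ^ 7 * (u - 2) - u ^ 5 * (u * u + 7 * u - 84)"
    by (simp add: eval_nat_numeral algebra_simps)
  also have "\<dots> \<le> u ^ 7 * (u - 2)"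
  proof -
    have "8 * 8 \<le> u * u" using u by (intro mult_mono) auto
    then have "0 \<le> u ^ 5 * (u * u + 7 * u - 84)" using u by (intro mult_nonneg_nonneg) auto
    then show ?thesis by linarith
  qed
  finally have "(u - 1) ^ 7 * (u + 4) \<le> u ^ 7 * (u - 2)" .
  then have "((u - 1) / u) ^ 7 * (u + 4) \<le> u - 2"
    using u by (simp add: power_divide field_simps)
  then have "((u - 1) / u) ^ 7 * ((u + 4) / 2) \<le> (u - 2) / 2" by simp
  moreover have e: "u - 1 = 2 * q + 1" "(u + 4) / 2 = q + 3" "(u - 2) / 2 = q" by (simp_all add: u_def)
  ultimately show ?thesis unfolding e unfolding u_def by blast
qed

text \<open>The ratio of consecutive peaks is a product of m - 1 factors, at most ((2 q + 1) / (2 q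
  + 2)) ^ (m - 1), and m \<ge> 8 allows the exponent 7. The factor q + 3 is what telescoping needs:
  it makes q times the peak at q drop by at least twice the next peak.\<close>

lemma peak_Suc_le:
  assumes m: "m \<ge> 8" and q: "q \<ge> 2"
  shows "peak m (Suc q) * (q + 3) \<le> peak m q * q"
proof -
  define c where "c = (2 * real q + 1) / (2 * real q + 2)"
  have c: "0 \<le> c" "c \<le> 1" by (auto simp: c_def)
  have c7: "c ^ 7 * (real q + 3) \<le> q"
  proof (cases "q = 2")
    case True
    then show ?thesis by (simp add: c_def eval_nat_numeral)
  next
    case False
    then show ?thesis unfolding c_def by (intro peak_ratio_bound) (use q in simp)
  qed
  define P where "P = (\<Prod>i<m - 1. real (m * q + Suc i))"
  \<comment> \<open>Factors are paired from both ends. Each pair has sum 2 m (q + 1 / 2), so its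
    product is at most the square of half that sum.\<close>
  have "P\<^sup>2 = (\<Prod>i<m - 1. real (m * q + Suc i)) * (\<Prod>i<m - 1. real (m * q + Suc (m - 1 - Suc i)))"
    unfolding P_def power2_eq_square
    by (subst (2) prod.nat_diff_reindex[of "\<lambda>i. real (m * q + Suc i)" "m - 1", symmetric]) simp
  also have "\<dots> = (\<Prod>i<m - 1. real (m * q + Suc i) * real (m * q + Suc (m - 1 - Suc i)))"
    by (simp only: prod.distrib)
  also have "\<dots> \<le> (\<Prod>i<m - 1. (real m * (real q + 1 / 2))\<^sup>2)"
  proof (intro prod_mono conjI)
    fix i assume "i \<in> {..<m - 1}"
    then have "real (m * q + Suc i) + real (m * q + Suc (m - 1 - Suc i)) = 2 * (real m * (real q + 1 / 2))"
      by (auto simp: algebra_simps of_nat_diff)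
    then have eq: "real (m * q + Suc (m - 1 - Suc i)) = 2 * (real m * (real q + 1 / 2)) - real (m * q + Suc i)" by simp
    have sq: "x * (2 * y - x) \<le> y\<^sup>2" for x y :: real
      using zero_le_power2[of "x - y"] by (simp add: power2_eq_square algebra_simps)
    show "real (m * q + Suc i) * real (m * q + Suc (m - 1 - Suc i)) \<le> (real m * (real q + 1 / 2))\<^sup>2"
      unfolding eq by (rule sq)
  next
    fix i show "0 \<le> real (m * q + Suc i) * real (m * q + Suc (m - 1 - Suc i))"
      by (intro mult_nonneg_nonneg of_nat_0_le_iff)
  qed
  also have "\<dots> = ((real m * (real q + 1 / 2)) ^ (m - 1))\<^sup>2" by (simp add: power_mult[symmetric] mult.commute)
  finally have P: "P \<le> (real m * (real q + 1 / 2)) ^ (m - 1)"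
    by (rule power2_le_imp_le) auto
  have m1: "m = Suc (m - 1)" using m by simp
  have "fact (m * q + k) = fact (m * q) * (\<Prod>i<k. real (m * q + Suc i))" for k
    by (induction k) (auto simp: algebra_simps)
  from this[of m] have "fact (m * Suc q) = fact (m * q) * (\<Prod>i<m. real (m * q + Suc i))" by (simp add: add.commute)
  also have "(\<Prod>i<m. real (m * q + Suc i)) = P * (real m * (real q + 1))"
    unfolding P_def by (subst m1, subst prod.lessThan_Suc) (use m in \<open>simp add: algebra_simps of_nat_diff\<close>)
  finally have f: "fact (m * Suc q) = fact (m * q) * (P * (real m * (real q + 1)))" .
  have den: "fact (Suc q) ^ m * real m ^ (m * Suc q) = (fact q ^ m * real m ^ (m * q)) * (real m * (real q + 1)) ^ m"
  proof -
    have "fact (Suc q) ^ m = (real q + 1) ^ m * fact q ^ m"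
      unfolding power_mult_distrib[symmetric] by (simp add: add.commute)
    moreover have "real m ^ (m * Suc q) = real m ^ (m * q) * real m ^ m"
      unfolding power_add[symmetric] by (simp add: add.commute)
    ultimately show ?thesis by (simp only: power_mult_distrib mult_ac)
  qed
  have "peak m (Suc q) = peak m q * (P * (real m * (real q + 1)) / (real m * (real q + 1)) ^ m)"
    unfolding peak_def f den by simp
  also have "P * (real m * (real q + 1)) / (real m * (real q + 1)) ^ m = P / (real m * (real q + 1)) ^ (m - 1)"
    by (subst m1, subst power_Suc) (use m in \<open>simp add: add_eq_0_iff\<close>)
  also have "peak m q * (P / (real m * (real q + 1)) ^ (m - 1)) \<le> peak m q * ((real m * (real q + 1 / 2)) ^ (m - 1) / (real m * (real q + 1)) ^ (m - 1))"
    by (intro mult_left_mono divide_right_mono P) (auto simp: peak_def)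
  also have "(real m * (real q + 1 / 2)) ^ (m - 1) / (real m * (real q + 1)) ^ (m - 1) = c ^ (m - 1)"
  proof -
    have "(real m * (real q + 1 / 2)) / (real m * (real q + 1)) = (real q + 1 / 2) / (real q + 1)" using m by simp
    also have "\<dots> = (2 * (real q + 1 / 2)) / (2 * (real q + 1))"
      by (rule mult_divide_mult_cancel_left[symmetric]) simp
    also have "\<dots> = c" unfolding c_def by (simp add: distrib_left)
    finally show ?thesis by (simp only: power_divide[symmetric])
  qed
  also have "peak m q * c ^ (m - 1) \<le> peak m q * c ^ 7"
    using c m by (intro mult_left_mono power_decreasing) (auto simp: peak_def)
  finally have "peak m (Suc q) * (q + 3) \<le> peak m q * c ^ 7 * (q + 3)" by (intro mult_right_mono) auto
  also have "\<dots> = peak m q * (c ^ 7 * (real q + 3))" by simp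
  also have "\<dots> \<le> peak m q * q" by (intro mult_left_mono c7) (auto simp: peak_def)
  finally show ?thesis by simp
qed

text \<open>By \<open>peak_Suc_le\<close> the quantity q * peak m q / 2 drops at every step by at
  least the next peak, so it dominates the remaining sum. At q = 2 it equals
  \<open>peak m 2\<close>.\<close>

lemma sum_peak_le:
  assumes m: "m \<ge> 8"
  shows "(\<Sum>q=2..<2 + k. peak m q) \<le> 2 * peak m 2"
proof -
  have pos: "0 \<le> peak m q" for q by (simp add: peak_def)
  have "(\<Sum>q=2..<3 + k. peak m q) \<le> 2 * peak m 2 - peak m (2 + k) * real (2 + k) / 2" for k
  proof (induction k)
    case 0
    have "{2..<3::nat} = {2}" by auto
    then show ?case by simp
  next
    case (Suc k)
    have "(\<Sum>q=2..<3 + Suc k. peak m q) = (\<Sum>q=2..<3 + k. peak m q) + peak m (Suc (2 + k))"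
    proof -
      have e: "3 + Suc k = Suc (3 + k)" "3 + k = Suc (2 + k)" by simp_all
      have "(\<Sum>q=2..<Suc (3 + k). peak m q) = (\<Sum>q=2..<3 + k. peak m q) + peak m (3 + k)"
        by (rule sum.atLeastLessThan_Suc) simp
      then show ?thesis unfolding e(1) unfolding e(2) .
    qed
    then show ?case using Suc peak_Suc_le[OF m, of "2 + k"] by (simp add: field_simps)
  qed
  then have "(\<Sum>q=2..<3 + k. peak m q) \<le> 2 * peak m 2"
    using mult_nonneg_nonneg[OF pos[of "2 + k"], of "real (2 + k) / 2"]
    by (smt (verit) of_nat_0_le_iff divide_nonneg_nonneg times_divide_eq_right)
  moreover have "(\<Sum>q=2..<2 + k. peak m q) \<le> (\<Sum>q=2..<3 + k. peak m q)"
    using pos by (intro sum_mono2) auto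
  ultimately show ?thesis by linarith
qed

text \<open>Times are grouped into blocks of length m. The first two blocks are kept; in block q
  every term is at most its first one, by monotonicity, and hence at most
  \<open>peak m q\<close>.\<close>

lemma sum_collision_le:
  assumes m: "m \<ge> 8"
  shows "(\<Sum>n<N. collision m n) \<le> (\<Sum>n<2 * m. collision m n) + 2 * m * peak m 2"
proof -
  have "(\<Sum>n<N. collision m n) \<le> (\<Sum>n<(2 + N) * m. collision m n)"
    using m by (intro sum_mono2) (auto intro: collision_nonneg simp: trans_le_add2)
  also have "\<dots> = (\<Sum>q<2 + N. \<Sum>n=q * m..<q * m + m. collision m n)" by (rule sum.nat_group[symmetric])
  also have "\<dots> = (\<Sum>q<2. \<Sum>n=q * m..<q * m + m. collision m n) + (\<Sum>q=2..<2 + N. \<Sum>n=q * m..<q * m + m. collision m n)"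
    unfolding lessThan_atLeast0 by (rule sum.atLeastLessThan_concat[symmetric]) auto
  also have "(\<Sum>q<2. \<Sum>n=q * m..<q * m + m. collision m n) = (\<Sum>n<2 * m. collision m n)" by (rule sum.nat_group)
  also have "(\<Sum>q=2..<2 + N. \<Sum>n=q * m..<q * m + m. collision m n) \<le> (\<Sum>q=2..<2 + N. m * peak m q)"
  proof (rule sum_mono)
    fix q assume q: "q \<in> {2..<2 + N}"
    have "(\<Sum>n=q * m..<q * m + m. collision m n) \<le> (\<Sum>n=q * m..<q * m + m. peak m q)"
    proof (rule sum_mono)
      fix n assume "n \<in> {q * m..<q * m + m}"
      then have "collision m n \<le> collision m (m * q)" using m by (intro collision_antimono) (auto simp: mult.commute)
      also have "\<dots> \<le> peak m q" using q m by (intro collision_le_peak) auto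
      finally show "collision m n \<le> peak m q" .
    qed
    then show "(\<Sum>n=q * m..<q * m + m. collision m n) \<le> m * peak m q" by simp
  qed
  also have "\<dots> = m * (\<Sum>q=2..<2 + N. peak m q)" by (simp only: sum_distrib_left)
  also have "\<dots> \<le> m * (2 * peak m 2)" by (intro mult_left_mono sum_peak_le m) auto
  finally show ?thesis by simp
qed

section \<open>Exact evaluation of the first collision numbers\<close>

fun dotsq :: "int list \<Rightarrow> int list \<Rightarrow> int" where
  "dotsq (c # cs) (b # bs) = c * c * b + dotsq cs bs"
| "dotsq [] bs = 0"
| "dotsq cs [] = 0"

fun pascal_next :: "int \<Rightarrow> int list \<Rightarrow> int list" where
  "pascal_next a [] = [a]"
| "pascal_next a (x # xs) = (a + x) # pascal_next x xs"

text \<open>The first list merely counts the remaining entries; \<open>ps\<close> is the current row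
  of Pascal's triangle and \<open>xs\<close> the table for one letter less.\<close>

fun bsq_row :: "'a list \<Rightarrow> int list \<Rightarrow> int list \<Rightarrow> int list" where
  "bsq_row [] ps xs = []"
| "bsq_row (u # us) ps xs = dotsq ps xs # bsq_row us (pascal_next 0 ps) xs"

lemma dotsq_eq: "dotsq cs bs = (\<Sum>j<min (length cs) (length bs). (cs ! j)\<^sup>2 * bs ! j)"
  by (induction cs bs rule: dotsq.induct) (auto simp: sum.lessThan_Suc_shift power2_eq_square simp del: sum.lessThan_Suc)

lemma length_pascal_next [simp]: "length (pascal_next a xs) = Suc (length xs)"
  by (induction a xs rule: pascal_next.induct) auto

lemma nth_pascal_next:
  "i \<le> length xs \<Longrightarrow> pascal_next a xs ! i =
     (if i = 0 then a else xs ! (i - 1)) + (if i < length xs then xs ! i else 0)"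
  by (induction a xs arbitrary: i rule: pascal_next.induct) (auto simp: nth_Cons split: nat.splits)

lemma pascal_next_choose:
  "pascal_next 0 (map (\<lambda>j. int (a choose j)) [0..<Suc a]) = map (\<lambda>j. int (Suc a choose j)) [0..<Suc (Suc a)]"
proof (rule nth_equalityI)
  fix i assume "i < length (pascal_next 0 (map (\<lambda>j. int (a choose j)) [0..<Suc a]))"
  then have i: "i \<le> Suc a" by simp
  have n: "map (\<lambda>j. int (a choose j)) [0..<Suc a] ! j = int (a choose j)" if "j < Suc a" for j
    using that by (simp del: upt_Suc)
  show "pascal_next 0 (map (\<lambda>j. int (a choose j)) [0..<Suc a]) ! i = map (\<lambda>j. int (Suc a choose j)) [0..<Suc (Suc a)] ! i"
    using i by (cases i) (auto simp: nth_pascal_next n simp del: upt_Suc)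
qed simp

lemma bsq_row_eq:
  assumes "length us \<le> N - a" "a \<le> N"
  shows "bsq_row us (map (\<lambda>j. int (a choose j)) [0..<Suc a]) (map (bsq k) [0..<N])
       = map (bsq (Suc k)) [a..<a + length us]"
  using assms
proof (induction us arbitrary: a)
  case (Cons u us)
  have N: "Suc a \<le> N" using Cons.prems by auto
  have "dotsq (map (\<lambda>j. int (a choose j)) [0..<Suc a]) (map (bsq k) [0..<N]) = bsq (Suc k) a"
    unfolding dotsq_eq bsq.simps using N by (intro sum.cong) (auto simp del: upt_Suc simp: nth_append)
  moreover have "bsq_row us (map (\<lambda>j. int (Suc a choose j)) [0..<Suc (Suc a)]) (map (bsq k) [0..<N])
       = map (bsq (Suc k)) [Suc a..<Suc a + length us]"
    using Cons.prems by (intro Cons.IH) auto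
  ultimately show ?case
    by (simp only: bsq_row.simps pascal_next_choose) (simp add: upt_conv_Cons del: bsq.simps upt_Suc)
qed simp

lemma bsq_row:
  "map (bsq (Suc k)) [0..<N] = bsq_row (map (bsq k) [0..<N]) [1] (map (bsq k) [0..<N])"
  using bsq_row_eq[of "map (bsq k) [0..<N]" N 0 k] by (simp del: bsq.simps)

lemma bsq_row_1: "map (bsq 1) [0..<N] = replicate N 1"
proof -
  have "bsq 1 = (\<lambda>_. 1)" by (rule ext) (simp add: sum.atMost_shift)
  then show ?thesis by (simp only: map_replicate_const) simp
qed

lemma bsq_row_step:
  assumes "map (bsq k) [0..<N] = xs" "bsq_row xs [1] xs = ys" "l = Suc k"
  shows "map (bsq l) [0..<N] = ys"
  unfolding assms(3) bsq_row assms(1) by (rule assms(2))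

text \<open>Eighteen entries are two blocks of length nine, as required by
  \<open>sum_collision_le\<close> for nine letters; two blocks for eight letters use sixteen of
  them.\<close>

lemma bsq_rows_1: "map (bsq 1) [0..<18] = [1, 1, 1, 1, 1, 1, 1, 1, 1, 1, 1, 1, 1, 1, 1, 1, 1, 1]"
  unfolding bsq_row_1 by (simp add: numeral_eq_Suc)

lemma bsq_rows_2: "map (bsq 2) [0..<18] = [1, 2, 6, 20, 70, 252, 924, 3432, 12870, 48620, 184756, 705432, 2704156, 10400600, 40116600, 155117520, 601080390, 2333606220]"
  by (rule bsq_row_step[OF bsq_rows_1]) (code_simp, simp)

lemma bsq_rows_3: "map (bsq 3) [0..<18] = [1, 3, 15, 93, 639, 4653, 35169, 272835, 2157759, 17319837, 140668065, 1153462995, 9533639025, 79326566595, 663835030335, 5582724468093, 47152425626559, 399769750195965]"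
  by (rule bsq_row_step[OF bsq_rows_2]) (code_simp, simp)

lemma bsq_rows_4: "map (bsq 4) [0..<18] = [1, 4, 28, 256, 2716, 31504, 387136, 4951552, 65218204, 878536624, 12046924528, 167595457792, 2359613230144, 33557651538688, 481365424895488, 6956365106016256, 101181938814289564, 1480129751586116848]"
  by (rule bsq_row_step[OF bsq_rows_3]) (code_simp, simp)

lemma bsq_rows_5: "map (bsq 5) [0..<18] = [1, 5, 45, 545, 7885, 127905, 2241225, 41467725, 798562125, 15855173825, 322466645545, 6687295253325, 140927922498025, 3010302779775725, 65046639827565525, 1419565970145097545, 31249959913055650125, 693192670456484513025]"
  by (rule bsq_row_step[OF bsq_rows_4]) (code_simp, simp)

lemma bsq_rows_6: "map (bsq 6) [0..<18] = [1, 6, 66, 996, 18306, 384156, 8848236, 218040696, 5651108226, 152254667436, 4229523740916, 120430899525096, 3499628148747756, 103446306284890536, 3102500089343886696, 94219208840385966096, 2892652835496484004226, 89662253086458906345036]"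
  by (rule bsq_row_step[OF bsq_rows_5]) (code_simp, simp)

lemma bsq_rows_7: "map (bsq 7) [0..<18] = [1, 7, 91, 1645, 36715, 948157, 27210169, 844691407, 27840317995, 961404929485, 34453695086041, 1272342313935007, 48163840784596201, 1861408648486464175, 73216844934326184595, 2923876764438202454245, 118311576139002457750315, 4843019129955904050049645]"
  by (rule bsq_row_step[OF bsq_rows_6]) (code_simp, simp)

lemma bsq_rows_8: "map (bsq 8) [0..<18] = [1, 8, 120, 2528, 66424, 2039808, 70283424, 2643158400, 106391894904, 4518833256512, 200396211454720, 9205443151733760, 435368682010660000, 21100379936684418560, 1044115187294444772480, 52597451834668445910528, 2691037806733052553149304, 139567074682665782246950080]"
  by (rule bsq_row_step[OF bsq_rows_7]) (code_simp, simp)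

lemma bsq_rows_9: "map (bsq 9) [0..<18] = [1, 9, 153, 3681, 111321, 3965409, 159700401, 7071121017, 337386574809, 17091486402849, 909016606157553, 50322658889918457, 2880377856928886769, 169569570177502573113, 10224662030381995585353, 629363959548197255942481, 39439533486823544576759769, 2510598661017963812643872673]"
  by (rule bsq_row_step[OF bsq_rows_8]) (code_simp, simp)

fun horner :: "real \<Rightarrow> int list \<Rightarrow> real" where
  "horner c [] = 0"
| "horner c (x # xs) = x + horner c xs / c"

lemma horner_eq: "c \<noteq> 0 \<Longrightarrow> horner c xs = (\<Sum>n<length xs. xs ! n / c ^ n)"
  by (induction xs) (auto simp: sum.lessThan_Suc_shift sum_divide_distrib field_simps simp del: sum.lessThan_Suc)

lemma sum_collision_horner:
  assumes "map (bsq k) [0..<N] = xs" "k > 0"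
  shows "(\<Sum>n<N. collision k n) = horner ((real k)\<^sup>2) xs"
proof -
  have "length xs = N" using assms(1) by auto
  moreover have "xs ! n = bsq k n" if "n < N" for n using that unfolding assms(1)[symmetric] by simp
  ultimately show ?thesis
    using assms(2) by (auto simp: horner_eq collision_def power_mult[symmetric] mult.commute intro!: sum.cong)
qed

text \<open>The tabulated part is at most 1.1727 and the tail \<open>16 * peak 8 2\<close> at most
  0.00466, together 1.17736.\<close>

lemma sum_collision_8: "(\<Sum>n<N. collision 8 n) \<le> 1.1774"
proof -
  have "(\<Sum>n<16. collision 8 n) \<le> (\<Sum>n<18. collision 8 n)"
    by (intro sum_mono2) (auto intro: collision_nonneg)
  also have "\<dots> \<le> 1.1727"
    by (subst sum_collision_horner[OF bsq_rows_8]) simp_all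
  finally have "(\<Sum>n<16. collision 8 n) \<le> 1.1727" .
  moreover have "16 * peak 8 2 \<le> 0.00466" by (simp add: peak_def fact_numeral)
  ultimately show ?thesis using sum_collision_le[of 8 N] by simp
qed

lemma sum_collision_9: "(\<Sum>n<N. collision 9 n) \<le> 1.149"
proof -
  have "(\<Sum>n<18. collision 9 n) \<le> 1.1466"
    by (subst sum_collision_horner[OF bsq_rows_9]) simp_all
  moreover have "18 * peak 9 2 \<le> 0.002" by (simp add: peak_def fact_numeral)
  ultimately show ?thesis using sum_collision_le[of 9 N] by simp
qed

section \<open>Words, their meetings and the moment recursion\<close>

definition words :: "nat \<Rightarrow> nat \<Rightarrow> nat list set" where
  "words m n = {w. length w = n \<and> set w \<subseteq> {..<m}}"

lemma finite_words [simp]: "finite (words m n)"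
  using finite_lists_length_eq[of "{..<m}" n] by (simp add: words_def conj_commute)

lemma card_words: "card (words m n) = m ^ n"
  using card_lists_length_eq[of "{..<m}" n] by (simp add: words_def conj_commute)

lemma take_words: "w \<in> words m n \<Longrightarrow> j \<le> n \<Longrightarrow> take j w \<in> words m j"
  by (auto simp: words_def dest: in_set_takeD)

lemma sum_words_split:
  fixes f :: "nat list \<Rightarrow> real"
  assumes "j \<le> n"
  shows "(\<Sum>w\<in>words m n. f w) = (\<Sum>u\<in>words m j. \<Sum>v\<in>words m (n - j). f (u @ v))"
proof -
  have "(\<Sum>w\<in>words m n. f w) = (\<Sum>(u, v)\<in>words m j \<times> words m (n - j). f (u @ v))"
    by (rule sum.reindex_bij_witness[where i="\<lambda>(u, v). u @ v" and j="\<lambda>w. (take j w, drop j w)"])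
       (use assms in \<open>auto simp: words_def dest: in_set_takeD in_set_dropD\<close>)
  then show ?thesis by (simp add: sum.cartesian_product)
qed

text \<open>The words with prescribed letter counts are the permutations of one multiset, whose
  number is a quotient of factorials.\<close>

lemma count_words:
  assumes "y \<in> types {..<m} n"
  shows "real (card {w \<in> words m n. (\<lambda>i\<in>{..<m}. count_list w i) = y}) = multinom {..<m} y"
proof -
  define M where "M = (\<Sum>i<m. replicate_mset (y i) i)"
  have cM: "count M i = (if i < m then y i else 0)" for i
  proof -
    have "count M i = (\<Sum>k<m. if k = i then y k else 0)"
      unfolding M_def count_sum by (intro sum.cong) auto
    then show ?thesis by simp
  qed
  have y: "y \<in> extensional {..<m}" "sum y {..<m} = n" using assms by (simp_all add: types_def PiE_def)
  have sM: "size M = n" unfolding M_def y(2)[symmetric] by (induction m) simp_all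
  have "{w \<in> words m n. (\<lambda>i\<in>{..<m}. count_list w i) = y} = permutations_of_multiset M"
  proof (intro equalityI subsetI)
    fix w assume w: "w \<in> {w \<in> words m n. (\<lambda>i\<in>{..<m}. count_list w i) = y}"
    have "count (mset w) i = count M i" for i
    proof (cases "i < m")
      case True
      have wy: "(\<lambda>i\<in>{..<m}. count_list w i) = y" using w by simp
      have "count_list w i = y i" using fun_cong[OF wy, of i] True by simp
      then show ?thesis using True by (simp add: cM count_mset)
    next
      case False
      then have "i \<notin> set w" using w by (auto simp: words_def)
      then show ?thesis using False by (simp add: cM count_mset)
    qed
    then show "w \<in> permutations_of_multiset M" by (simp add: permutations_of_multiset_def multiset_eq_iff)
  next
    fix w assume "w \<in> permutations_of_multiset M"
    then have w: "mset w = M" by (simp add: permutations_of_multiset_def)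
    then have c: "count_list w i = (if i < m then y i else 0)" for i using cM by (metis count_mset)
    have "length w = n" using w sM by (metis size_mset)
    moreover have "set w \<subseteq> {..<m}"
    proof
      fix i assume "i \<in> set w"
      then have "count_list w i \<noteq> 0" by (simp add: count_list_0_iff)
      then show "i \<in> {..<m}" using c[of i] by (auto split: if_splits)
    qed
    moreover have "(\<lambda>i\<in>{..<m}. count_list w i) = y"
      using y(1) by (auto simp: fun_eq_iff c extensional_def)
    ultimately show "w \<in> {w \<in> words m n. (\<lambda>i\<in>{..<m}. count_list w i) = y}" by (simp add: words_def)
  qed
  then have "card {w \<in> words m n. (\<lambda>i\<in>{..<m}. count_list w i) = y} * (\<Prod>i\<in>set_mset M. fact (count M i)) = fact n"
    using card_permutations_of_multiset_aux[of M] sM by simp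
  moreover have "(\<Prod>i\<in>set_mset M. fact (count M i)) = (\<Prod>i<m. fact (y i) :: nat)"
  proof -
    have "set_mset M \<subseteq> {..<m}"
    proof
      fix i assume "i \<in># M"
      then have "count M i \<noteq> 0" by simp
      then show "i \<in> {..<m}" using cM[of i] by (simp split: if_splits)
    qed
    then have "(\<Prod>i\<in>set_mset M. fact (count M i) :: nat) = (\<Prod>i<m. fact (count M i))"
      by (intro prod.mono_neutral_left) (auto simp: not_in_iff)
    then show ?thesis by (simp add: cM)
  qed
  ultimately have N: "card {w \<in> words m n. (\<lambda>i\<in>{..<m}. count_list w i) = y} * (\<Prod>i<m. fact (y i)) = fact n"
    by (simp only:)
  have "real (card {w \<in> words m n. (\<lambda>i\<in>{..<m}. count_list w i) = y}) * (\<Prod>i<m. fact (y i)) = fact n"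
    using arg_cong[OF N, of real] by (simp only: of_nat_mult of_nat_prod of_nat_fact)
  moreover have "(\<Prod>i<m. fact (y i) :: real) \<noteq> 0" by simp
  ultimately show ?thesis using y(2) by (simp add: multinom_def field_simps)
qed

lemma mset_eq_iff_counts:
  assumes "u \<in> words m n" "v \<in> words m n'"
  shows "mset u = mset v \<longleftrightarrow> (\<lambda>i\<in>{..<m}. count_list u i) = (\<lambda>i\<in>{..<m}. count_list v i)"
proof
  assume eq: "(\<lambda>i\<in>{..<m}. count_list u i) = (\<lambda>i\<in>{..<m}. count_list v i)"
  have "count_list u i = count_list v i" for i
  proof (cases "i < m")
    case True then show ?thesis using fun_cong[OF eq, of i] by simp
  next
    case False
    then have "i \<notin> set u" "i \<notin> set v" using assms by (auto simp: words_def)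
    then show ?thesis by simp
  qed
  then show "mset u = mset v" by (simp add: multiset_eq_iff count_mset)
next
  assume "mset u = mset v"
  then have "count_list u i = count_list v i" for i by (metis count_mset)
  then show "(\<lambda>i\<in>{..<m}. count_list u i) = (\<lambda>i\<in>{..<m}. count_list v i)" by simp
qed

lemma counts_types:
  assumes "w \<in> words m n" shows "(\<lambda>i\<in>{..<m}. count_list w i) \<in> types {..<m} n"
proof -
  have "(\<Sum>i<m. count_list w i) = length w"
    using assms sum_count_set[of w "{..<m}"] by (simp add: words_def)
  then show ?thesis using assms by (auto simp: types_def words_def)
qed

text \<open>Pairs are sorted by their common vector of letter counts. Each vector is attained by
  \<open>multinom\<close> many words, so squares of multinomial coefficients appear.\<close>

lemma sum_pairs_meet:
  "(\<Sum>u\<in>words m n. \<Sum>v\<in>words m n. of_bool (mset u = mset v)) = real_of_int (bsq m n)"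
proof -
  let ?c = "\<lambda>w. \<lambda>i\<in>{..<m}. count_list w i"
  have "(\<Sum>u\<in>words m n. \<Sum>v\<in>words m n. of_bool (mset u = mset v))
      = (\<Sum>u\<in>words m n. \<Sum>v\<in>words m n. \<Sum>y\<in>types {..<m} n. of_bool (?c u = y) * of_bool (?c v = y) :: real)"
  proof (intro sum.cong refl)
    fix u v assume uv: "u \<in> words m n" "v \<in> words m n"
    have "(\<Sum>y\<in>types {..<m} n. of_bool (?c u = y) * of_bool (?c v = y) :: real)
      = (\<Sum>y\<in>types {..<m} n. if y = ?c u then of_bool (?c v = ?c u) else 0)"
      by (intro sum.cong) auto
    also have "\<dots> = of_bool (?c v = ?c u)" using counts_types[OF uv(1)] by (simp add: sum.delta finite_types)
    finally show "of_bool (mset u = mset v) = (\<Sum>y\<in>types {..<m} n. of_bool (?c u = y) * of_bool (?c v = y) :: real)"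
      using mset_eq_iff_counts[OF uv] by auto
  qed
  also have "\<dots> = (\<Sum>u\<in>words m n. \<Sum>y\<in>types {..<m} n. \<Sum>v\<in>words m n. of_bool (?c u = y) * of_bool (?c v = y))"
    by (rule sum.cong[OF refl]) (rule sum.swap)
  also have "\<dots> = (\<Sum>y\<in>types {..<m} n. \<Sum>u\<in>words m n. \<Sum>v\<in>words m n. of_bool (?c u = y) * of_bool (?c v = y))"
    by (rule sum.swap)
  also have "\<dots> = (\<Sum>y\<in>types {..<m} n. (\<Sum>u\<in>words m n. of_bool (?c u = y)) * (\<Sum>v\<in>words m n. of_bool (?c v = y)))"
    by (simp only: sum_product)
  also have "\<dots> = (\<Sum>y\<in>types {..<m} n. (multinom {..<m} y)\<^sup>2)"
  proof (intro sum.cong refl)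
    fix y assume y: "y \<in> types {..<m} n"
    have "(\<Sum>u\<in>words m n. of_bool (?c u = y)) = real (card {w \<in> words m n. ?c w = y})"
      by (simp add: sum.If_cases of_bool_def Int_def)
    then show "(\<Sum>u\<in>words m n. of_bool (?c u = y)) * (\<Sum>v\<in>words m n. of_bool (?c v = y)) = (multinom {..<m} y)\<^sup>2"
      unfolding count_words[OF y] by (simp add: power2_eq_square)
  qed
  finally show ?thesis by (simp add: sum_multinom_square)
qed

text \<open>The multiset of the first j letters encodes the site reached at time j. The starting
  time k itself is excluded.\<close>

definition meets :: "nat list \<Rightarrow> nat list \<Rightarrow> nat \<Rightarrow> nat \<Rightarrow> nat set" where
  "meets u v k n = {j \<in> {k<..n}. mset (take j u) = mset (take j v)}"

text \<open>With 1 + r = 1 / p this is p times the second moment of the normalised number of open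
  paths, as computed in \<open>open_path_prob\<close>.\<close>

definition moment :: "nat \<Rightarrow> real \<Rightarrow> nat \<Rightarrow> real" where
  "moment m r n = (\<Sum>u\<in>words m n. \<Sum>v\<in>words m n. (1 + r) ^ card (meets u v 0 n)) / (real m ^ n)\<^sup>2"

lemma finite_meets [simp]: "finite (meets u v k n)"
  by (simp add: meets_def)

text \<open>For c meetings, (1 + r)^c - 1 is r times a geometric sum. The meeting at time j that is
  followed by i later meetings accounts for its term (1 + r)^i.\<close>

lemma meets_telescope:
  fixes r :: real
  shows "(1 + r) ^ card (meets u v 0 n) = 1 + r * (\<Sum>j=1..n. of_bool (mset (take j u) = mset (take j v)) * (1 + r) ^ card (meets u v j n))"
proof -
  have "(1 + r) ^ card (meets u v (n - k) n) = 1 + r * (\<Sum>j=n - k + 1..n. of_bool (mset (take j u) = mset (take j v)) * (1 + r) ^ card (meets u v j n))"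
    if "k \<le> n" for k
    using that
  proof (induction k)
    case 0
    have "meets u v n n = {}" by (auto simp: meets_def)
    then show ?case by simp
  next
    case (Suc k)
    define a where "a = n - k"
    have a: "n - Suc k = a - 1" "1 \<le> a" "a \<le> n" using Suc.prems by (auto simp: a_def)
    have s: "{a - 1 + 1..n} = insert a {a + 1..n}" using a by auto
    have IH: "(1 + r) ^ card (meets u v a n) = 1 + r * (\<Sum>j=a + 1..n. of_bool (mset (take j u) = mset (take j v)) * (1 + r) ^ card (meets u v j n))"
      using Suc.IH Suc.prems by (simp add: a_def)
    have "meets u v (a - 1) n = (if mset (take a u) = mset (take a v) then insert a (meets u v a n) else meets u v a n)"
    proof -
      have "{a - 1<..n} = insert a {a<..n}" using a by auto
      then show ?thesis unfolding meets_def by auto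
    qed
    moreover have "a \<notin> meets u v a n" by (simp add: meets_def)
    ultimately have "(1 + r) ^ card (meets u v (a - 1) n)
      = (1 + r) ^ card (meets u v a n) + r * (of_bool (mset (take a u) = mset (take a v)) * (1 + r) ^ card (meets u v a n))"
      by (simp add: distrib_right)
    then show ?case unfolding a(1) s using IH by (simp add: distrib_left)
  qed
  from this[of n] show ?thesis by simp
qed

lemma meets_drop:
  assumes "u \<in> words m n" "v \<in> words m n" "j \<le> n" "mset (take j u) = mset (take j v)"
  shows "card (meets u v j n) = card (meets (drop j u) (drop j v) 0 (n - j))"
proof -
  have t: "take (j + i) w = take j w @ take i (drop j w)" for i and w :: "nat list"
    by (rule take_add)
  have "meets u v j n = (\<lambda>i. j + i) ` meets (drop j u) (drop j v) 0 (n - j)"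
  proof (intro equalityI subsetI)
    fix k assume k: "k \<in> meets u v j n"
    then have "k = j + (k - j)" by (auto simp: meets_def)
    moreover have "k - j \<in> meets (drop j u) (drop j v) 0 (n - j)"
      using k assms(3,4) t[of "k - j" u] t[of "k - j" v] by (auto simp: meets_def)
    ultimately show "k \<in> (\<lambda>i. j + i) ` meets (drop j u) (drop j v) 0 (n - j)" by blast
  next
    fix k assume "k \<in> (\<lambda>i. j + i) ` meets (drop j u) (drop j v) 0 (n - j)"
    then show "k \<in> meets u v j n" using assms(3,4) by (auto simp: meets_def t)
  qed
  then show ?thesis by (simp add: card_image)
qed

text \<open>After a meeting the two walks start afresh from a common site, so the terms of
  \<open>meets_telescope\<close> factor into a past and a future. The result is a renewal
  equation.\<close>

lemma moment_recursion:
  assumes m: "m > 0"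
  shows "moment m r n = 1 + r * (\<Sum>j=1..n. collision m j * moment m r (n - j))"
proof -
  let ?W = "words m"
  define S where "S k = (\<Sum>u\<in>?W k. \<Sum>v\<in>?W k. (1 + r) ^ card (meets u v 0 k))" for k
  have tm: "(\<Sum>u\<in>?W n. \<Sum>v\<in>?W n. of_bool (mset (take j u) = mset (take j v)) * (1 + r) ^ card (meets u v j n))
     = bsq m j * S (n - j)" if j: "j \<in> {1..n}" for j
  proof -
    have jn: "j \<le> n" using j by simp
    have "(\<Sum>u\<in>?W n. \<Sum>v\<in>?W n. of_bool (mset (take j u) = mset (take j v)) * (1 + r) ^ card (meets u v j n))
      = (\<Sum>u\<in>?W n. \<Sum>v\<in>?W n. of_bool (mset (take j u) = mset (take j v)) * (1 + r) ^ card (meets (drop j u) (drop j v) 0 (n - j)))"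
      using meets_drop[OF _ _ jn] by (intro sum.cong refl) auto
    also have "\<dots> = (\<Sum>u1\<in>?W j. \<Sum>u2\<in>?W (n - j). \<Sum>v1\<in>?W j. \<Sum>v2\<in>?W (n - j).
        of_bool (mset u1 = mset v1) * (1 + r) ^ card (meets u2 v2 0 (n - j)))"
      unfolding sum_words_split[OF jn] by (intro sum.cong refl) (auto simp: words_def)
    also have "\<dots> = (\<Sum>u1\<in>?W j. \<Sum>v1\<in>?W j. \<Sum>u2\<in>?W (n - j). \<Sum>v2\<in>?W (n - j).
        of_bool (mset u1 = mset v1) * (1 + r) ^ card (meets u2 v2 0 (n - j)))"
      by (rule sum.cong[OF refl]) (rule sum.swap)
    also have "\<dots> = (\<Sum>u1\<in>?W j. \<Sum>v1\<in>?W j. of_bool (mset u1 = mset v1)) * S (n - j)"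
      unfolding S_def by (simp only: sum_distrib_left[symmetric] sum_distrib_right[symmetric])
    finally show ?thesis unfolding sum_pairs_meet .
  qed
  have "S n = (\<Sum>u\<in>?W n. \<Sum>v\<in>?W n. 1 + r * (\<Sum>j=1..n. of_bool (mset (take j u) = mset (take j v)) * (1 + r) ^ card (meets u v j n)))"
    unfolding S_def by (subst meets_telescope) (rule refl)
  also have "\<dots> = (real m ^ n)\<^sup>2 + r * (\<Sum>u\<in>?W n. \<Sum>v\<in>?W n. \<Sum>j=1..n. of_bool (mset (take j u) = mset (take j v)) * (1 + r) ^ card (meets u v j n))"
    by (simp only: sum.distrib sum_distrib_left[symmetric]) (simp add: card_words power2_eq_square)
  also have "(\<Sum>u\<in>?W n. \<Sum>v\<in>?W n. \<Sum>j=1..n. of_bool (mset (take j u) = mset (take j v)) * (1 + r) ^ card (meets u v j n))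
    = (\<Sum>u\<in>?W n. \<Sum>j=1..n. \<Sum>v\<in>?W n. of_bool (mset (take j u) = mset (take j v)) * (1 + r) ^ card (meets u v j n))"
    by (rule sum.cong[OF refl]) (rule sum.swap)
  also have "\<dots> = (\<Sum>j=1..n. \<Sum>u\<in>?W n. \<Sum>v\<in>?W n. of_bool (mset (take j u) = mset (take j v)) * (1 + r) ^ card (meets u v j n))"
    by (rule sum.swap)
  also have "\<dots> = (\<Sum>j=1..n. bsq m j * S (n - j))" by (rule sum.cong[OF refl]) (rule tm)
  finally have S: "S n = (real m ^ n)\<^sup>2 + r * (\<Sum>j=1..n. bsq m j * S (n - j))" .
  have M: "moment m r k = S k / (real m ^ k)\<^sup>2" for k by (simp add: moment_def S_def)
  have "moment m r n = 1 + r * ((\<Sum>j=1..n. bsq m j * S (n - j)) / (real m ^ n)\<^sup>2)"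
    unfolding M S using m by (simp add: add_divide_distrib)
  also have "(\<Sum>j=1..n. bsq m j * S (n - j)) / (real m ^ n)\<^sup>2 = (\<Sum>j=1..n. collision m j * moment m r (n - j))"
    unfolding sum_divide_distrib
  proof (rule sum.cong[OF refl])
    fix j assume "j \<in> {1..n}"
    then have "real m ^ n = real m ^ j * real m ^ (n - j)" by (simp add: power_add[symmetric])
    then show "bsq m j * S (n - j) / (real m ^ n)\<^sup>2 = collision m j * moment m r (n - j)"
      by (simp add: collision_def M power_mult_distrib)
  qed
  finally show ?thesis .
qed

text \<open>K = 1 / (1 - r a) is the fixed point of K = 1 + r a K, so the bound reproduces itself in
  the renewal equation. Time 0 accounts for 1 in the sum of collisions, leaving a for the later
  times.\<close>

lemma moment_le:
  assumes m: "m > 0" and r: "0 \<le> r" and a: "\<And>N. (\<Sum>n<N. collision m n) \<le> 1 + a" and l: "r * a < 1"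
  shows "moment m r n \<le> 1 / (1 - r * a)"
proof (induction n rule: less_induct)
  case (less n)
  let ?K = "1 / (1 - r * a)"
  have K: "0 < ?K" using l by simp
  have "collision m 0 = 1" 
  proof -
    have "bsq k 0 = 1" for k by (induction k) auto
    then show ?thesis by (simp add: collision_def)
  qed
  then have s: "(\<Sum>j=1..n. collision m j) \<le> a"
    using a[of "Suc n"] by (simp add: sum.atLeast1_atMost_eq lessThan_Suc_atMost[symmetric] sum.lessThan_Suc_shift del: sum.lessThan_Suc)
  have "moment m r n = 1 + r * (\<Sum>j=1..n. collision m j * moment m r (n - j))" by (rule moment_recursion[OF m])
  also have "(\<Sum>j=1..n. collision m j * moment m r (n - j)) \<le> (\<Sum>j=1..n. collision m j * ?K)"
    by (intro sum_mono mult_left_mono less.IH collision_nonneg) auto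
  then have "1 + r * (\<Sum>j=1..n. collision m j * moment m r (n - j)) \<le> 1 + r * (\<Sum>j=1..n. collision m j * ?K)"
    using r by (intro add_left_mono mult_left_mono)
  also have "(\<Sum>j=1..n. collision m j * ?K) = (\<Sum>j=1..n. collision m j) * ?K" by (simp only: sum_distrib_right)
  also have "1 + r * ((\<Sum>j=1..n. collision m j) * ?K) \<le> 1 + r * (a * ?K)"
    using r K s by (intro add_left_mono mult_left_mono mult_right_mono) auto
  also have "\<dots> = ?K" using l by (simp add: field_simps)
  finally show ?case .
qed

section \<open>Site percolation\<close>

definition reach :: "nat \<Rightarrow> site set \<Rightarrow> site \<Rightarrow> site set" where
  "reach d A x = {y. (\<lambda>u v. u \<in> A \<and> v \<in> A \<and> nbr d u v)\<^sup>*\<^sup>* x y}"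

definition percolates :: "nat \<Rightarrow> site set \<Rightarrow> bool" where
  "percolates d A \<longleftrightarrow> (\<exists>C\<in>clusters d A. infinite C)"

lemma percolates_iff: "percolates d A \<longleftrightarrow> (\<exists>x\<in>A. infinite (reach d A x))"
  by (auto simp: percolates_def clusters_def reach_def)

lemma reach_refl: "x \<in> reach d A x"
  by (simp add: reach_def)

lemma reach_step: "y \<in> reach d A x \<Longrightarrow> y \<in> A \<Longrightarrow> z \<in> A \<Longrightarrow> nbr d y z \<Longrightarrow> z \<in> reach d A x"
  unfolding reach_def by (auto intro: rtranclp.rtrancl_into_rtrancl)

lemma reach_induct [consumes 1, case_names refl step]:
  assumes "y \<in> reach d A x" "P x"
    "\<And>y z. y \<in> reach d A x \<Longrightarrow> P y \<Longrightarrow> y \<in> A \<Longrightarrow> z \<in> A \<Longrightarrow> nbr d y z \<Longrightarrow> P z"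
  shows "P y"
  using assms(1) unfolding reach_def mem_Collect_eq
proof (induction rule: rtranclp_induct)
  case (step y z)
  then show ?case using assms(3)[of y z] by (auto simp: reach_def)
qed (rule assms(2))

lemma reach_subset: "x \<in> A \<Longrightarrow> reach d A x \<subseteq> A"
proof
  fix y assume x: "x \<in> A" and "y \<in> reach d A x"
  from this(2) show "y \<in> A" by (induction rule: reach_induct) (use x in auto)
qed

lemma reach_trans: "z \<in> reach d A y \<Longrightarrow> y \<in> reach d A x \<Longrightarrow> z \<in> reach d A x"
  unfolding reach_def by simp

lemma reach_sym:
  assumes "y \<in> reach d A x" shows "x \<in> reach d A y"
  using assms
proof (induction rule: reach_induct)
  case (step y z)
  have "y \<in> reach d A z" using step by (intro reach_step[OF reach_refl]) (auto intro: nbr_sym)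
  then show ?case using step.IH reach_trans by blast
qed (rule reach_refl)

lemma reach_mono: "A \<subseteq> B \<Longrightarrow> reach d A x \<subseteq> reach d B x"
proof
  fix y assume "A \<subseteq> B" "y \<in> reach d A x"
  from this(2,1) show "y \<in> reach d B x"
    by (induction rule: reach_induct) (auto intro: reach_refl reach_step)
qed

lemma percolates_mono:
  assumes AB: "A \<subseteq> B" and "percolates d A"
  shows "percolates d B"
proof -
  obtain x where x: "x \<in> A" "infinite (reach d A x)" using assms(2) by (auto simp: percolates_iff)
  have "infinite (reach d B x)" using x(2) finite_subset[OF reach_mono[OF AB]] by blast
  then show ?thesis using x(1) AB by (auto simp: percolates_iff)
qed

text \<open>Deleting v breaks its cluster into pieces that each contain one of the finitely many
  neighbours of v, so one piece of an infinite cluster is infinite. This makes percolation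
  insensitive to finitely many sites.\<close>

lemma percolates_delete:
  assumes "percolates d A" shows "percolates d (A - {v})"
proof -
  obtain x where x: "x \<in> A" "infinite (reach d A x)" using assms by (auto simp: percolates_iff)
  show ?thesis
  proof (cases "v \<in> reach d A x")
    case False
    have "y \<in> reach d (A - {v}) x" if "y \<in> reach d A x" for y
      using that
    proof (induction rule: reach_induct)
      case (step y z)
      have "z \<in> reach d A x" by (rule reach_step[OF step.hyps])
      moreover have "y \<in> reach d A x" by (rule step.hyps(1))
      ultimately have "z \<noteq> v" "y \<noteq> v" using False by metis+
      then show ?case using step.hyps by (intro reach_step[OF step.IH]) simp_all
    qed (rule reach_refl)
    then have sub: "reach d A x \<subseteq> reach d (A - {v}) x" by blast
    have "infinite (reach d (A - {v}) x)" using x(2) finite_subset[OF sub] by blast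
    moreover have "x \<in> A - {v}" using False reach_refl x(1) by auto
    ultimately show ?thesis unfolding percolates_iff by blast
  next
    case True
    let ?U = "{u. nbr d v u \<and> u \<in> A - {v}}"
    have "y \<in> insert v (\<Union>u\<in>?U. reach d (A - {v}) u)" if "y \<in> reach d A v" for y
      using that
    proof (induction rule: reach_induct)
      case (step y z)
      show ?case
      proof (cases "z = v")
        case False
        show ?thesis
        proof (cases "y = v")
          case True
          then have "z \<in> ?U" using step.hyps False by simp
          then show ?thesis using reach_refl[of z d "A - {v}"] by (intro insertI2 UN_I)
        next
          case yv: False
          then have "y \<in> (\<Union>u\<in>?U. reach d (A - {v}) u)" using step.IH by simp
          then obtain u where u: "u \<in> ?U" "y \<in> reach d (A - {v}) u" by (rule UN_E)
          have "z \<in> reach d (A - {v}) u" using step.hyps False yv by (intro reach_step[OF u(2)]) simp_all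
          then show ?thesis using u(1) by (intro insertI2 UN_I)
        qed
      qed simp
    qed simp
    then have "y \<in> insert v (\<Union>u\<in>?U. reach d (A - {v}) u)" if "y \<in> reach d A x" for y
      using reach_trans[OF that reach_sym[OF True]] by simp
    then have "reach d A x \<subseteq> insert v (\<Union>u\<in>?U. reach d (A - {v}) u)" by (rule subsetI)
    from finite_subset[OF this] have "infinite (\<Union>u\<in>?U. reach d (A - {v}) u)"
      using x(2) by auto
    moreover have "finite ?U" by (rule finite_subset[OF _ finite_nbr[of d v]]) auto
    ultimately obtain u where "u \<in> ?U" "infinite (reach d (A - {v}) u)" by auto
    then show ?thesis unfolding percolates_iff by blast
  qed
qed

lemma percolates_Diff_finite: "finite F \<Longrightarrow> percolates d A \<Longrightarrow> percolates d (A - F)"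
proof (induction F rule: finite_induct)
  case (insert v F)
  have "A - insert v F = (A - F) - {v}" by auto
  then show ?case using percolates_delete insert by simp
qed simp

text \<open>Connections are counted by their length and quantified over the countable lattice, so
  that measurability follows step by step.\<close>

primrec reach_in :: "nat \<Rightarrow> nat \<Rightarrow> site set \<Rightarrow> site \<Rightarrow> site \<Rightarrow> bool" where
  "reach_in 0 d A x y \<longleftrightarrow> y = x"
| "reach_in (Suc n) d A x y \<longleftrightarrow> (\<exists>z\<in>Zd d. reach_in n d A x z \<and> z \<in> A \<and> y \<in> A \<and> nbr d z y)"

lemma reach_iff_reach_in: "y \<in> reach d A x \<longleftrightarrow> (\<exists>n. reach_in n d A x y)"
proof
  assume "y \<in> reach d A x"
  then show "\<exists>n. reach_in n d A x y"
  proof (induction rule: reach_induct)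
    case refl
    show ?case by (rule exI[of _ 0]) simp
  next
    case (step y z)
    then obtain n where "reach_in n d A x y" by auto
    then show ?case using step by (intro exI[of _ "Suc n"]) (auto simp: nbr_def)
  qed
next
  assume "\<exists>n. reach_in n d A x y"
  then obtain n where "reach_in n d A x y" ..
  then show "y \<in> reach d A x"
    by (induction n arbitrary: y) (auto intro: reach_refl reach_step)
qed

lemma countable_Zd: "countable (Zd d)"
  unfolding Zd_def by (intro countable_PiE) auto

lemma infinite_Zd: "d > 0 \<Longrightarrow> infinite (Zd d)"
proof
  assume d: "d > 0" and fin: "finite (Zd d)"
  have "inj (\<lambda>k::int. (\<lambda>i\<in>{..<d}. k))"
  proof (rule injI)
    fix k l :: int assume "(\<lambda>i\<in>{..<d}. k) = (\<lambda>i\<in>{..<d}. l)"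
    from fun_cong[OF this, of 0] show "k = l" using d by simp
  qed
  then have "infinite (range (\<lambda>k::int. (\<lambda>i\<in>{..<d}. k)))" using finite_imageD infinite_UNIV_int by blast
  moreover have "range (\<lambda>k::int. (\<lambda>i\<in>{..<d}. k)) \<subseteq> Zd d" by (intro image_subsetI) (simp add: Zd_def restrict_PiE_iff)
  ultimately show False using fin finite_subset by blast
qed

text \<open>An enumeration of the lattice expresses infinity of a cluster through countable
  quantifiers, again for the sake of measurability.\<close>

lemma infinite_iff_unbounded:
  assumes "C \<subseteq> Zd d"
  shows "infinite C \<longleftrightarrow> (\<forall>N::nat. \<exists>y\<in>Zd d. N < to_nat_on (Zd d) y \<and> y \<in> C)"
proof -
  have "inj_on (to_nat_on (Zd d)) C"
    using inj_on_to_nat_on[OF countable_Zd] assms by (rule inj_on_subset)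
  then have "infinite C \<longleftrightarrow> infinite (to_nat_on (Zd d) ` C)" by (simp add: finite_image_iff)
  also have "\<dots> \<longleftrightarrow> (\<forall>N. \<exists>n>N. n \<in> to_nat_on (Zd d) ` C)" by (rule infinite_nat_iff_unbounded)
  finally show ?thesis using assms by blast
qed

lemma pred_Bex_countable:
  assumes "countable X" "\<And>i. i \<in> X \<Longrightarrow> Measurable.pred M (\<lambda>\<omega>. P \<omega> i)"
  shows "Measurable.pred M (\<lambda>\<omega>. \<exists>i\<in>X. P \<omega> i)"
proof -
  have "{\<omega> \<in> space M. \<exists>i\<in>X. P \<omega> i} = (\<Union>i\<in>X. {\<omega> \<in> space M. P \<omega> i})" by auto
  also have "\<dots> \<in> sets M" using assms by (intro sets.countable_UN') (auto simp: pred_def)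
  finally show ?thesis by (simp add: pred_def)
qed

lemma pred_percolates:
  assumes P: "\<And>x. x \<in> Zd d \<Longrightarrow> Measurable.pred M (\<lambda>\<omega>. P \<omega> x)"
  shows "Measurable.pred M (\<lambda>\<omega>. percolates d {x \<in> Zd d. P \<omega> x})"
proof -
  note [measurable] = P
  have r: "Measurable.pred M (\<lambda>\<omega>. reach_in n d {x \<in> Zd d. P \<omega> x} x y)" if "x \<in> Zd d" "y \<in> Zd d" for n x y
    using that
  proof (induction n arbitrary: y)
    case (Suc n)
    have "Measurable.pred M (\<lambda>\<omega>. \<exists>z\<in>Zd d. reach_in n d {x \<in> Zd d. P \<omega> x} x z \<and> (P \<omega> z \<and> (P \<omega> y \<and> nbr d z y)))"
    proof (rule pred_Bex_countable[OF countable_Zd])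
      fix z assume z: "z \<in> Zd d"
      note [measurable] = Suc.IH[OF Suc.prems(1) z] P[OF z] P[OF Suc.prems(2)]
      show "Measurable.pred M (\<lambda>\<omega>. reach_in n d {x \<in> Zd d. P \<omega> x} x z \<and> (P \<omega> z \<and> (P \<omega> y \<and> nbr d z y)))"
        by measurable
    qed
    moreover have "(\<lambda>\<omega>. \<exists>z\<in>Zd d. reach_in n d {x \<in> Zd d. P \<omega> x} x z \<and> (P \<omega> z \<and> (P \<omega> y \<and> nbr d z y)))
      = (\<lambda>\<omega>. reach_in (Suc n) d {x \<in> Zd d. P \<omega> x} x y)"
      using Suc.prems(2) by (auto simp: fun_eq_iff)
    ultimately show ?case by (simp only:)
  qed simp
  have eq: "(\<lambda>\<omega>. percolates d {x \<in> Zd d. P \<omega> x}) = (\<lambda>\<omega>. \<exists>x\<in>Zd d. P \<omega> x \<and>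
     (\<forall>N::nat. \<exists>y\<in>Zd d. N < to_nat_on (Zd d) y \<and> (\<exists>n. reach_in n d {x \<in> Zd d. P \<omega> x} x y)))"
  proof
    fix \<omega>
    let ?A = "{x \<in> Zd d. P \<omega> x}"
    have "infinite (reach d ?A x) \<longleftrightarrow> (\<forall>N::nat. \<exists>y\<in>Zd d. N < to_nat_on (Zd d) y \<and> (\<exists>n. reach_in n d ?A x y))"
      if "x \<in> ?A" for x
      unfolding reach_iff_reach_in[symmetric]
      by (rule infinite_iff_unbounded) (use reach_subset[OF that, of d] in auto)
    then show "percolates d ?A = (\<exists>x\<in>Zd d. P \<omega> x \<and>
     (\<forall>N::nat. \<exists>y\<in>Zd d. N < to_nat_on (Zd d) y \<and> (\<exists>n. reach_in n d ?A x y)))"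
      unfolding percolates_iff by auto
  qed
  show ?thesis
    unfolding eq
  proof (rule pred_Bex_countable[OF countable_Zd])
    fix x assume x: "x \<in> Zd d"
    have "Measurable.pred M (\<lambda>\<omega>. \<exists>y\<in>Zd d. N < to_nat_on (Zd d) y \<and> (\<exists>n. reach_in n d {x \<in> Zd d. P \<omega> x} x y))" for N
    proof (rule pred_Bex_countable[OF countable_Zd])
      fix y assume y: "y \<in> Zd d"
      note [measurable] = r[OF x y]
      show "Measurable.pred M (\<lambda>\<omega>. N < to_nat_on (Zd d) y \<and> (\<exists>n. reach_in n d {x \<in> Zd d. P \<omega> x} x y))"
        by measurable
    qed
    note [measurable] = this P[OF x]
    show "Measurable.pred M (\<lambda>\<omega>. P \<omega> x \<and>
     (\<forall>N::nat. \<exists>y\<in>Zd d. N < to_nat_on (Zd d) y \<and> (\<exists>n. reach_in n d {x \<in> Zd d. P \<omega> x} x y)))"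
      by measurable
  qed
qed

section \<open>Site percolation: cylinder probabilities and the zero-one law\<close>

locale site_perc =
  fixes d :: nat and p :: real
  assumes p: "0 \<le> p" "p \<le> 1"
begin

sublocale PP: product_prob_space "\<lambda>_. measure_pmf (bernoulli_pmf p)" "Zd d"
  by unfold_locales

abbreviation SP :: "(site \<Rightarrow> bool) measure" where
  "SP \<equiv> site_percolation d p"

lemma SP_eq: "SP = Pi\<^sub>M (Zd d) (\<lambda>_. measure_pmf (bernoulli_pmf p))"
  by (simp add: site_percolation_def)

lemma prob_space_SP: "prob_space SP"
  unfolding SP_eq by (rule PP.P.prob_space_axioms)

lemma space_SP: "space SP = Zd d \<rightarrow>\<^sub>E UNIV"
  by (simp add: SP_eq space_PiM)

lemma sets_SP: "sets SP = sets (\<Pi>\<^sub>M x\<in>Zd d. count_space UNIV)"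
  unfolding SP_eq by (intro sets_PiM_cong) auto

lemma pred_SP: "x \<in> Zd d \<Longrightarrow> Measurable.pred SP (\<lambda>\<omega>. \<omega> x)"
proof -
  assume x: "x \<in> Zd d"
  have "(\<lambda>\<omega>. \<omega> x) \<in> (\<Pi>\<^sub>M x\<in>Zd d. count_space UNIV) \<rightarrow>\<^sub>M count_space (UNIV :: bool set)"
    by (rule measurable_component_singleton[OF x])
  then show ?thesis by (simp only: measurable_cong_sets[OF sets_SP refl])
qed

lemma sets_coordinate: "x \<in> Zd d \<Longrightarrow> {\<omega> \<in> space SP. \<omega> x \<in> B} \<in> sets SP"
proof -
  assume "x \<in> Zd d"
  from measurable_sets[OF pred_SP[OF this], of B]
  have "(\<lambda>\<omega>. \<omega> x) -` B \<inter> space SP \<in> sets SP" by simp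
  moreover have "{\<omega> \<in> space SP. \<omega> x \<in> B} = (\<lambda>\<omega>. \<omega> x) -` B \<inter> space SP" by auto
  ultimately show ?thesis by (simp only:)
qed

lemma measure_cylinder:
  assumes J: "finite J" "J \<subseteq> Zd d"
  shows "measure SP {\<omega> \<in> space SP. \<forall>x\<in>J. \<omega> x \<in> B x} = (\<Prod>x\<in>J. measure (measure_pmf (bernoulli_pmf p)) (B x))"
proof -
  have "{\<omega> \<in> space SP. \<forall>x\<in>J. \<omega> x \<in> B x} = prod_emb (Zd d) (\<lambda>_. measure_pmf (bernoulli_pmf p)) J (Pi\<^sub>E J B)"
    using J by (auto simp: prod_emb_def space_SP restrict_PiE_iff)
  then have "emeasure SP {\<omega> \<in> space SP. \<forall>x\<in>J. \<omega> x \<in> B x} = (\<Prod>x\<in>J. emeasure (measure_pmf (bernoulli_pmf p)) (B x))"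
    unfolding SP_eq using PP.emeasure_PiM_emb[OF J(2,1), of B] by simp
  also have "\<dots> = ennreal (\<Prod>x\<in>J. measure (measure_pmf (bernoulli_pmf p)) (B x))"
    by (simp add: measure_pmf.emeasure_eq_measure prod_ennreal)
  finally show ?thesis by (simp add: measure_def prod_nonneg)
qed

lemma measure_bernoulli: "measure (measure_pmf (bernoulli_pmf p)) {True} = p"
  "measure (measure_pmf (bernoulli_pmf p)) {False} = 1 - p"
  using p by (simp_all add: measure_pmf_single)

lemma measure_all_open:
  assumes J: "finite J" "J \<subseteq> Zd d"
  shows "measure SP {\<omega> \<in> space SP. \<forall>x\<in>J. \<omega> x} = p ^ card J"
  using measure_cylinder[OF J, of "\<lambda>_. {True}"] measure_bernoulli by simp

lemma sets_all_open: "finite J \<Longrightarrow> J \<subseteq> Zd d \<Longrightarrow> {\<omega> \<in> space SP. \<forall>x\<in>J. \<omega> x} \<in> sets SP"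
proof (rule sets.sets_Collect_finite_All)
  fix x assume "J \<subseteq> Zd d" "x \<in> J"
  then show "{\<omega> \<in> space SP. \<omega> x} \<in> sets SP" using pred_SP[of x] by (auto simp: pred_def)
qed

lemma integral_SP_cylinder:
  assumes J: "finite J" "J \<subseteq> Zd d"
  shows "(\<integral>\<omega>. g {x \<in> J. \<omega> x} \<partial>SP) = bernoulli_expect p J g"
proof -
  interpret S: prob_space SP by (rule prob_space_SP)
  let ?C = "\<lambda>\<xi>. {\<omega> \<in> space SP. \<forall>x\<in>J. \<omega> x \<in> {x \<in> \<xi>}}"
  have C: "?C \<xi> \<in> sets SP" for \<xi>
  proof (rule sets.sets_Collect_finite_All[OF _ J(1)])
    fix x assume x: "x \<in> J"
    then show "{\<omega> \<in> space SP. \<omega> x \<in> {x \<in> \<xi>}} \<in> sets SP" using J by (intro sets_coordinate) auto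
  qed
  have m: "measure SP (?C \<xi>) = p ^ card \<xi> * (1 - p) ^ card (J - \<xi>)" if "\<xi> \<in> Pow J" for \<xi>
  proof -
    have "measure SP (?C \<xi>) = (\<Prod>x\<in>J. if x \<in> \<xi> then p else 1 - p)"
      unfolding measure_cylinder[OF J, of "\<lambda>x. {x \<in> \<xi>}"]
      by (intro prod.cong refl) (simp add: measure_bernoulli)
    also have "\<dots> = (\<Prod>x\<in>J \<inter> \<xi>. p) * (\<Prod>x\<in>J - \<xi>. 1 - p)"
      using J by (simp add: prod.If_cases Diff_eq[symmetric] Compl_eq[symmetric] Int_def) (simp add: set_diff_eq)
    also have "J \<inter> \<xi> = \<xi>" using that by auto
    finally show ?thesis by simp
  qed
  have "(\<integral>\<omega>. g {x \<in> J. \<omega> x} \<partial>SP) = (\<integral>\<omega>. (\<Sum>\<xi>\<in>Pow J. g \<xi> * indicator (?C \<xi>) \<omega>) \<partial>SP)"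
  proof (rule Bochner_Integration.integral_cong[OF refl])
    fix \<omega> assume \<omega>: "\<omega> \<in> space SP"
    have "(\<Sum>\<xi>\<in>Pow J. g \<xi> * indicator (?C \<xi>) \<omega>) = (\<Sum>\<xi>\<in>Pow J. if \<xi> = {x \<in> J. \<omega> x} then g \<xi> else 0)"
      using \<omega> by (intro sum.cong refl) (auto simp: indicator_def)
    then show "g {x \<in> J. \<omega> x} = (\<Sum>\<xi>\<in>Pow J. g \<xi> * indicator (?C \<xi>) \<omega>)"
      using J by (simp add: sum.delta)
  qed
  also have "\<dots> = (\<Sum>\<xi>\<in>Pow J. g \<xi> * measure SP (?C \<xi>))"
  proof (subst Bochner_Integration.integral_sum)
    show "integrable SP (\<lambda>\<omega>. g \<xi> * indicator (?C \<xi>) \<omega>)" for \<xi>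
      using C[of \<xi>] by (intro integrable_mult_right) (simp add: S.emeasure_eq_measure)
    show "(\<Sum>\<xi>\<in>Pow J. \<integral>\<omega>. g \<xi> * indicator (?C \<xi>) \<omega> \<partial>SP) = (\<Sum>\<xi>\<in>Pow J. g \<xi> * measure SP (?C \<xi>))"
      using C by (intro sum.cong refl) simp
  qed
  also have "\<dots> = bernoulli_expect p J g"
    unfolding bernoulli_expect_def by (intro sum.cong refl) (simp only: m)
  finally show ?thesis .
qed

abbreviation perc_event :: "(site \<Rightarrow> bool) set" where
  "perc_event \<equiv> {\<omega> \<in> space SP. percolates d {x \<in> Zd d. \<omega> x}}"

lemma sets_perc_event: "perc_event \<in> sets SP"
  using pred_percolates[where M=SP and P="\<lambda>\<omega> x. \<omega> x" and d=d] pred_SP by (simp add: pred_def)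

text \<open>Kolmogorov's zero-one law for the independent coordinates, enumerated by
  \<open>e\<close>; it turns a positive probability of percolation into probability one.\<close>

lemma perc_event_0_1:
  assumes d: "d > 0"
  shows "measure SP perc_event = 0 \<or> measure SP perc_event = 1"
proof -
  interpret S: prob_space SP by (rule prob_space_SP)
  define e where "e = from_nat_into (Zd d)"
  have bij: "bij_betw e UNIV (Zd d)"
    unfolding e_def by (rule bij_betw_from_nat_into[OF countable_Zd infinite_Zd[OF d]])
  have inj: "inj e" and ran: "range e = Zd d" using bij by (auto simp: bij_betw_def)
  have eZ: "e i \<in> Zd d" for i using ran by auto
  define F where "F i = {(\<lambda>\<omega>. \<omega> (e i)) -` B \<inter> space SP | B. B \<in> sets (count_space (UNIV :: bool set))}" for i
  have me: "(\<lambda>\<omega>. \<omega> (e i)) \<in> SP \<rightarrow>\<^sub>M count_space UNIV" for i using pred_SP[OF eZ] .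
  show ?thesis
  proof (rule S.kolmogorov_0_1_law[of F])
    show "sigma_algebra (space SP) (F i)" for i
    proof -
      have "F i = sets (vimage_algebra (space SP) (\<lambda>\<omega>. \<omega> (e i)) (count_space UNIV))"
        unfolding F_def by (rule sets_vimage_algebra2[symmetric]) auto
      then show ?thesis
        using sets.sigma_algebra_axioms[of "vimage_algebra (space SP) (\<lambda>\<omega>. \<omega> (e i)) (count_space UNIV)"] by simp
    qed
  next
    show "S.indep_sets F UNIV"
    proof (rule S.indep_setsI)
      show "F i \<subseteq> S.events" for i using measurable_sets[OF me] by (auto simp: F_def)
    next
      fix A J assume J: "J \<noteq> {}" "J \<subseteq> UNIV" "finite (J :: nat set)" and A: "\<forall>j\<in>J. A j \<in> F j"
      then have "\<forall>j\<in>J. \<exists>B. A j = (\<lambda>\<omega>. \<omega> (e j)) -` B \<inter> space SP" by (auto simp: F_def)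
      then obtain B where B: "\<And>j. j \<in> J \<Longrightarrow> A j = (\<lambda>\<omega>. \<omega> (e j)) -` B j \<inter> space SP" by metis
      have A1: "A j = {\<omega> \<in> space SP. \<forall>x\<in>{e j}. \<omega> x \<in> B j}" if "j \<in> J" for j
        using B[OF that] by auto
      have m1: "measure SP (A j) = measure (measure_pmf (bernoulli_pmf p)) (B j)" if "j \<in> J" for j
        unfolding A1[OF that] using measure_cylinder[of "{e j}" "\<lambda>_. B j"] eZ by simp
      have iv: "inv e (e j) = j" for j using inj by simp
      have "(\<Inter>j\<in>J. A j) = {\<omega> \<in> space SP. \<forall>x\<in>e ` J. \<omega> x \<in> B (inv e x)}"
        using J(1) by (auto simp: B iv)
      then have "measure SP (\<Inter>j\<in>J. A j) = (\<Prod>x\<in>e ` J. measure (measure_pmf (bernoulli_pmf p)) (B (inv e x)))"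
        using measure_cylinder[of "e ` J" "\<lambda>x. B (inv e x)"] J eZ by auto
      also have "\<dots> = (\<Prod>j\<in>J. measure (measure_pmf (bernoulli_pmf p)) (B j))"
        using inj by (subst prod.reindex) (auto simp: iv inj_on_def)
      also have "\<dots> = (\<Prod>j\<in>J. measure SP (A j))" by (intro prod.cong refl) (simp add: m1)
      finally show "measure SP (\<Inter>j\<in>J. A j) = (\<Prod>j\<in>J. measure SP (A j))" .
    qed
  next
    show "perc_event \<in> S.tail_events F"
      unfolding S.tail_events_def
    proof (rule INT_I)
      fix n :: nat
      let ?G = "\<Union> (F ` {n..})"
      define M where "M = sigma (space SP) ?G"
      have Gs: "?G \<subseteq> Pow (space SP)" by (auto simp: F_def)
      have sM: "space M = space SP" "sets M = sigma_sets (space SP) ?G"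
        unfolding M_def using Gs by (simp_all add: sets_measure_of)
      have pr: "Measurable.pred M (\<lambda>\<omega>. x \<notin> e ` {..<n} \<and> \<omega> x)" if xZ: "x \<in> Zd d" for x
      proof -
        obtain i where i: "x = e i" using xZ ran by blast
        show ?thesis
        proof (cases "i < n")
          case False
          then have x: "x \<notin> e ` {..<n}" using inj i by (auto simp: inj_on_def)
          have "(\<lambda>\<omega>. \<omega> (e i)) -` {True} \<inter> space SP \<in> F i" by (auto simp: F_def)
          then have "(\<lambda>\<omega>. \<omega> (e i)) -` {True} \<inter> space SP \<in> sets M"
            unfolding sM using False by (intro sigma_sets.Basic) auto
          moreover have "(\<lambda>\<omega>. \<omega> (e i)) -` {True} \<inter> space SP = {\<omega> \<in> space M. x \<notin> e ` {..<n} \<and> \<omega> x}"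
            using x by (auto simp: sM i)
          ultimately show ?thesis unfolding pred_def by (simp only:)
        next
          case True
          then have "x \<in> e ` {..<n}" using i by auto
          then show ?thesis by simp
        qed
      qed
      \<comment> \<open>Closing the first n sites does not affect percolation, so the event depends
        only on the remaining coordinates and belongs to the tail.\<close>
      have "percolates d {x \<in> Zd d. \<omega> x} \<longleftrightarrow> percolates d {x \<in> Zd d. x \<notin> e ` {..<n} \<and> \<omega> x}" for \<omega>
      proof
        assume "percolates d {x \<in> Zd d. \<omega> x}"
        then have "percolates d ({x \<in> Zd d. \<omega> x} - e ` {..<n})" by (intro percolates_Diff_finite) auto
        also have "{x \<in> Zd d. \<omega> x} - e ` {..<n} = {x \<in> Zd d. x \<notin> e ` {..<n} \<and> \<omega> x}" by auto
        finally show "percolates d {x \<in> Zd d. x \<notin> e ` {..<n} \<and> \<omega> x}" .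
      qed (rule percolates_mono[rotated], auto)
      then have "perc_event = {\<omega> \<in> space M. percolates d {x \<in> Zd d. x \<notin> e ` {..<n} \<and> \<omega> x}}"
        by (simp add: sM)
      also have "\<dots> \<in> sets M"
        using pred_percolates[where M=M and d=d and P="\<lambda>\<omega> x. x \<notin> e ` {..<n} \<and> \<omega> x"] pr by (simp add: pred_def)
      finally show "perc_event \<in> sigma_sets (space SP) ?G" unfolding sM .
    qed
  qed
qed

section \<open>Open oriented paths\<close>

definition endpoint :: "nat list \<Rightarrow> site" where
  "endpoint w = (\<lambda>i\<in>{..<d}. int (count_list w i))"

definition trace :: "nat \<Rightarrow> nat list \<Rightarrow> site set" where
  "trace n w = (\<lambda>j. endpoint (take j w)) ` {..n}"

lemma endpoint_Zd: "endpoint w \<in> Zd d"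
  by (auto simp: endpoint_def Zd_def)

lemma level_endpoint:
  assumes "w \<in> words m n" "m \<le> d" shows "level d (endpoint w) = int n"
proof -
  have "(\<Sum>i<d. count_list w i) = length w"
    using assms by (intro sum_count_set) (auto simp: words_def)
  then have "(\<Sum>i<d. int (count_list w i)) = int n"
    using assms by (simp add: words_def of_nat_sum[symmetric] del: of_nat_sum)
  then show ?thesis by (simp add: level_def endpoint_def)
qed

lemma endpoint_eq_iff:
  assumes "u \<in> words m n" "v \<in> words m n" "m \<le> d"
  shows "endpoint u = endpoint v \<longleftrightarrow> mset u = mset v"
proof
  assume eq: "endpoint u = endpoint v"
  have "count_list u i = count_list v i" for i
  proof (cases "i < d")
    case True then show ?thesis using fun_cong[OF eq, of i] by (simp add: endpoint_def)
  next
    case False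
    then have "i \<notin> set u" "i \<notin> set v" using assms by (auto simp: words_def)
    then show ?thesis by simp
  qed
  then show "mset u = mset v" by (simp add: multiset_eq_iff count_mset)
next
  assume "mset u = mset v"
  then have "count_list u i = count_list v i" for i by (metis count_mset)
  then show "endpoint u = endpoint v" by (simp add: endpoint_def)
qed

text \<open>The level of a site equals the time at which an oriented path visits it. So a path never
  returns, and two paths share a site only when they meet at the same time; the common starting
  point adds one to the meetings.\<close>

lemma trace_facts:
  assumes u: "u \<in> words m n" and v: "v \<in> words m n" and m: "m \<le> d"
  shows "finite (trace n u)" "trace n u \<subseteq> Zd d" "card (trace n u) = n + 1"
    "card (trace n u \<union> trace n v) + card (meets u v 0 n) = 2 * n + 1"
proof -
  have lev: "level d (endpoint (take j w)) = int j" if "w \<in> words m n" "j \<le> n" for w j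
    using level_endpoint[OF take_words[OF that] m] .
  have inj: "inj_on (\<lambda>j. endpoint (take j w)) {..n}" if "w \<in> words m n" for w
  proof (rule inj_onI)
    fix i j assume ij: "i \<in> {..n}" "j \<in> {..n}" and eq: "endpoint (take i w) = endpoint (take j w)"
    have "int i = level d (endpoint (take i w))" using lev[OF that, of i] ij by simp
    also have "\<dots> = level d (endpoint (take j w))" by (simp only: eq)
    also have "\<dots> = int j" using lev[OF that, of j] ij by simp
    finally show "i = j" by simp
  qed
  show fin: "finite (trace n u)" by (simp add: trace_def)
  show "trace n u \<subseteq> Zd d" by (auto simp: trace_def endpoint_Zd)
  have c: "card (trace n w) = n + 1" if "w \<in> words m n" for w
    unfolding trace_def using inj[OF that] by (simp add: card_image)
  show "card (trace n u) = n + 1" by (rule c[OF u])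
  have int: "trace n u \<inter> trace n v = (\<lambda>j. endpoint (take j u)) ` insert 0 (meets u v 0 n)"
  proof (intro equalityI subsetI)
    fix x assume "x \<in> trace n u \<inter> trace n v"
    then obtain i j where ij: "i \<le> n" "j \<le> n" "x = endpoint (take i u)" "x = endpoint (take j v)"
      unfolding trace_def by blast
    have "int i = level d x" using lev[OF u ij(1)] by (simp only: ij(3))
    also have "\<dots> = int j" using lev[OF v ij(2)] by (simp only: ij(4))
    finally have "i = j" by simp
    then have "endpoint (take i u) = endpoint (take i v)" using ij(3,4) by (simp only:)
    then have "mset (take i u) = mset (take i v)"
      using endpoint_eq_iff[OF take_words[OF u ij(1)] take_words[OF v ij(1)] m] by (simp only:)
    then have "i \<in> insert 0 (meets u v 0 n)" using ij by (auto simp: meets_def)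
    then show "x \<in> (\<lambda>j. endpoint (take j u)) ` insert 0 (meets u v 0 n)" using ij by blast
  next
    fix x assume "x \<in> (\<lambda>j. endpoint (take j u)) ` insert 0 (meets u v 0 n)"
    then obtain j where j: "j \<in> insert 0 (meets u v 0 n)" "x = endpoint (take j u)" by blast
    then have jn: "j \<le> n" "mset (take j u) = mset (take j v)" by (auto simp: meets_def)
    have "endpoint (take j u) = endpoint (take j v)"
      using jn(2) endpoint_eq_iff[OF take_words[OF u jn(1)] take_words[OF v jn(1)] m] by (simp only:)
    then have "x = endpoint (take j v)" using j(2) by (simp only:)
    with j(2) jn(1) show "x \<in> trace n u \<inter> trace n v"
      unfolding trace_def by (intro IntI image_eqI[of x _ j]) simp_all
  qed
  have "inj_on (\<lambda>j. endpoint (take j u)) (insert 0 (meets u v 0 n))"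
    by (rule inj_on_subset[OF inj[OF u]]) (auto simp: meets_def)
  then have "card (trace n u \<inter> trace n v) = card (insert 0 (meets u v 0 n))"
    unfolding int by (rule card_image)
  also have "\<dots> = Suc (card (meets u v 0 n))" by (simp add: meets_def)
  finally have "card (trace n u \<inter> trace n v) = Suc (card (meets u v 0 n))" .
  moreover have "card (trace n u) + card (trace n v) = card (trace n u \<union> trace n v) + card (trace n u \<inter> trace n v)"
    by (rule card_Un_Int) (auto simp: trace_def)
  ultimately show "card (trace n u \<union> trace n v) + card (meets u v 0 n) = 2 * n + 1"
    using c[OF u] c[OF v] by simp
qed

lemma trace_reach:
  assumes w: "w \<in> words m n" and m: "m \<le> d" and j: "j \<le> n" and A: "trace n w \<subseteq> A"
  shows "endpoint (take j w) \<in> reach d A (endpoint [])"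
  using j
proof (induction j)
  case 0
  then show ?case by (simp add: reach_refl)
next
  case (Suc j)
  have IH: "endpoint (take j w) \<in> reach d A (endpoint [])" using Suc.prems by (intro Suc.IH) simp
  have jn: "j < length w" using Suc.prems w by (simp add: words_def)
  then have t: "take (Suc j) w = take j w @ [w ! j]" by (rule take_Suc_conv_app_nth)
  have "w ! j \<in> {..<m}" using w nth_mem[OF jn] unfolding words_def by blast
  then have wd: "w ! j < d" using m by simp
  have "endpoint (take (Suc j) w) = (endpoint (take j w))(w ! j := endpoint (take j w) (w ! j) + 1)"
    using wd by (auto simp: t endpoint_def fun_eq_iff)
  then have n: "nbr d (endpoint (take j w)) (endpoint (take (Suc j) w))"
    unfolding nbr_iff using endpoint_Zd wd by auto
  have tA: "endpoint (take i w) \<in> A" if "i \<le> n" for i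
    using A that unfolding trace_def by blast
  show ?case by (rule reach_step[OF IH tA tA n]) (use Suc.prems in auto)
qed

text \<open>Second moment method.\<close>

lemma open_path_prob:
  assumes m: "m > 0" "m \<le> d" and p0: "p > 0" and a: "\<And>N. (\<Sum>n<N. collision m n) \<le> 1 + a"
    and l: "(1 / p - 1) * a < 1"
  shows "p * (1 - (1 / p - 1) * a) \<le> measure SP {\<omega> \<in> space SP. \<exists>w\<in>words m n. \<forall>x\<in>trace n w. \<omega> x}"
proof -
  interpret S: prob_space SP by (rule prob_space_SP)
  let ?W = "words m n"
  define Op where "Op F = {\<omega> \<in> space SP. \<forall>x\<in>F. \<omega> x}" for F
  define N where "N = real m ^ n * p ^ (n + 1)"
  have N: "N > 0" using m p0 by (simp add: N_def)
  define X where "X \<omega> = (\<Sum>w\<in>?W. indicator (Op (trace n w)) \<omega>) / N" for \<omega>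
  define E where "E = {\<omega> \<in> space SP. \<exists>w\<in>?W. \<forall>x\<in>trace n w. \<omega> x}"
  have tr: "finite (trace n w)" "trace n w \<subseteq> Zd d" "card (trace n w) = n + 1" if "w \<in> ?W" for w
    using trace_facts[OF that that m(2)] by auto
  have Op: "Op F \<in> sets SP" "measure SP (Op F) = p ^ card F" if "finite F" "F \<subseteq> Zd d" for F
    unfolding Op_def using sets_all_open[OF that] measure_all_open[OF that] by auto
  have OO: "Op F \<inter> Op G = Op (F \<union> G)" for F G by (auto simp: Op_def)
  have E: "E \<in> sets SP"
  proof -
    have "E = (\<Union>w\<in>?W. Op (trace n w))" by (auto simp: E_def Op_def)
    then show ?thesis using Op(1) tr by auto
  qed
  have iO: "integrable SP (\<lambda>\<omega>. indicator (Op F) \<omega> :: real)" if "finite F" "F \<subseteq> Zd d" for F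
    using Op[OF that] by (simp add: S.emeasure_eq_measure)
  have iX: "integrable SP X" unfolding X_def using tr iO by auto
  have EX: "(\<integral>\<omega>. X \<omega> \<partial>SP) = 1"
  proof -
    have "(\<integral>\<omega>. X \<omega> \<partial>SP) = (\<Sum>w\<in>?W. measure SP (Op (trace n w))) / N"
      unfolding X_def using tr iO Op by (simp add: Bochner_Integration.integral_sum)
    also have "\<dots> = (\<Sum>w\<in>?W. p ^ (n + 1)) / N"
      by (intro arg_cong[where f="\<lambda>x. x / N"] sum.cong refl) (simp add: tr Op)
    also have "\<dots> = 1" using m p0 by (simp add: card_words N_def)
    finally show ?thesis .
  qed
  have X2: "(X \<omega>)\<^sup>2 = (\<Sum>u\<in>?W. \<Sum>v\<in>?W. indicator (Op (trace n u \<union> trace n v)) \<omega>) / N\<^sup>2" for \<omega>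
    unfolding X_def power_divide power2_eq_square[of "sum _ _"] sum_product
    by (simp add: indicator_inter_arith[symmetric] OO)
  have tr2: "finite (trace n u \<union> trace n v)" "trace n u \<union> trace n v \<subseteq> Zd d" if "u \<in> ?W" "v \<in> ?W" for u v
    using tr that by auto
  have iX2: "integrable SP (\<lambda>\<omega>. (X \<omega>)\<^sup>2)"
    unfolding X2 using tr2 iO by (intro integrable_divide_zero Bochner_Integration.integrable_sum) auto
  have EX2: "(\<integral>\<omega>. (X \<omega>)\<^sup>2 \<partial>SP) = moment m (1 / p - 1) n / p"
  proof -
    have "(\<integral>\<omega>. (X \<omega>)\<^sup>2 \<partial>SP) = (\<Sum>u\<in>?W. \<Sum>v\<in>?W. measure SP (Op (trace n u \<union> trace n v))) / N\<^sup>2"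
      unfolding X2 using tr2 iO Op by (simp add: Bochner_Integration.integral_sum Bochner_Integration.integrable_sum)
    also have "\<dots> = (\<Sum>u\<in>?W. \<Sum>v\<in>?W. p ^ (2 * n + 1) * (1 / p) ^ card (meets u v 0 n)) / N\<^sup>2"
    proof (intro arg_cong[where f="\<lambda>x. x / N\<^sup>2"] sum.cong refl)
      fix u v assume uv: "u \<in> ?W" "v \<in> ?W"
      have "p ^ card (trace n u \<union> trace n v) * p ^ card (meets u v 0 n) = p ^ (2 * n + 1)"
        unfolding power_add[symmetric] trace_facts(4)[OF uv m(2)] ..
      then show "measure SP (Op (trace n u \<union> trace n v)) = p ^ (2 * n + 1) * (1 / p) ^ card (meets u v 0 n)"
        using Op(2)[OF tr2[OF uv]] p0 by (simp add: power_divide field_simps)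
    qed
    also have "\<dots> = (p ^ (2 * n + 1) / (p ^ (n + 1))\<^sup>2) * moment m (1 / p - 1) n"
      by (simp add: moment_def N_def sum_distrib_left[symmetric] power_mult_distrib)
    also have "p ^ (2 * n + 1) / (p ^ (n + 1))\<^sup>2 = 1 / p"
    proof -
      have "(p ^ (n + 1))\<^sup>2 = p ^ (2 * n + 1) * p" by (simp add: power_mult[symmetric] power_add power2_eq_square mult_2)
      then show ?thesis using p0 by simp
    qed
    finally show ?thesis by simp
  qed
  \<comment> \<open>The reciprocal of the upper bound for the second moment.\<close>
  define s where "s = p * (1 - (1 / p - 1) * a)"
  have s: "s > 0" using p0 l by (simp add: s_def)
  have r0: "0 \<le> 1 / p - 1" using p p0 by simp
  have "moment m (1 / p - 1) n \<le> 1 / (1 - (1 / p - 1) * a)" by (rule moment_le[OF m(1) r0 a l])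
  then have "moment m (1 / p - 1) n / p \<le> 1 / (1 - (1 / p - 1) * a) / p" using p0 by (intro divide_right_mono) auto
  also have "\<dots> = 1 / s" unfolding s_def by (simp add: mult.commute)
  finally have mom: "(\<integral>\<omega>. (X \<omega>)\<^sup>2 \<partial>SP) \<le> 1 / s" unfolding EX2 .
  have "1 = (\<integral>\<omega>. X \<omega> \<partial>SP)" using EX by simp
  \<comment> \<open>A pointwise form of Cauchy-Schwarz: X vanishes off E, and on E the inequality
    says that the square of s X - 1 is nonnegative.\<close>
  also have "\<dots> \<le> (\<integral>\<omega>. (s * (X \<omega>)\<^sup>2 + indicator E \<omega> / s) / 2 \<partial>SP)"
  proof (rule integral_mono)
    show "integrable SP X" by (rule iX)
    show "integrable SP (\<lambda>\<omega>. (s * (X \<omega>)\<^sup>2 + indicator E \<omega> / s) / 2)"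
      using iX2 E by (auto simp: S.emeasure_eq_measure)
    fix \<omega> assume \<omega>: "\<omega> \<in> space SP"
    show "X \<omega> \<le> (s * (X \<omega>)\<^sup>2 + indicator E \<omega> / s) / 2"
    proof (cases "\<omega> \<in> E")
      case True
      have "0 \<le> (s * X \<omega> - 1)\<^sup>2 / s" using s by simp
      also have "(s * X \<omega> - 1)\<^sup>2 / s = s * (X \<omega>)\<^sup>2 - 2 * X \<omega> + 1 / s"
        using s by (simp add: power2_eq_square field_simps)
      finally show ?thesis using True by simp
    next
      case False
      then have "indicator (Op (trace n w)) \<omega> = (0::real)" if "w \<in> ?W" for w
        using that \<omega> by (auto simp: E_def Op_def indicator_def)
      then have "X \<omega> = 0" by (simp add: X_def)
      then show ?thesis using False by simp
    qed
  qed
  also have "\<dots> = (s * (\<integral>\<omega>. (X \<omega>)\<^sup>2 \<partial>SP) + measure SP E / s) / 2"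
    using iX2 E by (simp add: S.emeasure_eq_measure)
  finally have "1 \<le> (s * (\<integral>\<omega>. (X \<omega>)\<^sup>2 \<partial>SP) + measure SP E / s) / 2" .
  moreover have "s * (\<integral>\<omega>. (X \<omega>)\<^sup>2 \<partial>SP) \<le> s * (1 / s)" using mom s by (intro mult_left_mono) auto
  moreover have "s * (1 / s) = 1" using s by simp
  ultimately have "1 \<le> measure SP E / s" by argo
  then have "s \<le> measure SP E" using s by (simp add: field_simps)
  then show ?thesis by (simp add: s_def E_def)
qed

text \<open>The bound of \<open>open_path_prob\<close> does not depend on n, and the events
  decrease, so with positive probability there are open paths of all lengths. Then the cluster of
  the origin contains sites of every level and is infinite.\<close>

lemma percolation_pos:
  assumes m: "m > 0" "m \<le> d" and p0: "p > 0" and a: "\<And>N. (\<Sum>n<N. collision m n) \<le> 1 + a"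
    and l: "(1 / p - 1) * a < 1"
  shows "0 < measure SP perc_event"
proof -
  interpret S: prob_space SP by (rule prob_space_SP)
  define E where "E n = {\<omega> \<in> space SP. \<exists>w\<in>words m n. \<forall>x\<in>trace n w. \<omega> x}" for n
  define s where "s = p * (1 - (1 / p - 1) * a)"
  have s: "s > 0" using p0 l by (simp add: s_def)
  have Es: "E n \<in> sets SP" for n
  proof -
    have "E n = (\<Union>w\<in>words m n. {\<omega> \<in> space SP. \<forall>x\<in>trace n w. \<omega> x})" by (auto simp: E_def)
    then show ?thesis using sets_all_open trace_facts(1,2)[OF _ _ m(2)] by auto
  qed
  have dec: "decseq E"
  proof (rule decseq_SucI, rule subsetI)
    fix n \<omega> assume "\<omega> \<in> E (Suc n)"
    then obtain w where w: "w \<in> words m (Suc n)" "\<omega> \<in> space SP" "\<forall>x\<in>trace (Suc n) w. \<omega> x" by (auto simp: E_def)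
    have "trace n (take n w) \<subseteq> trace (Suc n) w" by (auto simp: trace_def min_def)
    then show "\<omega> \<in> E n" using w take_words[OF w(1), of n] by (auto simp: E_def)
  qed
  have "(\<lambda>n. measure SP (E n)) \<longlonglongrightarrow> measure SP (\<Inter>n. E n)"
    using Es dec by (intro S.finite_Lim_measure_decseq) auto
  moreover have "s \<le> measure SP (E n)" for n
    unfolding E_def s_def by (rule open_path_prob[OF m p0 a l])
  ultimately have "s \<le> measure SP (\<Inter>n. E n)" by (intro LIMSEQ_le_const) auto
  also have "\<dots> \<le> measure SP perc_event"
  proof (rule S.finite_measure_mono[OF _ sets_perc_event], rule subsetI)
    fix \<omega> assume \<omega>: "\<omega> \<in> (\<Inter>n. E n)"
    let ?A = "{x \<in> Zd d. \<omega> x}" and ?o = "endpoint []"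
    have "int n \<in> level d ` reach d ?A ?o" for n
    proof -
      obtain w where w: "w \<in> words m n" "\<forall>x\<in>trace n w. \<omega> x" using \<omega> by (auto simp: E_def)
      have "trace n w \<subseteq> ?A" using w trace_facts(2)[OF w(1) w(1) m(2)] by auto
      then have "endpoint (take n w) \<in> reach d ?A ?o" by (intro trace_reach[OF w(1) m(2)]) auto
      moreover have "level d (endpoint (take n w)) = int n"
        using level_endpoint[OF take_words[OF w(1), of n] m(2)] by simp
      ultimately show ?thesis by force
    qed
    then have "range int \<subseteq> level d ` reach d ?A ?o" by auto
    then have "infinite (level d ` reach d ?A ?o)"
      using finite_subset range_inj_infinite[of int] by (auto simp: inj_on_def)
    then have inf: "infinite (reach d ?A ?o)" by blast
    moreover have "?o \<in> ?A"
    proof -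
      have "\<omega> \<in> E 0" using \<omega> by auto
      then show ?thesis by (auto simp: E_def words_def trace_def endpoint_Zd)
    qed
    ultimately show "\<omega> \<in> perc_event" using \<omega> by (auto simp: percolates_iff E_def)
  qed
  finally show ?thesis using s by simp
qed

end

lemma site_pc_le:
  assumes m: "m > 0" "m \<le> d" and pp: "0 < p" "p \<le> 1" and a: "\<And>N. (\<Sum>n<N. collision m n) \<le> 1 + a"
    and l: "(1 / p - 1) * a < 1"
  shows "site_pc d \<le> p"
proof -
  interpret site_perc d p using pp by unfold_locales auto
  have "0 < measure (site_percolation d p) {\<omega> \<in> space (site_percolation d p). \<exists>C\<in>clusters d {x \<in> Zd d. \<omega> x}. infinite C}"
    using percolation_pos[OF m pp(1) a l] by (simp add: percolates_def)
  then show ?thesis unfolding site_pc_def using pp by (intro cInf_lower) (auto intro!: bdd_belowI[of _ 0])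
qed

section \<open>Stochastic domination\<close>

definition lexless :: "nat \<Rightarrow> site \<Rightarrow> site \<Rightarrow> bool" where
  "lexless d x y \<longleftrightarrow> (\<exists>i<d. x i < y i \<and> (\<forall>j<i. x j = y j))"

lemma lexless_irrefl: "\<not> lexless d x x"
  by (auto simp: lexless_def)

lemma lexless_trans: "lexless d x y \<Longrightarrow> lexless d y z \<Longrightarrow> lexless d x z"
proof -
  assume "lexless d x y" "lexless d y z"
  then obtain i j where i: "i < d" "x i < y i" "\<forall>k<i. x k = y k" and j: "j < d" "y j < z j" "\<forall>k<j. y k = z k"
    by (auto simp: lexless_def)
  show ?thesis unfolding lexless_def
  proof (intro exI[of _ "min i j"] conjI allI impI)
    show "x (min i j) < z (min i j)"
      using i j by (cases "i < j"; cases "i = j") (auto simp: min_def)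
  qed (use i j in auto)
qed

lemma lexless_total:
  assumes "x \<in> Zd d" "y \<in> Zd d" "x \<noteq> y" shows "lexless d x y \<or> lexless d y x"
proof -
  have "\<exists>i. i < d \<and> x i \<noteq> y i"
  proof (rule ccontr)
    assume "\<not> ?thesis"
    then have "x = y" using assms(1,2) unfolding Zd_def by (intro PiE_ext) auto
    then show False using assms(3) by simp
  qed
  then obtain i where i: "i < d" "x i \<noteq> y i" and m: "\<And>j. j < i \<Longrightarrow> \<not> (j < d \<and> x j \<noteq> y j)"
    using exists_least_iff[of "\<lambda>i. i < d \<and> x i \<noteq> y i"] by auto
  have eq: "\<forall>j<i. x j = y j" using m i(1) by (meson less_trans)
  then show ?thesis using i unfolding lexless_def by (metis linorder_neq_iff)
qed

definition lexmin :: "nat \<Rightarrow> site set \<Rightarrow> site \<Rightarrow> bool" where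
  "lexmin d \<Lambda> x \<longleftrightarrow> x \<in> \<Lambda> \<and> (\<forall>y\<in>\<Lambda>. y = x \<or> lexless d x y)"

lemma ex_lexmin: "finite \<Lambda> \<Longrightarrow> \<Lambda> \<noteq> {} \<Longrightarrow> \<Lambda> \<subseteq> Zd d \<Longrightarrow> \<exists>x. lexmin d \<Lambda> x"
proof (induction \<Lambda> rule: finite_ne_induct)
  case (singleton x)
  then show ?case by (auto simp: lexmin_def)
next
  case (insert x \<Lambda>)
  then obtain y where y: "y \<in> \<Lambda>" "\<forall>z\<in>\<Lambda>. z = y \<or> lexless d y z" by (auto simp: lexmin_def)
  show ?case
  proof (cases "lexless d x y")
    case True
    then have "lexmin d (insert x \<Lambda>) x" using y lexless_trans by (auto simp: lexmin_def)
    then show ?thesis by (rule exI[of _ x])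
  next
    case False
    have "x \<noteq> y" using y insert.hyps by auto
    then have "lexless d y x" using False lexless_total[of x d y] y insert.prems by auto
    then have "lexmin d (insert x \<Lambda>) y" using y by (auto simp: lexmin_def)
    then show ?thesis by (rule exI[of _ y])
  qed
qed

lemma ex_lex_sorted:
  assumes "finite B" "B \<subseteq> Zd d"
  shows "\<exists>xs. distinct xs \<and> set xs = B \<and> (\<forall>k<length xs. \<forall>z\<in>set (take k xs). lexless d z (xs ! k))"
  using assms
proof (induction "card B" arbitrary: B)
  case 0
  then show ?case by (intro exI[of _ "[]"]) auto
next
  case (Suc n)
  then have "B \<noteq> {}" by auto
  then obtain x where x: "lexmin d B x" using ex_lexmin Suc.prems by blast
  then have xB: "x \<in> B" by (simp add: lexmin_def)
  have "n = card (B - {x})" using Suc.hyps(2) Suc.prems xB by simp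
  from Suc.hyps(1)[OF this] obtain ys where ys: "distinct ys" "set ys = B - {x}"
    "\<forall>k<length ys. \<forall>z\<in>set (take k ys). lexless d z (ys ! k)" using Suc.prems by auto
  have "\<forall>k<length (x # ys). \<forall>z\<in>set (take k (x # ys)). lexless d z ((x # ys) ! k)"
  proof (intro allI impI ballI)
    fix k z assume k: "k < length (x # ys)" and z: "z \<in> set (take k (x # ys))"
    show "lexless d z ((x # ys) ! k)"
    proof (cases k)
      case (Suc j)
      then have j: "j < length ys" using k by simp
      have "z = x \<or> z \<in> set (take j ys)" using z Suc by auto
      then show ?thesis
      proof
        assume "z = x"
        moreover have "ys ! j \<in> B - {x}" using ys(2) nth_mem[OF j] by auto
        ultimately show ?thesis using x Suc by (auto simp: lexmin_def)
      qed (use ys(3) j Suc in auto)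
    qed (use z in auto)
  qed
  then show ?case using ys xB by (intro exI[of _ "x # ys"]) auto
qed

section \<open>Translation invariance in finite volume\<close>

definition shift :: "nat \<Rightarrow> site \<Rightarrow> site \<Rightarrow> site" where
  "shift d v x = (\<lambda>i\<in>{..<d}. x i + v i)"

lemma shift_Zd: "shift d v x \<in> Zd d"
  by (auto simp: shift_def Zd_def)

lemma shift_shift_neg: "x \<in> Zd d \<Longrightarrow> shift d v (shift d (\<lambda>i. - v i) x) = x"
  "x \<in> Zd d \<Longrightarrow> shift d (\<lambda>i. - v i) (shift d v x) = x"
  by (auto simp: shift_def Zd_def fun_eq_iff PiE_iff extensional_def)

lemma inj_shift: "inj_on (shift d v) (Zd d)"
  by (rule inj_on_inverseI[of _ "shift d (\<lambda>i. - v i)"]) (rule shift_shift_neg)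

lemma nbr_shift: "x \<in> Zd d \<Longrightarrow> y \<in> Zd d \<Longrightarrow> nbr d (shift d v x) (shift d v y) \<longleftrightarrow> nbr d x y"
  by (simp add: nbr_def shift_Zd) (simp add: shift_def)

lemma level_shift: "level d (shift d v x) = level d x + (\<Sum>i<d. v i)"
  by (simp add: level_def shift_def sum.distrib)

lemma lexless_shift: "lexless d (shift d v x) (shift d v y) \<longleftrightarrow> lexless d x y"
  unfolding lexless_def shift_def by (intro ex_cong1 conj_cong refl) auto

lemma touching_shift:
  assumes \<Lambda>: "\<Lambda> \<subseteq> Zd d"
  shows "touching d (shift d v ` \<Lambda>) = (\<lambda>(x, y). (shift d v x, shift d v y)) ` touching d \<Lambda>"
proof (intro equalityI subsetI)
  fix e assume "e \<in> touching d (shift d v ` \<Lambda>)"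
  then obtain x y where e: "e = (x, y)" "nbr d x y" "level d y = level d x + 1" "x \<in> shift d v ` \<Lambda> \<or> y \<in> shift d v ` \<Lambda>"
    by (auto simp: touching_def)
  let ?x = "shift d (\<lambda>i. - v i) x" and ?y = "shift d (\<lambda>i. - v i) y"
  have xy: "x \<in> Zd d" "y \<in> Zd d" using e by (auto simp: nbr_def)
  have bk: "shift d (\<lambda>i. - v i) z \<in> \<Lambda>" if "z \<in> shift d v ` \<Lambda>" for z
    using that \<Lambda> shift_shift_neg(2) by auto
  have "(?x, ?y) \<in> touching d \<Lambda>"
    using e bk xy by (auto simp: touching_def nbr_shift level_shift)
  moreover have "e = (shift d v ?x, shift d v ?y)" using e xy by (simp add: shift_shift_neg)
  ultimately show "e \<in> (\<lambda>(x, y). (shift d v x, shift d v y)) ` touching d \<Lambda>" by force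
next
  fix e assume "e \<in> (\<lambda>(x, y). (shift d v x, shift d v y)) ` touching d \<Lambda>"
  then obtain x y where e: "e = (shift d v x, shift d v y)" "(x, y) \<in> touching d \<Lambda>" by auto
  then have "x \<in> Zd d" "y \<in> Zd d" by (auto simp: touching_def nbr_def)
  then show "e \<in> touching d (shift d v ` \<Lambda>)"
    using e by (auto simp: touching_def nbr_shift level_shift)
qed

lemma weight_shift:
  assumes \<Lambda>: "\<Lambda> \<subseteq> Zd d" and A: "A \<subseteq> \<Lambda>"
  shows "weight d \<beta> (shift d v ` \<Lambda>) (shift d v ` A) = weight d \<beta> \<Lambda> A"
proof -
  have sp: "spin (shift d v ` A) (shift d v x) = spin A x" if "x \<in> Zd d" for x
  proof -
    have "shift d v x \<in> shift d v ` A \<longleftrightarrow> x \<in> A"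
      by (rule inj_on_image_mem_iff[OF inj_shift that]) (use A \<Lambda> in auto)
    then show ?thesis by (simp add: spin_def)
  qed
  have inj: "inj_on (\<lambda>(x, y). (shift d v x, shift d v y)) (touching d \<Lambda>)"
  proof (rule inj_onI, clarify)
    fix a b a' b' assume "(a, b) \<in> touching d \<Lambda>" "(a', b') \<in> touching d \<Lambda>"
      "shift d v a = shift d v a'" "shift d v b = shift d v b'"
    then show "a = a' \<and> b = b'"
      using inj_onD[OF inj_shift[of d v]] by (auto simp: touching_def nbr_def)
  qed
  have "(\<Sum>(x, y)\<in>touching d (shift d v ` \<Lambda>). spin (shift d v ` A) x * spin (shift d v ` A) y)
     = (\<Sum>(x, y)\<in>touching d \<Lambda>. spin A x * spin A y)"
    unfolding touching_shift[OF \<Lambda>] sum.reindex[OF inj]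
    by (intro sum.cong refl) (auto simp: sp touching_def nbr_def)
  then show ?thesis by (simp add: weight_def)
qed

definition plus_prob :: "nat \<Rightarrow> real \<Rightarrow> site set \<Rightarrow> site \<Rightarrow> real" where
  "plus_prob d \<beta> \<Lambda> x = mexp d \<beta> \<Lambda> (\<lambda>A. of_bool (x \<in> A))"

lemma plus_prob_shift:
  assumes \<Lambda>: "\<Lambda> \<subseteq> Zd d" and x: "x \<in> Zd d"
  shows "plus_prob d \<beta> (shift d v ` \<Lambda>) (shift d v x) = plus_prob d \<beta> \<Lambda> x"
proof -
  have bij: "bij_betw ((`) (shift d v)) (Pow \<Lambda>) (Pow (shift d v ` \<Lambda>))"
  proof (rule bij_betw_Pow)
    show "bij_betw (shift d v) \<Lambda> (shift d v ` \<Lambda>)"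
      using inj_on_subset[OF inj_shift \<Lambda>] by (rule inj_on_imp_bij_betw)
  qed
  have re: "(\<Sum>A\<in>Pow (shift d v ` \<Lambda>). f A) = (\<Sum>A\<in>Pow \<Lambda>. f (shift d v ` A))" for f :: "site set \<Rightarrow> real"
    by (rule sum.reindex_bij_betw[OF bij, symmetric])
  have mem: "shift d v x \<in> shift d v ` A \<longleftrightarrow> x \<in> A" if "A \<subseteq> \<Lambda>" for A
    by (rule inj_on_image_mem_iff[OF inj_shift x]) (use that \<Lambda> in auto)
  show ?thesis
    unfolding plus_prob_def expect_def re
    by (intro arg_cong2[where f="(/)"] sum.cong refl) (auto simp: weight_shift[OF \<Lambda>] mem)
qed

lemma plus_prob_le_1: "finite \<Lambda> \<Longrightarrow> 0 \<le> \<beta> \<Longrightarrow> plus_prob d \<beta> \<Lambda> x \<le> 1"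
  unfolding plus_prob_def
  using expect_mono[of \<Lambda> "weight d \<beta> \<Lambda>" "\<lambda>A. of_bool (x \<in> A)" "\<lambda>_. 1"]
    expect_const[of \<Lambda> "weight d \<beta> \<Lambda>" 1] log_supermodular_weight by simp

text \<open>Chain rule for the probability that all spins are minus.\<close>

lemma all_minus_ge:
  assumes \<beta>: "0 \<le> \<beta>" and q: "q \<le> 1"
    and le: "\<And>\<Lambda> x. finite \<Lambda> \<Longrightarrow> \<Lambda> \<subseteq> Zd d \<Longrightarrow> lexmin d \<Lambda> x \<Longrightarrow> plus_prob d \<beta> \<Lambda> x \<le> q"
    and \<Lambda>: "finite \<Lambda>" "\<Lambda> \<subseteq> Zd d"
  shows "(1 - q) ^ card \<Lambda> \<le> mexp d \<beta> \<Lambda> (\<lambda>A. of_bool (A = {}))"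
  using \<Lambda>
proof (induction "card \<Lambda>" arbitrary: \<Lambda>)
  case 0
  then have "\<Lambda> = {}" by simp
  then show ?case by (simp add: expect_def weight_def)
next
  case (Suc n)
  then have "\<Lambda> \<noteq> {}" by auto
  then obtain x where x: "lexmin d \<Lambda> x" using ex_lexmin Suc.prems by blast
  define D where "D = \<Lambda> - {x}"
  let ?w = "weight d \<beta> \<Lambda>"
  have xL: "x \<in> \<Lambda>" using x by (simp add: lexmin_def)
  have L: "\<Lambda> = insert x D" "finite D" "x \<notin> D" using xL Suc.prems by (auto simp: D_def)
  have cD: "n = card D" using Suc.hyps(2) Suc.prems xL by (simp add: D_def)
  have W: "log_supermodular \<Lambda> ?w" by (rule log_supermodular_weight[OF \<beta>])
  define Z where "Z = (\<Sum>A\<in>Pow \<Lambda>. ?w A)"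
  define ZD where "ZD = (\<Sum>A\<in>Pow D. ?w A)"
  have Z: "Z > 0" unfolding Z_def by (rule sum_weight_pos[OF Suc.prems(1) W])
  have ZD: "ZD > 0" unfolding ZD_def by (rule sum_weight_pos[OF L(2)]) (rule log_supermodular_weight[OF \<beta>])
  have "plus_prob d \<beta> \<Lambda> x * Z = (\<Sum>A\<in>Pow D. ?w (insert x A))"
  proof -
    have "plus_prob d \<beta> \<Lambda> x * Z = (\<Sum>A\<in>Pow \<Lambda>. of_bool (x \<in> A) * ?w A)"
      using Z by (simp add: plus_prob_def expect_def Z_def)
    also have "\<dots> = (\<Sum>A\<in>Pow D. of_bool (x \<in> A) * ?w A + of_bool (x \<in> insert x A) * ?w (insert x A))"
      using sum_Pow_insert[OF L(2,3), of "\<lambda>A. of_bool (x \<in> A) * ?w A"] L(1) by simp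
    also have "\<dots> = (\<Sum>A\<in>Pow D. ?w (insert x A))"
      using L(3) by (intro sum.cong refl) auto
    finally show ?thesis .
  qed
  moreover have "Z = ZD + (\<Sum>A\<in>Pow D. ?w (insert x A))"
    using sum_Pow_insert[OF L(2,3), of ?w] L(1) by (simp add: Z_def ZD_def sum.distrib)
  \<comment> \<open>\<open>ZD / Z\<close> is the probability of a minus spin at x, and given this
    event the other spins follow the minus measure on D.\<close>
  ultimately have ZZ: "ZD = (1 - plus_prob d \<beta> \<Lambda> x) * Z" by (simp add: algebra_simps)
  have em: "(\<Sum>A\<in>Pow S. of_bool (A = {}) * w A) = w {}" if "finite S" for S :: "site set" and w :: "site set \<Rightarrow> real"
  proof -
    have "(\<Sum>A\<in>Pow S. of_bool (A = {}) * w A) = (\<Sum>A\<in>Pow S. if A = {} then w {} else 0)"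
      by (intro sum.cong) auto
    then show ?thesis using that by (simp add: sum.delta)
  qed
  have "mexp d \<beta> D (\<lambda>A. of_bool (A = {})) = expect ?w D (\<lambda>A. of_bool (A = {}))"
    using Suc.prems by (intro mexp_subset[symmetric]) (auto simp: D_def)
  also have "\<dots> = ?w {} / ZD" unfolding expect_def em[OF L(2)] ZD_def ..
  finally have eD: "mexp d \<beta> D (\<lambda>A. of_bool (A = {})) = ?w {} / ZD" .
  have eL: "mexp d \<beta> \<Lambda> (\<lambda>A. of_bool (A = {})) = ?w {} / Z"
    unfolding expect_def em[OF Suc.prems(1)] Z_def ..
  have "(1 - q) ^ card \<Lambda> = (1 - q) * (1 - q) ^ card D" using Suc.hyps(2) cD by (metis power_Suc)
  also have "\<dots> \<le> (1 - plus_prob d \<beta> \<Lambda> x) * mexp d \<beta> D (\<lambda>A. of_bool (A = {}))"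
  proof (rule mult_mono)
    show "1 - q \<le> 1 - plus_prob d \<beta> \<Lambda> x" using le[OF Suc.prems x] by simp
    show "(1 - q) ^ card D \<le> mexp d \<beta> D (\<lambda>A. of_bool (A = {}))"
      using Suc.hyps(1)[OF cD] Suc.prems by (auto simp: D_def)
    show "0 \<le> 1 - plus_prob d \<beta> \<Lambda> x" using plus_prob_le_1[OF Suc.prems(1) \<beta>] by simp
  qed (use q in auto)
  also have "\<dots> = ?w {} / Z"
  proof -
    have "1 - plus_prob d \<beta> \<Lambda> x \<noteq> 0" using ZZ ZD by auto
    then show ?thesis unfolding eD ZZ using Z by simp
  qed
  finally show ?case unfolding eL .
qed

text \<open>Flipping all spins in \<open>\<Lambda>\<close> turns the minus into the plus boundary condition, for which all
  terms of the high temperature expansion are nonnegative.\<close>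

lemma partition_ge:
  assumes \<beta>: "0 \<le> \<beta>" and \<Lambda>: "finite \<Lambda>"
  shows "2 ^ card \<Lambda> * cosh \<beta> ^ card (touching d \<Lambda>) \<le> (\<Sum>A\<in>Pow \<Lambda>. weight d \<beta> \<Lambda> A)"
proof -
  let ?T = "touching d \<Lambda>"
  \<comment> \<open>Only endpoints inside the region carry a variable spin; after the flip a
    boundary edge acts as a positive field on its inner endpoint.\<close>
  define b where "b = (\<lambda>(x, y). {x, y} \<inter> \<Lambda>)"
  have fT: "finite ?T" by (rule finite_touching[OF \<Lambda>])
  have "(\<Sum>A\<in>Pow \<Lambda>. weight d \<beta> \<Lambda> A) = (\<Sum>A\<in>Pow \<Lambda>. weight d \<beta> \<Lambda> (\<Lambda> - A))"
    by (rule sum.reindex_bij_witness[where i="\<lambda>A. \<Lambda> - A" and j="\<lambda>A. \<Lambda> - A"]) (auto intro!: arg_cong[where f="weight d \<beta> \<Lambda>"])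
  also have "\<dots> = (\<Sum>A\<in>Pow \<Lambda>. exp (\<Sum>e\<in>?T. \<beta> * chi (b e) A))"
  proof (intro sum.cong refl)
    fix A
    have "spin (\<Lambda> - A) x * spin (\<Lambda> - A) y = chi (b (x, y)) A" if xy: "(x, y) \<in> ?T" for x y
    proof -
      have "x \<noteq> y" using xy by (auto simp: touching_def)
      have s: "spin (\<Lambda> - A) z = - spin A z" if "z \<in> \<Lambda>" for z using that by (auto simp: spin_def)
      have s': "spin (\<Lambda> - A) z = - 1" if "z \<notin> \<Lambda>" for z using that by (auto simp: spin_def)
      consider "x \<in> \<Lambda>" "y \<in> \<Lambda>" | "x \<in> \<Lambda>" "y \<notin> \<Lambda>" | "x \<notin> \<Lambda>" "y \<in> \<Lambda>" using xy by (auto simp: touching_def)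
      then show ?thesis
      proof cases
        case 1
        then have "b (x, y) = {x, y}" by (auto simp: b_def)
        then show ?thesis using 1 s \<open>x \<noteq> y\<close> by (simp add: chi_def)
      next
        case 2
        then have "b (x, y) = {x}" by (auto simp: b_def)
        then show ?thesis using 2 s s' by (simp add: chi_def)
      next
        case 3
        then have "b (x, y) = {y}" by (auto simp: b_def)
        then show ?thesis using 3 s s' by (simp add: chi_def)
      qed
    qed
    then have "(\<Sum>(x, y)\<in>?T. spin (\<Lambda> - A) x * spin (\<Lambda> - A) y) = (\<Sum>e\<in>?T. chi (b e) A)"
      by (intro sum.cong refl) auto
    then show "weight d \<beta> \<Lambda> (\<Lambda> - A) = exp (\<Sum>e\<in>?T. \<beta> * chi (b e) A)"
      by (simp add: weight_def sum_distrib_left)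
  qed
  also have "\<dots> = (\<Sum>A\<in>Pow \<Lambda>. \<Prod>e\<in>?T. cosh \<beta> + sinh \<beta> * chi (b e) A)"
    unfolding exp_sum_chi[OF fT] ..
  also have "2 ^ card \<Lambda> * (\<Prod>e\<in>?T. cosh \<beta>) \<le> \<dots>"
    by (rule sum_chi_prod_ge[OF \<Lambda> fT]) (use \<beta> in \<open>auto simp: b_def cosh_real_nonneg sinh_real_nonneg_iff\<close>)
  finally show ?thesis by simp
qed

section \<open>Large cubes of minus spins\<close>

definition cube :: "nat \<Rightarrow> nat \<Rightarrow> site set" where
  "cube d n = {..<d} \<rightarrow>\<^sub>E {0..<int n}"

lemma cube: "finite (cube d n)" "cube d n \<subseteq> Zd d" "card (cube d n) = n ^ d"
  by (auto simp: cube_def Zd_def card_PiE intro!: finite_PiE)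

text \<open>In each of the d directions the cube consists of n^(d - 1) lines of n sites, each
  touched by n + 1 edges.\<close>

lemma card_touching_cube:
  assumes d: "d > 0" shows "card (touching d (cube d n)) \<le> d * ((n + 1) * n ^ (d - 1))"
proof -
  define X where "X i = Pi\<^sub>E {..<d} (\<lambda>j. if j = i then {-1..<int n} else {0..<int n})" for i
  have fX: "finite (X i)" for i unfolding X_def by (intro finite_PiE) auto
  have cX: "card (X i) = (n + 1) * n ^ (d - 1)" if "i < d" for i
  proof -
    have "card (X i) = (\<Prod>j<d. card (if j = i then {-1..<int n} else {0..<int n}))"
      unfolding X_def by (rule card_PiE) simp
    also have "\<dots> = (n + 1) * (\<Prod>j\<in>{..<d} - {i}. card (if j = i then {-1..<int n} else {0..<int n}))"
    proof -
      have c: "card {-1..<int n} = n + 1" by (simp add: nat_add_distrib)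
      have "(\<Prod>j<d. card (if j = i then {-1..<int n} else {0..<int n}))
        = card (if i = i then {-1..<int n} else {0..<int n}) * (\<Prod>j\<in>{..<d} - {i}. card (if j = i then {-1..<int n} else {0..<int n}))"
        by (rule prod.remove) (use that in auto)
      then show ?thesis by (simp only: if_True refl c)
    qed
    also have "(\<Prod>j\<in>{..<d} - {i}. card (if j = i then {-1..<int n} else {0..<int n})) = (\<Prod>j\<in>{..<d} - {i}. n)"
      by (intro prod.cong) auto
    finally show ?thesis using that by simp
  qed
  have "touching d (cube d n) \<subseteq> (\<Union>i<d. (\<lambda>x. (x, x(i := x i + 1))) ` X i)"
  proof
    fix e assume "e \<in> touching d (cube d n)"
    then obtain x y where e: "e = (x, y)" "nbr d x y" "level d y = level d x + 1" "x \<in> cube d n \<or> y \<in> cube d n"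
      by (auto simp: touching_def)
    obtain i where i: "i < d" "y = x(i := x i + 1)" and xZ: "x \<in> Zd d"
    proof -
      have xZ: "x \<in> Zd d" using e(2) by (simp add: nbr_def)
      from e(2) obtain i where i: "i < d" "y = x(i := x i + 1) \<or> y = x(i := x i - 1)"
        unfolding nbr_iff by blast
      from i(2) have "y = x(i := x i + 1)"
      proof
        assume "y = x(i := x i - 1)"
        then have "level d y = level d x - 1" using level_upd[OF i(1)] by simp
        then show ?thesis using e(3) by simp
      qed
      from that[OF i(1) this xZ] show thesis .
    qed
    have "x \<in> X i"
      unfolding X_def
    proof (rule PiE_I)
      fix j assume j: "j \<in> {..<d}"
      from e(4) show "x j \<in> (if j = i then {-1..<int n} else {0..<int n})"
      proof
        assume "x \<in> cube d n"
        then have "x j \<in> {0..<int n}" using j unfolding cube_def by (rule PiE_mem)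
        then show ?thesis by (cases "j = i") simp_all
      next
        assume "y \<in> cube d n"
        then have "y j \<in> {0..<int n}" using j unfolding cube_def by (rule PiE_mem)
        then show ?thesis unfolding i(2) by (cases "j = i") simp_all
      qed
    next
      fix j assume "j \<notin> {..<d}"
      then show "x j = undefined" using xZ unfolding Zd_def by (rule PiE_arb[rotated])
    qed
    then show "e \<in> (\<Union>i<d. (\<lambda>x. (x, x(i := x i + 1))) ` X i)" using e i by auto
  qed
  then have "card (touching d (cube d n)) \<le> card (\<Union>i<d. (\<lambda>x. (x, x(i := x i + 1))) ` X i)"
    using fX by (intro card_mono) auto
  also have "\<dots> \<le> (\<Sum>i<d. card ((\<lambda>x. (x, x(i := x i + 1))) ` X i))" by (rule card_UN_le) simp
  also have "\<dots> \<le> (\<Sum>i<d. (n + 1) * n ^ (d - 1))"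
  proof (rule sum_mono)
    fix i assume "i \<in> {..<d}"
    then show "card ((\<lambda>x. (x, x(i := x i + 1))) ` X i) \<le> (n + 1) * n ^ (d - 1)"
      using card_image_le[OF fX, of "\<lambda>x. (x, x(i := x i + 1))" i] cX[of i] by simp
  qed
  finally show ?thesis by simp
qed

text \<open>Otherwise \<open>all_minus_ge\<close> and \<open>partition_ge\<close> on a cube of side
  n would give (2 (1 - q))^(n^d) \<le> (1 + tanh \<beta>)^T, where T counts the touching edges: all
  minus has weight exp \<beta> per edge, and exp \<beta> / cosh \<beta> = 1 + tanh \<beta>. This is
  absurd for large n, since T is close to d n^d.\<close>

lemma ex_plus_prob_gt:
  assumes d: "d > 0" and \<beta>: "0 \<le> \<beta>" and q: "q \<le> 1" and gt: "(1 + tanh \<beta>) ^ d < 2 * (1 - q)"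
  shows "\<exists>\<Lambda> x. finite \<Lambda> \<and> \<Lambda> \<subseteq> Zd d \<and> lexmin d \<Lambda> x \<and> q < plus_prob d \<beta> \<Lambda> x"
proof (rule ccontr)
  assume "\<not> ?thesis"
  then have le: "plus_prob d \<beta> \<Lambda> x \<le> q" if "finite \<Lambda>" "\<Lambda> \<subseteq> Zd d" "lexmin d \<Lambda> x" for \<Lambda> x
    using that by (meson not_le)
  define a where "a = 2 * (1 - q)"
  define c where "c = (1 + tanh \<beta>) ^ d"
  have t: "1 \<le> 1 + tanh \<beta>" using \<beta> by simp
  have c1: "1 \<le> c" unfolding c_def using t by (rule one_le_power)
  have ac: "c < a" using gt by (simp add: a_def c_def)
  have key: "a ^ n \<le> c ^ (n + 1)" if n: "n \<ge> 1" for n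
  proof -
    let ?B = "cube d n" and ?T = "card (touching d (cube d n))"
    \<comment> \<open>Volume and edge bound are the multiples n N and d (n + 1) N, so N-th roots can
      be taken on both sides.\<close>
    define N where "N = n ^ (d - 1)"
    have N: "N > 0" using n by (simp add: N_def)
    have nd: "n ^ d = n * N" unfolding N_def using d by (simp add: power_eq_if)
    have em: "(\<Sum>A\<in>Pow ?B. of_bool (A = {}) * weight d \<beta> ?B A) = exp \<beta> ^ ?T"
    proof -
      have "(\<Sum>A\<in>Pow ?B. of_bool (A = {}) * weight d \<beta> ?B A) = (\<Sum>A\<in>Pow ?B. if A = {} then weight d \<beta> ?B {} else 0)"
        by (intro sum.cong) auto
      also have "\<dots> = weight d \<beta> ?B {}" using cube(1) by (simp add: sum.delta)
      also have "\<dots> = exp (\<beta> * real ?T)" by (simp add: weight_def spin_def case_prod_unfold)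
      finally show ?thesis by (simp add: exp_of_nat_mult[symmetric] mult.commute)
    qed
    have "(1 - q) ^ (n ^ d) \<le> mexp d \<beta> ?B (\<lambda>A. of_bool (A = {}))"
      using all_minus_ge[OF \<beta> q le cube(1,2), of n] by (simp add: cube(3))
    also have "\<dots> = exp \<beta> ^ ?T / (\<Sum>A\<in>Pow ?B. weight d \<beta> ?B A)" by (simp add: expect_def em)
    also have "\<dots> \<le> exp \<beta> ^ ?T / (2 ^ (n ^ d) * cosh \<beta> ^ ?T)"
    proof (rule divide_left_mono)
      have "0 < (\<Sum>A\<in>Pow ?B. weight d \<beta> ?B A)"
        by (rule sum_weight_pos[OF cube(1) log_supermodular_weight[OF \<beta>]])
      then show "0 < (\<Sum>A\<in>Pow ?B. weight d \<beta> ?B A) * (2 ^ (n ^ d) * cosh \<beta> ^ ?T)"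
        by (intro mult_pos_pos zero_less_power cosh_real_pos) auto
      show "2 ^ (n ^ d) * cosh \<beta> ^ ?T \<le> (\<Sum>A\<in>Pow ?B. weight d \<beta> ?B A)"
        using partition_ge[OF \<beta> cube(1), of d n d] by (simp add: cube(3))
    qed simp
    also have "\<dots> = (1 + tanh \<beta>) ^ ?T / 2 ^ (n ^ d)"
    proof -
      have "exp \<beta> / cosh \<beta> = 1 + tanh \<beta>"
        using cosh_real_pos[of \<beta>] by (simp add: tanh_def cosh_plus_sinh[symmetric] add_divide_distrib)
      then have "(1 + tanh \<beta>) ^ ?T = exp \<beta> ^ ?T / cosh \<beta> ^ ?T" by (simp add: power_divide[symmetric])
      then show ?thesis by (simp add: field_simps)
    qed
    finally have f1: "(1 - q) ^ (n ^ d) \<le> (1 + tanh \<beta>) ^ ?T / 2 ^ (n ^ d)" .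
    have "a ^ (n ^ d) = (1 - q) ^ (n ^ d) * 2 ^ (n ^ d)"
      by (simp only: a_def power_mult_distrib mult.commute)
    also have "\<dots> \<le> (1 + tanh \<beta>) ^ ?T / 2 ^ (n ^ d) * 2 ^ (n ^ d)" by (rule mult_right_mono[OF f1]) simp
    also have "\<dots> = (1 + tanh \<beta>) ^ ?T" by simp
    also have "\<dots> \<le> (1 + tanh \<beta>) ^ (d * ((n + 1) * N))"
      using t card_touching_cube[OF d, of n] by (intro power_increasing) (auto simp: N_def)
    also have "\<dots> = (c ^ (n + 1)) ^ N" by (simp only: c_def power_mult)
    finally have "(a ^ n) ^ N \<le> (c ^ (n + 1)) ^ N" by (simp only: nd power_mult)
    then show ?thesis using c1 by (intro power_le_imp_le_base[of "a ^ n" "N - 1"]) (use N in auto)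
  qed
  \<comment> \<open>The edges on the surface cost a single factor c, whereas powers of a / c are
    unbounded.\<close>
  obtain n where n: "c < (a / c) ^ n" using real_arch_pow[of "a / c" c] ac c1 by auto
  have "n \<noteq> 0" using n c1 by (cases "n = 0") auto
  then have "a ^ n \<le> c ^ (n + 1)" by (intro key) simp
  then have "(a / c) ^ n \<le> c" using c1 by (simp add: power_divide field_simps)
  then show False using n by simp
qed

section \<open>Domination in infinite volume\<close>

context beta_nonneg
begin

text \<open>One good region suffices. For each exposed site y it is translated so that y is its
  smallest site; the translate then avoids everything exposed before y, and monotonicity in the
  region carries the bound p over to all unexposed sites.\<close>

lemma cyl_lim_dominates:
  assumes p: "0 \<le> p" "p \<le> 1" and \<Lambda>0: "finite \<Lambda>0" "\<Lambda>0 \<subseteq> Zd d" "lexmin d \<Lambda>0 x0" "p \<le> plus_prob d \<beta> \<Lambda>0 x0"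
    and B: "finite B" "B \<subseteq> Zd d" and f: "increasing_on B f"
  shows "bernoulli_expect p B f \<le> cyl_lim d \<beta> B f"
proof (rule tendsto_lowerbound[OF cyl_convergent[OF B(1)]])
  obtain xs where xs: "distinct xs" "set xs = B" and so: "\<And>k z. k < length xs \<Longrightarrow> z \<in> set (take k xs) \<Longrightarrow> lexless d z (xs ! k)"
    using ex_lex_sorted[OF B] by blast
  have x0: "x0 \<in> Zd d" "x0 \<in> \<Lambda>0" using \<Lambda>0 by (auto simp: lexmin_def)
  define v where "v y = (\<lambda>i. y i - x0 i)" for y :: site
  have vy: "shift d (v y) x0 = y" if "y \<in> Zd d" for y
    using that x0 by (auto simp: shift_def v_def Zd_def fun_eq_iff PiE_iff extensional_def)
  define L where "L y = shift d (v y) ` \<Lambda>0" for y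
  have L: "finite (L y)" "L y \<subseteq> Zd d" for y using \<Lambda>0 shift_Zd by (auto simp: L_def)
  have Lp: "p \<le> plus_prob d \<beta> (L y) y" if "y \<in> Zd d" for y
    using plus_prob_shift[OF \<Lambda>0(2) x0(1), of \<beta> "v y"] \<Lambda>0(4) vy[OF that] by (simp add: L_def)
  have Lm: "z = y \<or> lexless d y z" if y: "y \<in> Zd d" and z: "z \<in> L y" for y z
  proof -
    obtain u where u: "u \<in> \<Lambda>0" "z = shift d (v y) u" using z by (auto simp: L_def)
    then have "u = x0 \<or> lexless d x0 u" using \<Lambda>0(3) by (auto simp: lexmin_def)
    then show ?thesis using u vy[OF y] lexless_shift[of d "v y" x0 u] by auto
  qed
  define K where "K = B \<union> (\<Union>y\<in>B. L y)"
  have K: "finite K" "K \<subseteq> Zd d" using B L by (auto simp: K_def)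
  have "bernoulli_expect p B f \<le> mexp d \<beta> \<Delta> (\<lambda>A. f (A \<inter> B))" if \<Delta>: "finite \<Delta>" "K \<subseteq> \<Delta>" "\<Delta> \<subseteq> Zd d" for \<Delta>
    unfolding xs(2)[symmetric]
  proof (rule dominates_bernoulli_finite[OF \<Delta>(1) W p xs(1)])
    show "set xs \<subseteq> \<Delta>" using \<Delta> xs by (auto simp: K_def)
    show "increasing_on (set xs) f" using f xs by simp
    fix k assume k: "k < length xs"
    define y where "y = xs ! k"
    define F where "F = set (take k xs)"
    have yB: "y \<in> B" using k xs nth_mem[OF k] by (auto simp: y_def)
    then have yZ: "y \<in> Zd d" using B by auto
    \<comment> \<open>Sites exposed before y are lexicographically smaller than y, whereas y is the
      smallest site of its translate.\<close>
    have "L y \<inter> F = {}"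
    proof (rule ccontr)
      assume "L y \<inter> F \<noteq> {}"
      then obtain z where z: "z \<in> L y" "z \<in> F" by auto
      have "lexless d z y" using so[OF k] z by (simp add: F_def y_def)
      then show False using Lm[OF yZ z(1)] lexless_irrefl lexless_trans by blast
    qed
    then have sub: "L y \<subseteq> \<Delta> - F" using \<Delta> yB by (auto simp: K_def)
    have "p \<le> plus_prob d \<beta> (L y) y" by (rule Lp[OF yZ])
    also have "\<dots> \<le> mexp d \<beta> (\<Delta> - F) (\<lambda>A. of_bool (y \<in> A))"
      unfolding plus_prob_def using \<Delta> by (intro mexp_mono[OF sub _ \<beta>]) (auto simp: increasing_on_def)
    also have "\<dots> = expect (weight d \<beta> \<Delta>) (\<Delta> - F) (\<lambda>A. of_bool (y \<in> A))"
      using \<Delta> by (intro mexp_subset[symmetric]) auto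
    finally show "p \<le> expect (weight d \<beta> \<Delta>) (\<Delta> - set (take k xs)) (\<lambda>A. of_bool (xs ! k \<in> A))"
      by (simp add: y_def F_def)
  qed
  then show "\<forall>\<^sub>F \<Delta> in finite_subsets_at_top (Zd d). bernoulli_expect p B f \<le> mexp d \<beta> \<Delta> (\<lambda>A. f (A \<inter> B))"
    unfolding eventually_finite_subsets_at_top using K by (intro exI[of _ K]) auto
qed simp

end

text \<open>A closed upward hull of a compact set is a decreasing intersection of increasing
  cylinders, so by inner regularity the comparison of increasing cylinder functions extends to
  all measurable increasing sets.\<close>

lemma measure_upset_le:
  fixes P Q :: "('a \<Rightarrow> bool) measure" and S :: "'a set"
  assumes S: "countable S" "infinite S"
    and P: "prob_space P" "sets P = sets (\<Pi>\<^sub>M x\<in>S. count_space UNIV)"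
    and Q: "prob_space Q" "sets Q = sets (\<Pi>\<^sub>M x\<in>S. count_space UNIV)"
    and le: "\<And>J g. finite J \<Longrightarrow> J \<subseteq> S \<Longrightarrow> increasing_on J g \<Longrightarrow>
        (\<integral>\<omega>. g {x \<in> J. \<omega> x} \<partial>P) \<le> (\<integral>\<omega>. g {x \<in> J. \<omega> x} \<partial>Q)"
    and U: "U \<in> sets (\<Pi>\<^sub>M x\<in>S. count_space UNIV)"
    and up: "\<And>\<omega> \<omega>'. \<omega> \<in> U \<Longrightarrow> \<omega>' \<in> S \<rightarrow>\<^sub>E UNIV \<Longrightarrow> \<omega> \<le> \<omega>' \<Longrightarrow> \<omega>' \<in> U"
  shows "measure P U \<le> measure Q U"
proof -
  interpret P: prob_space P by (rule P(1))
  interpret Q: prob_space Q by (rule Q(1))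
  let ?M = "\<Pi>\<^sub>M x\<in>S. count_space (UNIV :: bool set)"
  have spM: "space ?M = S \<rightarrow>\<^sub>E UNIV" by (simp add: space_PiM)
  have spP: "space P = S \<rightarrow>\<^sub>E UNIV" using sets_eq_imp_space_eq[OF P(2)] spM by simp
  have spQ: "space Q = S \<rightarrow>\<^sub>E UNIV" using sets_eq_imp_space_eq[OF Q(2)] spM by simp
  define e where "e = from_nat_into S"
  have bij: "bij_betw e UNIV S" unfolding e_def by (rule bij_betw_from_nat_into[OF S])
  have inj: "inj e" and ran: "range e = S" using bij by (auto simp: bij_betw_def)
  have eS: "e i \<in> S" for i using ran by auto
  have iv: "inv e (e i) = i" for i using inj by simp
  have ev: "e (inv e x) = x" if "x \<in> S" for x using that ran by (simp add: f_inv_into_f)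
  \<comment> \<open>Configurations are embedded into real sequences, a Polish space where finite
    measures are inner regular with respect to compact sets. \<open>R\<close> inverts
    \<open>T\<close> on the sequences of zeros and ones, the set \<open>D\<close> below.\<close>
  define T :: "('a \<Rightarrow> bool) \<Rightarrow> nat \<Rightarrow> real" where "T \<omega> n = of_bool (\<omega> (e n))" for \<omega> n
  define R :: "(nat \<Rightarrow> real) \<Rightarrow> 'a \<Rightarrow> bool" where "R y = (\<lambda>x\<in>S. y (inv e x) = 1)" for y
  have RT: "R (T \<omega>) = \<omega>" if "\<omega> \<in> S \<rightarrow>\<^sub>E UNIV" for \<omega>
  proof
    fix x show "R (T \<omega>) x = \<omega> x"
      using ev[of x] PiE_arb[OF that, of x] by (cases "x \<in> S") (auto simp: R_def T_def)
  qed
  let ?B = "\<Pi>\<^sub>M i\<in>(UNIV :: nat set). (borel :: real measure)"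
  have coordM: "(\<lambda>\<omega>. \<omega> x) \<in> ?M \<rightarrow>\<^sub>M count_space UNIV" if "x \<in> S" for x
    by (rule measurable_component_singleton[OF that])
  have TB: "T \<in> ?M \<rightarrow>\<^sub>M ?B"
  proof -
    have "(\<lambda>\<omega>. \<lambda>n\<in>UNIV. of_bool (\<omega> (e n)) :: real) \<in> ?M \<rightarrow>\<^sub>M ?B"
    proof (rule measurable_restrict)
      fix n :: nat
      show "(\<lambda>\<omega>. of_bool (\<omega> (e n)) :: real) \<in> borel_measurable ?M"
        by (rule measurable_compose[OF coordM[OF eS]]) simp
    qed
    moreover have "(\<lambda>\<omega>. \<lambda>n\<in>UNIV. of_bool (\<omega> (e n)) :: real) = T" by (auto simp: T_def fun_eq_iff)
    ultimately show ?thesis by (simp only:)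
  qed
  have Tm: "T \<in> P \<rightarrow>\<^sub>M borel"
    using TB unfolding measurable_cong_sets[OF P(2) sets_PiM_equal_borel[symmetric], symmetric]
    by (simp only: measurable_cong_sets[OF P(2) sets_PiM_equal_borel[symmetric]] measurable_cong_sets[OF P(2) refl])
  have coordB: "(\<lambda>y. y i) \<in> borel_measurable (borel :: (nat \<Rightarrow> real) measure)" for i
    using measurable_component_singleton[of i UNIV "\<lambda>_. borel :: real measure"]
    by (simp only: measurable_cong_sets[OF sets_PiM_equal_borel refl] UNIV_I)
  have eq1: "{y :: nat \<Rightarrow> real. y i = c} \<in> sets borel" for i c
  proof -
    have "(\<lambda>y. y i) -` {c} \<inter> space (borel :: (nat \<Rightarrow> real) measure) \<in> sets borel"
      by (rule measurable_sets[OF coordB]) simp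
    then show ?thesis by (simp add: vimage_def)
  qed
  have Rm: "R \<in> borel \<rightarrow>\<^sub>M ?M"
    unfolding R_def
  proof (rule measurable_restrict)
    fix x assume "x \<in> S"
    show "(\<lambda>y :: nat \<Rightarrow> real. y (inv e x) = 1) \<in> borel \<rightarrow>\<^sub>M count_space UNIV"
      using eq1[of "inv e x" 1] by (simp add: pred_def)
  qed
  define D where "D = {y :: nat \<Rightarrow> real. \<forall>i. y i = 0 \<or> y i = 1}"
  have D: "D \<in> sets borel"
  proof -
    have "D = (\<Inter>i. {y. y i = 0} \<union> {y. y i = 1})" by (auto simp: D_def)
    also have "\<dots> \<in> sets borel" using eq1 by (intro sets.countable_INT'') auto
    finally show ?thesis .
  qed
  define U' where "U' = (R -` U \<inter> space borel) \<inter> D"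
  have U': "U' \<in> sets borel" unfolding U'_def using measurable_sets[OF Rm U] D by auto
  define P' where "P' = distr P borel T"
  interpret P': prob_space P' unfolding P'_def by (rule P.prob_space_distr[OF Tm])
  have TD: "T \<omega> \<in> D" for \<omega> by (auto simp: D_def T_def)
  have UP: "U \<in> sets P" using U P(2) by simp
  have PU: "measure P U = measure P' U'"
  proof -
    have "T -` U' \<inter> space P = U"
      using RT TD sets.sets_into_space[OF UP] by (auto simp: U'_def spP)
    then show ?thesis unfolding P'_def using measure_distr[OF Tm U'] by simp
  qed
  have "measure P' U' \<le> measure Q U + \<epsilon>" if \<epsilon>: "\<epsilon> > 0" for \<epsilon>
  proof -
    have sP': "sets P' = sets borel" by (simp add: P'_def)
    have "emeasure P' U' = (SUP K\<in>{K. K \<subseteq> U' \<and> compact K}. emeasure P' K)"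
      by (rule inner_regular[OF sP' _ U']) simp
    moreover have "ennreal (measure P' U' - \<epsilon>) < emeasure P' U' \<or> measure P' U' \<le> \<epsilon>"
      using \<epsilon> by (auto simp: P'.emeasure_eq_measure ennreal_less_iff)
    ultimately consider "measure P' U' \<le> \<epsilon>" | K where "K \<subseteq> U'" "compact K" "ennreal (measure P' U' - \<epsilon>) < emeasure P' K"
      by (auto simp: less_SUP_iff)
    then show ?thesis
    proof cases
      case 1
      then show ?thesis using measure_nonneg[of Q U] by linarith
    next
      case (2 K)
      have Km: "K \<in> sets borel" using 2(2) by (rule borel_compact)
      have mK: "measure P' U' - \<epsilon> \<le> measure P' K"
        using 2(3) by (simp add: P'.emeasure_eq_measure ennreal_less_iff) (metis ennreal_less_iff less_imp_le measure_nonneg ennreal_neg linorder_le_cases order_trans)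
      define J where "J n = e ` {..<n}" for n :: nat
      define g where "g n A = (of_bool (\<exists>k\<in>K. \<forall>i<n. k i = 1 \<longrightarrow> e i \<in> A) :: real)" for n A
      \<comment> \<open>The increasing cylinder of configurations that lie above some member of K on
        the first n sites.\<close>
      define V where "V n = {\<omega> \<in> space ?M. \<exists>k\<in>K. \<forall>i<n. k i = 1 \<longrightarrow> \<omega> (e i)}" for n
      have gV: "g n {x \<in> J n. \<omega> x} = indicator (V n) \<omega>" if "\<omega> \<in> space ?M" for n \<omega>
      proof -
        have "e i \<in> {x \<in> J n. \<omega> x} \<longleftrightarrow> \<omega> (e i)" if "i < n" for i using that by (auto simp: J_def)
        then show ?thesis using that by (auto simp: g_def V_def indicator_def of_bool_def)
      qed
      have V: "V n \<in> sets ?M" for n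
      proof -
        have "V n = (\<Union>I\<in>{I. I \<subseteq> {..<n} \<and> (\<exists>k\<in>K. {i. i < n \<and> k i = 1} = I)}. {\<omega> \<in> space ?M. \<forall>i\<in>I. \<omega> (e i)})"
          (is "_ = ?W")
        proof (rule set_eqI, rule iffI)
          fix \<omega> assume "\<omega> \<in> V n"
          then obtain k where k: "k \<in> K" "\<forall>i<n. k i = 1 \<longrightarrow> \<omega> (e i)" "\<omega> \<in> space ?M" unfolding V_def by blast
          show "\<omega> \<in> ?W"
          proof (rule UN_I[of "{i. i < n \<and> k i = 1}"])
            show "{i. i < n \<and> k i = 1} \<in> {I. I \<subseteq> {..<n} \<and> (\<exists>k\<in>K. {i. i < n \<and> k i = 1} = I)}" using k(1) by blast
            show "\<omega> \<in> {\<omega> \<in> space ?M. \<forall>i\<in>{i. i < n \<and> k i = 1}. \<omega> (e i)}" using k(2,3) by blast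
          qed
        next
          fix \<omega> assume "\<omega> \<in> ?W"
          then obtain k where k: "k \<in> K" "\<forall>i\<in>{i. i < n \<and> k i = 1}. \<omega> (e i)" "\<omega> \<in> space ?M" by blast
          then show "\<omega> \<in> V n" unfolding V_def by blast
        qed
        also have "\<dots> \<in> sets ?M"
        proof (rule sets.finite_UN)
          show "finite {I. I \<subseteq> {..<n} \<and> (\<exists>k\<in>K. {i. i < n \<and> k i = 1} = I)}"
            by (rule finite_subset[of _ "Pow {..<n}"]) auto
          fix I assume I: "I \<in> {I. I \<subseteq> {..<n} \<and> (\<exists>k\<in>K. {i. i < n \<and> k i = 1} = I)}"
          show "{\<omega> \<in> space ?M. \<forall>i\<in>I. \<omega> (e i)} \<in> sets ?M"
          proof (rule sets.sets_Collect_finite_All)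
            show "finite I" using I finite_subset[of I "{..<n}"] by auto
            show "{\<omega> \<in> space ?M. \<omega> (e i)} \<in> sets ?M" for i
              using coordM[OF eS[of i]] by (simp add: pred_def)
          qed
        qed
        finally show ?thesis .
      qed
      have "measure P' K \<le> measure P (V n)" for n
      proof -
        have "measure P' K = measure P (T -` K \<inter> space P)" unfolding P'_def by (rule measure_distr[OF Tm Km])
        also have "\<dots> \<le> measure P (V n)"
        proof (rule P.finite_measure_mono)
          show "T -` K \<inter> space P \<subseteq> V n"
          proof
            fix \<omega> assume \<omega>: "\<omega> \<in> T -` K \<inter> space P"
            then have "T \<omega> \<in> K" by simp
            moreover have "\<forall>i<n. T \<omega> i = 1 \<longrightarrow> \<omega> (e i)" by (auto simp: T_def)
            ultimately show "\<omega> \<in> V n" using \<omega> by (auto simp: V_def spP spM)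
          qed
          show "V n \<in> sets P" using V P(2) by simp
        qed
        finally show ?thesis .
      qed
      moreover have "measure P (V n) \<le> measure Q (V n)" for n
      proof -
        have "measure P (V n) = (\<integral>\<omega>. indicator (V n) \<omega> \<partial>P)" using V P(2) by simp
        also have "\<dots> = (\<integral>\<omega>. g n {x \<in> J n. \<omega> x} \<partial>P)"
          by (intro Bochner_Integration.integral_cong gV[symmetric] refl) (simp add: spP spM)
        also have "\<dots> \<le> (\<integral>\<omega>. g n {x \<in> J n. \<omega> x} \<partial>Q)"
        proof (rule le)
          show "finite (J n)" "J n \<subseteq> S" using eS by (auto simp: J_def)
          show "increasing_on (J n) (g n)"
            unfolding increasing_on_def
          proof (intro allI impI)
            fix A A' :: "'a set" assume "A \<subseteq> A'"
            then have "(\<exists>k\<in>K. \<forall>i<n. k i = 1 \<longrightarrow> e i \<in> A) \<Longrightarrow> (\<exists>k\<in>K. \<forall>i<n. k i = 1 \<longrightarrow> e i \<in> A')" by blast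
            then show "g n A \<le> g n A'" by (auto simp: g_def)
          qed
        qed
        also have "\<dots> = (\<integral>\<omega>. indicator (V n) \<omega> \<partial>Q)"
          by (intro Bochner_Integration.integral_cong gV refl) (simp add: spQ spM)
        also have "\<dots> = measure Q (V n)" using V Q(2) by simp
        finally show ?thesis .
      qed
      ultimately have KV: "measure P' K \<le> measure Q (V n)" for n by (meson order_trans)
      have "(\<lambda>n. measure Q (V n)) \<longlonglongrightarrow> measure Q (\<Inter>n. V n)"
      proof (rule Q.finite_Lim_measure_decseq)
        show "range V \<subseteq> sets Q" using V Q(2) by auto
        show "decseq V"
        proof (rule decseq_SucI, rule subsetI)
          fix n \<omega> assume "\<omega> \<in> V (Suc n)"
          then obtain k where "k \<in> K" "\<forall>i<Suc n. k i = 1 \<longrightarrow> \<omega> (e i)" "\<omega> \<in> space ?M" unfolding V_def by blast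
          then show "\<omega> \<in> V n" unfolding V_def using less_SucI by blast
        qed
      qed
      then have "measure P' K \<le> measure Q (\<Inter>n. V n)" using KV by (intro LIMSEQ_le_const) auto
      also have "\<dots> \<le> measure Q U"
      proof (rule Q.finite_measure_mono)
        show "U \<in> sets Q" using U Q(2) by simp
        show "(\<Inter>n. V n) \<subseteq> U"
        proof
          fix \<omega> assume \<omega>: "\<omega> \<in> (\<Inter>n. V n)"
          then have "\<forall>n. \<exists>k\<in>K. \<forall>i<n. k i = 1 \<longrightarrow> \<omega> (e i)" unfolding V_def by blast
          then obtain k where k: "\<And>n. k n \<in> K" "\<And>n i. i < n \<Longrightarrow> k n i = 1 \<Longrightarrow> \<omega> (e i)" by metis
          \<comment> \<open>A limit point l of the members k n of K is again in K. Where l equals 1,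
            the members along the subsequence equal 1 eventually, since their values are 0 or 1;
            hence \<omega> lies above \<open>R l\<close>.\<close>
          have "seq_compact K" using 2(2) by (simp add: compact_eq_seq_compact_metric)
          then obtain l r where l: "l \<in> K" "strict_mono r" "(k \<circ> r) \<longlonglongrightarrow> l"
            using k(1) unfolding seq_compact_def by metis
          have lU: "R l \<in> U" "l \<in> D" using l(1) 2(1) by (auto simp: U'_def)
          have "\<omega> (e i)" if li: "l i = 1" for i
          proof -
            have "(\<lambda>n. (k \<circ> r) n i) \<longlonglongrightarrow> l i"
              by (rule continuous_on_tendsto_compose[where f="\<lambda>y :: nat \<Rightarrow> real. y i" and s=UNIV,
                    OF continuous_on_product_coordinates l(3)]) auto
            then have "eventually (\<lambda>n. (k \<circ> r) n i > 1 / 2) sequentially"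
              using li by (intro order_tendstoD(1)) auto
            moreover have "eventually (\<lambda>n. i < n) sequentially" by (rule eventually_gt_at_top)
            ultimately have "eventually (\<lambda>n. (k \<circ> r) n i > 1 / 2 \<and> i < n) sequentially"
              by eventually_elim simp
            then obtain n where n: "(k \<circ> r) n i > 1 / 2" "i < n"
              unfolding eventually_sequentially by blast
            have "k (r n) \<in> D" using k(1)[of "r n"] 2(1) by (auto simp: U'_def)
            then have "k (r n) i = 0 \<or> k (r n) i = 1" by (simp add: D_def)
            then have "k (r n) i = 1" using n(1) by fastforce
            moreover have "i < r n" using n(2) seq_suble[OF l(2), of n] by linarith
            ultimately show ?thesis using k(2) by blast
          qed
          then have imp: "\<omega> x" if "x \<in> S" "R l x" for x
            using that ev[of x] by (auto simp: R_def) metis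
          have \<omega>S: "\<omega> \<in> S \<rightarrow>\<^sub>E UNIV" using \<omega> by (auto simp: V_def spM)
          have "R l \<le> \<omega>"
          proof (rule le_funI)
            fix x show "R l x \<le> \<omega> x"
              using imp[of x] PiE_arb[OF \<omega>S, of x] by (cases "x \<in> S") (auto simp: R_def)
          qed
          then show "\<omega> \<in> U" by (rule up[OF lU(1) \<omega>S])
        qed
      qed
      finally show ?thesis using mK by linarith
    qed
  qed
  then have "measure P' U' \<le> measure Q U" by (rule field_le_epsilon)
  then show ?thesis unfolding PU .
qed

text \<open>Rescaled to the unit interval, f is within 1 / n of the average of the indicators of n
  of its superlevel sets. These are increasing events, to which \<open>measure_upset_le\<close>
  applies.\<close>

lemma integral_mono_on_le:
  fixes P Q :: "('a \<Rightarrow> bool) measure" and f :: "('a \<Rightarrow> bool) \<Rightarrow> real"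
  assumes S: "countable S" "infinite S"
    and P: "prob_space P" "sets P = sets (\<Pi>\<^sub>M x\<in>S. count_space UNIV)"
    and Q: "prob_space Q" "sets Q = sets (\<Pi>\<^sub>M x\<in>S. count_space UNIV)"
    and le: "\<And>J g. finite J \<Longrightarrow> J \<subseteq> S \<Longrightarrow> increasing_on J g \<Longrightarrow>
        (\<integral>\<omega>. g {x \<in> J. \<omega> x} \<partial>P) \<le> (\<integral>\<omega>. g {x \<in> J. \<omega> x} \<partial>Q)"
    and f: "f \<in> borel_measurable (\<Pi>\<^sub>M x\<in>S. count_space UNIV)"
    and bd: "bounded (f ` (S \<rightarrow>\<^sub>E UNIV))" and mono: "mono_on (S \<rightarrow>\<^sub>E UNIV) f"
  shows "(\<integral>\<omega>. f \<omega> \<partial>P) \<le> (\<integral>\<omega>. f \<omega> \<partial>Q)"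
proof -
  interpret P: prob_space P by (rule P(1))
  interpret Q: prob_space Q by (rule Q(1))
  let ?M = "\<Pi>\<^sub>M x\<in>S. count_space (UNIV :: bool set)"
  let ?X = "S \<rightarrow>\<^sub>E (UNIV :: bool set)"
  have spM: "space ?M = ?X" by (simp add: space_PiM)
  have spP: "space P = ?X" using sets_eq_imp_space_eq[OF P(2)] spM by simp
  have spQ: "space Q = ?X" using sets_eq_imp_space_eq[OF Q(2)] spM by simp
  obtain C where C: "\<And>\<omega>. \<omega> \<in> ?X \<Longrightarrow> \<bar>f \<omega>\<bar> \<le> C" and C0: "C > 0"
    using bd unfolding bounded_pos by auto
  have fP: "f \<in> borel_measurable P" and fQ: "f \<in> borel_measurable Q"
    using f by (simp_all only: measurable_cong_sets[OF P(2) refl] measurable_cong_sets[OF Q(2) refl])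
  have iP: "integrable P f" by (rule P.integrable_const_bound[of _ C]) (use C fP spP in auto)
  have iQ: "integrable Q f" by (rule Q.integrable_const_bound[of _ C]) (use C fQ spQ in auto)
  define h where "h \<omega> = (f \<omega> + C) / (2 * C)" for \<omega>
  have h01: "0 \<le> h \<omega>" "h \<omega> \<le> 1" if "\<omega> \<in> ?X" for \<omega>
    using C[OF that] C0 by (auto simp: h_def field_simps abs_le_iff)
  have hm: "h \<in> borel_measurable ?M" unfolding h_def using f by measurable
  have ihP: "integrable P h" and ihQ: "integrable Q h" unfolding h_def using iP iQ by auto
  define L where "L k n = {\<omega> \<in> space ?M. real k / real n \<le> h \<omega>}" for k n :: nat
  have L: "L k n \<in> sets ?M" for k n unfolding L_def using hm by measurable
  have mL: "measure P (L k n) \<le> measure Q (L k n)" for k n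
  proof (rule measure_upset_le[OF S P Q le L])
    fix \<omega> \<omega>' assume a: "\<omega> \<in> L k n" "\<omega>' \<in> ?X" "\<omega> \<le> \<omega>'"
    then have "f \<omega> \<le> f \<omega>'" using mono by (auto simp: mono_on_def L_def spM)
    then have "h \<omega> \<le> h \<omega>'" using C0 by (auto simp: h_def divide_right_mono)
    then show "\<omega>' \<in> L k n" using a by (auto simp: L_def spM)
  qed
  \<comment> \<open>The sum of indicators is the integer part of n times h.\<close>
  have approx: "(\<Sum>k=1..n. indicator (L k n) \<omega>) / n \<le> h \<omega> \<and> h \<omega> \<le> (\<Sum>k=1..n. indicator (L k n) \<omega>) / n + 1 / n"
    if \<omega>: "\<omega> \<in> ?X" and n: "n \<ge> 1" for \<omega> and n :: nat
  proof -
    define c where "c = nat \<lfloor>n * h \<omega>\<rfloor>"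
    have nh: "0 \<le> n * h \<omega>" "n * h \<omega> \<le> n" using h01[OF \<omega>] n by (auto simp: mult_left_le)
    have c: "real c \<le> n * h \<omega>" "n * h \<omega> < real c + 1" using nh by (auto simp: c_def)
    have cn: "c \<le> n" using c(1) nh(2) by linarith
    have "(\<Sum>k=1..n. indicator (L k n) \<omega> :: real) = (\<Sum>k\<in>{1..n}. if k \<in> {1..c} then 1 else 0)"
    proof (rule sum.cong[OF refl])
      fix k assume k: "k \<in> {1..n}"
      have "\<omega> \<in> L k n \<longleftrightarrow> real k \<le> n * h \<omega>" using n \<omega> by (simp add: L_def spM field_simps)
      also have "\<dots> \<longleftrightarrow> k \<le> c" using c by linarith
      finally show "indicator (L k n) \<omega> = (if k \<in> {1..c} then 1 else (0::real))" using k by (simp add: indicator_def)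
    qed
    also have "\<dots> = (\<Sum>k\<in>{1..n} \<inter> {1..c}. 1)" by (rule sum.inter_restrict[symmetric]) simp
    also have "\<dots> = real c" using cn by (simp add: Int_absorb1)
    finally show ?thesis using c n by (simp add: field_simps)
  qed
  have "(\<integral>\<omega>. h \<omega> \<partial>P) \<le> (\<integral>\<omega>. h \<omega> \<partial>Q) + 1 / n" if n: "n \<ge> 1" for n :: nat
  proof -
    have LP: "L k n \<in> sets P" "L k n \<in> sets Q" for k using L P(2) Q(2) by simp_all
    have sumP: "(\<integral>\<omega>. (\<Sum>k=1..n. indicator (L k n) \<omega>) / n + 1 / n \<partial>P) = (\<Sum>k=1..n. measure P (L k n)) / n + 1 / n"
      using LP by (simp add: Bochner_Integration.integral_sum P.emeasure_eq_measure P.prob_space)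
    have sumQ: "(\<integral>\<omega>. (\<Sum>k=1..n. indicator (L k n) \<omega>) / n \<partial>Q) = (\<Sum>k=1..n. measure Q (L k n)) / n"
      using LP by (simp add: Bochner_Integration.integral_sum Q.emeasure_eq_measure)
    have "(\<integral>\<omega>. h \<omega> \<partial>P) \<le> (\<integral>\<omega>. (\<Sum>k=1..n. indicator (L k n) \<omega>) / n + 1 / n \<partial>P)"
      using approx n spP LP ihP
      by (intro integral_mono Bochner_Integration.integrable_add integrable_divide_zero Bochner_Integration.integrable_sum)
        (auto simp: P.emeasure_eq_measure)
    also have "\<dots> \<le> (\<Sum>k=1..n. measure Q (L k n)) / n + 1 / n"
      unfolding sumP by (intro add_right_mono divide_right_mono sum_mono mL) auto
    also have "\<dots> = (\<integral>\<omega>. (\<Sum>k=1..n. indicator (L k n) \<omega>) / n \<partial>Q) + 1 / n" unfolding sumQ ..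
    also have "\<dots> \<le> (\<integral>\<omega>. h \<omega> \<partial>Q) + 1 / n"
      using approx n spQ LP ihQ
      by (intro add_right_mono integral_mono integrable_divide_zero Bochner_Integration.integrable_sum)
        (auto simp: Q.emeasure_eq_measure)
    finally show ?thesis .
  qed
  then have "(\<integral>\<omega>. h \<omega> \<partial>P) \<le> (\<integral>\<omega>. h \<omega> \<partial>Q) + e" if "e > 0" for e
  proof -
    obtain n :: nat where "1 / e < n" using reals_Archimedean2 by blast
    moreover have "0 < 1 / e" using that by simp
    ultimately have n0: "0 < real n" by linarith
    have n: "n \<ge> 1" "1 / real n \<le> e" using n0 that \<open>1 / e < n\<close> by (auto simp: field_simps)
    show ?thesis using \<open>\<And>n. n \<ge> 1 \<Longrightarrow> (\<integral>\<omega>. h \<omega> \<partial>P) \<le> (\<integral>\<omega>. h \<omega> \<partial>Q) + 1 / real n\<close>[OF n(1)] n(2) by linarith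
  qed
  then have "(\<integral>\<omega>. h \<omega> \<partial>P) \<le> (\<integral>\<omega>. h \<omega> \<partial>Q)" by (rule field_le_epsilon)
  moreover have "(\<integral>\<omega>. h \<omega> \<partial>P) = ((\<integral>\<omega>. f \<omega> \<partial>P) + C) / (2 * C)"
    unfolding h_def using iP by (simp add: P.prob_space)
  moreover have "(\<integral>\<omega>. h \<omega> \<partial>Q) = ((\<integral>\<omega>. f \<omega> \<partial>Q) + C) / (2 * C)"
    unfolding h_def using iQ by (simp add: Q.prob_space)
  ultimately show ?thesis using C0 by (simp add: divide_le_cancel)
qed

section \<open>The torus\<close>

text \<open>The representative modulo 2 L in the interval from - L to L - 1. The even side length is
  what allows reflections without fixed sites.\<close>

definition wrap :: "int \<Rightarrow> int \<Rightarrow> int" where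
  "wrap L k = (k + L) mod (2 * L) - L"

definition torus :: "nat \<Rightarrow> int \<Rightarrow> site set" where
  "torus d L = {x \<in> Zd d. \<forall>i<d. - L \<le> x i \<and> x i < L}"

text \<open>Both orientations of every edge are present, as the antisymmetric fields
  require.\<close>

definition torus_edges :: "nat \<Rightarrow> int \<Rightarrow> (site \<times> site) set" where
  "torus_edges d L = {(x, x(i := wrap L (x i + s))) | x i s. x \<in> torus d L \<and> i < d \<and> (s = 1 \<or> s = -1)}"

lemma wrap_bounds: "L > 0 \<Longrightarrow> - L \<le> wrap L k \<and> wrap L k < L"
  unfolding wrap_def using pos_mod_bound[of "2 * L" "k + L"] pos_mod_sign[of "2 * L" "k + L"] by linarith

lemma wrap_eq_iff: "wrap L j = wrap L k \<longleftrightarrow> 2 * L dvd j - k"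
  by (simp add: wrap_def mod_eq_dvd_iff)

lemma wrap_id: "- L \<le> k \<Longrightarrow> k < L \<Longrightarrow> wrap L k = k"
  by (simp add: wrap_def)

lemma wrap_dvd: "2 * L dvd wrap L k - k"
proof -
  have "wrap L k - k = - (2 * L) * ((k + L) div (2 * L))"
    unfolding wrap_def minus_div_mult_eq_mod[symmetric] by (simp add: algebra_simps)
  then show ?thesis by simp
qed

lemma wrap_eqI: "2 * L dvd j - k \<Longrightarrow> wrap L j = wrap L k"
  by (simp add: wrap_eq_iff)

lemma wrap_add_wrap: "wrap L (wrap L j + k) = wrap L (j + k)"
  using wrap_dvd[of L j] by (intro wrap_eqI) simp

lemma wrap_diff_wrap: "wrap L (k - wrap L j) = wrap L (k - j)"
  using wrap_dvd[of L j] by (intro wrap_eqI) (simp add: dvd_diff_commute)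

lemma finite_torus: "finite (torus d L)"
proof (rule finite_subset)
  show "torus d L \<subseteq> {..<d} \<rightarrow>\<^sub>E {-L..<L}" by (auto simp: torus_def Zd_def PiE_def Pi_def)
qed (intro finite_PiE, auto)

lemma torus_upd: "x \<in> torus d L \<Longrightarrow> i < d \<Longrightarrow> - L \<le> k \<Longrightarrow> k < L \<Longrightarrow> x(i := k) \<in> torus d L"
  by (auto simp: torus_def Zd_def PiE_iff extensional_def)

lemma torus_edgesI:
  "x \<in> torus d L \<Longrightarrow> i < d \<Longrightarrow> s = 1 \<or> s = -1 \<Longrightarrow> y = x(i := wrap L (x i + s)) \<Longrightarrow> (x, y) \<in> torus_edges d L"
  unfolding torus_edges_def by blast

lemma torus_edgesE:
  assumes "(x, y) \<in> torus_edges d L"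
  obtains i s where "x \<in> torus d L" "i < d" "s = 1 \<or> s = -1" "y = x(i := wrap L (x i + s))"
  using assms unfolding torus_edges_def by blast

lemma torus_edges_subset: "L > 0 \<Longrightarrow> torus_edges d L \<subseteq> torus d L \<times> torus d L"
  using wrap_bounds by (auto elim!: torus_edgesE intro!: torus_upd)

lemma torus_edges_sym:
  assumes L: "L > 0" and e: "(x, y) \<in> torus_edges d L"
  shows "(y, x) \<in> torus_edges d L"
proof -
  obtain i s where x: "x \<in> torus d L" and i: "i < d" and s: "s = 1 \<or> s = -1" and y: "y = x(i := wrap L (x i + s))"
    using e by (rule torus_edgesE)
  have yT: "y \<in> torus d L" using torus_edges_subset[OF L] e by blast
  have "wrap L (y i + - s) = wrap L (x i)" using y wrap_add_wrap[of L "x i + s" "- s"] by simp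
  also have "\<dots> = x i" using x i by (intro wrap_id) (auto simp: torus_def)
  finally have "x = y(i := wrap L (y i + - s))" by (simp add: y)
  then show ?thesis by (rule torus_edgesI[OF yT i, of "- s", rotated]) (use s in auto)
qed

lemma torus_edges_neq:
  assumes L: "L > 0" and e: "(x, y) \<in> torus_edges d L"
  shows "x \<noteq> y"
proof -
  obtain i s where x: "x \<in> torus d L" and i: "i < d" and s: "s = 1 \<or> s = -1" and y: "y = x(i := wrap L (x i + s))"
    using e by (rule torus_edgesE)
  have "wrap L (x i + s) \<noteq> wrap L (x i)"
  proof
    assume "wrap L (x i + s) = wrap L (x i)"
    then have "2 * L dvd s" by (simp add: wrap_eq_iff)
    then have "2 * L dvd 1" using s by auto
    then show False using L by (auto dest: zdvd_imp_le)
  qed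
  moreover have "wrap L (x i) = x i" using x i by (intro wrap_id) (auto simp: torus_def)
  ultimately show ?thesis using y by (metis fun_upd_same)
qed

section \<open>Reflections of the torus\<close>

lemma mod_reflect:
  fixes u L :: int
  assumes "L > 0"
  shows "(- u - 1) mod (2 * L) = 2 * L - 1 - u mod (2 * L)"
proof -
  have "(- u - 1) mod (2 * L) = (2 * L - 1 - u mod (2 * L)) mod (2 * L)"
  proof -
    have "2 * L dvd (- u - 1) - (2 * L - 1 - u mod (2 * L))"
    proof -
      have "(- u - 1) - (2 * L - 1 - u mod (2 * L)) = - (2 * L) * (u div (2 * L) + 1)"
        unfolding minus_div_mult_eq_mod[symmetric] by (simp add: algebra_simps)
      then show ?thesis by simp
    qed
    then show ?thesis by (simp only: mod_eq_dvd_iff)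
  qed
  also have "\<dots> = 2 * L - 1 - u mod (2 * L)"
    using assms pos_mod_bound[of "2 * L" u] pos_mod_sign[of "2 * L" u] by (intro mod_pos_pos_trivial) linarith+
  finally show ?thesis .
qed

text \<open>The reflection in coordinate i exchanges a and a + s, and the half consists of the L
  layers a, a - s, a - 2 s and so on. On a cycle the cut consists of two places, the given bond and
  the antipodal one, and at both a crossing bond joins mirror images.\<close>

lemma torus_reflection:
  assumes L: "L > 0" and i: "i < d" and s: "s = 1 \<or> s = -1"
  shows "bond_reflection (torus d L) (torus_edges d L) (\<lambda>z. z(i := wrap L (2 * a + s - z i)))
    {z \<in> torus d L. (s * (a - z i)) mod (2 * L) < L}"
proof -
  let ?V = "torus d L" and ?E = "torus_edges d L"
  let ?t = "\<lambda>z :: site. z(i := wrap L (2 * a + s - z i))"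
  let ?H = "{z \<in> ?V. (s * (a - z i)) mod (2 * L) < L}"
  have ss: "s * s = 1" using s by auto
  have xi: "wrap L (x i) = x i" if "x \<in> ?V" for x using that i by (intro wrap_id) (auto simp: torus_def)
  have tV: "?t x \<in> ?V" if "x \<in> ?V" for x using that wrap_bounds[OF L] i by (intro torus_upd) auto
  show ?thesis
  proof
    show "finite ?V" by (rule finite_torus)
    show "?E \<subseteq> ?V \<times> ?V" by (rule torus_edges_subset[OF L])
    show "(y, x) \<in> ?E" if "(x, y) \<in> ?E" for x y using torus_edges_sym[OF L that] .
    show "?H \<subseteq> ?V" by blast
    show "?t x \<in> ?V" if "x \<in> ?V" for x by (rule tV[OF that])
    show "?t (?t x) = x" if "x \<in> ?V" for x
      using xi[OF that] by (simp add: wrap_diff_wrap)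
    show "?t x \<in> ?H \<longleftrightarrow> x \<notin> ?H" if x: "x \<in> ?V" for x
    proof -
      define u where "u = s * (a - x i)"
      have "2 * L dvd s * (a - wrap L (2 * a + s - x i)) - (- u - 1)"
      proof -
        have "s * (a - wrap L (2 * a + s - x i)) - (- u - 1)
            = - s * (wrap L (2 * a + s - x i) - (2 * a + s - x i)) + (1 - s * s)"
          unfolding u_def by (simp add: algebra_simps)
        then show ?thesis using wrap_dvd[of L] ss by simp
      qed
      then have "(s * (a - ?t x i)) mod (2 * L) = (- u - 1) mod (2 * L)" by (simp add: mod_eq_dvd_iff)
      also have "\<dots> = 2 * L - 1 - u mod (2 * L)" by (rule mod_reflect[OF L])
      finally have "?t x \<in> ?H \<longleftrightarrow> 2 * L - 1 - u mod (2 * L) < L" using tV[OF x] by simp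
      also have "\<dots> \<longleftrightarrow> \<not> (u mod (2 * L) < L)" by linarith
      also have "\<dots> \<longleftrightarrow> x \<notin> ?H" using x by (simp add: u_def)
      finally show ?thesis .
    qed
    show "(?t x, ?t y) \<in> ?E" if e: "(x, y) \<in> ?E" for x y
    proof -
      obtain j t where x: "x \<in> ?V" and j: "j < d" and t: "t = 1 \<or> t = -1" and y: "y = x(j := wrap L (x j + t))"
        using e by (rule torus_edgesE)
      show ?thesis
      proof (cases "j = i")
        case False
        then have "?t y = (?t x)(j := wrap L (?t x j + t))" by (simp add: y fun_upd_twist)
        then show ?thesis by (rule torus_edgesI[OF tV[OF x] j t])
      next
        case True
        have "wrap L (2 * a + s - wrap L (x i + t)) = wrap L (wrap L (2 * a + s - x i) + - t)"
          unfolding wrap_diff_wrap wrap_add_wrap by (simp add: algebra_simps)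
        then have "?t y = (?t x)(i := wrap L (?t x i + - t))" by (simp add: y True)
        then show ?thesis by (rule torus_edgesI[OF tV[OF x] i, of "- t", rotated]) (use t in auto)
      qed
    qed
    show "y = ?t x" if e: "(x, y) \<in> ?E" and xH: "x \<in> ?H" and yH: "y \<notin> ?H" for x y
    proof -
      obtain j t where x: "x \<in> ?V" and j: "j < d" and t: "t = 1 \<or> t = -1" and y: "y = x(j := wrap L (x j + t))"
        using e by (rule torus_edgesE)
      have yV: "y \<in> ?V" using e torus_edges_subset[OF L] by blast
      have ji: "j = i"
      proof (rule ccontr)
        assume "j \<noteq> i"
        then have "y i = x i" by (simp add: y)
        then show False using xH yH yV by simp
      qed
      define u where "u = s * (a - x i)"
      define r where "r = u mod (2 * L)"
      have r: "0 \<le> r" "r < L" using xH L by (auto simp: r_def u_def)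
      have ur: "2 * L dvd u - r" unfolding r_def by (simp add: dvd_minus_mod)
      have "2 * L dvd s * (a - y i) - (r - s * t)"
      proof -
        have "s * (a - y i) - (r - s * t) = - s * (wrap L (x i + t) - (x i + t)) + (u - r)"
          unfolding u_def y ji by (simp add: algebra_simps)
        then show ?thesis by (simp only:) (intro dvd_add dvd_mult wrap_dvd ur)
      qed
      then have "(s * (a - y i)) mod (2 * L) = (r - s * t) mod (2 * L)" by (simp add: mod_eq_dvd_iff)
      then have ge: "L \<le> (r - s * t) mod (2 * L)" using yH yV by simp
      have key: "2 * L dvd (x i + t) - (2 * a + s - x i)"
      proof (cases "s * t = 1")
        case True
        then have ts: "t = s" using s t by auto
        \<comment> \<open>Moving in direction s leaves the half only from layer a, across the given
          bond.\<close>
        have "r = 0"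
        proof (rule ccontr)
          assume "r \<noteq> 0"
          then have "(r - s * t) mod (2 * L) = r - 1" using r True L by (simp add: mod_pos_pos_trivial)
          then show False using ge r by linarith
        qed
        then have "2 * L dvd s * (a - x i)" using ur by (simp add: u_def)
        then have "2 * L dvd s * (s * (a - x i)) * (- 2)" by (rule dvd_mult2[OF dvd_mult])
        also have "s * (s * (a - x i)) * (- 2) = (x i + t) - (2 * a + s - x i)"
        proof -
          have "s * (s * (a - x i)) * (- 2) = (s * s) * (a - x i) * (- 2)" by (simp only: mult.assoc)
          also have "\<dots> = (x i + t) - (2 * a + s - x i)" unfolding ss ts by simp
          finally show ?thesis .
        qed
        finally show ?thesis .
      next
        case False
        then have st: "s * t = -1" and ts: "t = - s" using s t by auto
        \<comment> \<open>Moving in direction - s leaves the half only from its last layer, across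
          the antipodal bond; the mirror image agrees with the neighbour modulo 2 L.\<close>
        have "r = L - 1"
        proof (rule ccontr)
          assume "r \<noteq> L - 1"
          then have "(r - s * t) mod (2 * L) = r + 1" using r st L by (simp add: mod_pos_pos_trivial)
          then show False using ge r \<open>r \<noteq> L - 1\<close> by linarith
        qed
        then have "2 * L dvd s * (a - x i) - (L - 1)" using ur by (simp add: u_def)
        then have "2 * L dvd (- 2 * s) * (s * (a - x i) - (L - 1)) + (- s) * (2 * L)" by (rule dvd_add[OF dvd_mult dvd_mult[OF dvd_refl]])
        also have "(- 2 * s) * (s * (a - x i) - (L - 1)) + (- s) * (2 * L) = (x i + t) - (2 * a + s - x i)"
        proof -
          have "(- 2 * s) * (s * (a - x i) - (L - 1)) + (- s) * (2 * L) = - 2 * (s * s) * (a - x i) - 2 * s"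
            by (simp add: algebra_simps)
          also have "\<dots> = (x i + t) - (2 * a + s - x i)" unfolding ss ts by simp
          finally show ?thesis .
        qed
        finally show ?thesis .
      qed
      then show ?thesis using wrap_eqI[OF key] by (simp add: y ji)
    qed
  qed
qed

lemma torus_bonds:
  assumes L: "L > 0" and e: "(x, y) \<in> torus_edges d L"
  shows "\<exists>\<theta> H. bond_reflection (torus d L) (torus_edges d L) \<theta> H \<and> x \<in> H \<and> y \<notin> H"
proof -
  obtain i s where x: "x \<in> torus d L" and i: "i < d" and s: "s = 1 \<or> s = -1" and y: "y = x(i := wrap L (x i + s))"
    using e by (rule torus_edgesE)
  have ss: "s * s = 1" using s by auto
  have "2 * L dvd s * (x i - y i) - (- 1)"
  proof -
    have "s * (x i - y i) - (- 1) = - s * (wrap L (x i + s) - (x i + s)) + (1 - s * s)"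
      by (simp add: y algebra_simps)
    then show ?thesis using wrap_dvd[of L] ss by simp
  qed
  then have "(s * (x i - y i)) mod (2 * L) = (- 1) mod (2 * L)" by (simp add: mod_eq_dvd_iff)
  also have "\<dots> = 2 * L - 1" using mod_reflect[OF L, of 0] by simp
  finally have "\<not> (s * (x i - y i)) mod (2 * L) < L" using L by simp
  then have "x \<in> {z \<in> torus d L. (s * (x i - z i)) mod (2 * L) < L}"
      "y \<notin> {z \<in> torus d L. (s * (x i - z i)) mod (2 * L) < L}"
    using x L by auto
  then show ?thesis using torus_reflection[OF L i s, of "x i"] by blast
qed

section \<open>Balls in the torus\<close>

definition ball1 :: "nat \<Rightarrow> nat \<Rightarrow> site set" where
  "ball1 d n = {x \<in> Zd d. (\<Sum>i<d. \<bar>x i\<bar>) \<le> int n}"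

lemma coord_le_ball1: "x \<in> ball1 d n \<Longrightarrow> i < d \<Longrightarrow> \<bar>x i\<bar> \<le> int n"
  using member_le_sum[of i "{..<d}" "\<lambda>i. \<bar>x i\<bar>"] by (auto simp: ball1_def)

lemma ball1_torus: "int n < L \<Longrightarrow> ball1 d n \<subseteq> torus d L"
proof
  fix x assume L: "int n < L" and x: "x \<in> ball1 d n"
  have "- L \<le> x i \<and> x i < L" if "i < d" for i using coord_le_ball1[OF x that] L by linarith
  then show "x \<in> torus d L" using x by (auto simp: torus_def ball1_def)
qed

lemma finite_ball1: "finite (ball1 d n)"
  by (rule finite_subset[OF ball1_torus[of n "int n + 1"] finite_torus]) simp

lemma torus_edges_nbr:
  assumes L: "L \<ge> 2" and x: "x \<in> torus d L" and int: "\<And>i. i < d \<Longrightarrow> \<bar>x i\<bar> + 1 < L"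
  shows "(x, y) \<in> torus_edges d L \<longleftrightarrow> nbr d x y"
proof -
  have w: "wrap L (x i + s) = x i + s" if "i < d" "s = 1 \<or> s = -1" for i s
    using int[OF that(1)] that(2) by (intro wrap_id) auto
  show ?thesis
  proof
    assume "(x, y) \<in> torus_edges d L"
    then obtain i s where "i < d" "s = 1 \<or> s = -1" "y = x(i := wrap L (x i + s))" by (rule torus_edgesE)
    then show "nbr d x y" using w x by (auto simp: nbr_iff torus_def)
  next
    assume "nbr d x y"
    then obtain i where i: "i < d" "y = x(i := x i + 1) \<or> y = x(i := x i + -1)" by (auto simp: nbr_iff)
    then obtain s where s: "s = 1 \<or> s = -1" "y = x(i := x i + s)" by blast
    show "(x, y) \<in> torus_edges d L" by (rule torus_edgesI[OF x i(1) s(1)]) (use s w i in auto)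
  qed
qed

text \<open>For n + 1 < L no edge at the ball wraps around, so torus edges there are lattice edges.
  They occur in both orientations, whereas \<open>touching\<close> lists the upward one.\<close>

lemma torus_edges_touching:
  assumes L: "int n + 1 < L"
  shows "{(x, y) \<in> torus_edges d L. x \<in> ball1 d n \<or> y \<in> ball1 d n}
    = touching d (ball1 d n) \<union> prod.swap ` touching d (ball1 d n)"
proof -
  have L2: "L \<ge> 2 \<or> n = 0" "L > 0" using L by auto
  have *: "(x, y) \<in> torus_edges d L \<longleftrightarrow> nbr d x y" if "x \<in> ball1 d n" for x y
  proof (rule torus_edges_nbr)
    show "L \<ge> 2" using L by simp
    show "x \<in> torus d L" using ball1_torus[of n L] L that by auto
    show "\<bar>x i\<bar> + 1 < L" if "i < d" for i using coord_le_ball1[OF \<open>x \<in> ball1 d n\<close> that] L by linarith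
  qed
  have **: "(x, y) \<in> torus_edges d L \<longleftrightarrow> nbr d x y" if "y \<in> ball1 d n" for x y
    using *[OF that, of x] torus_edges_sym[OF L2(2), of x y d] torus_edges_sym[OF L2(2), of y x d] nbr_sym[of d x y] nbr_sym[of d y x] by blast
  show ?thesis
  proof (intro equalityI subsetI)
    fix e assume "e \<in> {(x, y) \<in> torus_edges d L. x \<in> ball1 d n \<or> y \<in> ball1 d n}"
    then obtain x y where e: "e = (x, y)" "nbr d x y" "x \<in> ball1 d n \<or> y \<in> ball1 d n" using * ** by blast
    from nbr_level[OF e(2)] show "e \<in> touching d (ball1 d n) \<union> prod.swap ` touching d (ball1 d n)"
    proof
      assume "level d y = level d x + 1"
      then show ?thesis using e by (simp add: touching_def)
    next
      assume "level d y = level d x - 1"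
      then have "(y, x) \<in> touching d (ball1 d n)" using e nbr_sym by (auto simp: touching_def)
      then show ?thesis using e(1) by force
    qed
  next
    fix e assume "e \<in> touching d (ball1 d n) \<union> prod.swap ` touching d (ball1 d n)"
    then obtain x y where e: "e = (x, y)" "nbr d x y" "x \<in> ball1 d n \<or> y \<in> ball1 d n"
      unfolding touching_def by (force dest: nbr_sym)
    then show "e \<in> {(x, y) \<in> torus_edges d L. x \<in> ball1 d n \<or> y \<in> ball1 d n}" using * ** by blast
  qed
qed

section \<open>A flow of small energy\<close>

definition sphere :: "nat \<Rightarrow> nat set \<Rightarrow> nat \<Rightarrow> site set" where
  "sphere d T n = {x \<in> Zd d. (\<forall>i<d. i \<notin> T \<longrightarrow> x i = 0) \<and> (\<Sum>i\<in>T. nat \<bar>x i\<bar>) = n}"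

definition absv :: "nat set \<Rightarrow> site \<Rightarrow> nat \<Rightarrow> nat" where
  "absv T x = (\<lambda>i\<in>T. nat \<bar>x i\<bar>)"

text \<open>The conditional probability of the signs of x given the moduli of its
  coordinates.\<close>

definition sgnw :: "nat set \<Rightarrow> site \<Rightarrow> real" where
  "sgnw T x = (\<Prod>i\<in>T. if x i = 0 then 1 else 1 / 2)"

text \<open>On the sphere of radius \<open>n\<close>, the law at time \<open>n\<close> of the walk on the coordinates \<open>T\<close> which at each step increases the modulus
  of a uniformly chosen coordinate, with a uniform sign when that coordinate is zero.\<close>

definition mass :: "nat set \<Rightarrow> site \<Rightarrow> real" where
  "mass T x = multinom T (absv T x) * sgnw T x / real (card T) ^ (\<Sum>i\<in>T. nat \<bar>x i\<bar>)"

definition outward :: "int \<Rightarrow> int set" where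
  "outward k = (if k = 0 then {1, -1} else {k + sgn k})"

definition steps :: "nat \<Rightarrow> nat set \<Rightarrow> nat \<Rightarrow> (site \<times> nat \<times> int) set" where
  "steps d T n = Sigma (sphere d T n) (\<lambda>x. Sigma T (\<lambda>i. outward (x i)))"

text \<open>The mass of x times the probability of stepping to y. The sign factor is taken at y
  because leaving zero costs a factor 1 / 2.\<close>

definition flow :: "nat set \<Rightarrow> site \<Rightarrow> site \<Rightarrow> real" where
  "flow T x y = multinom T (absv T x) * sgnw T y / real (card T) ^ Suc (\<Sum>i\<in>T. nat \<bar>x i\<bar>)"

lemma finite_outward [simp]: "finite (outward k)"
  by (simp add: outward_def)

lemma outward_abs: "k \<in> outward j \<Longrightarrow> \<bar>k\<bar> = \<bar>j\<bar> + 1"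
  by (auto simp: outward_def sgn_if split: if_splits)

lemma outward_step: "k \<in> outward j \<Longrightarrow> k = j + 1 \<or> k = j - 1"
  by (auto simp: outward_def sgn_if split: if_splits)

lemma outward_nz: "k \<in> outward j \<Longrightarrow> k \<noteq> 0 \<and> k \<noteq> j \<and> k - sgn k = j"
  by (auto simp: outward_def sgn_if split: if_splits)

lemma outward_inward: "k \<noteq> 0 \<Longrightarrow> k \<in> outward (k - sgn k)"
  by (auto simp: outward_def sgn_if split: if_splits)

section \<open>Conservation and energy of the flow\<close>

context
  fixes d :: nat and T :: "nat set"
  assumes T: "T \<subseteq> {..<d}" "T \<noteq> {}"
begin

lemma add_sgn_neq_0: "k \<noteq> 0 \<Longrightarrow> k + sgn k \<noteq> (0 :: int)"
  by (simp add: sgn_if)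

lemma finT: "finite T" using T finite_subset by blast

lemma cardT: "real (card T) > 0" using T finT by (simp add: card_gt_0_iff)

lemma finite_sphere: "finite (sphere d T n)"
proof (rule finite_subset)
  show "sphere d T n \<subseteq> {..<d} \<rightarrow>\<^sub>E {-int n..int n}"
  proof
    fix x assume x: "x \<in> sphere d T n"
    have bd: "\<bar>x i\<bar> \<le> int n" if "i < d" for i
    proof (cases "i \<in> T")
      case True
      have "nat \<bar>x i\<bar> \<le> (\<Sum>i\<in>T. nat \<bar>x i\<bar>)" by (rule member_le_sum[OF True _ finT]) simp
      then show ?thesis using x by (simp add: sphere_def)
    next
      case False then show ?thesis using x that by (simp add: sphere_def)
    qed
    have "- int n \<le> x i \<and> x i \<le> int n" if "i < d" for i using bd[OF that] by linarith
    then show "x \<in> {..<d} \<rightarrow>\<^sub>E {-int n..int n}"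
      using x by (auto simp: sphere_def Zd_def PiE_def Pi_def)
  qed
qed (intro finite_PiE, auto)

lemma finite_steps: "finite (steps d T n)"
  unfolding steps_def using finite_sphere finT by (intro finite_SigmaI) auto

lemma sum_upd: "i \<in> T \<Longrightarrow> (\<Sum>j\<in>T. nat \<bar>(x(i := k)) j\<bar>) + nat \<bar>x i\<bar> = (\<Sum>j\<in>T. nat \<bar>x j\<bar>) + nat \<bar>k\<bar>"
  for x :: site
proof -
  assume i: "i \<in> T"
  have "(\<Sum>j\<in>T - {i}. nat \<bar>(x(i := k)) j\<bar>) = (\<Sum>j\<in>T - {i}. nat \<bar>x j\<bar>)" by (intro sum.cong) auto
  then show ?thesis
    using sum.remove[OF finT i, of "\<lambda>j. nat \<bar>x j\<bar>"] sum.remove[OF finT i, of "\<lambda>j. nat \<bar>(x(i := k)) j\<bar>"] by simp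
qed

lemma step_mem:
  assumes "x \<in> sphere d T n" "i \<in> T" "k \<in> outward (x i)"
  shows "x(i := k) \<in> sphere d T (Suc n)"
proof -
  have "nat \<bar>k\<bar> = nat \<bar>x i\<bar> + 1" using outward_abs[OF assms(3)] by simp
  then have "(\<Sum>j\<in>T. nat \<bar>(x(i := k)) j\<bar>) = Suc (\<Sum>j\<in>T. nat \<bar>x j\<bar>)" using sum_upd[OF assms(2), of x k] by linarith
  moreover have "x(i := k) \<in> Zd d" using assms T by (auto simp: sphere_def Zd_def PiE_iff extensional_def)
  ultimately show ?thesis using assms by (auto simp: sphere_def)
qed

lemma sgnw_upd: "i \<in> T \<Longrightarrow> k \<noteq> 0 \<Longrightarrow> sgnw T (x(i := k)) = (if x i = 0 then 1 / 2 else 1) * sgnw T x"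
  unfolding sgnw_def by (subst (1 2) prod.remove[OF finT, of i]) auto

lemma multinom_absv: "multinom T (absv T x) = fact (\<Sum>i\<in>T. nat \<bar>x i\<bar>) / (\<Prod>i\<in>T. fact (nat \<bar>x i\<bar>))"
  unfolding multinom_def absv_def by simp

lemma flow_out:
  assumes x: "x \<in> sphere d T n"
  shows "(\<Sum>i\<in>T. \<Sum>k\<in>outward (x i). flow T x (x(i := k))) = mass T x"
proof -
  have "(\<Sum>k\<in>outward (x i). flow T x (x(i := k))) = mass T x / card T" if i: "i \<in> T" for i
    using cardT add_sgn_neq_0[of "x i"] by (simp add: outward_def flow_def mass_def sgnw_upd[OF i] mult_ac)
  then show ?thesis using cardT by simp
qed

lemma flow_square_out:
  assumes x: "x \<in> sphere d T n"
  shows "(\<Sum>i\<in>T. \<Sum>k\<in>outward (x i). (flow T x (x(i := k)))\<^sup>2)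
    = (multinom T (absv T x) * sgnw T x / real (card T) ^ Suc n)\<^sup>2 * (\<Sum>i\<in>T. if x i = 0 then 1 / 2 else 1)"
proof -
  have s: "(\<Sum>i\<in>T. nat \<bar>x i\<bar>) = n" using x by (simp add: sphere_def)
  have "(\<Sum>k\<in>outward (x i). (flow T x (x(i := k)))\<^sup>2)
     = (multinom T (absv T x) * sgnw T x / real (card T) ^ Suc n)\<^sup>2 * (if x i = 0 then 1 / 2 else 1)" if i: "i \<in> T" for i
    using add_sgn_neq_0[of "x i"] by (simp add: outward_def flow_def sgnw_upd[OF i] s power2_eq_square mult_ac)
  then show ?thesis by (simp add: sum_distrib_left)
qed

text \<open>The inward neighbour of y in coordinate i supplies the share \<bar>y i\<bar> / (n + 1)
  of the mass of y, and these shares add up to 1. This is Pascal's rule for multinomial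
  coefficients.\<close>

lemma flow_in:
  assumes y: "y \<in> sphere d T (Suc n)"
  shows "(\<Sum>i\<in>{i \<in> T. y i \<noteq> 0}. flow T (y(i := y i - sgn (y i))) y) = mass T y"
proof -
  let ?D = "\<Prod>j\<in>T. fact (nat \<bar>y j\<bar>) :: real"
  have sy: "(\<Sum>i\<in>T. nat \<bar>y i\<bar>) = Suc n" using y by (simp add: sphere_def)
  have D: "?D > 0" by (intro prod_pos) auto
  have m: "multinom T (absv T (y(i := y i - sgn (y i)))) = fact n * real (nat \<bar>y i\<bar>) / ?D
      \<and> (\<Sum>j\<in>T. nat \<bar>(y(i := y i - sgn (y i))) j\<bar>) = n" if i: "i \<in> T" "y i \<noteq> 0" for i
  proof -
    let ?x = "y(i := y i - sgn (y i))"
    have a: "nat \<bar>y i\<bar> = Suc (nat \<bar>y i - sgn (y i)\<bar>)" using i(2) by (auto simp: sgn_if)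
    have s: "(\<Sum>j\<in>T. nat \<bar>?x j\<bar>) = n" using sum_upd[OF i(1), of y "y i - sgn (y i)"] sy a by linarith
    have "?D = fact (nat \<bar>y i\<bar>) * (\<Prod>j\<in>T - {i}. fact (nat \<bar>y j\<bar>))" by (rule prod.remove[OF finT i(1)])
    also have "(\<Prod>j\<in>T - {i}. fact (nat \<bar>y j\<bar>) :: real) = (\<Prod>j\<in>T - {i}. fact (nat \<bar>?x j\<bar>))"
      by (intro prod.cong) auto
    also have "fact (nat \<bar>y i\<bar>) = real (nat \<bar>y i\<bar>) * (fact (nat \<bar>?x i\<bar>) :: real)" unfolding a by simp
    finally have "?D = real (nat \<bar>y i\<bar>) * (fact (nat \<bar>?x i\<bar>) * (\<Prod>j\<in>T - {i}. fact (nat \<bar>?x j\<bar>)))" by simp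
    also have "fact (nat \<bar>?x i\<bar>) * (\<Prod>j\<in>T - {i}. fact (nat \<bar>?x j\<bar>)) = (\<Prod>j\<in>T. fact (nat \<bar>?x j\<bar>) :: real)"
      by (rule prod.remove[OF finT i(1), symmetric])
    finally have DD: "?D = real (nat \<bar>y i\<bar>) * (\<Prod>j\<in>T. fact (nat \<bar>?x j\<bar>))" .
    then have "multinom T (absv T ?x) = fact n * real (nat \<bar>y i\<bar>) / ?D"
      using D i(2) unfolding multinom_absv s by (simp add: field_simps)
    with s show ?thesis by simp
  qed
  have "(\<Sum>i\<in>{i \<in> T. y i \<noteq> 0}. flow T (y(i := y i - sgn (y i))) y)
     = (\<Sum>i\<in>{i \<in> T. y i \<noteq> 0}. fact n / ?D * sgnw T y / real (card T) ^ Suc n * real (nat \<bar>y i\<bar>))"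
  proof (rule sum.cong[OF refl])
    fix i assume "i \<in> {i \<in> T. y i \<noteq> 0}"
    then have mi: "multinom T (absv T (y(i := y i - sgn (y i)))) = fact n * real (nat \<bar>y i\<bar>) / ?D"
      "(\<Sum>j\<in>T. nat \<bar>(y(i := y i - sgn (y i))) j\<bar>) = n" using m by auto
    show "flow T (y(i := y i - sgn (y i))) y = fact n / ?D * sgnw T y / real (card T) ^ Suc n * real (nat \<bar>y i\<bar>)"
      unfolding flow_def mi by simp
  qed
  also have "\<dots> = (\<Sum>i\<in>T. fact n / ?D * sgnw T y / real (card T) ^ Suc n * real (nat \<bar>y i\<bar>))"
    using finT by (intro sum.mono_neutral_left) auto
  also have "\<dots> = fact n / ?D * sgnw T y / real (card T) ^ Suc n * real (Suc n)"
    by (simp only: sum_distrib_left[symmetric] of_nat_sum[symmetric] sy)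
  also have "\<dots> = mass T y"
    unfolding mass_def multinom_absv sy by simp
  finally show ?thesis .
qed

text \<open>What leaves a site equals its mass by \<open>flow_out\<close>, and what enters a site of
  the next sphere equals its mass by \<open>flow_in\<close>; so only the two bounding spheres
  contribute.\<close>

lemma flow_divergence:
  "(\<Sum>(x, i, k)\<in>steps d T n. (u x - u (x(i := k))) * flow T x (x(i := k)))
    = (\<Sum>x\<in>sphere d T n. u x * mass T x) - (\<Sum>x\<in>sphere d T (Suc n). u x * mass T x)"
proof -
  have Sig: "(\<Sum>(x, i, k)\<in>steps d T n. g x i k) = (\<Sum>x\<in>sphere d T n. \<Sum>i\<in>T. \<Sum>k\<in>outward (x i). g x i k)"
    for g :: "site \<Rightarrow> nat \<Rightarrow> int \<Rightarrow> real"
    unfolding steps_def using finite_sphere finT by (simp add: sum.Sigma)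
  have "(\<Sum>(x, i, k)\<in>steps d T n. u x * flow T x (x(i := k))) = (\<Sum>x\<in>sphere d T n. u x * mass T x)"
    unfolding Sig by (intro sum.cong refl) (simp add: sum_distrib_left[symmetric] flow_out)
  moreover have "(\<Sum>(x, i, k)\<in>steps d T n. u (x(i := k)) * flow T x (x(i := k)))
     = (\<Sum>(y, i)\<in>Sigma (sphere d T (Suc n)) (\<lambda>y. {i \<in> T. y i \<noteq> 0}). u y * flow T (y(i := y i - sgn (y i))) y)"
  proof (rule sum.reindex_bij_witness[where i="\<lambda>(y, i). (y(i := y i - sgn (y i)), i, y i)" and j="\<lambda>(x, i, k). (x(i := k), i)"])
    fix a assume "a \<in> steps d T n"
    then obtain x i k where a: "a = (x, i, k)" "x \<in> sphere d T n" "i \<in> T" "k \<in> outward (x i)" by (auto simp: steps_def)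
    note k = outward_nz[OF a(4)]
    show "(case (case a of (x, i, k) \<Rightarrow> (x(i := k), i)) of (y, i) \<Rightarrow> (y(i := y i - sgn (y i)), i, y i)) = a"
      using a k by simp
    show "(case a of (x, i, k) \<Rightarrow> (x(i := k), i)) \<in> Sigma (sphere d T (Suc n)) (\<lambda>y. {i \<in> T. y i \<noteq> 0})"
      using a k step_mem by simp
    show "(case (case a of (x, i, k) \<Rightarrow> (x(i := k), i)) of (y, i) \<Rightarrow> u y * flow T (y(i := y i - sgn (y i))) y)
        = (case a of (x, i, k) \<Rightarrow> u (x(i := k)) * flow T x (x(i := k)))"
      using a k by simp
  next
    fix b assume "b \<in> Sigma (sphere d T (Suc n)) (\<lambda>y. {i \<in> T. y i \<noteq> 0})"
    then obtain y i where b: "b = (y, i)" "y \<in> sphere d T (Suc n)" "i \<in> T" "y i \<noteq> 0" by auto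
    show "(case (case b of (y, i) \<Rightarrow> (y(i := y i - sgn (y i)), i, y i)) of (x, i, k) \<Rightarrow> (x(i := k), i)) = b"
      using b by simp
    have a: "nat \<bar>y i\<bar> = Suc (nat \<bar>y i - sgn (y i)\<bar>)" using b(4) by (auto simp: sgn_if)
    have "(\<Sum>j\<in>T. nat \<bar>(y(i := y i - sgn (y i))) j\<bar>) = n"
      using sum_upd[OF b(3), of y "y i - sgn (y i)"] b(2) a by (simp add: sphere_def)
    moreover have "y(i := y i - sgn (y i)) \<in> Zd d" using b T by (auto simp: sphere_def Zd_def PiE_iff extensional_def)
    ultimately have "y(i := y i - sgn (y i)) \<in> sphere d T n" using b by (auto simp: sphere_def)
    then show "(case b of (y, i) \<Rightarrow> (y(i := y i - sgn (y i)), i, y i)) \<in> steps d T n"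
      using b outward_inward[OF b(4)] by (simp add: steps_def)
  qed
  moreover have "\<dots> = (\<Sum>y\<in>sphere d T (Suc n). u y * mass T y)"
    using finite_sphere finT
    by (subst sum.Sigma[symmetric]) (auto intro!: sum.cong simp: sum_distrib_left[symmetric] flow_in)
  ultimately show ?thesis
    by (simp add: left_diff_distrib sum_subtractf split_beta)
qed

text \<open>Every nonzero modulus can be realised with two signs.\<close>

lemma sum_sphere_fibre:
  fixes \<phi> :: "(nat \<Rightarrow> nat) \<Rightarrow> real"
  shows "(\<Sum>x\<in>sphere d T n. \<phi> (absv T x)) = (\<Sum>y\<in>types T n. 2 ^ card {i \<in> T. y i \<noteq> 0} * \<phi> y)"
proof -
  have sub: "absv T ` sphere d T n \<subseteq> types T n" by (auto simp: absv_def sphere_def types_def)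
  have "(\<Sum>x\<in>sphere d T n. \<phi> (absv T x)) = (\<Sum>y\<in>types T n. \<Sum>x\<in>{x \<in> sphere d T n. absv T x = y}. \<phi> (absv T x))"
    by (rule sum.group[symmetric, OF finite_sphere finite_types[OF finT] sub])
  also have "\<dots> = (\<Sum>y\<in>types T n. 2 ^ card {i \<in> T. y i \<noteq> 0} * \<phi> y)"
  proof (rule sum.cong[OF refl])
    fix y assume y: "y \<in> types T n"
    have yE: "y \<in> extensional T" "sum y T = n" using y by (auto simp: types_def PiE_def)
    let ?B = "\<lambda>i. if i \<in> T then {int (y i), - int (y i)} else {0}"
    have "{x \<in> sphere d T n. absv T x = y} = PiE {..<d} ?B"
    proof (intro equalityI subsetI)
      fix x assume x: "x \<in> {x \<in> sphere d T n. absv T x = y}"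
      have "x i \<in> ?B i" if i: "i < d" for i
      proof (cases "i \<in> T")
        case True
        have "absv T x i = y i" using x by simp
        then have "nat \<bar>x i\<bar> = y i" using True by (simp add: absv_def)
        then show ?thesis using True by auto
      qed (use x i in \<open>simp add: sphere_def\<close>)
      then show "x \<in> PiE {..<d} ?B" using x by (simp add: sphere_def Zd_def PiE_iff)
    next
      fix x assume x: "x \<in> PiE {..<d} ?B"
      have xi: "x i \<in> ?B i" if "i < d" for i using PiE_mem[OF x, of i] that by simp
      have a: "nat \<bar>x i\<bar> = y i" if "i \<in> T" for i
      proof -
        have "x i \<in> {int (y i), - int (y i)}" using xi[of i] that T by auto
        then show ?thesis by auto
      qed
      have z: "x i = 0" if "i < d" "i \<notin> T" for i using xi[OF that(1)] that(2) by simp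
      have "absv T x = y"
      proof
        fix i show "absv T x i = y i"
          using a[of i] yE(1) by (cases "i \<in> T") (simp_all add: absv_def extensional_def)
      qed
      moreover have "x \<in> Zd d" using x by (simp add: Zd_def PiE_iff)
      ultimately show "x \<in> {x \<in> sphere d T n. absv T x = y}" using a z yE(2) by (simp add: sphere_def)
    qed
    moreover have "card (PiE {..<d} ?B) = 2 ^ card {i \<in> T. y i \<noteq> 0}"
    proof -
      have "card (PiE {..<d} ?B) = (\<Prod>i<d. if i \<in> {i \<in> T. y i \<noteq> 0} then 2 else 1)"
        unfolding card_PiE[OF finite_lessThan] by (intro prod.cong refl) (auto simp: card_insert_if)
      also have "\<dots> = (\<Prod>i\<in>{..<d} \<inter> {i \<in> T. y i \<noteq> 0}. 2)" by (rule prod.inter_restrict[symmetric]) simp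
      also have "{..<d} \<inter> {i \<in> T. y i \<noteq> 0} = {i \<in> T. y i \<noteq> 0}" using T by auto
      finally show ?thesis by simp
    qed
    ultimately have "card {x \<in> sphere d T n. absv T x = y} = 2 ^ card {i \<in> T. y i \<noteq> 0}" by simp
    moreover have "(\<Sum>x\<in>{x \<in> sphere d T n. absv T x = y}. \<phi> (absv T x)) = (\<Sum>x\<in>{x \<in> sphere d T n. absv T x = y}. \<phi> y)"
      by (rule sum.cong) auto
    ultimately show "(\<Sum>x\<in>{x \<in> sphere d T n. absv T x = y}. \<phi> (absv T x)) = 2 ^ card {i \<in> T. y i \<noteq> 0} * \<phi> y"
      by simp
  qed
  finally show ?thesis .
qed

text \<open>With c nonzero moduli there are 2^c choices of signs, each of squared weight 4^(- c). A
  nonzero coordinate contributes one step of relative energy 1, a zero coordinate two steps of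
  relative energy 1 / 4 each, in total (m + c) / 2 for m coordinates.\<close>

lemma level_energy:
  "(\<Sum>(x, i, k)\<in>steps d T n. (flow T x (x(i := k)))\<^sup>2)
    = (\<Sum>y\<in>types T n. (multinom T y)\<^sup>2 * ((card T + card {i \<in> T. y i \<noteq> 0}) / 2 ^ Suc (card {i \<in> T. y i \<noteq> 0})))
      / (real (card T) ^ Suc n)\<^sup>2"
proof -
  let ?c = "\<lambda>y :: nat \<Rightarrow> nat. card {i \<in> T. y i \<noteq> 0}"
  have sg: "sgnw T x = 1 / 2 ^ ?c (absv T x)" for x
  proof -
    have "sgnw T x = (\<Prod>i\<in>T. if i \<in> {i \<in> T. x i \<noteq> 0} then 1 / 2 else 1)"
      unfolding sgnw_def by (intro prod.cong) auto
    also have "\<dots> = (\<Prod>i\<in>T \<inter> {i \<in> T. x i \<noteq> 0}. 1 / 2)" by (rule prod.inter_restrict[OF finT, symmetric])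
    also have "T \<inter> {i \<in> T. x i \<noteq> 0} = {i \<in> T. absv T x i \<noteq> 0}" by (auto simp: absv_def)
    finally show ?thesis by (simp add: power_one_over)
  qed
  have su: "(\<Sum>i\<in>T. if x i = 0 then 1 / 2 else 1) = (card T + ?c (absv T x)) / (2::real)" for x :: site
  proof -
    have "(\<Sum>i\<in>T. if x i = 0 then 1 / 2 else 1) = (\<Sum>i\<in>T. 1 / 2 + (if i \<in> {i \<in> T. x i \<noteq> 0} then 1 / 2 else 0 :: real))"
      by (intro sum.cong) auto
    also have "\<dots> = card T / 2 + (\<Sum>i\<in>T \<inter> {i \<in> T. x i \<noteq> 0}. 1 / 2)"
      unfolding sum.distrib sum.inter_restrict[OF finT] by simp
    also have "T \<inter> {i \<in> T. x i \<noteq> 0} = {i \<in> T. absv T x i \<noteq> 0}" by (auto simp: absv_def)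
    finally show ?thesis by (simp add: add_divide_distrib)
  qed
  have "(\<Sum>(x, i, k)\<in>steps d T n. (flow T x (x(i := k)))\<^sup>2)
     = (\<Sum>x\<in>sphere d T n. \<Sum>i\<in>T. \<Sum>k\<in>outward (x i). (flow T x (x(i := k)))\<^sup>2)"
    unfolding steps_def using finite_sphere finT by (simp add: sum.Sigma)
  also have "\<dots> = (\<Sum>x\<in>sphere d T n. (multinom T (absv T x) * (1 / 2 ^ ?c (absv T x)) / real (card T) ^ Suc n)\<^sup>2
       * ((card T + ?c (absv T x)) / 2))"
    by (intro sum.cong refl) (simp only: flow_square_out sg su)
  also have "\<dots> = (\<Sum>y\<in>types T n. 2 ^ ?c y * ((multinom T y * (1 / 2 ^ ?c y) / real (card T) ^ Suc n)\<^sup>2 * ((card T + ?c y) / 2)))"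
    by (rule sum_sphere_fibre)
  also have "\<dots> = (\<Sum>y\<in>types T n. (multinom T y)\<^sup>2 * ((card T + ?c y) / 2 ^ Suc (?c y)) / (real (card T) ^ Suc n)\<^sup>2)"
    by (intro sum.cong refl) (simp add: power2_eq_square mult_ac)
  finally show ?thesis by (simp add: sum_divide_distrib)
qed

end

section \<open>Numerical bound for the energy\<close>

lemma walk_weight_le: "c \<ge> 2 \<Longrightarrow> (8 + real c) / 2 ^ Suc c \<le> 5 / 4"
proof -
  \<comment> \<open>Equality holds at c = 2, the worst case among these; c = 1 gives 9 / 4 and c = 0
    gives 4.\<close>
  have "4 * (8 + real c) \<le> 5 * 2 ^ Suc c" if "c \<ge> 2" for c
    using that by (induction c rule: dec_induct) auto
  then show "c \<ge> 2 \<Longrightarrow> (8 + real c) / 2 ^ Suc c \<le> 5 / 4" by (simp add: field_simps)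
qed

text \<open>There is at most one such type for each coordinate, and its multinomial coefficient is 1
  as all letters are equal.\<close>

lemma sum_single_type_le:
  assumes T: "finite T"
  shows "(\<Sum>y\<in>{y \<in> types T n. card {i \<in> T. y i \<noteq> 0} = 1}. (multinom T y)\<^sup>2) \<le> card T"
proof -
  let ?X = "{y \<in> types T n. card {i \<in> T. y i \<noteq> 0} = 1}"
  have y: "\<exists>i\<in>T. y = (\<lambda>k\<in>T. if k = i then n else 0) \<and> multinom T y = 1" if "y \<in> ?X" for y
  proof -
    have t: "y \<in> extensional T" "sum y T = n" "card {i \<in> T. y i \<noteq> 0} = 1" using that by (auto simp: types_def PiE_def)
    obtain i where i: "{i \<in> T. y i \<noteq> 0} = {i}" using t(3) by (auto simp: card_1_singleton_iff)
    then have iT: "i \<in> T" by blast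
    have z: "y k = 0" if "k \<in> T" "k \<noteq> i" for k using i that by blast
    have yi: "y i = n" using t(2) z sum.remove[OF T iT, of y] by simp
    have "y = (\<lambda>k\<in>T. if k = i then n else 0)"
    proof
      fix k show "y k = (\<lambda>k\<in>T. if k = i then n else 0) k"
        using t(1) z[of k] yi by (cases "k \<in> T") (auto simp: extensional_def)
    qed
    moreover have "(\<Prod>k\<in>T. fact (y k) :: real) = fact n"
      using prod.remove[OF T iT, of "\<lambda>k. fact (y k) :: real"] z yi by simp
    ultimately show ?thesis using iT t(2) by (auto simp: multinom_def)
  qed
  have "?X \<subseteq> (\<lambda>i. \<lambda>k\<in>T. if k = i then n else 0) ` T"
  proof
    fix x assume "x \<in> ?X"
    from y[OF this] show "x \<in> (\<lambda>i. \<lambda>k\<in>T. if k = i then n else 0) ` T" by blast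
  qed
  then have "card ?X \<le> card T" using T by (meson card_image_le card_mono finite_imageI le_trans)
  moreover have "(\<Sum>y\<in>?X. (multinom T y)\<^sup>2) = (\<Sum>y\<in>?X. 1)"
  proof (rule sum.cong[OF refl])
    fix x assume "x \<in> ?X"
    from y[OF this] show "(multinom T x)\<^sup>2 = 1" by force
  qed
  ultimately show ?thesis by simp
qed

text \<open>The origin contributes 4 / 64. Later times contribute 5 / 4 of the collision
  probabilities, in total at most 5 / 4 * 0.1774, and a geometric series of at most 8 / 63 from the
  axes, both divided by 64. The sum is just below 0.06795.\<close>

lemma flow_energy_le:
  assumes T: "T \<subseteq> {..<d}" and c8: "card T = 8"
  shows "(\<Sum>n<N. \<Sum>(x, i, k)\<in>steps d T n. (flow T x (x(i := k)))\<^sup>2) \<le> 0.06795"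
proof -
  have T0: "T \<noteq> {}" using c8 by auto
  have fin: "finite T" using T finite_subset by blast
  define e where "e n = (\<Sum>(x, i, k)\<in>steps d T n. (flow T x (x(i := k)))\<^sup>2)" for n
  let ?c = "\<lambda>y :: nat \<Rightarrow> nat. card {i \<in> T. y i \<noteq> 0}"
  define w where "w y = (8 + real (?c y)) / 2 ^ Suc (?c y)" for y
  have e: "e n = (\<Sum>y\<in>types T n. (multinom T y)\<^sup>2 * w y) / (8 ^ Suc n)\<^sup>2" for n
    unfolding e_def w_def using level_energy[OF T T0, of n] c8 by simp
  have e0: "e 0 \<le> 4 / 64"
  proof -
    have "types T 0 \<subseteq> {\<lambda>k\<in>T. 0}"
      using fin by (auto simp: types_def fun_eq_iff PiE_def extensional_def)
    then have "(\<Sum>y\<in>types T 0. (multinom T y)\<^sup>2 * w y) \<le> (\<Sum>y\<in>{\<lambda>k\<in>T. 0}. (multinom T y)\<^sup>2 * w y)"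
      by (intro sum_mono2) (auto simp: w_def)
    also have "\<dots> = 4" by (simp add: multinom_def w_def)
    finally show ?thesis by (simp add: e)
  qed
  have eS: "e (Suc n) \<le> (5 / 4 * collision 8 (Suc n) + 8 * (1 / 64) ^ Suc n) / 64" for n
  proof -
    let ?X = "types T (Suc n)"
    \<comment> \<open>On the axes the weight is 9 / 4, hence one additional copy of the squared
      coefficient on top of the factor 5 / 4.\<close>
    have "(\<Sum>y\<in>?X. (multinom T y)\<^sup>2 * w y)
       \<le> (\<Sum>y\<in>?X. 5 / 4 * (multinom T y)\<^sup>2 + (if ?c y = 1 then (multinom T y)\<^sup>2 else 0))"
    proof (rule sum_mono)
      fix y assume y: "y \<in> ?X"
      have "{i \<in> T. y i \<noteq> 0} \<noteq> {}"
      proof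
        assume "{i \<in> T. y i \<noteq> 0} = {}"
        then have "sum y T = 0" by simp
        then show False using y by (simp add: types_def)
      qed
      then have "?c y \<noteq> 0" using fin by simp
      then consider "?c y = 1" | "?c y \<ge> 2" by linarith
      then show "(multinom T y)\<^sup>2 * w y \<le> 5 / 4 * (multinom T y)\<^sup>2 + (if ?c y = 1 then (multinom T y)\<^sup>2 else 0)"
      proof cases
        case 1 then show ?thesis by (simp add: w_def)
      next
        case 2
        then have "w y \<le> 5 / 4" unfolding w_def by (rule walk_weight_le)
        then have "(multinom T y)\<^sup>2 * w y \<le> (multinom T y)\<^sup>2 * (5 / 4)" by (intro mult_left_mono) auto
        then show ?thesis using 2 by simp
      qed
    qed
    also have "\<dots> = 5 / 4 * (\<Sum>y\<in>?X. (multinom T y)\<^sup>2) + (\<Sum>y\<in>{y \<in> ?X. ?c y = 1}. (multinom T y)\<^sup>2)"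
      by (simp add: sum.distrib sum_distrib_left sum.inter_filter[OF finite_types[OF fin]])
    also have "\<dots> \<le> 5 / 4 * bsq 8 (Suc n) + 8"
      using sum_single_type_le[OF fin, of "Suc n"] sum_multinom_square[OF fin, of "Suc n"] c8 by simp
    finally have "e (Suc n) \<le> (5 / 4 * bsq 8 (Suc n) + 8) / (8 ^ Suc (Suc n))\<^sup>2"
      unfolding e by (rule divide_right_mono) simp
    also have "(8 ^ Suc (Suc n))\<^sup>2 = (64 * 64 ^ Suc n :: real)"
      by (simp add: power2_eq_square power_mult_distrib[symmetric])
    also have "(5 / 4 * bsq 8 (Suc n) + 8) / (64 * 64 ^ Suc n) = (5 / 4 * collision 8 (Suc n) + 8 * (1 / 64) ^ Suc n) / 64"
    proof -
      have "((8::real) ^ Suc n)\<^sup>2 = 64 ^ Suc n" by (simp add: power2_eq_square power_mult_distrib[symmetric])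
      then show ?thesis unfolding collision_def by (simp add: power_one_over add_divide_distrib mult_ac)
    qed
    finally show ?thesis .
  qed
  show ?thesis
  proof (cases N)
    case (Suc M)
    have "(\<Sum>n<N. e n) = e 0 + (\<Sum>n<M. e (Suc n))" unfolding Suc by (rule sum.lessThan_Suc_shift)
    also have "\<dots> \<le> 4 / 64 + (\<Sum>n<M. (5 / 4 * collision 8 (Suc n) + 8 * (1 / 64) ^ Suc n) / 64)"
      by (intro add_mono sum_mono e0 eS)
    also have "(\<Sum>n<M. (5 / 4 * collision 8 (Suc n) + 8 * (1 / 64) ^ Suc n) / 64)
        = (5 / 4 * (\<Sum>n<M. collision 8 (Suc n)) + (\<Sum>n<M. (1 / 64) ^ n) / 8) / 64"
      by (simp add: sum.distrib sum_distrib_left sum_divide_distrib add_divide_distrib)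
    also have "(\<Sum>n<M. collision 8 (Suc n)) \<le> 0.1774"
    proof -
      have "(\<Sum>n<Suc M. collision 8 n) = collision 8 0 + (\<Sum>n<M. collision 8 (Suc n))"
        by (rule sum.lessThan_Suc_shift)
      moreover have "collision 8 0 = 1"
      proof -
        have "bsq k 0 = 1" for k by (induction k) auto
        then show ?thesis by (simp add: collision_def)
      qed
      ultimately show ?thesis using sum_collision_8[of "Suc M"] by simp
    qed
    also have "(\<Sum>n<M. (1 / 64 :: real) ^ n) \<le> 64 / 63"
      by (simp add: sum_gp_strict)
    finally show ?thesis by (simp add: e_def)
  qed simp
qed

section \<open>The flow as an antisymmetric field on the torus\<close>

definition flow_edges :: "nat \<Rightarrow> nat set \<Rightarrow> nat \<Rightarrow> (site \<times> site) set" where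
  "flow_edges d T N = (\<Union>n<N. (\<lambda>(x, i, k). (x, x(i := k))) ` steps d T n)"

definition flow_field :: "nat \<Rightarrow> nat set \<Rightarrow> nat \<Rightarrow> site \<times> site \<Rightarrow> real" where
  "flow_field d T N = (\<lambda>(x, y). of_bool ((x, y) \<in> flow_edges d T N) * flow T x y - of_bool ((y, x) \<in> flow_edges d T N) * flow T y x)"

lemma sphere_norm:
  assumes "x \<in> sphere d T n" "T \<subseteq> {..<d}"
  shows "(\<Sum>i<d. \<bar>x i\<bar>) = int n"
proof -
  have "(\<Sum>i<d. \<bar>x i\<bar>) = (\<Sum>i\<in>T. \<bar>x i\<bar>)" using assms by (intro sum.mono_neutral_right) (auto simp: sphere_def)
  also have "\<dots> = int (\<Sum>i\<in>T. nat \<bar>x i\<bar>)" by simp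
  also have "(\<Sum>i\<in>T. nat \<bar>x i\<bar>) = n" using assms by (simp add: sphere_def)
  finally show ?thesis .
qed

context
  fixes d :: nat and T :: "nat set"
  assumes T: "T \<subseteq> {..<d}" "T \<noteq> {}"
begin

lemma flow_edgesE:
  assumes "(x, y) \<in> flow_edges d T N"
  obtains n i k where "n < N" "x \<in> sphere d T n" "i \<in> T" "k \<in> outward (x i)" "y = x(i := k)" "y \<in> sphere d T (Suc n)"
  using assms step_mem[OF T] unfolding flow_edges_def steps_def by auto

lemma flow_edges_level: "(x, y) \<in> flow_edges d T N \<Longrightarrow> (\<Sum>i<d. \<bar>y i\<bar>) = (\<Sum>i<d. \<bar>x i\<bar>) + 1"
proof (erule flow_edgesE)
  fix n assume "x \<in> sphere d T n" "y \<in> sphere d T (Suc n)"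
  from this[THEN sphere_norm[OF _ T(1)]] show ?thesis by simp
qed

lemma flow_edges_torus:
  assumes L: "int N < L" "2 \<le> L"
  shows "flow_edges d T N \<subseteq> torus_edges d L"
proof (rule subrelI)
  fix x y assume "(x, y) \<in> flow_edges d T N"
  then obtain n i k where e: "n < N" "x \<in> sphere d T n" "i \<in> T" "k \<in> outward (x i)" "y = x(i := k)"
    by (rule flow_edgesE)
  have x: "x \<in> ball1 d n" using sphere_norm[OF e(2) T(1)] e(2) by (simp add: ball1_def sphere_def)
  have "(x, y) \<in> torus_edges d L \<longleftrightarrow> nbr d x y"
  proof (rule torus_edges_nbr[OF L(2)])
    show "x \<in> torus d L" using ball1_torus[of n L d] x e(1) L(1) by auto
    show "\<bar>x i\<bar> + 1 < L" if "i < d" for i using coord_le_ball1[OF x that] e(1) L(1) by linarith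
  qed
  moreover have "nbr d x y" using outward_step[OF e(4)] e T x by (auto simp: nbr_iff ball1_def)
  ultimately show "(x, y) \<in> torus_edges d L" by simp
qed

lemma sum_flow_edges:
  fixes g :: "site \<Rightarrow> site \<Rightarrow> real"
  shows "(\<Sum>(x, y)\<in>flow_edges d T N. g x y) = (\<Sum>n<N. \<Sum>(x, i, k)\<in>steps d T n. g x (x(i := k)))"
proof -
  let ?p = "\<lambda>(x :: site, i :: nat, k :: int). (x, x(i := k))"
  have inj: "inj_on ?p (steps d T n)" for n
  proof (rule inj_onI)
    fix a b assume ab: "a \<in> steps d T n" "b \<in> steps d T n" and eq: "?p a = ?p b"
    obtain x i k where a: "a = (x, i, k)" "k \<in> outward (x i)" using ab(1) by (auto simp: steps_def)
    obtain y j l where b: "b = (y, j, l)" "l \<in> outward (y j)" using ab(2) by (auto simp: steps_def)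
    have yx: "y = x" and u: "x(i := k) = x(j := l)" using eq a b by auto
    have nk: "k \<noteq> x i" using outward_nz[OF a(2)] by blast
    have "i = j"
    proof (rule ccontr)
      assume "i \<noteq> j"
      then have "k = x i" using fun_cong[OF u, of i] by simp
      then show False using nk by simp
    qed
    then show "a = b" using fun_cong[OF u, of i] a b yx by simp
  qed
  have "(\<Sum>(x, y)\<in>flow_edges d T N. g x y) = (\<Sum>n<N. \<Sum>(x, y)\<in>?p ` steps d T n. g x y)"
    unfolding flow_edges_def
  proof (rule sum.UNION_disjoint)
    show "\<forall>n\<in>{..<N}. finite (?p ` steps d T n)" using finite_steps[OF T] by auto
    show "\<forall>n\<in>{..<N}. \<forall>m\<in>{..<N}. n \<noteq> m \<longrightarrow> ?p ` steps d T n \<inter> ?p ` steps d T m = {}"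
      by (auto simp: steps_def sphere_def)
  qed simp
  also have "\<dots> = (\<Sum>n<N. \<Sum>(x, i, k)\<in>steps d T n. g x (x(i := k)))"
    by (intro sum.cong refl) (subst sum.reindex[OF inj], simp add: split_beta)
  finally show ?thesis .
qed

lemma sum_torus_swap:
  fixes g :: "site \<Rightarrow> site \<Rightarrow> real"
  assumes "L > 0"
  shows "(\<Sum>(x, y)\<in>torus_edges d L. g y x) = (\<Sum>(x, y)\<in>torus_edges d L. g x y)"
  by (rule sum.reindex_bij_witness[where i=prod.swap and j=prod.swap]) (auto intro: torus_edges_sym[OF assms])

lemma sum_flow_restrict:
  fixes g :: "site \<Rightarrow> site \<Rightarrow> real"
  assumes L: "int N < L" "2 \<le> L"
  shows "(\<Sum>(x, y)\<in>torus_edges d L. of_bool ((x, y) \<in> flow_edges d T N) * g x y) = (\<Sum>(x, y)\<in>flow_edges d T N. g x y)"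
proof -
  have fin: "finite (torus_edges d L)"
    using finite_subset[OF torus_edges_subset] finite_torus L by (meson finite_SigmaI le_less_trans not_le order_less_le_trans zero_less_numeral)
  show ?thesis
    by (rule sum.mono_neutral_cong_right[OF fin flow_edges_torus[OF L]]) auto
qed

text \<open>The contributions of the spheres telescope: a unit source at the origin, and a sink
  distributed over the sphere of radius N.\<close>

lemma flow_field_divergence:
  assumes L: "int N < L" "2 \<le> L"
  shows "(\<Sum>(x, y)\<in>torus_edges d L. u x * flow_field d T N (x, y)) = u (origin d) - (\<Sum>x\<in>sphere d T N. u x * mass T x)"
proof -
  let ?E = "torus_edges d L" and ?D = "flow_edges d T N"
  have L0: "L > 0" using L by simp
  have "(\<Sum>(x, y)\<in>?E. u x * flow_field d T N (x, y))
     = (\<Sum>(x, y)\<in>?E. of_bool ((x, y) \<in> ?D) * (u x * flow T x y)) - (\<Sum>(x, y)\<in>?E. of_bool ((y, x) \<in> ?D) * (u x * flow T y x))"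
    unfolding sum_subtractf[symmetric] by (intro sum.cong refl) (auto simp: flow_field_def right_diff_distrib)
  also have "(\<Sum>(x, y)\<in>?E. of_bool ((y, x) \<in> ?D) * (u x * flow T y x)) = (\<Sum>(x, y)\<in>?E. of_bool ((x, y) \<in> ?D) * (u y * flow T x y))"
    by (rule sum_torus_swap[OF L0])
  finally have "(\<Sum>(x, y)\<in>?E. u x * flow_field d T N (x, y)) = (\<Sum>(x, y)\<in>?D. (u x - u y) * flow T x y)"
    unfolding sum_flow_restrict[OF L] sum_subtractf[symmetric] by (simp add: split_beta left_diff_distrib)
  also have "\<dots> = (\<Sum>n<N. (\<Sum>x\<in>sphere d T n. u x * mass T x) - (\<Sum>x\<in>sphere d T (Suc n). u x * mass T x))"
    unfolding sum_flow_edges flow_divergence[OF T] ..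
  also have "\<dots> = (\<Sum>x\<in>sphere d T 0. u x * mass T x) - (\<Sum>x\<in>sphere d T N. u x * mass T x)"
    by (rule sum_lessThan_telescope')
  also have "(\<Sum>x\<in>sphere d T 0. u x * mass T x) = u (origin d)"
  proof -
    have fin: "finite T" using T finite_subset by blast
    have "x = origin d" if x: "x \<in> sphere d T 0" for x
    proof
      fix i show "x i = origin d i"
      proof (cases "i < d")
        case True
        have "\<bar>x i\<bar> \<le> (\<Sum>i<d. \<bar>x i\<bar>)" using True by (intro member_le_sum) auto
        then show ?thesis using sphere_norm[OF x T(1)] True by (simp add: origin_def)
      next
        case False
        then show ?thesis using x by (auto simp: sphere_def Zd_def PiE_def extensional_def origin_def)
      qed
    qed
    moreover have "origin d \<in> sphere d T 0"
    proof -
      have "(\<Sum>i\<in>T. nat \<bar>origin d i\<bar>) = 0" using T by (intro sum.neutral) (auto simp: origin_def)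
      then show ?thesis by (auto simp: sphere_def origin_def Zd_def)
    qed
    ultimately have "sphere d T 0 = {origin d}" by blast
    moreover have "mass T (origin d) = 1"
    proof -
      have "origin d i = 0" if "i \<in> T" for i using that T by (auto simp: origin_def)
      then show ?thesis by (simp add: mass_def multinom_absv[OF T] sgnw_def)
    qed
    ultimately show ?thesis by simp
  qed
  finally show ?thesis .
qed

text \<open>Flow edges point outwards, so an edge never carries flow in both orientations. The field
  takes opposite values on the two orientations, whence the factor 2.\<close>

lemma flow_field_energy:
  assumes L: "int N < L" "2 \<le> L"
  shows "(\<Sum>e\<in>torus_edges d L. (flow_field d T N e)\<^sup>2) = 2 * (\<Sum>n<N. \<Sum>(x, i, k)\<in>steps d T n. (flow T x (x(i := k)))\<^sup>2)"
proof -
  let ?E = "torus_edges d L" and ?D = "flow_edges d T N"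
  have L0: "L > 0" using L by simp
  have "(\<Sum>e\<in>?E. (flow_field d T N e)\<^sup>2) = (\<Sum>(x, y)\<in>?E. of_bool ((x, y) \<in> ?D) * (flow T x y)\<^sup>2 + of_bool ((y, x) \<in> ?D) * (flow T y x)\<^sup>2)"
  proof (intro sum.cong refl, clarify)
    fix x y
    have "\<not> ((x, y) \<in> ?D \<and> (y, x) \<in> ?D)" using flow_edges_level[of x y N] flow_edges_level[of y x N] by auto
    then show "(flow_field d T N (x, y))\<^sup>2 = of_bool ((x, y) \<in> ?D) * (flow T x y)\<^sup>2 + of_bool ((y, x) \<in> ?D) * (flow T y x)\<^sup>2"
      by (auto simp: flow_field_def)
  qed
  also have "\<dots> = (\<Sum>(x, y)\<in>?E. of_bool ((x, y) \<in> ?D) * (flow T x y)\<^sup>2) + (\<Sum>(x, y)\<in>?E. of_bool ((y, x) \<in> ?D) * (flow T y x)\<^sup>2)"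
    unfolding sum.distrib[symmetric] by (intro sum.cong refl) auto
  also have "(\<Sum>(x, y)\<in>?E. of_bool ((y, x) \<in> ?D) * (flow T y x)\<^sup>2) = (\<Sum>(x, y)\<in>?E. of_bool ((x, y) \<in> ?D) * (flow T x y)\<^sup>2)"
    by (rule sum_torus_swap[OF L0])
  finally show ?thesis unfolding sum_flow_restrict[OF L] sum_flow_edges by simp
qed

lemma flow_field_coord:
  assumes "flow_field d T N (x, y) \<noteq> 0"
  shows "\<exists>i\<in>T. x i \<noteq> y i"
proof -
  have *: "\<exists>i\<in>T. x i \<noteq> y i" if "(x, y) \<in> flow_edges d T N" for x y
    using that by (rule flow_edgesE) (use outward_nz in force)
  have "(x, y) \<in> flow_edges d T N \<or> (y, x) \<in> flow_edges d T N" using assms by (auto simp: flow_field_def)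
  then show ?thesis
  proof
    assume "(y, x) \<in> flow_edges d T N"
    from *[OF this] obtain i where "i \<in> T" "y i \<noteq> x i" by blast
    then show ?thesis by (intro bexI[of _ i]) auto
  qed (rule *)
qed

end

lemma antisym_flow_field: "antisym_field (flow_field d T N)"
  by (rule antisym_fieldI) (simp add: flow_field_def)

section \<open>Averaging over windows of eight coordinates\<close>

definition window :: "nat \<Rightarrow> nat \<Rightarrow> nat set" where
  "window d j = (\<lambda>k. (j + k) mod d) ` {..<8}"

lemma window_subset: "d > 0 \<Longrightarrow> window d j \<subseteq> {..<d}"
  by (auto simp: window_def)

lemma card_window:
  assumes "d \<ge> 8"
  shows "card (window d j) = 8"
proof -
  have "inj_on (\<lambda>k. (j + k) mod d) {..<8}"
  proof (rule inj_onI)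
    fix k l :: nat assume kl: "k \<in> {..<8}" "l \<in> {..<8}" and eq: "(j + k) mod d = (j + l) mod d"
    from eq have "int d dvd int (j + k) - int (j + l)" by (metis mod_eq_dvd_iff zmod_int)
    then have "int d dvd int k - int l" by simp
    then have "int d dvd \<bar>int k - int l\<bar>" by simp
    moreover have "\<bar>int k - int l\<bar> < int d" using kl assms by (simp add: abs_less_iff)
    ultimately have "\<not> 0 < \<bar>int k - int l\<bar>" using zdvd_not_zless by blast
    then show "k = l" by simp
  qed
  then show ?thesis by (simp add: window_def card_image)
qed

text \<open>The position of i within a window determines the starting point of the window.\<close>

lemma card_windows_containing:
  assumes "d \<ge> 8"
  shows "card {j. j < d \<and> i \<in> window d j} \<le> 8"
proof -
  have "{j. j < d \<and> i \<in> window d j} \<subseteq> (\<lambda>k. (i + (d - k)) mod d) ` {..<8}"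
  proof
    fix j assume j: "j \<in> {j. j < d \<and> i \<in> window d j}"
    then obtain k where k: "k < 8" "i = (j + k) mod d" by (auto simp: window_def)
    have "(i + (d - k)) mod d = (j + k + (d - k)) mod d" unfolding k(2) by (rule mod_add_left_eq)
    also have "j + k + (d - k) = j + d" using k(1) assms by simp
    finally have "j = (i + (d - k)) mod d" using j by simp
    then show "j \<in> (\<lambda>k. (i + (d - k)) mod d) ` {..<8}" using k(1) by blast
  qed
  from card_mono[OF _ this] have "card {j. j < d \<and> i \<in> window d j} \<le> card ((\<lambda>k. (i + (d - k)) mod d) ` {..<8::nat})" by simp
  also have "\<dots> \<le> 8" using card_image_le[of "{..<8::nat}" "\<lambda>k. (i + (d - k)) mod d"] by simp
  finally show ?thesis .
qed

definition mean_field :: "nat \<Rightarrow> nat \<Rightarrow> site \<times> site \<Rightarrow> real" where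
  "mean_field d N e = (\<Sum>j<d. flow_field d (window d j) N e) / d"

lemma antisym_mean_field: "antisym_field (mean_field d N)"
proof (rule antisym_fieldI)
  fix x y
  have "flow_field d (window d j) N (y, x) = - flow_field d (window d j) N (x, y)" for j
    by (rule antisym_fieldD[OF antisym_flow_field])
  then show "mean_field d N (y, x) = - mean_field d N (x, y)" by (simp add: mean_field_def sum_negf)
qed

text \<open>An edge in direction i carries flow only from the windows containing i. By
  Cauchy-Schwarz the energy of the average is at most 8 / d^2 times the sum of the d energies, each
  at most 2 * 0.06795.\<close>

lemma mean_field_energy:
  assumes d: "d \<ge> 8" and L: "int N < L" "2 \<le> L"
  shows "(\<Sum>e\<in>torus_edges d L. (mean_field d N e)\<^sup>2) \<le> 1.0872 / d"
proof -
  let ?E = "torus_edges d L" and ?h = "\<lambda>j. flow_field d (window d j) N"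
  have W: "window d j \<subseteq> {..<d}" "window d j \<noteq> {}" for j using window_subset[of d j] card_window[OF d, of j] d by auto
  have pt: "(mean_field d N e)\<^sup>2 \<le> 8 / (real d)\<^sup>2 * (\<Sum>j<d. (?h j e)\<^sup>2)" if e: "e \<in> ?E" for e
  proof -
    obtain x y where xy: "e = (x, y)" by (cases e)
    obtain i0 s where i0: "y = x(i0 := wrap L (x i0 + s))" using e unfolding xy by (rule torus_edgesE)
    define J where "J = {j. j < d \<and> i0 \<in> window d j}"
    have J: "J \<subseteq> {..<d}" "finite J" by (auto simp: J_def)
    have z: "?h j e = 0" if "j \<in> {..<d} - J" for j
    proof (rule ccontr)
      assume "?h j e \<noteq> 0"
      then obtain i where "i \<in> window d j" "x i \<noteq> y i" using flow_field_coord[OF W] unfolding xy by blast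
      then have "i0 \<in> window d j" unfolding i0 by (cases "i = i0") auto
      then show False using that by (auto simp: J_def)
    qed
    have "(\<Sum>j<d. ?h j e) = (\<Sum>j\<in>J. ?h j e)" using J z by (intro sum.mono_neutral_right) auto
    then have "(\<Sum>j<d. ?h j e)\<^sup>2 = (\<Sum>j\<in>J. ?h j e)\<^sup>2" by simp
    also have "\<dots> \<le> (\<Sum>j\<in>J. (?h j e)\<^sup>2) * card J" by (rule sum_squared_le_sum_of_squares)
    also have "\<dots> \<le> (\<Sum>j<d. (?h j e)\<^sup>2) * 8"
      using J card_windows_containing[OF d, of i0] by (intro mult_mono sum_mono2) (auto simp: J_def intro: sum_nonneg)
    finally show ?thesis unfolding mean_field_def power_divide
      by (simp add: divide_right_mono mult.commute)
  qed
  have "(\<Sum>e\<in>?E. (mean_field d N e)\<^sup>2) \<le> (\<Sum>e\<in>?E. 8 / (real d)\<^sup>2 * (\<Sum>j<d. (?h j e)\<^sup>2))"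
    by (rule sum_mono) (rule pt)
  also have "\<dots> = 8 / (real d)\<^sup>2 * (\<Sum>j<d. \<Sum>e\<in>?E. (?h j e)\<^sup>2)"
    unfolding sum_distrib_left[symmetric] by (subst sum.swap) simp
  also have "\<dots> \<le> 8 / (real d)\<^sup>2 * (\<Sum>j<d. 2 * 0.06795)"
    unfolding flow_field_energy[OF W L]
    by (intro mult_left_mono sum_mono flow_energy_le W card_window[OF d]) auto
  also have "\<dots> = 1.0872 / d" using d by (simp add: power2_eq_square)
  finally show ?thesis .
qed

lemma mean_field_divergence:
  assumes d: "d \<ge> 8" and L: "int N < L" "2 \<le> L"
  shows "(\<Sum>(x, y)\<in>torus_edges d L. u x * mean_field d N (x, y))
    = u (origin d) - (\<Sum>j<d. \<Sum>x\<in>sphere d (window d j) N. u x * mass (window d j) x) / d"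
proof -
  let ?E = "torus_edges d L" and ?h = "\<lambda>j. flow_field d (window d j) N"
  have W: "window d j \<subseteq> {..<d}" "window d j \<noteq> {}" for j using window_subset[of d j] card_window[OF d, of j] d by auto
  have "(\<Sum>(x, y)\<in>?E. u x * mean_field d N (x, y)) = (\<Sum>e\<in>?E. \<Sum>j<d. u (fst e) * ?h j e) / d"
    by (simp add: mean_field_def sum_distrib_left sum_divide_distrib split_beta)
  also have "\<dots> = (\<Sum>j<d. \<Sum>(x, y)\<in>?E. u x * ?h j (x, y)) / d"
    by (subst sum.swap) (simp add: split_beta)
  also have "\<dots> = (\<Sum>j<d. u (origin d) - (\<Sum>x\<in>sphere d (window d j) N. u x * mass (window d j) x)) / d"
    by (simp only: flow_field_divergence[OF W L])
  finally show ?thesis using d by (simp add: sum_subtractf diff_divide_distrib)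
qed

section \<open>The critical inverse temperature\<close>

text \<open>The infrared bound for the averaged flow says that the spin at the origin minus its
  average \<open>M\<close> over the sphere has second moment at most 1 - \<delta>. As the spin has
  square 1, its correlation with \<open>M\<close> is at least \<delta> / 2, so some site of the
  sphere has correlation at least that; \<delta> / 4 leaves room for the contradiction.\<close>

lemma torus_two_point:
  assumes d: "d \<ge> 8" and \<beta>: "\<beta> > 0" and L: "int N < L" "2 \<le> L"
  defines "w \<equiv> \<lambda>A. exp (\<beta> / 2 * (\<Sum>(x, y)\<in>torus_edges d L. spin A x * spin A y))"
    and "\<delta> \<equiv> 1 - 1.0872 / (2 * real d * \<beta>)"
  assumes \<delta>: "\<delta> > 0"
  shows "\<exists>y \<in> Zd d. (\<Sum>i<d. \<bar>y i\<bar>) = int N \<and>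
    \<delta> / 4 * (\<Sum>A\<in>Pow (torus d L). w A) \<le> (\<Sum>A\<in>Pow (torus d L). spin A (origin d) * spin A y * w A)"
proof (rule ccontr)
  assume neg: "\<not> ?thesis"
  let ?V = "torus d L" and ?E = "torus_edges d L" and ?o = "origin d"
  let ?W = "\<lambda>j. window d j"
  have d0: "d > 0" and L0: "L > 0" using d L by auto
  have W: "?W j \<subseteq> {..<d}" "?W j \<noteq> {}" for j using window_subset[of d j] card_window[OF d, of j] d by auto
  define Z where "Z = (\<Sum>A\<in>Pow ?V. w A)"
  define G where "G y = (\<Sum>A\<in>Pow ?V. spin A ?o * spin A y * w A)" for y
  define M where "M A = (\<Sum>j<d. \<Sum>x\<in>sphere d (?W j) N. spin A x * mass (?W j) x) / d" for A
  have Z: "Z > 0" unfolding Z_def by (intro sum_pos) (auto simp: w_def finite_torus)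
  have w0: "w A > 0" for A by (simp add: w_def)
  have one: "(\<Sum>j<d. \<Sum>x\<in>sphere d (?W j) N. mass (?W j) x) / d = 1"
  proof -
    \<comment> \<open>The divergence of an antisymmetric field has total 0, so the sink absorbs
      exactly the unit source.\<close>
    have "(\<Sum>x\<in>sphere d (?W j) N. mass (?W j) x) = 1" for j
    proof -
      have "(\<Sum>(x, y)\<in>?E. flow_field d (?W j) N (x, y)) = (\<Sum>(x, y)\<in>?E. flow_field d (?W j) N (y, x))"
        by (rule sum_torus_swap[OF W[of j] L0, symmetric])
      also have "\<dots> = - (\<Sum>(x, y)\<in>?E. flow_field d (?W j) N (x, y))"
        unfolding sum_negf[symmetric]
        by (intro sum.cong refl) (auto intro: antisym_fieldD[OF antisym_flow_field])
      finally have "(\<Sum>(x, y)\<in>?E. flow_field d (?W j) N (x, y)) = 0" by simp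
      then show ?thesis using flow_field_divergence[OF W[of j] L, of "\<lambda>_. 1"] by simp
    qed
    then show ?thesis using d0 by simp
  qed
  have m0: "mass (?W j) x \<ge> 0" for j x
    unfolding mass_def sgnw_def by (intro divide_nonneg_nonneg mult_nonneg_nonneg multinom_nonneg prod_nonneg) auto
  have "(\<Sum>A\<in>Pow ?V. (spin A ?o - M A)\<^sup>2 * w A) \<le> 1.0872 / d / (2 * \<beta>) * Z"
  proof -
    have "(\<Sum>A\<in>Pow ?V. (\<Sum>(x, y)\<in>?E. spin A x * mean_field d N (x, y))\<^sup>2 * w A)
       \<le> (\<Sum>e\<in>?E. (mean_field d N e)\<^sup>2) / (2 * \<beta>) * (\<Sum>A\<in>Pow ?V. w A)"
      unfolding w_def
      by (rule infrared_bound[OF finite_torus torus_edges_subset[OF L0] torus_edges_sym[OF L0] torus_bonds[OF L0]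
            antisym_mean_field \<beta>])
    also have "\<dots> \<le> 1.0872 / d / (2 * \<beta>) * Z"
      using mean_field_energy[OF d L] \<beta> Z unfolding Z_def by (intro mult_right_mono divide_right_mono) auto
    finally show ?thesis unfolding mean_field_divergence[OF d L] M_def .
  qed
  also have "1.0872 / d / (2 * \<beta>) = 1 - \<delta>" by (simp add: \<delta>_def mult_ac)
  finally have upper: "(\<Sum>A\<in>Pow ?V. (spin A ?o - M A)\<^sup>2 * w A) \<le> (1 - \<delta>) * Z" .
  \<comment> \<open>The square of \<open>M\<close> is discarded, which leaves only the correlation
    of the origin with \<open>M\<close>.\<close>
  have "Z - 2 * (\<Sum>A\<in>Pow ?V. spin A ?o * M A * w A) = (\<Sum>A\<in>Pow ?V. (1 - 2 * (spin A ?o * M A)) * w A)"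
    by (simp add: Z_def left_diff_distrib sum_subtractf sum_distrib_left mult.assoc)
  also have "\<dots> \<le> (\<Sum>A\<in>Pow ?V. (spin A ?o - M A)\<^sup>2 * w A)"
  proof (rule sum_mono)
    fix A
    have "(spin A ?o - M A)\<^sup>2 = 1 - 2 * (spin A ?o * M A) + (M A)\<^sup>2"
      by (simp add: power2_diff power2_eq_square[of "spin A ?o"])
    then show "(1 - 2 * (spin A ?o * M A)) * w A \<le> (spin A ?o - M A)\<^sup>2 * w A"
      using w0[of A] by (intro mult_right_mono) auto
  qed
  finally have lower: "Z - 2 * (\<Sum>A\<in>Pow ?V. spin A ?o * M A * w A) \<le> (1 - \<delta>) * Z" using upper by simp
  have "(\<Sum>A\<in>Pow ?V. spin A ?o * M A * w A) = (\<Sum>j<d. \<Sum>x\<in>sphere d (?W j) N. mass (?W j) x * G x) / d"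
  proof -
    have "(\<Sum>A\<in>Pow ?V. spin A ?o * M A * w A)
       = (\<Sum>A\<in>Pow ?V. \<Sum>j<d. \<Sum>x\<in>sphere d (?W j) N. mass (?W j) x * (spin A ?o * spin A x * w A)) / d"
      unfolding M_def sum_divide_distrib
      by (intro sum.cong refl) (simp add: sum_distrib_left sum_distrib_right sum_divide_distrib mult_ac)
    also have "\<dots> = (\<Sum>j<d. \<Sum>A\<in>Pow ?V. \<Sum>x\<in>sphere d (?W j) N. mass (?W j) x * (spin A ?o * spin A x * w A)) / d"
      by (subst sum.swap) simp
    also have "\<dots> = (\<Sum>j<d. \<Sum>x\<in>sphere d (?W j) N. \<Sum>A\<in>Pow ?V. mass (?W j) x * (spin A ?o * spin A x * w A)) / d"
      by (intro arg_cong[where f="\<lambda>x. x / d"] sum.cong refl) (rule sum.swap)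
    finally show ?thesis by (simp add: G_def sum_distrib_left)
  qed
  also have "\<dots> \<le> (\<Sum>j<d. \<Sum>x\<in>sphere d (?W j) N. mass (?W j) x * (\<delta> / 4 * Z)) / d"
  proof (intro divide_right_mono sum_mono mult_left_mono m0)
    fix j x assume x: "x \<in> sphere d (?W j) N"
    then have "x \<in> Zd d" by (simp add: sphere_def)
    then show "G x \<le> \<delta> / 4 * Z" using neg sphere_norm[OF x W(1)] unfolding G_def Z_def by fastforce
  qed simp
  also have "\<dots> = (\<Sum>j<d. \<Sum>x\<in>sphere d (?W j) N. mass (?W j) x) / d * (\<delta> / 4 * Z)"
    by (simp only: sum_distrib_right times_divide_eq_left)
  also have "\<dots> = \<delta> / 4 * Z" unfolding one by simp
  finally have "(\<Sum>A\<in>Pow ?V. spin A ?o * M A * w A) \<le> \<delta> / 4 * Z" .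
  then have "Z - \<delta> / 2 * Z \<le> (1 - \<delta>) * Z" using lower by simp
  moreover have "(1 - \<delta>) * Z = Z - \<delta> / 2 * Z - \<delta> / 2 * Z" by (simp add: algebra_simps)
  moreover have "0 < \<delta> / 2 * Z" using \<delta> Z by simp
  ultimately show False by linarith
qed

text \<open>Freezing all spins of the torus outside the ball to plus increases the correlation
  between the origin and a site y just outside the ball. Then the spin at y is 1, so the origin has
  magnetization at least \<delta> / 4 under plus boundary conditions; flipping all spins gives minus
  boundary conditions.\<close>

lemma ball_magnetization_le:
  assumes d: "d \<ge> 8" and \<beta>: "\<beta> > 0" and \<delta>: "1 - 1.0872 / (2 * real d * \<beta>) > 0" (is "?\<delta> > 0")
  shows "mexp d \<beta> (ball1 d n) (\<lambda>A. spin A (origin d)) \<le> - (?\<delta> / 4)"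
proof -
  define L where "L = int n + 2"
  have L: "int (Suc n) < L" "2 \<le> L" "L > 0" "int n + 1 < L" by (auto simp: L_def)
  let ?V = "torus d L" and ?E = "torus_edges d L" and ?o = "origin d" and ?B = "ball1 d n"
  define w where "w A = exp (\<beta> / 2 * (\<Sum>(x, y)\<in>?E. spin A x * spin A y))" for A
  obtain y where y: "y \<in> Zd d" "(\<Sum>i<d. \<bar>y i\<bar>) = int (Suc n)"
    "?\<delta> / 4 * (\<Sum>A\<in>Pow ?V. w A) \<le> (\<Sum>A\<in>Pow ?V. spin A ?o * spin A y * w A)"
    using torus_two_point[OF d \<beta> L(1,2) \<delta>] unfolding w_def by blast
  have fV: "finite ?V" by (rule finite_torus)
  have EV: "?E \<subseteq> ?V \<times> ?V" by (rule torus_edges_subset[OF L(3)])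
  have fE: "finite ?E" using finite_subset[OF EV] fV by blast
  have BV: "?B \<subseteq> ?V" by (rule ball1_torus) (simp add: L_def)
  have oB: "?o \<in> ?B" by (auto simp: ball1_def origin_def Zd_def)
  have yB: "y \<notin> ?B" using y by (simp add: ball1_def)
  have yV: "y \<in> ?V"
  proof -
    have "y \<in> ball1 d (Suc n)" using y by (simp add: ball1_def)
    then show ?thesis using ball1_torus[of "Suc n" L d] L(1) by auto
  qed
  have yo: "?o \<noteq> y" using oB yB by blast
  let ?R = "?V - ?B" and ?J = "\<lambda>e :: site \<times> site. \<beta> / 2" and ?b = "\<lambda>(x :: site, y). {x, y}"
  have wc: "w A = exp (\<Sum>e\<in>?E. ?J e * chi (?b e) A)" for A
  proof -
    have "(\<Sum>e\<in>?E. ?J e * chi (?b e) A) = (\<Sum>(x, y)\<in>?E. \<beta> / 2 * (spin A x * spin A y))"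
      using torus_edges_neq[OF L(3)] by (intro sum.cong refl) (auto simp: chi_def)
    then show ?thesis by (simp add: w_def sum_distrib_left split_beta)
  qed
  have chi: "chi {?o, y} A = spin A ?o * spin A y" for A using yo by (simp add: chi_def)
  have gks: "(\<Sum>A\<in>Pow ?V. chi {?o, y} A * w A) * (\<Sum>A\<in>Pow ?V. of_bool (?R \<subseteq> A) * w A)
       \<le> (\<Sum>A\<in>Pow ?V. of_bool (?R \<subseteq> A) * (chi {?o, y} A * w A)) * (\<Sum>A\<in>Pow ?V. w A)"
    unfolding wc
  proof (rule GKS_conditional[OF fV fE])
    show "{?o, y} \<subseteq> ?V" using oB BV yV by auto
    show "?b e \<subseteq> ?V" if "e \<in> ?E" for e using that EV by auto
  qed (use \<beta> in auto)
  \<comment> \<open>Complementation in the torus turns frozen plus spins outside the ball into minus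
    ones, so arbitrary subsets of the ball remain.\<close>
  have flip: "(\<Sum>A\<in>Pow ?V. of_bool (?R \<subseteq> A) * F A) = (\<Sum>C\<in>Pow ?B. F (?V - C))" for F :: "site set \<Rightarrow> real"
  proof -
    have "(\<Sum>A\<in>Pow ?V. of_bool (?R \<subseteq> A) * F A) = (\<Sum>A\<in>{A \<in> Pow ?V. ?R \<subseteq> A}. F A)"
      unfolding sum.inter_filter[OF finite_Pow_iff[THEN iffD2, OF fV]]
    proof (rule sum.cong[OF refl])
      fix A show "of_bool (?R \<subseteq> A) * F A = (if ?R \<subseteq> A then F A else 0)"
        by (cases "?R \<subseteq> A") (simp_all only: of_bool_eq if_True if_False mult_1 mult_zero_left)
    qed
    also have "\<dots> = (\<Sum>C\<in>Pow ?B. F (?V - C))"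
      by (rule sum.reindex_bij_witness[where i="\<lambda>C. ?V - C" and j="\<lambda>A. ?V - A"])
        (use BV in \<open>auto simp: double_diff\<close>)
    finally show ?thesis .
  qed
  define T where "T = touching d ?B"
  \<comment> \<open>These oriented bonds do not touch the ball and always join equal spins, so they
    contribute a constant factor to the weight.\<close>
  define K where "K = card (?E - (T \<union> prod.swap ` T))"
  have fT: "finite T" unfolding T_def by (rule finite_touching[OF finite_ball1])
  have TE: "{(x, y) \<in> ?E. x \<in> ?B \<or> y \<in> ?B} = T \<union> prod.swap ` T"
    unfolding T_def by (rule torus_edges_touching[OF L(4)])
  have wV: "w (?V - C) = exp (\<beta> / 2 * K) * weight d \<beta> ?B C" if C: "C \<in> Pow ?B" for C
  proof -
    let ?g = "\<lambda>(x, y). spin C x * spin C y"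
    have sub: "T \<union> prod.swap ` T \<subseteq> ?E" unfolding TE[symmetric] by auto
    have "(\<Sum>(x, y)\<in>?E. spin (?V - C) x * spin (?V - C) y) = sum ?g ?E"
    proof (intro sum.cong refl, clarify)
      fix x y assume "(x, y) \<in> ?E"
      then have "x \<in> ?V" "y \<in> ?V" using EV by auto
      then show "spin (?V - C) x * spin (?V - C) y = spin C x * spin C y" by (simp add: spin_def)
    qed
    also have "\<dots> = sum ?g (?E - (T \<union> prod.swap ` T)) + sum ?g (T \<union> prod.swap ` T)"
      by (rule sum.subset_diff[OF sub fE])
    also have "sum ?g (?E - (T \<union> prod.swap ` T)) = (\<Sum>e\<in>?E - (T \<union> prod.swap ` T). 1)"
    proof (intro sum.cong refl)
      fix e assume e: "e \<in> ?E - (T \<union> prod.swap ` T)"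
      obtain x y where xy: "e = (x, y)" by (cases e)
      have "(x, y) \<notin> {(x, y) \<in> ?E. x \<in> ?B \<or> y \<in> ?B}" "(x, y) \<in> ?E" using e unfolding TE xy by simp_all
      then have "x \<notin> ?B \<and> y \<notin> ?B" by simp
      then have "x \<notin> C" "y \<notin> C" using C by auto
      then show "?g e = 1" by (simp add: xy spin_def)
    qed
    also have "sum ?g (T \<union> prod.swap ` T) = sum ?g T + sum ?g (prod.swap ` T)"
      using fT by (intro sum.union_disjoint) (auto simp: T_def touching_def)
    also have "sum ?g (prod.swap ` T) = sum ?g T"
      by (subst sum.reindex) (auto simp: inj_on_def mult.commute intro!: sum.cong)
    finally show ?thesis unfolding w_def weight_def T_def[symmetric] K_def
      by (simp add: exp_add[symmetric] distrib_left)
  qed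
  let ?Z = "\<Sum>A\<in>Pow ?V. w A" and ?ZB = "\<Sum>C\<in>Pow ?B. weight d \<beta> ?B C"
    and ?S = "\<Sum>C\<in>Pow ?B. spin C ?o * weight d \<beta> ?B C"
  define e where "e = exp (\<beta> / 2 * K)"
  have Z: "?Z > 0" by (intro sum_pos) (auto simp: w_def finite_torus)
  have ZB: "?ZB > 0" by (intro sum_pos) (auto simp: weight_def finite_ball1)
  have e: "e > 0" by (simp add: e_def)
  have f1: "(\<Sum>A\<in>Pow ?V. of_bool (?R \<subseteq> A) * w A) = e * ?ZB"
    unfolding flip sum_distrib_left by (intro sum.cong refl) (simp add: wV e_def)
  have f2: "(\<Sum>A\<in>Pow ?V. of_bool (?R \<subseteq> A) * (chi {?o, y} A * w A)) = e * (- ?S)"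
    unfolding flip sum_distrib_left sum_negf[symmetric]
  proof (intro sum.cong refl)
    fix C assume C: "C \<in> Pow ?B"
    have "spin (?V - C) y = 1" using C yB yV by (auto simp: spin_def)
    moreover have "spin (?V - C) ?o = - spin C ?o" using oB BV by (auto simp: spin_def)
    ultimately show "chi {?o, y} (?V - C) * w (?V - C) = e * - (spin C ?o * weight d \<beta> ?B C)"
      by (simp add: chi wV[OF C] e_def)
  qed
  have f3: "?\<delta> / 4 * ?Z \<le> (\<Sum>A\<in>Pow ?V. chi {?o, y} A * w A)" unfolding chi by (rule y(3))
  have "?\<delta> / 4 * ?Z * (e * ?ZB) \<le> (\<Sum>A\<in>Pow ?V. chi {?o, y} A * w A) * (e * ?ZB)"
    by (rule mult_right_mono[OF f3 less_imp_le[OF mult_pos_pos[OF e ZB]]])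
  also have "\<dots> \<le> e * (- ?S) * ?Z" using gks unfolding f1 f2 .
  finally have "(e * ?Z) * (?\<delta> / 4 * ?ZB) \<le> (e * ?Z) * (- ?S)" by (simp only: mult_ac)
  then have "?\<delta> / 4 * ?ZB \<le> - ?S" using e Z by (simp only: mult_le_cancel_left_pos[OF mult_pos_pos])
  then have "?S \<le> - (?\<delta> / 4 * ?ZB)" by linarith
  then have "?S / ?ZB \<le> - (?\<delta> / 4)" by (simp only: pos_divide_le_eq[OF ZB] mult_minus_left)
  then show ?thesis by (simp add: expect_def)
qed

context beta_nonneg
begin

lemma magnetization_eq: "(\<integral>\<sigma>. \<sigma> (origin d) \<partial>\<mu>) = cyl_lim d \<beta> {origin d} (\<lambda>A. spin A (origin d))"
proof -
  have o: "origin d \<in> Zd d" by (auto simp: origin_def Zd_def)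
  have "(\<integral>\<sigma>. \<sigma> (origin d) \<partial>\<mu>) = (\<integral>\<sigma>. spin {x \<in> {origin d}. \<sigma> x = 1} (origin d) \<partial>\<mu>)"
  proof (rule Bochner_Integration.integral_cong[OF refl])
    fix \<sigma> assume "\<sigma> \<in> space \<mu>"
    then have "\<sigma> \<in> Zd d \<rightarrow>\<^sub>E {-1, 1}" using sets_eq_imp_space_eq[OF sets_\<mu>] space_PM by simp
    from PiE_mem[OF this o] show "\<sigma> (origin d) = spin {x \<in> {origin d}. \<sigma> x = 1} (origin d)"
      by (auto simp: spin_def)
  qed
  also have "\<dots> = cyl_lim d \<beta> {origin d} (\<lambda>A. spin A (origin d))" using o by (intro integral_\<mu>_cyl) auto
  finally show ?thesis .
qed

lemma magnetization_tendsto: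
  "((\<lambda>\<Lambda>. mexp d \<beta> \<Lambda> (\<lambda>A. spin A (origin d))) \<longlongrightarrow> (\<integral>\<sigma>. \<sigma> (origin d) \<partial>\<mu>)) (finite_subsets_at_top (Zd d))"
proof -
  have "spin (A \<inter> {origin d}) (origin d) = spin A (origin d)" for A by (simp add: spin_def)
  then show ?thesis
    unfolding magnetization_eq using cyl_convergent[of "{origin d}" "\<lambda>A. spin A (origin d)"] by simp
qed

end

text \<open>Every finite region lies in a ball, and magnetizations increase with the region. So the
  uniform bound on balls holds in all finite volumes and passes to the limit.\<close>

lemma magnetization_neg:
  assumes d: "d \<ge> 8" and b: "1.0872 / (2 * real d) < \<beta>"
  shows "(\<integral>\<sigma>. \<sigma> (origin d) \<partial>minus_phase d \<beta>) < 0"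
proof -
  have "0 < 1.0872 / (2 * real d)" using d by simp
  then have \<beta>0: "\<beta> > 0" using b by linarith
  interpret beta_nonneg d \<beta> using \<beta>0 by unfold_locales simp
  define \<delta> where "\<delta> = 1 - 1.0872 / (2 * real d * \<beta>)"
  have "1.0872 / (2 * real d) / \<beta> < 1" using b by (simp only: pos_divide_less_eq[OF \<beta>0] mult_1)
  then have \<delta>: "\<delta> > 0" by (simp add: \<delta>_def)
  have "(\<integral>\<sigma>. \<sigma> (origin d) \<partial>\<mu>) \<le> - (\<delta> / 4)"
  proof (rule tendsto_upperbound[OF magnetization_tendsto])
    show "\<forall>\<^sub>F \<Lambda> in finite_subsets_at_top (Zd d). mexp d \<beta> \<Lambda> (\<lambda>A. spin A (origin d)) \<le> - (\<delta> / 4)"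
    proof (rule eventually_finite_subsets_at_top_weakI)
      fix \<Lambda> assume \<Lambda>: "finite \<Lambda>" "\<Lambda> \<subseteq> Zd d"
      define n where "n = (\<Sum>x\<in>\<Lambda>. nat (\<Sum>i<d. \<bar>x i\<bar>))"
      have "\<Lambda> \<subseteq> ball1 d n"
      proof
        fix x assume x: "x \<in> \<Lambda>"
        have "nat (\<Sum>i<d. \<bar>x i\<bar>) \<le> n" unfolding n_def using \<Lambda>(1) x by (intro member_le_sum) auto
        then show "x \<in> ball1 d n" using x \<Lambda>(2) by (auto simp: ball1_def nat_le_iff)
      qed
      then have "mexp d \<beta> \<Lambda> (\<lambda>A. spin A (origin d)) \<le> mexp d \<beta> (ball1 d n) (\<lambda>A. spin A (origin d))"
        by (rule mexp_mono[OF _ finite_ball1 less_imp_le[OF \<beta>0]]) (auto simp: increasing_on_def spin_def)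
      also have "\<dots> \<le> - (\<delta> / 4)" using ball_magnetization_le[OF d \<beta>0, of n] \<delta> unfolding \<delta>_def by blast
      finally show "mexp d \<beta> \<Lambda> (\<lambda>A. spin A (origin d)) \<le> - (\<delta> / 4)" .
    qed
  qed simp
  then show ?thesis unfolding minus_phase_eq using \<delta> by linarith
qed

text \<open>Without interaction the spins are symmetric. This makes the set in the definition of
  \<open>beta_c\<close> nonempty, so that its supremum is bounded by every upper bound.\<close>

lemma magnetization_0: "(\<integral>\<sigma>. \<sigma> (origin d) \<partial>minus_phase d 0) = 0"
proof -
  interpret beta_nonneg d 0 by unfold_locales simp
  have o: "origin d \<in> Zd d" by (auto simp: origin_def Zd_def)
  have z: "mexp d 0 \<Lambda> (\<lambda>A. spin A (origin d)) = 0" if \<Lambda>: "finite \<Lambda>" "origin d \<in> \<Lambda>" for \<Lambda>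
  proof -
    let ?o = "origin d"
    have "(\<Sum>A\<in>Pow \<Lambda>. spin A ?o) = (\<Sum>A\<in>Pow \<Lambda>. - spin A ?o)"
      by (rule sum.reindex_bij_witness[where i="\<lambda>A. \<Lambda> - A" and j="\<lambda>A. \<Lambda> - A"])
        (use \<Lambda> in \<open>auto simp: spin_def double_diff\<close>)
    then have "(\<Sum>A\<in>Pow \<Lambda>. spin A ?o) = 0" by (simp add: sum_negf)
    then show ?thesis by (simp add: expect_def weight_def)
  qed
  have "((\<lambda>\<Lambda>. mexp d 0 \<Lambda> (\<lambda>A. spin A (origin d))) \<longlongrightarrow> 0) (finite_subsets_at_top (Zd d))"
  proof (rule tendsto_eventually)
    show "\<forall>\<^sub>F \<Lambda> in finite_subsets_at_top (Zd d). mexp d 0 \<Lambda> (\<lambda>A. spin A (origin d)) = 0"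
      unfolding eventually_finite_subsets_at_top
      using o z by (intro exI[of _ "{origin d}"]) auto
  qed
  then show ?thesis
    unfolding minus_phase_eq
    by (rule tendsto_unique[OF finite_subsets_at_top_neq_bot magnetization_tendsto])
qed

lemma beta_c_le:
  assumes d: "d \<ge> 8"
  shows "beta_c d \<le> 1.0872 / (2 * real d)"
  unfolding beta_c_def
proof (rule cSup_least)
  show "{\<beta>. 0 \<le> \<beta> \<and> (\<integral>\<sigma>. \<sigma> (origin d) \<partial>minus_phase d \<beta>) = 0} \<noteq> {}" using magnetization_0[of d] by blast
  fix \<beta> assume "\<beta> \<in> {\<beta>. 0 \<le> \<beta> \<and> (\<integral>\<sigma>. \<sigma> (origin d) \<partial>minus_phase d \<beta>) = 0}"
  then show "\<beta> \<le> 1.0872 / (2 * real d)" using magnetization_neg[OF d, of \<beta>] by fastforce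
qed

section \<open>Domination of site percolation and percolation of plus spins\<close>

lemma stochastically_dominates_site_percolation:
  assumes d: "d > 0" and \<beta>: "0 \<le> \<beta>" and p: "0 \<le> p" "p \<le> 1" and gt: "(1 + tanh \<beta>) ^ d < 2 * (1 - p)"
  shows "stochastically_dominates (Zd d) (minus_phase d \<beta>) (\<lambda>x \<sigma>. \<sigma> x = 1) (site_percolation d p) (\<lambda>x \<omega>. \<omega> x)"
proof -
  interpret B: beta_nonneg d \<beta> using \<beta> by unfold_locales
  interpret S: site_perc d p using p by unfold_locales
  let ?M = "\<Pi>\<^sub>M x\<in>Zd d. count_space (UNIV :: bool set)"
  let ?Y = "\<lambda>\<sigma>. \<lambda>x\<in>Zd d. \<sigma> x = (1 :: real)"
  have pr: "Measurable.pred B.\<mu> (\<lambda>\<sigma>. \<sigma> x = 1)" if "x \<in> Zd d" for x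
    using B.pred_component[OF that] by (simp only: measurable_cong_sets[OF B.sets_\<mu> refl])
  have Y: "?Y \<in> B.\<mu> \<rightarrow>\<^sub>M ?M" by (rule measurable_restrict) (rule pr)
  \<comment> \<open>The law of the set of plus sites, so that both measures live on the same space
    of Boolean configurations.\<close>
  define Q where "Q = distr B.\<mu> ?M ?Y"
  interpret M: prob_space B.\<mu> by (rule B.prob_space_\<mu>)
  have Q: "prob_space Q" "sets Q = sets ?M" by (auto simp: Q_def intro: M.prob_space_distr[OF Y])
  obtain \<Lambda> x where \<Lambda>: "finite \<Lambda>" "\<Lambda> \<subseteq> Zd d" "lexmin d \<Lambda> x" "p < plus_prob d \<beta> \<Lambda> x"
    using ex_plus_prob_gt[OF d \<beta> p(2) gt] by blast
  have cyl: "(\<integral>\<omega>. g {x \<in> J. \<omega> x} \<partial>site_percolation d p) \<le> (\<integral>\<omega>. g {x \<in> J. \<omega> x} \<partial>Q)"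
    if J: "finite J" "J \<subseteq> Zd d" and g: "increasing_on J g" for J g
  proof -
    have "(\<integral>\<omega>. g {x \<in> J. \<omega> x} \<partial>site_percolation d p) = bernoulli_expect p J g"
      by (rule S.integral_SP_cylinder[OF J])
    also have "\<dots> \<le> cyl_lim d \<beta> J g"
      by (rule B.cyl_lim_dominates[OF p \<Lambda>(1-3) less_imp_le[OF \<Lambda>(4)] J g])
    also have "\<dots> = (\<integral>\<sigma>. g {x \<in> J. \<sigma> x = 1} \<partial>B.\<mu>)" by (rule B.integral_\<mu>_cyl[OF J, symmetric])
    also have "\<dots> = (\<integral>\<sigma>. g {x \<in> J. ?Y \<sigma> x} \<partial>B.\<mu>)"
      using J by (intro Bochner_Integration.integral_cong refl arg_cong[where f=g]) auto
    also have "\<dots> = (\<integral>\<omega>. g {x \<in> J. \<omega> x} \<partial>Q)"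
      unfolding Q_def
    proof (rule integral_distr[symmetric, OF Y])
      show "(\<lambda>\<omega>. g {x \<in> J. \<omega> x}) \<in> borel_measurable ?M"
      proof (rule measurable_pred_set[OF J(1)])
        fix x assume "x \<in> J"
        then have x: "x \<in> Zd d" using J by blast
        show "Measurable.pred ?M (\<lambda>\<omega>. \<omega> x)" by (rule measurable_component_singleton[OF x])
      qed
    qed
    finally show ?thesis .
  qed
  have dom: "(\<integral>\<omega>. f (\<lambda>x\<in>Zd d. \<omega> x) \<partial>site_percolation d p) \<le> (\<integral>\<sigma>. f (?Y \<sigma>) \<partial>B.\<mu>)"
    if f: "f \<in> borel_measurable ?M" "bounded (f ` (Zd d \<rightarrow>\<^sub>E UNIV))" "mono_on (Zd d \<rightarrow>\<^sub>E UNIV) f" for f :: "_ \<Rightarrow> real"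
  proof -
    have "(\<integral>\<omega>. f (\<lambda>x\<in>Zd d. \<omega> x) \<partial>site_percolation d p) = (\<integral>\<omega>. f \<omega> \<partial>site_percolation d p)"
      by (intro Bochner_Integration.integral_cong refl arg_cong[where f=f])
        (auto simp: S.space_SP fun_eq_iff PiE_def extensional_def)
    also have "\<dots> \<le> (\<integral>\<omega>. f \<omega> \<partial>Q)"
      by (rule integral_mono_on_le[OF countable_Zd infinite_Zd[OF d] S.prob_space_SP S.sets_SP Q cyl f])
    also have "\<dots> = (\<integral>\<sigma>. f (?Y \<sigma>) \<partial>B.\<mu>)" unfolding Q_def by (rule integral_distr[OF Y f(1)])
    finally show ?thesis .
  qed
  show ?thesis
    unfolding stochastically_dominates_def B.minus_phase_eq
    by (intro conjI allI ballI impI B.prob_space_\<mu> S.prob_space_SP pr S.pred_SP dom) simp_all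
qed

text \<open>Percolation is an increasing event, and by the zero-one law it has probability one under
  site percolation. Domination, applied to its indicator, carries this over to the minus
  phase.\<close>

lemma AE_percolates:
  assumes d: "d > 0" and \<beta>: "0 \<le> \<beta>" and p: "0 \<le> p" "p \<le> 1"
    and dom: "stochastically_dominates (Zd d) (minus_phase d \<beta>) (\<lambda>x \<sigma>. \<sigma> x = 1) (site_percolation d p) (\<lambda>x \<omega>. \<omega> x)"
    and pos: "0 < measure (site_percolation d p) {\<omega> \<in> space (site_percolation d p). percolates d {x \<in> Zd d. \<omega> x}}"
  shows "AE \<sigma> in minus_phase d \<beta>. \<exists>C \<in> clusters d {x \<in> Zd d. \<sigma> x = 1}. infinite C"
proof -
  interpret B: beta_nonneg d \<beta> using \<beta> by unfold_locales
  interpret S: site_perc d p using p by unfold_locales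
  interpret M: prob_space B.\<mu> by (rule B.prob_space_\<mu>)
  let ?M = "\<Pi>\<^sub>M x\<in>Zd d. count_space (UNIV :: bool set)"
  let ?P = "{\<sigma> \<in> space B.\<mu>. percolates d {x \<in> Zd d. \<sigma> x = 1}}"
  define f where "f \<omega> = (of_bool (percolates d {x \<in> Zd d. \<omega> x}) :: real)" for \<omega>
  have pr: "Measurable.pred B.\<mu> (\<lambda>\<sigma>. \<sigma> x = 1)" if "x \<in> Zd d" for x
    using B.pred_component[OF that] by (simp only: measurable_cong_sets[OF B.sets_\<mu> refl])
  have P: "?P \<in> sets B.\<mu>"
    using pred_percolates[where M=B.\<mu> and d=d and P="\<lambda>\<sigma> x. \<sigma> x = 1", OF pr] by (simp add: pred_def)
  have fm: "f \<in> borel_measurable ?M"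
  proof -
    have "Measurable.pred ?M (\<lambda>\<omega>. percolates d {x \<in> Zd d. \<omega> x})"
      by (rule pred_percolates) (rule measurable_component_singleton)
    then show ?thesis unfolding f_def by measurable
  qed
  have fb: "bounded (f ` (Zd d \<rightarrow>\<^sub>E UNIV))" by (rule boundedI[of _ 1]) (auto simp: f_def)
  have fmono: "mono_on (Zd d \<rightarrow>\<^sub>E UNIV) f"
  proof (rule mono_onI)
    fix \<omega> \<omega>' :: "site \<Rightarrow> bool" assume "\<omega> \<le> \<omega>'"
    then have "{x \<in> Zd d. \<omega> x} \<subseteq> {x \<in> Zd d. \<omega>' x}" by (auto simp: le_fun_def)
    from percolates_mono[OF this] show "f \<omega> \<le> f \<omega>'" by (simp add: f_def)
  qed
  have "measure (site_percolation d p) S.perc_event = 1" using S.perc_event_0_1[OF d] pos by auto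
  also have "measure (site_percolation d p) S.perc_event = (\<integral>\<omega>. indicator S.perc_event \<omega> \<partial>site_percolation d p)"
    using S.sets_perc_event by simp
  also have "\<dots> = (\<integral>\<omega>. f (\<lambda>x\<in>Zd d. \<omega> x) \<partial>site_percolation d p)"
    by (intro Bochner_Integration.integral_cong refl) (simp add: f_def indicator_def cong: conj_cong)
  finally have "1 = (\<integral>\<omega>. f (\<lambda>x\<in>Zd d. \<omega> x) \<partial>site_percolation d p)" by simp
  also have "\<dots> \<le> (\<integral>\<sigma>. f (\<lambda>x\<in>Zd d. \<sigma> x = 1) \<partial>B.\<mu>)"
  proof -
    have "\<forall>f :: (site \<Rightarrow> bool) \<Rightarrow> real. f \<in> borel_measurable ?M \<and> bounded (f ` (Zd d \<rightarrow>\<^sub>E UNIV)) \<and> mono_on (Zd d \<rightarrow>\<^sub>E UNIV) f \<longrightarrow>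
        (\<integral>\<omega>. f (\<lambda>x\<in>Zd d. \<omega> x) \<partial>site_percolation d p) \<le> (\<integral>\<sigma>. f (\<lambda>x\<in>Zd d. \<sigma> x = 1) \<partial>B.\<mu>)"
      using dom unfolding stochastically_dominates_def B.minus_phase_eq by (elim conjE)
    from spec[OF this, of f] show ?thesis using fm fb fmono by simp
  qed
  also have "\<dots> = (\<integral>\<sigma>. indicator ?P \<sigma> \<partial>B.\<mu>)"
    by (intro Bochner_Integration.integral_cong refl) (simp add: f_def indicator_def cong: conj_cong)
  also have "\<dots> = measure B.\<mu> ?P" using P by simp
  finally have "measure B.\<mu> ?P = 1" using M.prob_le_1[of ?P] by linarith
  then have "AE \<sigma> in B.\<mu>. percolates d {x \<in> Zd d. \<sigma> x = 1}" using M.prob_Collect_eq_1[OF P] by simp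
  then show ?thesis unfolding B.minus_phase_eq percolates_def .
qed

lemma tanh_le_self:
  fixes x :: real
  assumes "0 \<le> x"
  shows "tanh x \<le> x"
proof -
  have "0 - tanh 0 \<le> x - tanh x"
  proof (rule DERIV_nonneg_imp_nondecreasing[OF assms])
    fix y :: real
    have "((\<lambda>x. x - tanh x) has_real_derivative 1 - (1 - tanh y ^ 2) * 1) (at y)"
      by (auto intro!: derivative_eq_intros)
    then show "\<exists>D. ((\<lambda>x. x - tanh x) has_real_derivative D) (at y) \<and> 0 \<le> D" by force
  qed
  then show ?thesis by simp
qed

text \<open>For d \<ge> 9 the power is at most exp (d \<beta>) \<le> exp 0.545, about 1.7246 and
  below 2 * 0.865. For d = 8 this would exceed 2 * 0.848, so the power of 1 + 1.09 / 16 is evaluated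
  directly.\<close>

lemma tanh_power_less:
  assumes d: "d \<ge> 8" and \<beta>: "0 \<le> \<beta>" "\<beta> < 1.09 / (2 * real d)" and q: "q = (if d = 8 then 0.152 else 0.135 :: real)"
  shows "(1 + tanh \<beta>) ^ d < 2 * (1 - q)"
proof (cases "d = 8")
  case True
  have "(1 + tanh \<beta>) ^ 8 \<le> (1 + 0.068125) ^ 8"
    using tanh_le_self[OF \<beta>(1)] \<beta> True by (intro power_mono) auto
  also have "\<dots> < 2 * (1 - q)" using True q by (simp add: power_divide)
  finally show ?thesis using True by simp
next
  case False
  have "1 + tanh \<beta> \<le> exp \<beta>" using tanh_le_self[OF \<beta>(1)] exp_ge_add_one_self[of \<beta>] by linarith
  then have "(1 + tanh \<beta>) ^ d \<le> exp \<beta> ^ d" using \<beta>(1) by (intro power_mono) auto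
  also have "\<dots> = exp (real d * \<beta>)" by (simp add: exp_of_nat_mult)
  also have "real d * \<beta> \<le> 0.545" using \<beta>(2) d by (simp add: field_simps)
  then have "exp (real d * \<beta>) \<le> exp 0.545" by simp
  \<comment> \<open>The estimate exp x \<le> 1 / (1 - x) is sharp enough only for small x, hence the
    64-th root.\<close>
  also have "exp 0.545 = exp (0.545 / 64 :: real) ^ 64"
    using exp_of_nat_mult[of 64 "0.545 / 64 :: real"] by simp
  also have "\<dots> \<le> (1 / (1 - 0.545 / 64)) ^ 64"
  proof (rule power_mono)
    have "1 - 0.545 / 64 \<le> exp (- (0.545 / 64) :: real)"
      using exp_ge_add_one_self[of "- (0.545 / 64) :: real"] by simp
    then have "1 / exp (- (0.545 / 64) :: real) \<le> 1 / (1 - 0.545 / 64)" by (intro divide_left_mono) auto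
    then show "exp (0.545 / 64 :: real) \<le> 1 / (1 - 0.545 / 64)" by (simp add: exp_minus inverse_eq_divide)
  qed simp
  also have "\<dots> < 2 * (1 - q)" using False q by (simp add: power_divide)
  finally show ?thesis .
qed

theorem theorem2:
  fixes d :: nat
  assumes "d \<ge> 8"
  shows "\<exists>\<epsilon>>0. \<forall>\<beta>. 0 \<le> \<beta> \<and> \<beta> < beta_c d + \<epsilon> \<longrightarrow>
    (\<exists>p\<in>{0..1}. p > site_pc d \<and>
       stochastically_dominates (Zd d)
         (minus_phase d \<beta>) (\<lambda>x \<sigma>. \<sigma> x = 1)
         (site_percolation d p) (\<lambda>x \<omega>. \<omega> x)) \<and>
    (AE \<sigma> in minus_phase d \<beta>. \<exists>C \<in> clusters d {x \<in> Zd d. \<sigma> x = 1}. infinite C)"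
proof -
  \<comment> \<open>The range of inverse temperatures extends to 1.09 / (2 d), slightly beyond the
    bound 1.0872 / (2 d) for \<open>beta_c\<close>, which makes \<epsilon> positive.\<close>
  define \<epsilon> where "\<epsilon> = 1.09 / (2 * real d) - beta_c d"
  \<comment> \<open>Slightly above the thresholds of the second moment method, 0.1774 / 1.1774
    (about 0.1507) for d = 8 and 0.149 / 1.149 (about 0.1297) with nine letters, and still small
    enough for \<open>tanh_power_less\<close>.\<close>
  define q where "q = (if d = 8 then 0.152 else 0.135 :: real)"
  have d: "d > 0" using assms by simp
  have q01: "0 < q" "0 \<le> q" "q \<le> 1" by (auto simp: q_def)
  have "1.0872 / (2 * real d) < 1.09 / (2 * real d)" by (rule divide_strict_right_mono) (use d in auto)
  then have \<epsilon>: "\<epsilon> > 0" using beta_c_le[OF assms] unfolding \<epsilon>_def by linarith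
  interpret S: site_perc d q using q01 by unfold_locales
  have pc: "site_pc d < q \<and> 0 < measure S.SP S.perc_event"
  proof (cases "d = 8")
    case True
    have a: "(\<Sum>n<N. collision 8 n) \<le> 1 + 0.1774" for N using sum_collision_8[of N] by simp
    have "site_pc d \<le> 0.151" by (rule site_pc_le[OF _ _ _ _ a]) (use True in auto)
    moreover have "0 < measure S.SP S.perc_event"
      by (rule S.percolation_pos[OF _ _ _ a]) (use True in \<open>auto simp: q_def\<close>)
    ultimately show ?thesis using True by (simp add: q_def)
  next
    case False
    have a: "(\<Sum>n<N. collision 9 n) \<le> 1 + 0.149" for N using sum_collision_9[of N] by simp
    have "site_pc d \<le> 0.13" by (rule site_pc_le[OF _ _ _ _ a]) (use False assms in auto)
    moreover have "0 < measure S.SP S.perc_event"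
      by (rule S.percolation_pos[OF _ _ _ a]) (use False assms in \<open>auto simp: q_def\<close>)
    ultimately show ?thesis using False by (simp add: q_def)
  qed
  show ?thesis
  proof (intro exI[of _ \<epsilon>] conjI allI impI \<epsilon>)
    fix \<beta> assume "0 \<le> \<beta> \<and> \<beta> < beta_c d + \<epsilon>"
    then have \<beta>: "0 \<le> \<beta>" "\<beta> < 1.09 / (2 * real d)" by (auto simp: \<epsilon>_def)
    have dom: "stochastically_dominates (Zd d) (minus_phase d \<beta>) (\<lambda>x \<sigma>. \<sigma> x = 1) (site_percolation d q) (\<lambda>x \<omega>. \<omega> x)"
      by (rule stochastically_dominates_site_percolation[OF d \<beta>(1) q01(2,3) tanh_power_less[OF assms \<beta> q_def]])
    then show "\<exists>p\<in>{0..1}. p > site_pc d \<and>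
       stochastically_dominates (Zd d) (minus_phase d \<beta>) (\<lambda>x \<sigma>. \<sigma> x = 1) (site_percolation d p) (\<lambda>x \<omega>. \<omega> x)"
      using q01 pc by (intro bexI[of _ q]) auto
    show "AE \<sigma> in minus_phase d \<beta>. \<exists>C \<in> clusters d {x \<in> Zd d. \<sigma> x = 1}. infinite C"
      using pc by (intro AE_percolates[OF d \<beta>(1) q01(2,3) dom]) auto
  qed
qed

end
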